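(* For every measurable function $\bar\rho:\mathbb R^d\to\mathbb R$ and every $\mu\in\mathcal P$, there exists a weak solution $(\Omega,\mathcal F,(\mathcal F_t),\mathbb P,W,\xi,\rho)$ of the MVM equation such that $\xi_0=\mu$ and $\rho_t=\bar\rho$ for all $t\ge0$.
   Context: Fix $d\in\mathbb N$; $\mathcal P$ is the set of Borel probability measures on $\mathbb R^d$ with the weak topology, $\mu(\varphi)=\int\varphi\,d\mu$, $\operatorname{Cov}_\mu(\varphi,\psi)=\mu(\varphi\psi)-\mu(\varphi)\mu(\psi)$, $C_b$ = bounded continuous real functions on $\mathbb R^d$. An MVM is a $\mathcal P$-valued adapted process $\xi$ with $\xi(\varphi)=(\xi_t(\varphi))_t$ a martingale for every $\varphi\in C_b$; it is continuous if its paths are weakly continuous. A weak solution of the MVM equation is a tuple $(\Omega,\mathcal F,(\mathcal F_t),\mathbb P,W,\xi,\rho)$ where $W$ is a standard Brownian motion, $\xi$ a continuous MVM and $\rho:\Omega\times\mathbb R_+\times\mathbb R^d\to\mathbb R$ is measurable w.r.t. (progressive $\sigma$-algebra)$\otimes\mathcal B(\mathbb R^d)$, such that for every $\varphi\in C_b$, $\mathbb P\otimes dt$-a.e. $\xi_t(|\rho_t|)<\infty$ and $\int_0^t\operatorname{Cov}_{\xi_s}(\varphi,\rho_s)^2ds<\infty$, and $\xi_t(\varphi)=\xi_0(\varphi)+\int_0^t\operatorname{Cov}_{\xi_s}(\varphi,\rho_s)\,dW_s$ for all $t\ge0$. *)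

theory Defs
  imports "HOL-Probability.Probability"
begin

definition filtration_on :: "'w measure \<Rightarrow> (real \<Rightarrow> 'w measure) \<Rightarrow> bool" where
  "filtration_on M F \<longleftrightarrow>
     (\<forall>t\<ge>0. space (F t) = space M \<and> sets (F t) \<subseteq> sets M) \<and>
     (\<forall>s t. 0 \<le> s \<and> s \<le> t \<longrightarrow> sets (F s) \<subseteq> sets (F t))"

definition indep_of_subalg :: "'w measure \<Rightarrow> 'w measure \<Rightarrow> ('w \<Rightarrow> real) \<Rightarrow> bool" where
  "indep_of_subalg M G X \<longleftrightarrow>
     (\<forall>A\<in>sets G. \<forall>B\<in>sets (borel :: real measure).
        measure M (A \<inter> (X -` B \<inter> space M)) = measure M A * measure M (X -` B \<inter> space M))"

definition brownian_motion :: "'w measure \<Rightarrow> (real \<Rightarrow> 'w measure) \<Rightarrow> ('w \<Rightarrow> real \<Rightarrow> real) \<Rightarrow> bool" where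
  "brownian_motion M F W \<longleftrightarrow>
     (\<forall>t\<ge>0. (\<lambda>\<omega>. W \<omega> t) \<in> borel_measurable (F t)) \<and>
     (AE \<omega> in M. W \<omega> 0 = 0) \<and>
     (AE \<omega> in M. continuous_on {0..} (W \<omega>)) \<and>
     (\<forall>s t. 0 \<le> s \<and> s < t \<longrightarrow>
        distributed M lborel (\<lambda>\<omega>. W \<omega> t - W \<omega> s) (normal_density 0 (sqrt (t - s))) \<and>
        indep_of_subalg M (F s) (\<lambda>\<omega>. W \<omega> t - W \<omega> s))"

definition simple_integrand ::
  "(real \<Rightarrow> 'w measure) \<Rightarrow> nat \<Rightarrow> (nat \<Rightarrow> real) \<Rightarrow> (nat \<Rightarrow> 'w \<Rightarrow> real) \<Rightarrow> bool" where
  "simple_integrand F n t h \<longleftrightarrow>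
     0 \<le> t 0 \<and> (\<forall>i<n. t i < t (Suc i)) \<and>
     (\<forall>i<n. h i \<in> borel_measurable (F (t i)) \<and> (\<exists>B. \<forall>\<omega>. \<bar>h i \<omega>\<bar> \<le> B))"

definition simple_proc :: "nat \<Rightarrow> (nat \<Rightarrow> real) \<Rightarrow> (nat \<Rightarrow> 'w \<Rightarrow> real) \<Rightarrow> 'w \<Rightarrow> real \<Rightarrow> real" where
  "simple_proc n t h \<omega> s = (\<Sum>i<n. h i \<omega> * indicator {t i<..t (Suc i)} s)"

definition simple_stoch_int ::
  "('w \<Rightarrow> real \<Rightarrow> real) \<Rightarrow> nat \<Rightarrow> (nat \<Rightarrow> real) \<Rightarrow> (nat \<Rightarrow> 'w \<Rightarrow> real) \<Rightarrow> 'w \<Rightarrow> real \<Rightarrow> real" where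
  "simple_stoch_int W n t h \<omega> s =
     (\<Sum>i<n. h i \<omega> * (W \<omega> (min s (t (Suc i))) - W \<omega> (min s (t i))))"

text \<open>\<open>X\<close> is (a version of) the Ito integral process \<open>t \<mapsto> \<integral>_0^t H dW\<close>:
  there are simple integrands \<open>H_k\<close> with \<open>\<integral>_0^T (H_k - H)^2 ds \<rightarrow> 0\<close> in probability for every T,
  and \<open>\<integral>_0^. H_k dW \<rightarrow> X\<close> uniformly on \<open>[0,T]\<close> in probability for every T
  (convergence in probability stated via outer probability, to avoid measurability side issues).\<close>
definition ito_integral ::
  "'w measure \<Rightarrow> (real \<Rightarrow> 'w measure) \<Rightarrow> ('w \<Rightarrow> real \<Rightarrow> real) \<Rightarrow> ('w \<Rightarrow> real \<Rightarrow> real) \<Rightarrow> ('w \<Rightarrow> real \<Rightarrow> real) \<Rightarrow> bool" where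
  "ito_integral M F W H X \<longleftrightarrow>
     (\<exists>n t h. (\<forall>k. simple_integrand F (n k) (t k) (h k)) \<and>
       (\<forall>T\<ge>0. \<forall>\<epsilon>>0. eventually (\<lambda>k. \<exists>A\<in>sets M. emeasure M A \<le> ennreal \<epsilon> \<and>
           (\<forall>\<omega>\<in>space M - A.
              (\<integral>\<^sup>+ s\<in>{0..T}. ennreal ((simple_proc (n k) (t k) (h k) \<omega> s - H \<omega> s)\<^sup>2) \<partial>lborel)
                \<le> ennreal \<epsilon>)) sequentially) \<and>
       (\<forall>T\<ge>0. \<forall>\<epsilon>>0. eventually (\<lambda>k. \<exists>A\<in>sets M. emeasure M A \<le> ennreal \<epsilon> \<and>
           (\<forall>\<omega>\<in>space M - A. \<forall>s\<in>{0..T}.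
              \<bar>simple_stoch_int W (n k) (t k) (h k) \<omega> s - X \<omega> s\<bar> \<le> \<epsilon>)) sequentially))"

definition Cb :: "('a::topological_space \<Rightarrow> real) set" where
  "Cb = {\<phi>. continuous_on UNIV \<phi> \<and> bounded (range \<phi>)}"

definition meas_cov :: "'a measure \<Rightarrow> ('a \<Rightarrow> real) \<Rightarrow> ('a \<Rightarrow> real) \<Rightarrow> real" where
  "meas_cov \<nu> f g = (\<integral>x. f x * g x \<partial>\<nu>) - (\<integral>x. f x \<partial>\<nu>) * (\<integral>x. g x \<partial>\<nu>)"

text \<open>Continuous MVM: \<open>P\<close>-valued (Borel probability measures on \<open>R^d\<close>), adapted
  (each \<open>\<xi>_t(\<phi>)\<close>, \<open>\<phi>\<in>C_b\<close>, is \<open>F_t\<close>-measurable; these maps generate the Borel sigma-algebra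
  of the weak topology), weakly continuous paths (i.e. \<open>t \<mapsto> \<xi>_t(\<phi>)\<close> continuous for every
  \<open>\<phi>\<in>C_b\<close>), and \<open>\<xi>(\<phi>)\<close> is an \<open>(F_t)\<close>-martingale for every \<open>\<phi>\<in>C_b\<close>.\<close>
definition continuous_MVM ::
  "'w measure \<Rightarrow> (real \<Rightarrow> 'w measure) \<Rightarrow> ('w \<Rightarrow> real \<Rightarrow> ('a::euclidean_space) measure) \<Rightarrow> bool" where
  "continuous_MVM M F \<xi> \<longleftrightarrow>
     (\<forall>\<omega>\<in>space M. \<forall>t\<ge>0. prob_space (\<xi> \<omega> t) \<and> sets (\<xi> \<omega> t) = sets borel) \<and>
     (\<forall>\<phi>\<in>Cb. \<forall>t\<ge>0. (\<lambda>\<omega>. \<integral>x. \<phi> x \<partial>(\<xi> \<omega> t)) \<in> borel_measurable (F t)) \<and>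
     (\<forall>\<phi>\<in>Cb. \<forall>\<omega>\<in>space M. continuous_on {0..} (\<lambda>t. \<integral>x. \<phi> x \<partial>(\<xi> \<omega> t))) \<and>
     (\<forall>\<phi>\<in>Cb. \<forall>t\<ge>0. integrable M (\<lambda>\<omega>. \<integral>x. \<phi> x \<partial>(\<xi> \<omega> t))) \<and>
     (\<forall>\<phi>\<in>Cb. \<forall>s t. 0 \<le> s \<and> s \<le> t \<longrightarrow>
        (AE \<omega> in M. real_cond_exp M (F s) (\<lambda>\<omega>'. \<integral>x. \<phi> x \<partial>(\<xi> \<omega>' t)) \<omega>
                      = (\<integral>x. \<phi> x \<partial>(\<xi> \<omega> s))))"

text \<open>Progressive measurability of \<open>\<rho> : \<Omega> \<times> R_+ \<times> R^d \<rightarrow> R\<close> w.r.t.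
  (progressive sigma-algebra) \<open>\<otimes>\<close> \<open>B(R^d)\<close>, expressed via restrictions to \<open>\<Omega> \<times> [0,t] \<times> R^d\<close>.\<close>
definition progressive_field ::
  "(real \<Rightarrow> 'w measure) \<Rightarrow> ('w \<Rightarrow> real \<Rightarrow> 'a::euclidean_space \<Rightarrow> real) \<Rightarrow> bool" where
  "progressive_field F \<rho> \<longleftrightarrow>
     (\<forall>t\<ge>0. (\<lambda>(\<omega>, s, x). \<rho> \<omega> s x)
        \<in> borel_measurable (F t \<Otimes>\<^sub>M (restrict_space borel {0..t} \<Otimes>\<^sub>M borel)))"

definition weak_MVM_solution ::
  "'w measure \<Rightarrow> (real \<Rightarrow> 'w measure) \<Rightarrow> ('w \<Rightarrow> real \<Rightarrow> real) \<Rightarrow>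
   ('w \<Rightarrow> real \<Rightarrow> ('a::euclidean_space) measure) \<Rightarrow> ('w \<Rightarrow> real \<Rightarrow> 'a \<Rightarrow> real) \<Rightarrow> bool" where
  "weak_MVM_solution M F W \<xi> \<rho> \<longleftrightarrow>
     prob_space M \<and> filtration_on M F \<and> brownian_motion M F W \<and>
     continuous_MVM M F \<xi> \<and> progressive_field F \<rho> \<and>
     (\<forall>\<phi>\<in>Cb.
        (AE p in M \<Otimes>\<^sub>M lborel. snd p \<ge> 0 \<longrightarrow>
           (\<integral>\<^sup>+ x. ennreal \<bar>\<rho> (fst p) (snd p) x\<bar> \<partial>(\<xi> (fst p) (snd p))) < \<infinity> \<and>
           (\<integral>\<^sup>+ s\<in>{0..snd p}. ennreal ((meas_cov (\<xi> (fst p) s) \<phi> (\<rho> (fst p) s))\<^sup>2) \<partial>lborel) < \<infinity>) \<and>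
        ito_integral M F W
          (\<lambda>\<omega> s. meas_cov (\<xi> \<omega> s) \<phi> (\<rho> \<omega> s))
          (\<lambda>\<omega> t. (\<integral>x. \<phi> x \<partial>(\<xi> \<omega> t)) - (\<integral>x. \<phi> x \<partial>(\<xi> \<omega> 0))))"

end

theory Submission
 imports Defs
begin

text \<open>
  Let \<open>X\<close> have law \<open>\<mu>\<close>, let \<open>B\<close> be an independent Brownian motion and put \<open>Y t = B t + \<rho>(X) t\<close>.
  The solution is the posterior law \<open>\<xi> t\<close> of \<open>X\<close> given \<open>F t = \<sigma>(Y r, r \<le> t)\<close>, which by Bayes' formula has the explicit
  density \<open>exp (\<rho> Y t - \<rho>\<^sup>2 t / 2)\<close> with respect to \<open>\<mu>\<close>, up to normalization. So \<open>\<xi>(\<phi>)\<close> is a martingale, and the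
  driving Brownian motion \<open>W\<close> is the innovation process \<open>dW = dY - \<xi>(\<rho>) dt\<close>.

  Since \<open>\<rho>\<close> is only measurable, \<open>\<rho>(X)\<close> need not be integrable. For \<open>t > 0\<close> the Gaussian weight makes all moments of
  \<open>\<rho>\<close> under \<open>\<xi> t\<close> finite, so everything is first done on \<open>[s, \<infinity>)\<close> with \<open>s > 0\<close> and on events where \<open>Y s\<close> is bounded; then
  \<open>s\<close> tends to 0, using Kolmogorov's maximal inequality for continuity at 0.
  No Ito calculus is needed: the increments of \<open>W\<close> are identified by their characteristic functions, the isometry
  \<open>E (\<xi> t(\<phi>) - \<xi> s(\<phi>))\<^sup>2 = E \<integral> Cov(\<phi>, \<rho>)\<^sup>2\<close> comes from a second-order expansion of the Bayes update over a short time, and the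
  mixed moment with \<open>W\<close> from replacing \<open>\<xi> t(\<phi>)\<close> by \<open>\<phi>(X)\<close>. Together they say that the stochastic integrals of simple
  approximations of \<open>Cov(\<phi>, \<rho>)\<close> converge to \<open>\<xi>(\<phi>) - \<mu>(\<phi>)\<close>.
\<close>

section \<open>Maximal inequality and uniqueness of Fourier transforms\<close>

text \<open>The sample space is to be the real line, so a whole sequence of reals is coded into one
  real and a product measure is transported along the code. The local expansion behind the isometry
  has an error of order h^(3/2) whose constant depends on a bound for \<rho>; the isometry is
  therefore proved for truncated \<rho>, with the same \<open>X\<close> and \<open>B\<close>, and
  the truncation is removed by a dominated convergence with varying dominators. At time 0 the
  obstacle is that the bound exp (y^2 / (2 t)) of the Bayes weight need not stay bounded along a
  path. Instead, the posterior mass of {|\<rho>| > K} is a martingale in [0, 1] with mean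
  \<mu>(|\<rho>| > K), so the maximal inequality makes it small at all times at once, and off this
  set the weight is bounded. The identity aimed at is E (N - \<integral> g dW)^2 = E \<integral>
  (Cov - g)^2 for increments N of \<xi>(\<phi>) and simple g: the error of the integrand is then
  exactly the error of the integral.\<close>

lemma caratheodory_measurable:
 fixes f :: "'w => real => real"
 assumes meas: "\<And>r. (\<lambda>w. f w r) \<in> borel_measurable M"
  and cont: "\<And>w. w \<in> space M ==> continuous_on UNIV (f w)"
 shows "(\<lambda>p. f (fst p) (snd p)) \<in> borel_measurable (M \<Otimes>\<^sub>M borel)"
proof (rule borel_measurable_LIMSEQ_real)
 fix n :: nat
 show "(\<lambda>p. f (fst p) (real_of_int \<lfloor>real (Suc n) * snd p\<rfloor> / real (Suc n))) \<in> borel_measurable (M \<Otimes>\<^sub>M borel)"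
  by (rule measurable_compose_countable[where f = "\<lambda>i p. f (fst p) (real_of_int i / real (Suc n))"
     and g = "\<lambda>p. \<lfloor>real (Suc n) * snd p\<rfloor>"]) (use meas in measurable)
next
 fix p assume p: "p \<in> space (M \<Otimes>\<^sub>M (borel :: real measure))"
 have "(\<lambda>n. real_of_int \<lfloor>real (Suc n) * snd p\<rfloor> / real (Suc n)) \<longlonglongrightarrow> snd p"
 proof (rule real_tendsto_sandwich)
  show "\<forall>\<^sub>F n in sequentially. snd p - 1 / real (Suc n) <= real_of_int \<lfloor>real (Suc n) * snd p\<rfloor> / real (Suc n)"
  proof (intro always_eventually allI)
   fix n
   have "real (Suc n) * snd p - 1 <= real_of_int \<lfloor>real (Suc n) * snd p\<rfloor>" by linarith
   then have "(real (Suc n) * snd p - 1) / real (Suc n) <= real_of_int \<lfloor>real (Suc n) * snd p\<rfloor> / real (Suc n)"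
    by (rule divide_right_mono) simp
   then show "snd p - 1 / real (Suc n) <= real_of_int \<lfloor>real (Suc n) * snd p\<rfloor> / real (Suc n)"
    by (simp add: diff_divide_distrib)
  qed
  show "\<forall>\<^sub>F n in sequentially. real_of_int \<lfloor>real (Suc n) * snd p\<rfloor> / real (Suc n) <= snd p"
  proof (intro always_eventually allI)
   fix n
   have "real_of_int \<lfloor>real (Suc n) * snd p\<rfloor> <= real (Suc n) * snd p" by linarith
   then show "real_of_int \<lfloor>real (Suc n) * snd p\<rfloor> / real (Suc n) <= snd p"
    by (simp add: divide_le_eq mult.commute)
  qed
  show "(\<lambda>n. snd p - 1 / real (Suc n)) \<longlonglongrightarrow> snd p"
   using tendsto_diff[OF tendsto_const[of "snd p"] LIMSEQ_inverse_real_of_nat]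
   by (simp add: inverse_eq_divide)
 qed simp
 moreover have "isCont (f (fst p)) (snd p)"
  using cont[of "fst p"] p by (simp add: space_pair_measure continuous_on_eq_continuous_at mem_Times_iff)
 ultimately show "(\<lambda>n. f (fst p) (real_of_int \<lfloor>real (Suc n) * snd p\<rfloor> / real (Suc n))) \<longlonglongrightarrow> f (fst p) (snd p)"
  by (rule isCont_tendsto_compose[rotated])
qed

text \<open>The exceedance event splits by the first index of \<open>J\<close> at which it happens.
  The piece for \<open>r\<close> lies in \<open>F r\<close>, so \<open>le\<close> applies to it.
  Asking only for domination by one terminal variable \<open>E\<close> covers squares of martingales
  without conditional expectations.\<close>

lemma maximal_inequality_finite:
 fixes D :: "real => 'w => real"
 assumes sub: "\<And>r. r \<in> J ==> subalgebra M (F r)"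
  and mono: "\<And>r r'. r \<in> J ==> r' \<in> J ==> r <= r' ==> sets (F r) \<subseteq> sets (F r')"
  and J: "finite J"
  and meas: "\<And>r. r \<in> J ==> D r \<in> borel_measurable (F r)"
  and E: "E \<in> borel_measurable M"
  and le: "\<And>r A. r \<in> J ==> A \<in> sets (F r) ==>
   (\<integral>\<^sup>+w. ennreal ((D r w)^2) * indicator A w \<partial>M) <= (\<integral>\<^sup>+w. E w * indicator A w \<partial>M)"
  and c: "0 <= c"
 shows "ennreal (c^2) * emeasure M {w\<in>space M. \<exists>r\<in>J. c < \<bar>D r w\<bar>} <= (\<integral>\<^sup>+w. E w \<partial>M)"
proof -
 define A where "A r = {w\<in>space M. c < \<bar>D r w\<bar> \<and> (\<forall>q\<in>{q\<in>J. q < r}. \<bar>D q w\<bar> <= c)}" for r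
 have spF: "space (F r) = space M" if "r \<in> J" for r
  using sub[OF that] by (simp add: subalgebra_def)
 have AF: "A r \<in> sets (F r)" if r: "r \<in> J" for r
 proof -
  have "D q \<in> borel_measurable (F r)" if "q \<in> J" "q < r" for q
   by (rule measurable_from_subalg[OF _ meas[OF that(1)]])
    (use that r mono[of q r] spF in \<open>auto simp: subalgebra_def\<close>)
  then have "{w\<in>space (F r). \<forall>q\<in>{q\<in>J. q < r}. \<bar>D q w\<bar> <= c} \<in> sets (F r)"
   using J by (intro sets.sets_Collect_finite_All borel_measurable_le borel_measurable_abs borel_measurable_const) auto
  moreover have "{w\<in>space (F r). c < \<bar>D r w\<bar>} \<in> sets (F r)" using meas[OF r] by measurable
  ultimately have "{w\<in>space (F r). c < \<bar>D r w\<bar> \<and> (\<forall>q\<in>{q\<in>J. q < r}. \<bar>D q w\<bar> <= c)} \<in> sets (F r)"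
   by (intro sets.sets_Collect_conj)
  then show ?thesis by (simp add: A_def spF[OF r])
 qed
 have AM: "A r \<in> sets M" if "r \<in> J" for r
  using AF[OF that] sub[OF that] by (auto simp: subalgebra_def)
 have disj: "disjoint_family_on A J"
  unfolding disjoint_family_on_def A_def by (force simp: not_le neq_iff)
 have "{w\<in>space M. \<exists>r\<in>J. c < \<bar>D r w\<bar>} = (\<Union>r\<in>J. A r)"
 proof (intro set_eqI iffI)
  fix w assume dy: "w \<in> {w\<in>space M. \<exists>r\<in>J. c < \<bar>D r w\<bar>}"
  define K where "K = {r\<in>J. c < \<bar>D r w\<bar>}"
  have K: "finite K" "K \<noteq> {}" using dy J by (auto simp: K_def)
  have "Min K \<in> K" using K by simp
  moreover have "\<bar>D q w\<bar> <= c" if "q \<in> J" "q < Min K" for q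
   using Min_le[OF K(1), of q] that by (auto simp: K_def not_le[symmetric])
  ultimately show "w \<in> (\<Union>r\<in>J. A r)" using dy by (auto simp: A_def K_def)
 qed (auto simp: A_def)
 then have "ennreal (c^2) * emeasure M {w\<in>space M. \<exists>r\<in>J. c < \<bar>D r w\<bar>} = (\<Sum>r\<in>J. ennreal (c^2) * emeasure M (A r))"
  using sum_emeasure[OF _ disj J] AM by (simp add: image_subset_iff sum_distrib_left[symmetric])
 also have "\<dots> <= (\<Sum>r\<in>J. \<integral>\<^sup>+w. E w * indicator (A r) w \<partial>M)"
 proof (rule sum_mono)
  fix r assume r: "r \<in> J"
  have "ennreal (c^2) * emeasure M (A r) = (\<integral>\<^sup>+w. ennreal (c^2) * indicator (A r) w \<partial>M)"
   using AM[OF r] by (simp add: nn_integral_cmult_indicator)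
  also have "\<dots> <= (\<integral>\<^sup>+w. ennreal ((D r w)^2) * indicator (A r) w \<partial>M)"
  proof (rule nn_integral_mono)
   fix w
   have "c^2 <= (D r w)^2" if "c < \<bar>D r w\<bar>"
    using power_mono[of c "\<bar>D r w\<bar>" 2] that c by simp
   then show "ennreal (c^2) * indicator (A r) w <= ennreal ((D r w)^2) * indicator (A r) w"
    by (auto simp: indicator_def A_def intro!: ennreal_leI)
  qed
  also have "\<dots> <= (\<integral>\<^sup>+w. E w * indicator (A r) w \<partial>M)" by (rule le[OF r AF[OF r]])
  finally show "ennreal (c^2) * emeasure M (A r) <= (\<integral>\<^sup>+w. E w * indicator (A r) w \<partial>M)" .
 qed
 also have "\<dots> = (\<integral>\<^sup>+w. (\<Sum>r\<in>J. E w * indicator (A r) w) \<partial>M)"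
  using AM E by (subst nn_integral_sum) auto
 also have "\<dots> <= (\<integral>\<^sup>+w. E w \<partial>M)"
 proof (rule nn_integral_mono)
  fix w
  have "(\<Sum>r\<in>J. E w * indicator (A r) w) = E w * indicator (\<Union>r\<in>J. A r) w"
   by (simp add: indicator_UN_disjoint[OF J disj] sum_distrib_left)
  also have "\<dots> <= E w" by (auto simp: indicator_def)
  finally show "(\<Sum>r\<in>J. E w * indicator (A r) w) <= E w" .
 qed
 finally show ?thesis .
qed

text \<open>By continuity and the strict inequality, an exceedance on the interval already occurs on
  a countable dense set of times. That set is exhausted by the finite sets \<open>J N\<close>, and
  the bound passes to the increasing union.\<close>

lemma maximal_inequality_continuous:
 fixes D :: "real => 'w => real"
 assumes sub: "\<And>r. r \<in> {a..b} ==> subalgebra M (F r)"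
  and mono: "\<And>r r'. a <= r ==> r <= r' ==> r' <= b ==> sets (F r) \<subseteq> sets (F r')"
  and meas: "\<And>r. r \<in> {a..b} ==> D r \<in> borel_measurable (F r)"
  and cont: "\<And>w. w \<in> space M ==> continuous_on {a..b} (\<lambda>r. D r w)"
  and E: "E \<in> borel_measurable M"
  and le: "\<And>r A. r \<in> {a..b} ==> A \<in> sets (F r) ==>
   (\<integral>\<^sup>+w. ennreal ((D r w)^2) * indicator A w \<partial>M) <= (\<integral>\<^sup>+w. E w * indicator A w \<partial>M)"
  and c: "0 <= c" and ab: "a <= b"
 shows "{w\<in>space M. \<exists>r\<in>{a..b}. c < \<bar>D r w\<bar>} \<in> sets M" (is ?g1)
  and "ennreal (c^2) * emeasure M {w\<in>space M. \<exists>r\<in>{a..b}. c < \<bar>D r w\<bar>} <= (\<integral>\<^sup>+w. E w \<partial>M)" (is ?g2)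
proof -
 define S where "S = (\<lambda>(i::nat, n::nat). a + (b - a) * (real i / real (Suc n))) ` {(i, n). i <= Suc n}"
 have Sab: "S \<subseteq> {a..b}"
 proof
  fix x assume "x \<in> S"
  then obtain i n :: nat where x: "x = a + (b - a) * (real i / real (Suc n))" "i <= Suc n" by (auto simp: S_def)
  have "real i / real (Suc n) <= 1" using x(2) by simp
  then have "(b - a) * (real i / real (Suc n)) <= (b - a) * 1" using ab by (intro mult_left_mono) auto
  then show "x \<in> {a..b}" using ab by (auto simp: x(1))
 qed
 have Sc: "countable S" unfolding S_def by (rule countable_image) simp
 have Sne: "S \<noteq> {}" unfolding S_def by (auto intro!: exI[of _ 0])
 define J where "J N = from_nat_into S ` {..N}" for N :: nat
 have JS: "J N \<subseteq> S" for N using from_nat_into[OF Sne] by (auto simp: J_def)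
 have UJ: "(\<Union>N. J N) = S"
  using JS from_nat_into_surj[OF Sc] by (fastforce simp: J_def)
 have DM: "D r \<in> borel_measurable M" if "r \<in> {a..b}" for r
  using measurable_from_subalg[OF sub[OF that] meas[OF that]] .
 define T where "T N = {w\<in>space M. \<exists>r\<in>J N. c < \<bar>D r w\<bar>}" for N
 have TM: "T N \<in> sets M" for N
 proof -
  have [measurable]: "D r \<in> borel_measurable M" if "r \<in> J N" for r using DM JS Sab that by blast
  have "finite (J N)" by (simp add: J_def)
  then show ?thesis unfolding T_def by measurable
 qed
 have eq: "{w\<in>space M. \<exists>r\<in>{a..b}. c < \<bar>D r w\<bar>} = (\<Union>N. T N)"
 proof (intro set_eqI iffI)
  fix w assume "w \<in> {w\<in>space M. \<exists>r\<in>{a..b}. c < \<bar>D r w\<bar>}"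
  then obtain r where dy: "w \<in> space M" and r: "r \<in> {a..b}" "c < \<bar>D r w\<bar>" by auto
  \<comment> \<open>Rounding this fraction down to multiples of 1 / (n + 1) yields points of
    \<open>S\<close> that converge to \<open>r\<close>.\<close>
  define x where "x = (if a = b then 0 else (r - a) / (b - a))"
  have x: "0 <= x" "x <= 1" "r = a + (b - a) * x" using r ab by (auto simp: x_def field_simps)
  define y where "y n = real (nat \<lfloor>x * real (Suc n)\<rfloor>) / real (Suc n)" for n
  have ylim: "y \<longlonglongrightarrow> x"
  proof (rule real_tendsto_sandwich)
   have fl: "real (nat \<lfloor>x * real (Suc n)\<rfloor>) = real_of_int \<lfloor>x * real (Suc n)\<rfloor>" for n
    using x(1) by simp
   show "\<forall>\<^sub>F n in sequentially. x - 1 / real (Suc n) <= y n"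
   proof (intro always_eventually allI)
    fix n
    have "x * real (Suc n) - 1 <= real_of_int \<lfloor>x * real (Suc n)\<rfloor>" by linarith
    from divide_right_mono[OF this, of "real (Suc n)"]
    show "x - 1 / real (Suc n) <= y n" unfolding y_def fl by (simp add: diff_divide_distrib)
   qed
   show "\<forall>\<^sub>F n in sequentially. y n <= x"
   proof (intro always_eventually allI)
    fix n
    have "real_of_int \<lfloor>x * real (Suc n)\<rfloor> <= x * real (Suc n)" by linarith
    from divide_right_mono[OF this, of "real (Suc n)"]
    show "y n <= x" unfolding y_def fl by simp
   qed
   show "(\<lambda>n. x - 1 / real (Suc n)) \<longlonglongrightarrow> x"
    using tendsto_diff[OF tendsto_const[of x] LIMSEQ_inverse_real_of_nat]
    by (simp add: inverse_eq_divide)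
  qed simp
  have yS: "a + (b - a) * y n \<in> S" for n
  proof -
   have "x * real (Suc n) <= real (Suc n)" using x(1,2) by (intro mult_left_le_one_le) auto
   then have "nat \<lfloor>x * real (Suc n)\<rfloor> <= Suc n" unfolding nat_le_iff floor_le_iff by linarith
   then show ?thesis unfolding S_def y_def by (intro image_eqI[where x="(nat \<lfloor>x * real (Suc n)\<rfloor>, n)"]) auto
  qed
  have "(\<lambda>n. a + (b - a) * y n) \<longlonglongrightarrow> r" unfolding x(3) by (intro tendsto_intros ylim)
  then have "(\<lambda>n. D (a + (b - a) * y n) w) \<longlonglongrightarrow> D r w"
   using cont[OF dy] subsetD[OF Sab yS] r(1)
   by (intro continuous_on_tendsto_compose[of "{a..b}" "\<lambda>r. D r w"] always_eventually) auto
  then have "(\<lambda>n. \<bar>D (a + (b - a) * y n) w\<bar>) \<longlonglongrightarrow> \<bar>D r w\<bar>" by (rule tendsto_rabs)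
  from order_tendstoD(1)[OF this r(2)] obtain n where "c < \<bar>D (a + (b - a) * y n) w\<bar>"
   by (auto simp: eventually_sequentially)
  then show "w \<in> (\<Union>N. T N)" using yS[of n] dy unfolding UJ[symmetric] T_def by auto
 next
  fix w assume "w \<in> (\<Union>N. T N)"
  then show "w \<in> {w\<in>space M. \<exists>r\<in>{a..b}. c < \<bar>D r w\<bar>}" using JS Sab unfolding T_def by blast
 qed
 show ?g1 unfolding eq using TM by auto
 have inc: "incseq T" unfolding incseq_def T_def J_def by fastforce
 have "ennreal (c^2) * emeasure M (\<Union>N. T N) = (SUP N. ennreal (c^2) * emeasure M (T N))"
  using SUP_emeasure_incseq[OF _ inc, of M] TM by (simp add: SUP_mult_left_ennreal[symmetric] image_subset_iff)
 also have "\<dots> <= (\<integral>\<^sup>+w. E w \<partial>M)"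
 proof (rule SUP_least)
  fix N
  have JN: "J N \<subseteq> {a..b}" using JS Sab by blast
  show "ennreal (c^2) * emeasure M (T N) <= (\<integral>\<^sup>+w. E w \<partial>M)"
   unfolding T_def
  proof (rule maximal_inequality_finite[where F=F, OF _ _ _ _ E])
   show "sets (F r) \<subseteq> sets (F r')" if "r \<in> J N" "r' \<in> J N" "r <= r'" for r r'
    using mono[of r r'] subsetD[OF JN that(1)] subsetD[OF JN that(2)] that(3) by simp
   show "finite (J N)" by (simp add: J_def)
  qed (use JN sub meas le c in auto)
 qed
 finally show ?g2
  unfolding eq .
qed

text \<open>Tilt the measure: since \<open>\<Psi>\<close> is bounded and has mean 0 (the hypothesis
  at l = 0), 1 + \<Psi> / L is a probability density. The hypothesis says that the tilt leaves the
  characteristic function of \<open>V\<close> unchanged, so by uniqueness it leaves the law of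
  \<open>V\<close> unchanged.\<close>

lemma (in prob_space) char_orthogonal_real:
 fixes V \<Psi> :: "'a => real"
 assumes [measurable]: "V \<in> borel_measurable M" "\<Psi> \<in> borel_measurable M" "C \<in> sets borel"
  and K: "\<And>w. w \<in> space M ==> \<bar>\<Psi> w\<bar> <= K"
  and z: "\<And>l. (LINT w|M. iexp (l * V w) * complex_of_real (\<Psi> w)) = 0"
 shows "(LINT w|M. indicator C (V w) * \<Psi> w) = 0"
proof -
 \<comment> \<open>One more than \<open>K\<close>, so that it is positive even for K = 0.\<close>
 define L where "L = K + 1"
 obtain dy where "dy \<in> space M" using not_empty by auto
 with K have "0 <= K" by force
 then have L: "L > 0" by (simp add: L_def)
 define g where "g w = 1 + \<Psi> w / L" for w
 have [measurable]: "g \<in> borel_measurable M" unfolding g_def by measurable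
 have bnd: "\<bar>\<Psi> w\<bar> / L <= 1" if "w \<in> space M" for w
  using K[OF that] L by (simp add: L_def)
 have g0: "0 <= g w" if "w \<in> space M" for w
 proof -
  have "- (\<Psi> w / L) <= \<bar>\<Psi> w\<bar> / L" using divide_right_mono[of "- \<Psi> w" "\<bar>\<Psi> w\<bar>" L] L by simp
  with bnd[OF that] show ?thesis by (simp add: g_def)
 qed
 have iP: "integrable M \<Psi>" using K by (intro integrable_const_bound[where B=K]) auto
 have ig: "integrable M g" unfolding g_def using iP by auto
 have "(LINT w|M. complex_of_real (\<Psi> w)) = 0" using z[of 0] by simp
 then have P0: "(LINT w|M. \<Psi> w) = 0" by (simp add: integral_complex_of_real)
 have g1: "(LINT w|M. g w) = 1" unfolding g_def using iP by (simp add: P0 prob_space)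
 have pd: "prob_space (density M g)"
 proof
  have "(\<integral>\<^sup>+w. ennreal (g w) \<partial>M) = ennreal 1"
   using nn_integral_eq_integral[OF ig] g0 g1 by simp
  then show "emeasure (density M g) (space (density M g)) = 1" by (simp add: emeasure_density cong: nn_integral_cong)
 qed
 have r1: "real_distribution (distr (density M g) borel V)"
  using prob_space.prob_space_distr[OF pd, of V borel]
  by (simp add: real_distribution_def real_distribution_axioms_def)
 have r2: "real_distribution (distr M borel V)"
  using prob_space_distr[of V borel] by (simp add: real_distribution_def real_distribution_axioms_def)
 have "char (distr (density M g) borel V) = char (distr M borel V)"
 proof
  fix l
  have "char (distr (density M g) borel V) l = (LINT w|M. g w *\<^sub>R iexp (l * V w))"
   unfolding char_def using g0 by (subst integral_distr, simp, simp, subst integral_density) (auto intro!: AE_I2)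
  also have "\<dots> = (LINT w|M. iexp (l * V w) + (1 / L) *\<^sub>R (iexp (l * V w) * complex_of_real (\<Psi> w)))"
   by (intro Bochner_Integration.integral_cong) (auto simp: g_def scaleR_conv_of_real algebra_simps)
  also have "\<dots> = (LINT w|M. iexp (l * V w)) + (1 / L) *\<^sub>R (LINT w|M. iexp (l * V w) * complex_of_real (\<Psi> w))"
  proof (subst Bochner_Integration.integral_add)
   show "integrable M (\<lambda>w. iexp (l * V w))" by (intro integrable_const_bound[where B=1]) auto
   show "integrable M (\<lambda>w. (1 / L) *\<^sub>R (iexp (l * V w) * complex_of_real (\<Psi> w)))"
    using K by (intro integrable_scaleR_right integrable_const_bound[where B=K]) (auto simp: norm_mult)
  qed simp
  also have "\<dots> = char (distr M borel V) l"
   unfolding z char_def by (subst integral_distr) auto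
  finally show "char (distr (density M g) borel V) l = char (distr M borel V) l" .
 qed
 then have eq: "distr (density M g) borel V = distr M borel V" by (rule Levy_uniqueness[OF r1 r2])
 have "(LINT x|distr (density M g) borel V. indicator C x) = (LINT w|M. g w * indicator C (V w))"
  using g0 by (subst integral_distr, simp, simp, subst integral_density) (auto intro!: AE_I2)
 also have "\<dots> = (LINT w|M. indicator C (V w) + (1 / L) * (indicator C (V w) * \<Psi> w))"
  by (intro Bochner_Integration.integral_cong) (auto simp: g_def algebra_simps)
 also have "\<dots> = (LINT w|M. indicator C (V w)) + (1 / L) * (LINT w|M. indicator C (V w) * \<Psi> w)"
 proof (subst Bochner_Integration.integral_add)
  show "integrable M (\<lambda>w. indicator C (V w) :: real)" by (intro integrable_const_bound[where B=1]) auto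
  show "integrable M (\<lambda>w. 1 / L * (indicator C (V w) * \<Psi> w))"
   using K \<open>0 <= K\<close> by (intro integrable_mult_right integrable_const_bound[where B=K]) (auto simp: indicator_def)
 qed simp
 finally have "(LINT x|distr (density M g) borel V. indicator C x) =
   (LINT w|M. indicator C (V w)) + (1 / L) * (LINT w|M. indicator C (V w) * \<Psi> w)" .
 moreover have "(LINT x|distr M borel V. indicator C x) = (\<integral>w. indicator C (V w) \<partial>M :: real)"
  by (subst integral_distr) auto
 ultimately show ?thesis using eq L by simp
qed

text \<open>Conjugating the hypothesis at frequency -l gives it for the conjugate of
  \<open>\<Psi>\<close>, so the real and the imaginary part both fall under the real case.\<close>

lemma (in prob_space) char_orthogonal:
 fixes V :: "'a => real" and \<Psi> :: "'a => complex"
 assumes [measurable]: "V \<in> borel_measurable M" "\<Psi> \<in> borel_measurable M" "C \<in> sets borel"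
  and K: "\<And>w. w \<in> space M ==> norm (\<Psi> w) <= K"
  and z: "\<And>l. (LINT w|M. iexp (l * V w) * \<Psi> w) = 0"
 shows "(LINT w|M. indicator C (V w) * \<Psi> w) = 0"
proof -
 have i: "integrable M (\<lambda>w. f (V w) * \<Psi> w)"
  if [measurable]: "f \<in> borel_measurable borel" and "\<And>x. norm (f x) <= 1" for f :: "real => complex"
  using mult_mono[OF that(2) K] by (intro integrable_const_bound[where B="1 * K"]) (auto simp: norm_mult)
 have [measurable]: "(\<lambda>w. cnj (\<Psi> w)) \<in> borel_measurable M"
  by (rule borel_measurable_continuous_on[OF continuous_on_cnj[OF continuous_on_id]]) measurable
 have i': "integrable M (\<lambda>w. f (V w) * cnj (\<Psi> w))"
  if [measurable]: "f \<in> borel_measurable borel" and "\<And>x. norm (f x) <= 1" for f :: "real => complex"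
  using mult_mono[OF that(2) K] by (intro integrable_const_bound[where B="1 * K"]) (auto simp: norm_mult)
 have z': "(LINT w|M. iexp (l * V w) * cnj (\<Psi> w)) = 0" for l
 proof -
  have "(LINT w|M. iexp (l * V w) * cnj (\<Psi> w)) = (LINT w|M. cnj (iexp (- l * V w) * \<Psi> w))"
   by (intro Bochner_Integration.integral_cong) (auto simp: exp_cnj)
  also have "\<dots> = cnj (LINT w|M. iexp (- l * V w) * \<Psi> w)" 
   by (intro integral_bounded_linear[OF bounded_linear_cnj] i) auto
  finally show ?thesis using z[of "- l"] by simp
 qed
 have ii: "integrable M (\<lambda>w. iexp (l * V w) * \<Psi> w)" for l
  by (rule i[of "\<lambda>x. iexp (l * x)"]) (auto simp: norm_exp_i_times)
 have ii': "integrable M (\<lambda>w. iexp (l * V w) * cnj (\<Psi> w))" for l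
  by (rule i'[of "\<lambda>x. iexp (l * x)"]) (auto simp: norm_exp_i_times)
 have re: "(LINT w|M. indicator C (V w) * Re (\<Psi> w)) = 0"
 proof (rule char_orthogonal_real[where K=K])
  fix l
  have "(LINT w|M. iexp (l * V w) * complex_of_real (Re (\<Psi> w)))
    = (LINT w|M. (1/2) * (iexp (l * V w) * \<Psi> w + iexp (l * V w) * cnj (\<Psi> w)))"
   by (intro Bochner_Integration.integral_cong)
    (auto simp: complex_add_cnj distrib_left[symmetric])
  also have "\<dots> = 0"
   unfolding integral_mult_right_zero
   by (subst Bochner_Integration.integral_add[OF ii ii']) (simp only: z z' add_0 mult_zero_right)
  finally show "(LINT w|M. iexp (l * V w) * complex_of_real (Re (\<Psi> w))) = 0" .
 next
  fix w assume "w \<in> space M"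
  then show "\<bar>Re (\<Psi> w)\<bar> <= K" using K[of w] abs_Re_le_cmod[of "\<Psi> w"] by linarith
 qed simp_all
 have im: "(LINT w|M. indicator C (V w) * Im (\<Psi> w)) = 0"
 proof (rule char_orthogonal_real[where K=K])
  fix l
  have "(LINT w|M. iexp (l * V w) * complex_of_real (Im (\<Psi> w)))
    = (LINT w|M. (1/(2*\<i>)) * (iexp (l * V w) * \<Psi> w - iexp (l * V w) * cnj (\<Psi> w)))"
  proof (rule Bochner_Integration.integral_cong[OF refl])
   fix w
   have "complex_of_real (Im (\<Psi> w)) = (1/(2*\<i>)) * (\<Psi> w - cnj (\<Psi> w))"
    by (simp add: complex_eq_iff)
   then show "iexp (l * V w) * complex_of_real (Im (\<Psi> w))
    = (1/(2*\<i>)) * (iexp (l * V w) * \<Psi> w - iexp (l * V w) * cnj (\<Psi> w))"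
    by (simp only: right_diff_distrib mult.left_commute)
  qed
  also have "\<dots> = 0"
   unfolding integral_mult_right_zero
   by (subst Bochner_Integration.integral_diff[OF ii ii']) (simp only: z z' diff_self mult_zero_right)
  finally show "(LINT w|M. iexp (l * V w) * complex_of_real (Im (\<Psi> w))) = 0" .
 next
  fix w assume "w \<in> space M"
  then show "\<bar>Im (\<Psi> w)\<bar> <= K" using K[of w] abs_Im_le_cmod[of "\<Psi> w"] by linarith
 qed simp_all
 have iC: "integrable M (\<lambda>w. indicator C (V w) * \<Psi> w)"
  by (rule i) (auto simp: indicator_def)
 have cri: "Re (indicator C v * z) = indicator C v * Re z" "Im (indicator C v * z) = indicator C v * Im z" for v z
  by (auto simp: indicator_def)
 show ?thesis
 proof (rule complex_eqI)
  show "Re (LINT w|M. indicator C (V w) * \<Psi> w) = Re 0"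
   using re by (subst integral_Re[OF iC, symmetric]) (simp only: cri zero_complex.sel)
  show "Im (LINT w|M. indicator C (V w) * \<Psi> w) = Im 0"
   using im by (subst integral_Im[OF iC, symmetric]) (simp only: cri zero_complex.sel)
 qed
qed

text \<open>Increments of order (y - x)^(3/2) force the derivative to vanish. The exponent is that
  of the error in \<open>char_step\<close>.\<close>

lemma constant_of_superlinear_increments:
 fixes f :: "real => 'b::real_normed_vector"
 assumes "\<And>x y. a <= x ==> x <= y ==> y <= b ==> y - x <= 1 ==> norm (f y - f x) <= C * ((y - x) * sqrt (y - x))"
  and "a <= b"
 shows "f b = f a"
proof -
 have C: "norm (f y - f x) <= \<bar>C\<bar> * (\<bar>y - x\<bar> * sqrt \<bar>y - x\<bar>)"
  if "x \<in> {a..b}" "y \<in> {a..b}" "\<bar>y - x\<bar> <= 1" for x y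
 proof -
  have "norm (f y - f x) <= C * (\<bar>y - x\<bar> * sqrt \<bar>y - x\<bar>)"
   using assms(1)[of x y] assms(1)[of y x] that by (cases "x <= y") (auto simp: norm_minus_commute)
  also have "\<dots> <= \<bar>C\<bar> * (\<bar>y - x\<bar> * sqrt \<bar>y - x\<bar>)" by (intro mult_right_mono) auto
  finally show ?thesis .
 qed
 have "\<exists>c. \<forall>x\<in>{a..b}. f x = c"
 proof (rule has_vector_derivative_zero_constant)
  fix x assume x: "x \<in> {a..b}"
  have "((\<lambda>y. (f y - f x - 0) /\<^sub>R norm (y - x)) \<longlongrightarrow> 0) (at x within {a..b})"
  proof (rule tendsto_norm_zero_cancel, rule tendsto_sandwich)
   show "\<forall>\<^sub>F y in at x within {a..b}. 0 <= norm ((f y - f x - 0) /\<^sub>R norm (y - x))" by simp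
   have "\<forall>\<^sub>F y in at x within {a..b}. dist y x < 1" by (simp add: eventually_at) (use zero_less_one in blast)
   moreover have "\<forall>\<^sub>F y in at x within {a..b}. y \<in> {a..b} \<and> y \<noteq> x" by (simp add: eventually_at_filter)
   ultimately show "\<forall>\<^sub>F y in at x within {a..b}. norm ((f y - f x - 0) /\<^sub>R norm (y - x)) <= \<bar>C\<bar> * sqrt \<bar>y - x\<bar>"
   proof eventually_elim
    case (elim y)
    then have "norm (f y - f x) <= \<bar>C\<bar> * (\<bar>y - x\<bar> * sqrt \<bar>y - x\<bar>)" "0 < \<bar>y - x\<bar>"
     using C[OF x, of y] by (auto simp: dist_real_def)
    then show ?case by (simp add: inverse_eq_divide divide_le_eq mult.commute mult.assoc mult.left_commute
     del: scaleR_right_diff_distrib)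
   qed
   show "((\<lambda>y. \<bar>C\<bar> * sqrt \<bar>y - x\<bar>) \<longlongrightarrow> 0) (at x within {a..b})"
    by (auto intro!: tendsto_eq_intros)
  qed simp
  then show "(f has_vector_derivative 0) (at x within {a..b})"
   by (simp add: has_vector_derivative_def has_derivative_within bounded_linear_zero inverse_eq_divide)
 qed auto
 with assms(2) show ?thesis by (metis atLeastAtMost_iff order_refl)
qed

text \<open>Dominated convergence with dominators that vary with n; it serves the truncation of
  \<rho>, which changes the dominator too. The part of \<open>f n\<close> below the limit dominator
  converges by ordinary domination. The excess is at most the positive part of g n - g', which
  vanishes in mean because the integrals of the dominators converge.\<close>

lemma pratt:
 fixes f g :: "nat => 'a => real"
 assumes int: "\<And>n. integrable M (f n)" "\<And>n. integrable M (g n)" "integrable M g'" "f' \<in> borel_measurable M"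
  and fg: "\<And>n. AE x in M. 0 <= f n x \<and> f n x <= g n x"
  and lf: "AE x in M. (\<lambda>n. f n x) \<longlonglongrightarrow> f' x" and lg: "AE x in M. (\<lambda>n. g n x) \<longlonglongrightarrow> g' x"
  and li: "(\<lambda>n. \<integral>x. g n x \<partial>M) \<longlonglongrightarrow> (LINT x|M. g' x)"
 shows "integrable M f'" and "(\<lambda>n. \<integral>x. f n x \<partial>M) \<longlonglongrightarrow> (LINT x|M. f' x)" (is ?g1)
proof -
 have fg': "AE x in M. \<forall>n. 0 <= f n x \<and> f n x <= g n x" using fg by (simp add: AE_all_countable)
 have lim: "AE x in M. 0 <= f' x \<and> f' x <= g' x"
  using fg' lf lg by eventually_elim (blast intro: LIMSEQ_le LIMSEQ_le_const)
 show if': "integrable M f'"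
  by (rule Bochner_Integration.integrable_bound[OF int(3,4)]) (use lim in \<open>eventually_elim; auto\<close>)
 have [measurable]: "f n \<in> borel_measurable M" "g n \<in> borel_measurable M" "g' \<in> borel_measurable M" for n
  using int by auto
 have im: "integrable M (\<lambda>x. min (f n x) (g' x))" "integrable M (\<lambda>x. max 0 (g' x - g n x))"
   "integrable M (\<lambda>x. max 0 (g n x - g' x))" for n using int by auto
 have l1: "(\<lambda>n. \<integral>x. min (f n x) (g' x) \<partial>M) \<longlonglongrightarrow> (LINT x|M. f' x)"
 proof (rule integral_dominated_convergence[where w=g'])
  show "AE x in M. (\<lambda>n. min (f n x) (g' x)) \<longlonglongrightarrow> f' x"
   using lf lim
  proof eventually_elim
   case (elim x)
   have "(\<lambda>n. min (f n x) (g' x)) \<longlonglongrightarrow> min (f' x) (g' x)" using elim by (intro tendsto_min tendsto_const)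
   then show ?case using elim by simp
  qed
  show "AE x in M. norm (min (f n x) (g' x)) <= g' x" for n
   using fg[of n] lim by eventually_elim auto
 qed (use int in auto)
 have l2: "(\<lambda>n. \<integral>x. max 0 (g' x - g n x) \<partial>M) \<longlonglongrightarrow> (LINT x|M. 0)"
 proof (rule integral_dominated_convergence[where w=g'])
  show "AE x in M. (\<lambda>n. max 0 (g' x - g n x)) \<longlonglongrightarrow> 0"
   using lg
  proof eventually_elim
   case (elim x)
   have "(\<lambda>n. max 0 (g' x - g n x)) \<longlonglongrightarrow> max 0 (g' x - g' x)" using elim by (intro tendsto_intros)
   then show ?case by simp
  qed
  show "AE x in M. norm (max 0 (g' x - g n x)) <= g' x" for n
   using fg[of n] lim by eventually_elim auto
 qed (use int in auto)
 have l3: "(\<lambda>n. \<integral>x. max 0 (g n x - g' x) \<partial>M) \<longlonglongrightarrow> 0"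
 proof -
  have "(LINT x|M. max 0 (g n x - g' x)) = (LINT x|M. g n x) - (LINT x|M. g' x) + (LINT x|M. max 0 (g' x - g n x))" for n
  proof -
   have "(LINT x|M. max 0 (g n x - g' x)) = (LINT x|M. (g n x - g' x) + max 0 (g' x - g n x))"
    by (intro Bochner_Integration.integral_cong) auto
   also have "\<dots> = (LINT x|M. g n x - g' x) + (LINT x|M. max 0 (g' x - g n x))"
    by (rule Bochner_Integration.integral_add) (use int im in auto)
   finally show ?thesis using int by simp
  qed
  moreover have "(\<lambda>n. (LINT x|M. g n x) - (LINT x|M. g' x) + (LINT x|M. max 0 (g' x - g n x))) \<longlonglongrightarrow>
    (LINT x|M. g' x) - (LINT x|M. g' x) + 0" using l2 li by (intro tendsto_intros) simp_all
  ultimately show ?thesis by simp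
 qed
 show ?g1
 proof (rule tendsto_sandwich)
  show "\<forall>\<^sub>F n in sequentially. (LINT x|M. min (f n x) (g' x)) <= (LINT x|M. f n x)"
   using int im by (intro always_eventually allI integral_mono) auto
  show "\<forall>\<^sub>F n in sequentially. (LINT x|M. f n x) <= (LINT x|M. min (f n x) (g' x)) + (LINT x|M. max 0 (g n x - g' x))"
  proof (intro always_eventually allI)
   fix n
   have "(LINT x|M. f n x) <= (LINT x|M. min (f n x) (g' x) + max 0 (g n x - g' x))"
    using int(1) im fg[of n] by (intro integral_mono_AE) auto
   then show "(LINT x|M. f n x) <= (LINT x|M. min (f n x) (g' x)) + (LINT x|M. max 0 (g n x - g' x))"
    using im by simp
  qed
  show "(\<lambda>n. (LINT x|M. min (f n x) (g' x)) + (LINT x|M. max 0 (g n x - g' x))) \<longlonglongrightarrow> (LINT x|M. f' x)"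
   using tendsto_add[OF l1 l3] by simp
 qed (rule l1)
qed

section \<open>Independent sequences on the real line\<close>

text \<open>Bit sequences are coded by base 4 expansions with digits 0 and 1, which are unique.\<close>

definition digit_shift :: "real => real" where
 "digit_shift x = 4 * x - of_int \<lfloor>4 * x\<rfloor>"

definition digit_sum :: "(nat => bool) => real" where
 "digit_sum a = (\<Sum>n. (if a n then 1 else 0) * (1 / 4) ^ Suc n)"

text \<open>After multiplication by 4 the first digit is in front of the point and the rest is at
  most 1/3 < 1. So no carry occurs and the floor recovers the digit.\<close>

lemma digit_sum_bounds: "0 <= digit_sum a" "digit_sum a <= 1 / 3"
 and digit_sum_Suc: "digit_sum a = ((if a 0 then 1 else 0) + digit_sum (\<lambda>n. a (Suc n))) / 4"
proof -
 have g: "(\<lambda>n. (1 / 4 :: real) ^ Suc n) sums (1 / 3)"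
  using sums_mult[OF geometric_sums[of "1/4::real"], of "1/4"] by simp
 have s: "summable (\<lambda>n. (if a n then 1 else 0) * (1 / 4 :: real) ^ Suc n)" for a :: "nat => bool"
  by (rule summable_comparison_test'[OF sums_summable[OF g], of 0]) auto
 show "0 <= digit_sum a" unfolding digit_sum_def by (intro suminf_nonneg s) auto
 show "digit_sum a <= 1 / 3"
  unfolding digit_sum_def sums_unique[OF g] by (intro suminf_le s sums_summable[OF g]) auto
 have "digit_sum a = (\<Sum>n. (if a (Suc n) then 1 else 0) * (1 / 4) ^ Suc (Suc n)) + (if a 0 then 1 else 0) * (1/4) ^ Suc 0"
  unfolding digit_sum_def by (rule suminf_split_head[OF s, unfolded eq_diff_eq, symmetric])
 also have "(\<Sum>n. (if a (Suc n) then 1 else 0) * (1 / 4 :: real) ^ Suc (Suc n))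
   = (\<Sum>n. (1/4) * ((if a (Suc n) then 1 else 0) * (1 / 4) ^ Suc n))"
  by (intro suminf_cong) simp
 also have "\<dots> = (1/4) * digit_sum (\<lambda>n. a (Suc n))"
  unfolding digit_sum_def by (rule suminf_mult[OF s])
 finally show "digit_sum a = ((if a 0 then 1 else 0) + digit_sum (\<lambda>n. a (Suc n))) / 4" by simp
qed

lemma floor_digit_sum: "\<lfloor>4 * digit_sum a\<rfloor> = (if a 0 then 1 else 0)"
 using digit_sum_bounds[of "\<lambda>n. a (Suc n)"] by (simp add: digit_sum_Suc[of a] floor_unique)

lemma digit_shift_digit_sum: "(digit_shift ^^ n) (digit_sum a) = digit_sum (\<lambda>k. a (k + n))"
proof (induction n)
 case (Suc n)
 have "digit_shift (digit_sum b) = digit_sum (\<lambda>k. b (Suc k))" for b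
  unfolding digit_shift_def floor_digit_sum by (subst digit_sum_Suc) (simp add: add_divide_distrib)
 with Suc show ?case by simp
qed simp

text \<open>A real is determined by the rationals above it, so a sequence of reals becomes a doubly
  indexed array of bits, hence one bit sequence, hence one real. The decoder is measurable as a
  countable supremum.\<close>

lemma real_sequence_coding:
 obtains e :: "(nat => real) => real" and d :: "real => nat => real"
 where "e \<in> borel_measurable (Pi\<^sub>M UNIV (\<lambda>_. borel))" "\<And>i. (\<lambda>x. d x i) \<in> borel_measurable borel"
  "\<And>f. d (e f) = f"
proof -
 define q :: "nat => real" where "q j = of_rat (from_nat j)" for j
 define b where "b f n = (f (fst (prod_decode n)) < q (snd (prod_decode n)))" for f n
 define e where "e f = digit_sum (b f)" for f
 define dg where "dg n x = (\<lfloor>4 * (digit_shift ^^ n) x\<rfloor> = 1)" for n and x :: real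
 \<comment> \<open>A set bit means \<open>f i < q j\<close>. Such rationals are replaced by
   -\<infinity>, so the supremum runs over the rationals not above \<open>f i\<close>.\<close>
 define d where "d x i = real_of_ereal (SUP j. if dg (prod_encode (i, j)) x then - \<infinity> else ereal (q j))" for x i
 have dge: "dg n (e f) = b f n" for n f
  unfolding dg_def e_def digit_shift_digit_sum floor_digit_sum by simp
 have [measurable]: "digit_shift \<in> borel_measurable borel"
  unfolding digit_shift_def by measurable
 have sm: "(digit_shift ^^ n) \<in> borel_measurable borel" for n
 proof (induction n)
  case (Suc n)
  note [measurable] = Suc
  have "(\<lambda>x. digit_shift ((digit_shift ^^ n) x)) \<in> borel_measurable borel" by measurable
  then show ?case by (simp add: comp_def)
 qed simp
 have dm: "Measurable.pred borel (dg n)" for n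
  unfolding dg_def using sm[of n] by measurable
 show ?thesis
 proof
  have [measurable]: "Measurable.pred (Pi\<^sub>M UNIV (\<lambda>_. borel)) (\<lambda>f. b f n)" for n
   unfolding b_def by measurable
  show "e \<in> borel_measurable (Pi\<^sub>M UNIV (\<lambda>_. borel))"
   unfolding e_def digit_sum_def by measurable
  show "(\<lambda>x. d x i) \<in> borel_measurable borel" for i
   unfolding d_def using dm by measurable
  show "d (e f) = f" for f
  proof
   fix i
   have "(SUP j. if dg (prod_encode (i, j)) (e f) then - \<infinity> else ereal (q j)) = ereal (f i)"
   proof (rule SUP_eqI)
    show "(if dg (prod_encode (i, j)) (e f) then - \<infinity> else ereal (q j)) <= ereal (f i)" for j
     by (simp add: dge b_def)
   next
    fix y assume y: "\<And>j. j \<in> UNIV ==> (if dg (prod_encode (i, j)) (e f) then - \<infinity> else ereal (q j)) <= y"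
    show "ereal (f i) <= y"
    proof (rule dense_le)
     fix z assume z: "z < ereal (f i)"
     show "z <= y"
     proof (cases z)
      case (real r)
      with z have "r < f i" by simp
      then obtain p where p: "r < of_rat p" "of_rat p < f i" using of_rat_dense by blast
      have "q (to_nat p) = of_rat p" by (simp add: q_def)
      with y[of "to_nat p"] p have "ereal (of_rat p) <= y" by (simp add: dge b_def)
      with p(1) real show ?thesis by (meson ereal_less_eq(3) less_imp_le order_trans)
     qed (use z in auto)
    qed
   qed
   then show "d (e f) i = f i" by (simp add: d_def)
  qed
 qed
qed

text \<open>Brings the law of \<open>X\<close> to the real line, so that \<open>X\<close> can be
  decoded from the first member of a sequence of independent reals.\<close>

lemma euclidean_coding:
 obtains e :: "'a::euclidean_space => real" and d :: "real => 'a"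
 where "e \<in> borel_measurable borel" "d \<in> borel_measurable borel" "\<And>x. d (e x) = x"
proof -
 obtain e :: "(nat => real) => real" and d
  where e[measurable]: "e \<in> borel_measurable (Pi\<^sub>M UNIV (\<lambda>_. borel))"
   and d[measurable]: "\<And>i. (\<lambda>x. d x i) \<in> borel_measurable borel" and de: "\<And>f. d (e f) = f"
  using real_sequence_coding by metis
 obtain g where g: "bij_betw g {0..<DIM('a)} (Basis :: 'a set)"
  using ex_bij_betw_nat_finite[OF finite_Basis] by blast
 define c where "c x = e (\<lambda>i. x \<bullet> g i)" for x
 define k where "k r = (\<Sum>i\<in>{0..<DIM('a)}. d r i *\<^sub>R g i)" for r
 show ?thesis
 proof
  have "(\<lambda>x::'a. \<lambda>i\<in>UNIV. x \<bullet> g i) \<in> borel \<rightarrow>\<^sub>M Pi\<^sub>M UNIV (\<lambda>_. borel)"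
   by (rule measurable_restrict) simp
  then have [measurable]: "(\<lambda>x::'a. \<lambda>i. x \<bullet> g i) \<in> borel \<rightarrow>\<^sub>M Pi\<^sub>M UNIV (\<lambda>_. borel)" unfolding restrict_UNIV .
  show "c \<in> borel_measurable borel" unfolding c_def by measurable
  show "k \<in> borel_measurable borel" unfolding k_def by measurable
  show "k (c x) = x" for x
  proof -
   have "k (c x) = (\<Sum>i\<in>{0..<DIM('a)}. (x \<bullet> g i) *\<^sub>R g i)" by (simp add: k_def c_def de)
   also have "\<dots> = (\<Sum>u\<in>Basis. (x \<bullet> u) *\<^sub>R u)" by (rule sum.reindex_bij_betw[OF g])
   also have "\<dots> = x" by (rule euclidean_representation)
   finally show ?thesis .
  qed
 qed
qed

text \<open>The product measure lives on sequences; its image under the code lives on the reals, and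
  the decoded coordinates keep the joint law because decoding inverts coding.\<close>

lemma independent_sequence_on_real:
 fixes m :: "nat => real measure"
 assumes m: "\<And>i. prob_space (m i)" "\<And>i. sets (m i) = sets borel"
 obtains M :: "real measure" and Z :: "nat => real => real"
 where "prob_space M" "prob_space.indep_vars M (\<lambda>_. borel) Z UNIV" "\<And>i. distr M borel (Z i) = m i"
proof -
 obtain e :: "(nat => real) => real" and d
  where e[measurable]: "e \<in> borel_measurable (Pi\<^sub>M UNIV (\<lambda>_. borel))"
   and d[measurable]: "\<And>i. (\<lambda>x. d x i) \<in> borel_measurable borel" and de: "\<And>f. d (e f) = f"
  using real_sequence_coding by metis
 have "(\<lambda>x. \<lambda>i\<in>UNIV. d x i) \<in> borel \<rightarrow>\<^sub>M Pi\<^sub>M UNIV (\<lambda>_. borel)"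
  by (rule measurable_restrict) simp
 then have dm: "d \<in> borel \<rightarrow>\<^sub>M Pi\<^sub>M UNIV (\<lambda>_. borel)" unfolding restrict_UNIV .
 let ?P = "Pi\<^sub>M UNIV m"
 have sP: "sets ?P = sets (Pi\<^sub>M UNIV (\<lambda>_. borel))" using m(2) by (intro sets_PiM_cong) auto
 have em: "e \<in> ?P \<rightarrow>\<^sub>M borel" using e by (simp add: measurable_cong_sets[OF sP])
 interpret P: prob_space ?P by (rule prob_space_PiM[OF m(1)])
 define M where "M = distr ?P borel e"
 interpret M: prob_space M unfolding M_def by (rule P.prob_space_distr[OF em])
 have comp: "distr M borel (\<lambda>x. d x i) = m i" for i
 proof -
  have "distr M borel (\<lambda>x. d x i) = distr ?P borel (\<lambda>f. f i)"
   unfolding M_def using em by (subst distr_distr) (auto simp: comp_def de)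
  also have "\<dots> = distr ?P (m i) (\<lambda>f. f i)" by (intro distr_cong) (auto simp: m)
  also have "\<dots> = m i" using m by (intro distr_PiM_component) auto
  finally show ?thesis .
 qed
 have "M.indep_vars (\<lambda>_. borel) (\<lambda>i x. d x i) UNIV"
 proof (subst M.indep_vars_iff_distr_eq_PiM')
  have "distr M (Pi\<^sub>M UNIV (\<lambda>_. borel)) (\<lambda>x. \<lambda>i\<in>UNIV. d x i) = distr ?P (Pi\<^sub>M UNIV (\<lambda>_. borel)) (\<lambda>f. f)"
   unfolding M_def restrict_UNIV using em dm by (subst distr_distr) (auto simp: comp_def de)
  also have "\<dots> = ?P" by (rule distr_id2) (simp add: sP)
  also have "\<dots> = Pi\<^sub>M UNIV (\<lambda>i. distr M borel (\<lambda>x. d x i))" unfolding comp ..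
  finally show "distr M (Pi\<^sub>M UNIV (\<lambda>_. borel)) (\<lambda>x. \<lambda>i\<in>UNIV. d x i) = Pi\<^sub>M UNIV (\<lambda>i. distr M borel (\<lambda>x. d x i))" .
 qed (auto simp: M_def)
 with that M.prob_space_axioms comp show ?thesis by blast
qed

text \<open>Parametrized by the variance, so that \<open>h\<close> is the length of the time step of
  a Brownian increment.\<close>

definition gauss :: "real => real measure" where
 "gauss h = density lborel (\<lambda>x. ennreal (normal_density 0 (sqrt h) x))"

lemma sets_gauss [simp, measurable_cong]: "sets (gauss h) = sets borel"
 and space_gauss [simp]: "space (gauss h) = UNIV"
 by (simp_all add: gauss_def)

lemma prob_space_gauss: "0 < h ==> prob_space (gauss h)"
 unfolding gauss_def by (rule prob_space_normal_density) simp

lemma real_distribution_gauss: "0 < h ==> real_distribution (gauss h)"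
 using prob_space_gauss[of h] by (simp add: real_distribution_def real_distribution_axioms_def)

lemma gauss_eq_distr:
 assumes "0 < h" shows "gauss h = distr std_normal_distribution borel (\<lambda>x. sqrt h * x)"
proof -
 interpret S: real_distribution std_normal_distribution by (rule real_dist_normal_dist)
 have "distributed std_normal_distribution lborel (\<lambda>x. x) (\<lambda>x. ennreal (std_normal_density x))"
  unfolding distributed_def by (auto intro: distr_id2)
 from S.normal_density_affine[OF this, of "sqrt h" 0] assms
 show ?thesis by (simp add: distributed_def gauss_def distr_cong[of _ _ lborel borel])
qed

lemma char_gauss: "0 < h ==> char (gauss h) l = complex_of_real (exp (- (l^2 * h / 2)))"
proof -
 assume h: "0 < h"
 have "char (gauss h) l = (CLINT x|std_normal_distribution. iexp (l * (sqrt h * x)))"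
  unfolding gauss_eq_distr[OF h] char_def by (subst integral_distr) auto
 also have "\<dots> = char std_normal_distribution (l * sqrt h)"
  unfolding char_def by (simp add: mult.assoc)
 also have "\<dots> = complex_of_real (exp (- (l^2 * h / 2)))"
  using h by (simp add: char_std_normal_distribution power_mult_distrib)
 finally show ?thesis .
qed

text \<open>Together \<open>cV\<close> and \<open>cA\<close> say that
  \<open>indicator A w - prob A\<close> is orthogonal to every exponential of \<open>V\<close>. By
  \<open>char_orthogonal\<close> it is then orthogonal to every event of \<open>V\<close>, which is
  independence.\<close>

lemma (in prob_space) indep_gauss_of_char:
 fixes V :: "'a => real"
 assumes [measurable]: "V \<in> borel_measurable M" "A \<in> events" "D \<in> sets borel" and h: "0 < h"
  and cV: "\<And>l. (LINT w|M. iexp (l * V w)) = complex_of_real (exp (- (l^2 * h / 2)))"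
  and cA: "\<And>l. (LINT w|M. iexp (l * V w) * indicator A w) = complex_of_real (exp (- (l^2 * h / 2))) * prob A"
 shows "prob {w\<in>space M. w \<in> A \<and> V w \<in> D} = prob A * measure (gauss h) D" (is ?g1)
  and "distr M borel V = gauss h" (is ?g2)
proof -
 show d: ?g2
 proof (rule Levy_uniqueness)
  show "real_distribution (distr M borel V)"
   using prob_space_distr[of V borel] by (simp add: real_distribution_def real_distribution_axioms_def)
  show "real_distribution (gauss h)" by (rule real_distribution_gauss[OF h])
  show "char (distr M borel V) = char (gauss h)"
   unfolding char_gauss[OF h, abs_def] unfolding char_def using cV by (intro ext, subst integral_distr) simp_all
 qed
 have z: "(LINT w|M. indicator D (V w) * (complex_of_real (indicator A w - prob A))) = 0"
 proof (rule char_orthogonal[where K=1])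
  show "norm (complex_of_real (indicator A w - prob A)) <= 1" for w
   unfolding norm_of_real using prob_le_1[of A] by (auto simp: indicator_def)
  fix l
  have i: "integrable M (\<lambda>w. iexp (l * V w))" "integrable M (\<lambda>w. iexp (l * V w) * indicator A w)"
   by (auto intro!: integrable_const_bound[where B=1] simp: norm_mult indicator_def)
  have "(LINT w|M. iexp (l * V w) * complex_of_real (indicator A w - prob A))
   = (LINT w|M. iexp (l * V w) * indicator A w - iexp (l * V w) * complex_of_real (prob A))"
   by (intro Bochner_Integration.integral_cong) (auto simp: indicator_def algebra_simps)
  also have "\<dots> = 0" using i cV[of l] cA[of l] by simp
  finally show "(LINT w|M. iexp (l * V w) * complex_of_real (indicator A w - prob A)) = 0" .
 qed auto
 have "(LINT w|M. complex_of_real (indicator D (V w) * (indicator A w - prob A))) = 0"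
 proof -
  have "complex_of_real (indicator D (V w) * (indicator A w - prob A))
   = indicator D (V w) * complex_of_real (indicator A w - prob A)" for w
   by (cases "V w \<in> D") auto
  with z show ?thesis by (simp only:)
 qed
 then have "(LINT w|M. indicator D (V w) * (indicator A w - prob A)) = 0"
  unfolding integral_complex_of_real by simp
 moreover have "(LINT w|M. indicator D (V w) * (indicator A w - prob A))
   = (LINT w|M. indicator {w\<in>space M. w \<in> A \<and> V w \<in> D} w - prob A * indicator {w\<in>space M. V w \<in> D} w)"
  by (intro Bochner_Integration.integral_cong) (auto simp: indicator_def algebra_simps)
 moreover have "\<dots> = prob {w\<in>space M. w \<in> A \<and> V w \<in> D} - prob A * prob {w\<in>space M. V w \<in> D}"
 proof -
  define S1 S2 where "S1 = {w\<in>space M. w \<in> A \<and> V w \<in> D}" and "S2 = {w\<in>space M. V w \<in> D}"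
  have S: "S1 \<in> events" "S2 \<in> events" unfolding S1_def S2_def by measurable
  then have "integrable M (indicat_real S1)" "integrable M (indicat_real S2)"
   by (auto intro!: integrable_real_indicator simp: emeasure_eq_measure)
  moreover have "S1 \<inter> space M = S1" "S2 \<inter> space M = S2" by (auto simp: S1_def S2_def)
  ultimately show ?thesis unfolding S1_def[symmetric] S2_def[symmetric] by simp
 qed
 moreover have "prob {w\<in>space M. V w \<in> D} = measure (gauss h) D"
  unfolding d[symmetric] by (subst measure_distr) (auto intro!: arg_cong[where f=prob])
 ultimately show ?g1 by simp
qed

section \<open>Levy's construction of Brownian motion\<close>

text \<open>Independence is required only for finite cylinders in \<open>X\<close> and the past of
  \<open>B\<close>, which is what characteristic functions can verify;
  \<open>indep_increment\<close> extends it to the generated sigma-algebra. Path properties hold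
  everywhere rather than almost surely, so no exceptional set is carried along.\<close>

locale bm_pair = prob_space M for M :: "'w measure" +
 fixes X :: "'w => 'a::euclidean_space" and B :: "'w => real => real"
 assumes X_meas [measurable]: "X \<in> borel_measurable M"
  and B_meas: "\<And>t. 0 <= t ==> (\<lambda>w. B w t) \<in> borel_measurable M"
  and B_zero: "\<And>w. w \<in> space M ==> B w 0 = 0"
  and B_cont: "\<And>w. w \<in> space M ==> continuous_on {0..} (B w)"
  and B_indep: "\<And>s t J C0 C D. 0 <= s ==> s < t ==> finite J ==> J \<subseteq> {0..s} ==> C0 \<in> sets borel ==>
   (\<And>r. C r \<in> sets borel) ==> D \<in> sets borel ==>
   prob {w\<in>space M. (X w \<in> C0 \<and> (\<forall>r\<in>J. B w r \<in> C r)) \<and> B w t - B w s \<in> D}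
   = prob {w\<in>space M. X w \<in> C0 \<and> (\<forall>r\<in>J. B w r \<in> C r)} * measure (gauss (t - s)) D"

lemma sum_pairs: "(\<Sum>j<2 * K. f j) = (\<Sum>k<K. f (2 * k) + f (Suc (2 * k)))"
 for f :: "nat => 'b::comm_monoid_add"
 by (induction K) (simp_all add: add.assoc)

text \<open>The law of \<open>Z 0\<close> is arbitrary: it is reserved for the code of
  \<open>X\<close>. The other members are the standard Gaussians of the construction.\<close>

locale gaussian_sequence = prob_space M for M :: "'w measure" +
 fixes Z :: "nat => 'w => real"
 assumes Z_indep: "indep_vars (\<lambda>_. borel) Z UNIV"
  and Z_gauss: "\<And>i. distr M borel (Z (Suc i)) = gauss 1"
begin

lemma Z_meas [measurable]: "Z i \<in> borel_measurable M"
 using Z_indep by (auto simp: indep_vars_def)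

abbreviation xi :: "nat \<times> nat => 'w => real" where
 "xi p \<equiv> Z (Suc (prod_encode p))"

text \<open>Increment over the k-th interval of length 2^-n. Halving an interval splits its
  increment into equal halves, shifted by plus and minus a fresh Gaussian of variance 2^-n / 4. Each
  half then has variance 2^-(n+1), and the two halves are uncorrelated.\<close>

primrec dinc :: "nat => nat => 'w => real" where
 "dinc 0 k = xi (0, k)"
| "dinc (Suc n) k = (\<lambda>w. dinc n (k div 2) w / 2 +
   (if even k then 1 else - 1) * (sqrt (1 / 2 ^ n) / 2) * xi (Suc n, k div 2) w)"

lemma dinc_meas [measurable]: "dinc n k \<in> borel_measurable M"
 by (induction n arbitrary: k) simp_all

lemma char_xi:
 assumes S: "finite S" and [measurable]: "C \<in> sets borel"
 shows "(LINT w|M. indicator C (Z 0 w) * iexp (\<Sum>p\<in>S. \<gamma> p * xi p w))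
  = complex_of_real (prob {w\<in>space M. Z 0 w \<in> C} * exp (- (\<Sum>p\<in>S. (\<gamma> p)\<^sup>2) / 2))"
proof -
 define f :: "nat => real => complex" where
  "f i x = (if i = 0 then indicator C x else iexp (\<gamma> (prod_decode (i - 1)) * x))" for i x
 have [measurable]: "f i \<in> borel_measurable borel" for i unfolding f_def by (cases "i = 0") auto
 let ?e = "\<lambda>p. Suc (prod_encode p)"
 have inj: "inj_on ?e S" by (auto intro!: inj_onI)
 let ?I = "insert 0 (?e ` S)"
 have fin: "finite ?I" using S by simp
 have ind: "indep_vars (\<lambda>_. borel) (\<lambda>i w. f i (Z i w)) ?I"
  by (rule indep_vars_compose2[OF indep_vars_subset[OF Z_indep]]) auto
 have int: "integrable M (\<lambda>w. f i (Z i w))" for i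
  by (rule integrable_const_bound[where B=1]) (auto simp: f_def indicator_def)
 have eq: "indicator C (Z 0 w) * iexp (\<Sum>p\<in>S. \<gamma> p * xi p w) = (\<Prod>i\<in>?I. f i (Z i w))" for w
  using S by (simp add: prod.reindex[OF inj] image_iff f_def exp_sum sum_distrib_left)
 have "(LINT w|M. indicator C (Z 0 w) * iexp (\<Sum>p\<in>S. \<gamma> p * xi p w)) = (\<Prod>i\<in>?I. \<integral>w. f i (Z i w) \<partial>M)"
  unfolding eq by (rule indep_vars_lebesgue_integral[OF fin ind]) (rule int)
 also have "\<dots> = (LINT w|M. f 0 (Z 0 w)) * (\<Prod>p\<in>S. \<integral>w. f (?e p) (xi p w) \<partial>M)"
  using S by (simp add: prod.reindex[OF inj] image_iff)
 also have "(LINT w|M. f 0 (Z 0 w)) = complex_of_real (prob {w\<in>space M. Z 0 w \<in> C})"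
 proof -
  have "(LINT w|M. f 0 (Z 0 w)) = (LINT w|M. complex_of_real (indicator {w\<in>space M. Z 0 w \<in> C} w))"
   by (intro Bochner_Integration.integral_cong) (auto simp: f_def indicator_def)
  also have "\<dots> = complex_of_real (prob ({w\<in>space M. Z 0 w \<in> C} \<inter> space M))"
   unfolding integral_complex_of_real by simp
  also have "{w\<in>space M. Z 0 w \<in> C} \<inter> space M = {w\<in>space M. Z 0 w \<in> C}" by auto
  finally show ?thesis .
 qed
 also have "(\<Prod>p\<in>S. \<integral>w. f (?e p) (xi p w) \<partial>M) = (\<Prod>p\<in>S. complex_of_real (exp (- (\<gamma> p)\<^sup>2 / 2)))"
 proof (rule prod.cong[OF refl])
  fix p
  have "(LINT w|M. f (?e p) (xi p w)) = char (distr M borel (xi p)) (\<gamma> p)"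
   unfolding char_def by (subst integral_distr) (auto simp: f_def)
  also have "\<dots> = complex_of_real (exp (- (\<gamma> p)\<^sup>2 / 2))"
   unfolding Z_gauss by (subst char_gauss) auto
  finally show "(LINT w|M. f (?e p) (xi p w)) = complex_of_real (exp (- (\<gamma> p)\<^sup>2 / 2))" .
 qed
 also have "\<dots> = complex_of_real (exp (\<Sum>p\<in>S. - (\<gamma> p)\<^sup>2 / 2))"
  by (simp only: exp_sum[OF S] of_real_prod)
 also have "(\<Sum>p\<in>S. - (\<gamma> p)\<^sup>2 / 2) = - (\<Sum>p\<in>S. (\<gamma> p)\<^sup>2) / 2"
  by (simp add: sum_divide_distrib[symmetric] sum_negf)
 finally show ?thesis by simp
qed

text \<open>Induction on the level: increments of level m + 1 are linear in those of level m and the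
  Gaussians of level m + 1. The finite family \<open>S\<close> of Gaussians of finer levels is
  carried along so that these can be absorbed. The outcome is the joint characteristic function of
  independent Gaussians.\<close>

lemma char_dinc_xi:
 assumes "finite S" "\<And>p. p \<in> S ==> m < fst p" and [measurable]: "C \<in> sets borel"
 shows "(LINT w|M. indicator C (Z 0 w) * iexp ((\<Sum>j<K. \<alpha> j * dinc m j w) + (\<Sum>p\<in>S. \<gamma> p * xi p w)))
  = complex_of_real (prob {w\<in>space M. Z 0 w \<in> C} *
    exp (- ((\<Sum>j<K. (\<alpha> j)\<^sup>2) / 2 ^ m + (\<Sum>p\<in>S. (\<gamma> p)\<^sup>2)) / 2))"
 using assms(1,2)
proof (induction m arbitrary: K \<alpha> S \<gamma>)
 case 0
 let ?P = "Pair 0 ` {..<K}"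
 define g where "g p = (if fst p = 0 then \<alpha> (snd p) else \<gamma> p)" for p :: "nat \<times> nat"
 have disj: "?P \<inter> S = {}" using 0(2) by force
 have split: "(\<Sum>p\<in>?P \<union> S. h p) = (\<Sum>j<K. h (0, j)) + (\<Sum>p\<in>S. h p)" for h :: "nat \<times> nat => real"
  using 0(1) disj by (simp add: sum.union_disjoint sum.reindex inj_on_def)
 have gS: "g p = \<gamma> p" if "p \<in> S" for p using 0(2)[OF that] by (simp add: g_def)
 have g0: "g (0, j) = \<alpha> j" for j by (simp add: g_def)
 show ?case using char_xi[of "?P \<union> S" C g] 0(1)
  unfolding split by (simp add: g0 gS cong: sum.cong)
next
 case (Suc m)
 \<comment> \<open>Padding by zeros makes the number of increments even, so that they pair up as
   halves of level \<open>m\<close> intervals.\<close>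
 define a where "a j = (if j < K then \<alpha> j else 0)" for j
 define c where "c = sqrt (1 / 2 ^ m) / (2::real)"
 define \<beta> where "\<beta> k = (a (2 * k) + a (Suc (2 * k))) / 2" for k
 define g where "g p = (if fst p = Suc m then c * (a (2 * snd p) - a (Suc (2 * snd p))) else \<gamma> p)" for p :: "nat \<times> nat"
 let ?P = "Pair (Suc m) ` {..<K}"
 have disj: "?P \<inter> S = {}" using Suc.prems(2) by force
 have split: "(\<Sum>p\<in>?P \<union> S. h p) = (\<Sum>j<K. h (Suc m, j)) + (\<Sum>p\<in>S. h p)" for h :: "nat \<times> nat => real"
  using Suc.prems(1) disj by (simp add: sum.union_disjoint sum.reindex inj_on_def)
 have gS: "g p = \<gamma> p" if "p \<in> S" for p using Suc.prems(2)[OF that] by (simp add: g_def)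
 have g0: "g (Suc m, j) = c * (a (2 * j) - a (Suc (2 * j)))" for j by (simp add: g_def)
 have pad: "(\<Sum>j<K. f j (\<alpha> j)) = (\<Sum>k<K. f (2 * k) (a (2 * k)) + f (Suc (2 * k)) (a (Suc (2 * k))))"
  if "\<And>j. f j 0 = 0" for f :: "nat => real => real"
 proof -
  have "(\<Sum>j<K. f j (\<alpha> j)) = (\<Sum>j<2 * K. f j (a j))"
   by (rule sum.mono_neutral_cong_left) (auto simp: a_def that)
  then show ?thesis by (simp only: sum_pairs)
 qed
 have s1: "(\<Sum>j<K. \<alpha> j * dinc (Suc m) j w) + (\<Sum>p\<in>S. \<gamma> p * xi p w)
  = (\<Sum>k<K. \<beta> k * dinc m k w) + (\<Sum>p\<in>?P \<union> S. g p * xi p w)" for w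
 proof -
  have "(\<Sum>j<K. \<alpha> j * dinc (Suc m) j w)
   = (\<Sum>k<K. a (2 * k) * dinc (Suc m) (2 * k) w + a (Suc (2 * k)) * dinc (Suc m) (Suc (2 * k)) w)"
   using pad[of "\<lambda>j v. v * dinc (Suc m) j w"] by simp
  also have "\<dots> = (\<Sum>k<K. \<beta> k * dinc m k w + g (Suc m, k) * xi (Suc m, k) w)"
   by (rule sum.cong) (auto simp: \<beta>_def g0 c_def algebra_simps add_divide_distrib)
  finally show ?thesis unfolding split by (simp add: sum.distrib gS cong: sum.cong)
 qed
 have c2: "c^2 = 1 / (4 * 2 ^ m)" by (simp add: c_def power_divide real_sqrt_pow2)
 \<comment> \<open>Parallelogram identity: passing from the two coefficients of a pair to their
   scaled sum (for the parent) and difference (for the fresh Gaussian) preserves the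
   variance.\<close>
 have s2: "(\<Sum>k<K. (\<beta> k)\<^sup>2) / 2 ^ m + (\<Sum>p\<in>?P \<union> S. (g p)\<^sup>2) = (\<Sum>j<K. (\<alpha> j)\<^sup>2) / 2 ^ Suc m + (\<Sum>p\<in>S. (\<gamma> p)\<^sup>2)"
 proof -
  have "(\<Sum>k<K. (\<beta> k)\<^sup>2) / 2 ^ m + (\<Sum>k<K. (g (Suc m, k))\<^sup>2)
   = (\<Sum>k<K. (\<beta> k)\<^sup>2 / 2 ^ m + (g (Suc m, k))^2)"
   by (simp add: sum.distrib sum_divide_distrib)
  also have "\<dots> = (\<Sum>k<K. ((a (2 * k))^2 + (a (Suc (2 * k)))^2) / 2 ^ Suc m)"
  proof (rule sum.cong[OF refl])
   fix k
   show "(\<beta> k)^2 / 2 ^ m + (g (Suc m, k))^2 = ((a (2 * k))^2 + (a (Suc (2 * k)))^2) / 2 ^ Suc m"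
    unfolding g0 power_mult_distrib c2 \<beta>_def by (simp add: field_simps power2_eq_square)
  qed
  also have "\<dots> = (\<Sum>j<K. (\<alpha> j)\<^sup>2) / 2 ^ Suc m"
   using pad[of "\<lambda>j v. v\<^sup>2"] by (simp add: sum_divide_distrib)
  finally show ?thesis unfolding split by (simp add: gS cong: sum.cong)
 qed
 show ?case unfolding s1 s2[symmetric]
  by (rule Suc.IH) (use Suc.prems in force)+
qed

lemma char_dinc:
 assumes [measurable]: "C \<in> sets borel"
 shows "(LINT w|M. indicator C (Z 0 w) * iexp (\<Sum>j<K. \<alpha> j * dinc m j w))
  = complex_of_real (prob {w\<in>space M. Z 0 w \<in> C} * exp (- ((\<Sum>j<K. (\<alpha> j)\<^sup>2) / 2 ^ m) / 2))"
 using char_dinc_xi[where S="{}" and \<gamma>="\<lambda>_. 0" and K=K and \<alpha>=\<alpha> and m=m and C=C] assms by simp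

definition walk :: "nat => nat => 'w => real" where
 "walk n k w = (\<Sum>j<k. dinc n j w)"

definition interp :: "nat => real => 'w => real" where
 "interp n t w = walk n (nat \<lfloor>2 ^ n * t\<rfloor>) w + frac (2 ^ n * t) * dinc n (nat \<lfloor>2 ^ n * t\<rfloor>) w"

lemma walk_meas [measurable]: "walk n k \<in> borel_measurable M"
 unfolding walk_def by measurable

lemma interp_meas [measurable]: "interp n t \<in> borel_measurable M"
 unfolding interp_def by measurable

lemma walk_double: "walk (Suc n) (2 * k) w = walk n k w"
 by (simp add: walk_def sum_pairs)

text \<open>Inside an interval of length 2^-n the two interpolations differ by a tent over its
  midpoint, whose height is the displacement introduced there.\<close>

lemma interp_step:
 assumes "0 <= t"
 shows "\<bar>interp (Suc n) t w - interp n t w\<bar> <= sqrt (1 / 2 ^ n) / 2 * \<bar>xi (Suc n, nat \<lfloor>2 ^ n * t\<rfloor>) w\<bar>"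
proof -
 define x where "x = 2 ^ n * t"
 define k where "k = nat \<lfloor>x\<rfloor>"
 define c where "c = sqrt (1 / 2 ^ n) / (2::real)"
 have c0: "0 <= c" by (simp add: c_def)
 have x0: "0 <= x" using assms by (simp add: x_def)
 then have k: "real k = of_int \<lfloor>x\<rfloor>" "int k = \<lfloor>x\<rfloor>" by (simp_all add: k_def)
 have xk: "x = real k + frac x" by (simp add: k frac_def)
 have f01: "0 <= frac x" "frac x < 1" by (simp_all add: frac_lt_1)
 have i0: "interp n t w = walk n k w + frac x * dinc n k w" by (simp add: interp_def x_def k_def)
 show ?thesis
 proof (cases "frac x < 1 / 2")
  case True
  have "2 * real k <= 2 * x" "2 * x < 2 * real k + 1" using True f01 xk by linarith+
  then have fl: "\<lfloor>2 * x\<rfloor> = int (2 * k)" by (intro floor_unique) auto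
  have tx: "2 ^ Suc n * t = 2 * x" by (simp add: x_def)
  have "frac (2 * x) = 2 * x - 2 * real k" unfolding frac_def fl by simp
  then have "nat \<lfloor>2 ^ Suc n * t\<rfloor> = 2 * k" "frac (2 ^ Suc n * t) = 2 * frac x"
   using xk unfolding tx fl by (simp, linarith)
  then have "interp (Suc n) t w = walk n k w + 2 * frac x * (dinc n k w / 2 + c * xi (Suc n, k) w)"
   by (simp add: interp_def walk_double c_def)
  then have "interp (Suc n) t w - interp n t w = 2 * frac x * (c * xi (Suc n, k) w)"
   unfolding i0 by (simp add: algebra_simps add_divide_distrib diff_divide_distrib)
  then have "\<bar>interp (Suc n) t w - interp n t w\<bar> = 2 * frac x * (c * \<bar>xi (Suc n, k) w\<bar>)"
   using f01 c0 by (simp add: abs_mult)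
  also have "\<dots> <= 1 * (c * \<bar>xi (Suc n, k) w\<bar>)" using True c0 by (intro mult_right_mono) auto
  finally show ?thesis by (simp add: c_def k_def x_def)
 next
  case False
  have "2 * real k + 1 <= 2 * x" "2 * x < 2 * real k + 2" using False f01 xk by linarith+
  then have fl: "\<lfloor>2 * x\<rfloor> = int (Suc (2 * k))" by (intro floor_unique) auto
  have tx: "2 ^ Suc n * t = 2 * x" by (simp add: x_def)
  have "frac (2 * x) = 2 * x - 2 * real k - 1" unfolding frac_def fl by simp
  then have "nat \<lfloor>2 ^ Suc n * t\<rfloor> = Suc (2 * k)" "frac (2 ^ Suc n * t) = 2 * frac x - 1"
   using xk unfolding tx fl by (simp, linarith)
  moreover have "walk (Suc n) (Suc (2 * k)) w = walk n k w + dinc (Suc n) (2 * k) w"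
   using walk_double[of n k w] by (simp add: walk_def)
  ultimately have "interp (Suc n) t w = walk n k w + (dinc n k w / 2 + c * xi (Suc n, k) w)
    + (2 * frac x - 1) * (dinc n k w / 2 - c * xi (Suc n, k) w)"
   by (simp add: interp_def c_def)
  then have "interp (Suc n) t w - interp n t w = (2 - 2 * frac x) * (c * xi (Suc n, k) w)"
   unfolding i0 by (simp add: algebra_simps add_divide_distrib diff_divide_distrib)
  then have "\<bar>interp (Suc n) t w - interp n t w\<bar> = (2 - 2 * frac x) * (c * \<bar>xi (Suc n, k) w\<bar>)"
   using f01 c0 by (simp add: abs_mult)
  also have "\<dots> <= 1 * (c * \<bar>xi (Suc n, k) w\<bar>)" using False c0 by (intro mult_right_mono) auto
  finally show ?thesis by (simp add: c_def k_def x_def)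
 qed
qed

text \<open>As a finite sum of ramps clamped to [0, 1] the interpolation is visibly continuous; the
  floor in its definition hides this.\<close>

lemma interp_continuous: "continuous_on {0..real N} (\<lambda>t. interp n t w)"
proof -
 define h where "h t = (\<Sum>j<Suc (N * 2 ^ n). dinc n j w * max 0 (min 1 (2 ^ n * t - real j)))" for t
 have "interp n t w = h t" if t: "t \<in> {0..real N}" for t
 proof -
  define x where "x = 2 ^ n * t"
  define k where "k = nat \<lfloor>x\<rfloor>"
  have x0: "0 <= x" "x <= real (N * 2 ^ n)" using t by (auto simp: x_def)
  then have k: "real k = of_int \<lfloor>x\<rfloor>" by (simp add: k_def)
  have xk: "x = real k + frac x" by (simp add: k frac_def)
  have f01: "0 <= frac x" "frac x < 1" by (simp_all add: frac_lt_1)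
  have "real k <= real (N * 2 ^ n)" using xk f01 x0 by linarith
  then have kN: "k <= N * 2 ^ n" by (simp only: of_nat_le_iff)
  have "h t = (\<Sum>j<Suc (N * 2 ^ n). (if j < k then dinc n j w else 0) + (if j = k then frac x * dinc n k w else 0))"
   unfolding h_def
  proof (rule sum.cong[OF refl])
   fix j
   consider "j < k" | "j = k" | "k < j" by linarith
   then show "dinc n j w * max 0 (min 1 (2 ^ n * t - real j))
    = (if j < k then dinc n j w else 0) + (if j = k then frac x * dinc n k w else 0)"
   proof cases
    case 1
    then have "real j + 1 <= real k" by linarith
    then have "1 <= x - real j" using xk f01 by linarith
    then show ?thesis using 1 by (simp add: x_def)
   next
    case 2
    then have "x - real j = frac x" using xk by linarith
    then show ?thesis using 2 f01 by (simp add: x_def)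
   next
    case 3
    then have "real k + 1 <= real j" by linarith
    then have "x - real j <= 0" using xk f01 by linarith
    then show ?thesis using 3 by (simp add: x_def)
   qed
  qed
  also have "\<dots> = walk n k w + frac x * dinc n k w"
  proof -
   have "(\<Sum>j<Suc (N * 2 ^ n). if j < k then dinc n j w else 0) = walk n k w"
    unfolding walk_def using kN by (intro sum.mono_neutral_cong_right) auto
   moreover have "(\<Sum>j<Suc (N * 2 ^ n). if j = k then frac x * dinc n k w else 0) = frac x * dinc n k w"
    using kN by (subst sum.delta) auto
   ultimately show ?thesis by (simp only: sum.distrib)
  qed
  finally show ?thesis by (simp add: interp_def x_def k_def)
 qed
 then show ?thesis
  by (subst continuous_on_cong[OF refl]) (auto simp: h_def intro!: continuous_intros)
qed

text \<open>At level n the index range 4^n covers the times below 2^n, hence eventually every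
  bounded interval. The bound (4/3)^n is large enough for Borel-Cantelli and small enough for
  (4/3)^n 2^(-n/2) to be summable.\<close>

definition good :: "'w set" where
 "good = {w\<in>space M. \<exists>N. \<forall>n\<in>{N..}. \<forall>k\<in>{..<4 ^ n}. \<bar>xi (Suc n, k) w\<bar> <= (4 / 3) ^ n}"

lemma good_meas [measurable]: "good \<in> events"
 unfolding good_def by measurable

text \<open>Markov's inequality with the sixth moment, which is 15: the union over 4^n indices has
  probability at most 15 times the n-th power of 4 (3/4)^6, which is below 3/4. The fourth moment
  would not do, since 4 (3/4)^4 > 1.\<close>

lemma AE_good: "AE w in M. w \<in> good"
proof -
 define A where "A n = {w\<in>space M. \<exists>k\<in>{..<(4::nat) ^ n}. (4 / 3) ^ n < \<bar>xi (Suc n, k) w\<bar>}" for n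
 have Am: "A n \<in> events" for n unfolding A_def by measurable
 have i6: "integrable M (\<lambda>w. (Z (Suc i) w) ^ 6)" "(LINT w|M. (Z (Suc i) w) ^ 6) = 15" for i
 proof -
  have g1: "gauss 1 = std_normal_distribution" by (simp add: gauss_def)
  have "integrable (distr M borel (Z (Suc i))) (\<lambda>x. x ^ 6)"
   unfolding Z_gauss g1 by (rule integrable_std_normal_distribution_moment)
  then show "integrable M (\<lambda>w. (Z (Suc i) w) ^ 6)" by (subst (asm) integrable_distr_eq) auto
  have "(LINT x|distr M borel (Z (Suc i)). x ^ 6) = 15"
   unfolding Z_gauss g1 using std_normal_distribution_even_moments(1)[of 3]
   by (simp add: fact_numeral)
  then show "(LINT w|M. (Z (Suc i) w) ^ 6) = 15" by (subst (asm) integral_distr) auto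
 qed
 have one: "prob {w\<in>space M. (4 / 3) ^ n < \<bar>Z (Suc i) w\<bar>} <= 15 / ((4 / 3) ^ n) ^ 6" for n i
 proof -
  have "prob {w\<in>space M. (4 / 3) ^ n < \<bar>Z (Suc i) w\<bar>} <= prob {w\<in>space M. ((4 / 3) ^ n) ^ 6 <= (Z (Suc i) w) ^ 6}"
  proof (rule finite_measure_mono)
   show "{w\<in>space M. (4 / 3) ^ n < \<bar>Z (Suc i) w\<bar>} \<subseteq> {w\<in>space M. ((4 / 3) ^ n) ^ 6 <= (Z (Suc i) w) ^ 6}"
   proof safe
    fix w assume "(4 / 3) ^ n < \<bar>Z (Suc i) w\<bar>"
    then have "((4 / 3) ^ n) ^ 6 <= \<bar>Z (Suc i) w\<bar> ^ 6" by (intro power_mono) auto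
    then show "((4 / 3) ^ n) ^ 6 <= (Z (Suc i) w) ^ 6" by simp
   qed
  qed measurable
  also have "\<dots> <= (LINT w|M. (Z (Suc i) w) ^ 6) / ((4 / 3) ^ n) ^ 6"
   using i6 by (intro integral_Markov_inequality_measure[where A="{}"]) auto
  finally show ?thesis by (simp add: i6)
 qed
 have bound: "prob (A n) <= 15 * (3 / 4) ^ n" for n
 proof -
  have "A n = (\<Union>k\<in>{..<(4::nat) ^ n}. {w\<in>space M. (4 / 3) ^ n < \<bar>xi (Suc n, k) w\<bar>})"
   by (auto simp: A_def)
  then have "prob (A n) <= (\<Sum>k<(4::nat) ^ n. prob {w\<in>space M. (4 / 3) ^ n < \<bar>xi (Suc n, k) w\<bar>})"
   by (simp only:) (rule finite_measure_subadditive_finite, auto)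
  also have "\<dots> <= (\<Sum>k<(4::nat) ^ n. 15 / ((4 / 3) ^ n) ^ 6)" by (intro sum_mono one)
  also have "\<dots> = 15 * (4 / (4 / 3) ^ 6) ^ n" 
   using power_divide[of 4 "(4 / 3 :: real) ^ 6" n] by (simp only: power_mult[symmetric] mult.commute[of n]) simp
  also have "\<dots> <= 15 * (3 / 4) ^ n" by (intro mult_left_mono power_mono) (auto simp: field_simps)
  finally show ?thesis .
 qed
 have "summable (\<lambda>n. prob (A n))"
  by (rule summable_comparison_test'[of "\<lambda>n. 15 * (3 / 4) ^ n" 0]) (auto intro!: summable_mult summable_geometric bound)
 then have "AE w in M. \<forall>\<^sub>F n in sequentially. w \<in> space M - A n"
  by (intro borel_cantelli_AE1 Am) (auto simp: emeasure_eq_measure)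
 then show ?thesis
 proof eventually_elim
  case (elim w)
  then obtain N where N: "\<And>n. n \<ge> N ==> w \<in> space M - A n" by (auto simp: eventually_sequentially)
  then have "w \<in> space M" by blast
  moreover have "\<bar>xi (Suc n, k) w\<bar> <= (4 / 3) ^ n" if "n \<ge> N" "k < 4 ^ n" for n k
   using N[OF that(1)] that(2) unfolding A_def by (auto simp: not_less)
  ultimately show ?case unfolding good_def by auto
 qed
qed

text \<open>Off \<open>good\<close> the path is set to 0, so that every path is continuous.\<close>

definition bm :: "'w => real => real" where
 "bm w t = (if w \<in> good then lim (\<lambda>n. interp n t w) else 0)"

lemma bm_meas [measurable]: "(\<lambda>w. bm w t) \<in> borel_measurable M"
 unfolding bm_def by measurable

lemma interp_uniform_limit:
 assumes "w \<in> good"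
 shows "uniform_limit {0..real T} (\<lambda>n t. interp n t w) (bm w) sequentially"
proof -
 obtain N where N: "\<And>n k. n \<ge> N ==> k < 4 ^ n ==> \<bar>xi (Suc n, k) w\<bar> <= (4 / 3) ^ n"
  using assms by (auto simp: good_def)
 \<comment> \<open>Ratio of the geometric bound: 2^(-n/2) is the scale of the tents and (4/3)^n the
   growth of their Gaussians; the square of the ratio is 8/9.\<close>
 define r where "r = sqrt (1/2) * (4/3)"
 have r: "0 <= r" "r < 1"
 proof -
  have "r^2 = 8 / 9" by (simp add: r_def power_mult_distrib power_divide)
  then have "r^2 < 1^2" by simp
  then show "r < 1" by (rule power_less_imp_less_base) simp
 qed (simp add: r_def)
 have "uniform_limit {0..real T} (\<lambda>n t. \<Sum>i<n. interp (Suc i) t w - interp i t w)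
  (\<lambda>t. suminf (\<lambda>i. interp (Suc i) t w - interp i t w)) sequentially"
 proof (rule Weierstrass_m_test_ev)
  show "summable (\<lambda>n. r ^ n)" using r by (intro summable_geometric) simp
  have "\<forall>\<^sub>F n in sequentially. n \<ge> max N (Suc T)" by (rule eventually_ge_at_top)
  then show "\<forall>\<^sub>F n in sequentially. \<forall>t\<in>{0..real T}. norm (interp (Suc n) t w - interp n t w) <= r ^ n"
  proof (eventually_elim, intro ballI)
   fix n t assume n: "n \<ge> max N (Suc T)" and t: "t \<in> {0..real T}"
   \<comment> \<open>This puts the index of every time up to \<open>T\<close> below 4^n, where
     \<open>good\<close> gives a bound.\<close>
   have "T < (2::nat) ^ n" using n less_exp[of n] by linarith
   then have "2 ^ n * T < (2::nat) ^ n * 2 ^ n" by simp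
   also have "\<dots> = 4 ^ n" by (simp add: power_mult_distrib[symmetric])
   finally have "real (2 ^ n * T) < real (4 ^ n)" by (simp only: of_nat_less_iff)
   moreover have "2 ^ n * t <= real (2 ^ n * T)" using t by simp
   ultimately have "2 ^ n * t < real (4 ^ n)" by linarith
   then have "nat \<lfloor>2 ^ n * t\<rfloor> < 4 ^ n"
    using t by (subst nat_less_iff) (auto simp: floor_less_iff)
   then have "\<bar>xi (Suc n, nat \<lfloor>2 ^ n * t\<rfloor>) w\<bar> <= (4 / 3) ^ n" using N n by auto
   then have "\<bar>interp (Suc n) t w - interp n t w\<bar> <= sqrt (1 / 2 ^ n) / 2 * (4 / 3) ^ n"
    using t by (intro order_trans[OF interp_step] mult_left_mono) auto
   also have "\<dots> = r ^ n / 2" by (simp add: r_def power_mult_distrib real_sqrt_power[symmetric] power_divide)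
   also have "\<dots> <= r ^ n" using r by simp
   finally show "norm (interp (Suc n) t w - interp n t w) <= r ^ n" by simp
  qed
 qed
 then have u: "uniform_limit {0..real T} (\<lambda>n t. interp 0 t w + (\<Sum>i<n. interp (Suc i) t w - interp i t w))
  (\<lambda>t. interp 0 t w + suminf (\<lambda>i. interp (Suc i) t w - interp i t w)) sequentially"
  by (intro uniform_limit_add uniform_limit_const)
 have tel: "interp 0 t w + (\<Sum>i<n. interp (Suc i) t w - interp i t w) = interp n t w" for n t
  by (induction n) simp_all
 have "bm w t = interp 0 t w + suminf (\<lambda>i. interp (Suc i) t w - interp i t w)" if "t \<in> {0..real T}" for t
  using tendsto_uniform_limitI[OF u that] assms unfolding tel bm_def by (simp add: limI)
 note eq = this
 show ?thesis unfolding uniform_limit_iff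
 proof (intro allI impI)
  fix e :: real assume "0 < e"
  from uniform_limitD[OF u this]
  show "\<forall>\<^sub>F n in sequentially. \<forall>t\<in>{0..real T}. dist (interp n t w) (bm w t) < e"
   by (rule eventually_mono) (auto simp: tel eq)
 qed
qed

lemma bm_continuous: "continuous_on {0..} (bm w)"
proof (cases "w \<in> good")
 case True
 have c: "continuous_on {0..real T} (bm w)" for T
  by (rule uniform_limit_theorem[OF _ interp_uniform_limit[OF True]])
   (auto intro!: always_eventually interp_continuous)
 show ?thesis unfolding continuous_on_eq_continuous_within
 proof
  fix x :: real assume x: "x \<in> {0..}"
  obtain T :: nat where T: "x < real T" using reals_Archimedean2 by blast
  have "at x within {0..} = at x within {0..real T}"
   by (rule at_within_nhd[of x "{..<real T}"]) (use T in auto)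
  with c[of T] x T show "continuous (at x within {0..}) (bm w)"
   by (simp add: continuous_on_eq_continuous_within continuous_within)
 qed
qed (simp add: bm_def)

lemma bm_zero: "bm w 0 = 0"
 by (simp add: bm_def interp_def walk_def limI)

lemma floor_dyadic_tendsto:
 "0 <= t ==> (\<lambda>n. real (nat \<lfloor>2 ^ n * t\<rfloor>) / 2 ^ n) \<longlonglongrightarrow> t"
proof (rule real_tendsto_sandwich)
 assume t: "0 <= t"
 have fl: "real (nat \<lfloor>2 ^ n * t\<rfloor>) = of_int \<lfloor>2 ^ n * t\<rfloor>" for n using t by simp
 show "\<forall>\<^sub>F n in sequentially. t - (1 / 2) ^ n <= real (nat \<lfloor>2 ^ n * t\<rfloor>) / 2 ^ n"
 proof (intro always_eventually allI)
  fix n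
  have "2 ^ n * t - 1 <= real (nat \<lfloor>2 ^ n * t\<rfloor>)" unfolding fl by linarith
  from divide_right_mono[OF this, of "2 ^ n"]
  show "t - (1 / 2) ^ n <= real (nat \<lfloor>2 ^ n * t\<rfloor>) / 2 ^ n" by (simp add: diff_divide_distrib power_divide)
 qed
 show "\<forall>\<^sub>F n in sequentially. real (nat \<lfloor>2 ^ n * t\<rfloor>) / 2 ^ n <= t"
 proof (intro always_eventually allI)
  fix n
  have "real (nat \<lfloor>2 ^ n * t\<rfloor>) <= 2 ^ n * t" unfolding fl by linarith
  from divide_right_mono[OF this, of "2 ^ n"]
  show "real (nat \<lfloor>2 ^ n * t\<rfloor>) / 2 ^ n <= t" by simp
 qed
 show "(\<lambda>n. t - (1 / 2) ^ n) \<longlonglongrightarrow> t"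
  using tendsto_diff[OF tendsto_const[of t] LIMSEQ_power_zero[of "1/2::real"]] by simp
qed simp

text \<open>Compare at the dyadic point below \<open>t\<close>, where the walk and its interpolation
  agree. Uniform convergence handles the level, continuity of the limit handles the moving
  point.\<close>

lemma walk_tendsto_bm:
 assumes dy: "w \<in> good" and t: "0 <= t"
 shows "(\<lambda>n. walk n (nat \<lfloor>2 ^ n * t\<rfloor>) w) \<longlonglongrightarrow> bm w t"
proof -
 define s where "s n = real (nat \<lfloor>2 ^ n * t\<rfloor>) / 2 ^ n" for n
 have ws: "walk n (nat \<lfloor>2 ^ n * t\<rfloor>) w = interp n (s n) w" for n
  by (simp add: interp_def s_def)
 obtain T :: nat where T: "t <= real T" using real_arch_simple by blast
 have sT: "s n \<in> {0..real T}" for n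
 proof -
  have "real (nat \<lfloor>2 ^ n * t\<rfloor>) <= 2 ^ n * t" using t by simp
  from divide_right_mono[OF this, of "2 ^ n"] have "s n <= t" by (simp add: s_def)
  with T show ?thesis by (simp add: s_def)
 qed
 have "(\<lambda>n. bm w (s n)) \<longlonglongrightarrow> bm w t"
  using floor_dyadic_tendsto[OF t] sT t
  by (intro continuous_on_tendsto_compose[OF bm_continuous]) (auto simp: s_def)
 moreover have "(\<lambda>n. interp n (s n) w - bm w (s n)) \<longlonglongrightarrow> 0"
 proof (rule LIMSEQ_I)
  fix e :: real assume "0 < e"
  from uniform_limitD[OF interp_uniform_limit[OF dy, of T] this]
  obtain N where "\<And>n. n \<ge> N ==> \<forall>x\<in>{0..real T}. dist (interp n x w) (bm w x) < e"
   by (auto simp: eventually_sequentially)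
  then show "\<exists>N. \<forall>n\<ge>N. norm (interp n (s n) w - bm w (s n) - 0) < e"
   using sT by (intro exI[of _ N]) (simp add: dist_real_def del: atLeastAtMost_iff)
 qed
 ultimately have "(\<lambda>n. bm w (s n) + (interp n (s n) w - bm w (s n))) \<longlonglongrightarrow> bm w t + 0" by (rule tendsto_add)
 then show ?thesis by (simp add: ws)
qed

lemma sum_list_walk:
 fixes L :: "(real \<times> real) list"
 assumes "\<And>r l. (r, l) \<in> set L ==> nat \<lfloor>2 ^ n * r\<rfloor> <= a"
 shows "(\<Sum>(r, l)\<leftarrow>L. l * walk n (nat \<lfloor>2 ^ n * r\<rfloor>) w)
  = (\<Sum>j<a. (\<Sum>(r, l)\<leftarrow>L. if j < nat \<lfloor>2 ^ n * r\<rfloor> then l else 0) * dinc n j w)"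
 using assms
proof (induction L)
 case (Cons p L)
 obtain r l where p: "p = (r, l)" by force
 have "l * walk n (nat \<lfloor>2 ^ n * r\<rfloor>) w = (\<Sum>j<a. (if j < nat \<lfloor>2 ^ n * r\<rfloor> then l else 0) * dinc n j w)"
  unfolding walk_def sum_distrib_left using Cons.prems[of r l] p
  by (intro sum.mono_neutral_cong_left) auto
 moreover have "(\<Sum>(r, l)\<leftarrow>L. l * walk n (nat \<lfloor>2 ^ n * r\<rfloor>) w)
  = (\<Sum>j<a. (\<Sum>(r, l)\<leftarrow>L. if j < nat \<lfloor>2 ^ n * r\<rfloor> then l else 0) * dinc n j w)"
  by (rule Cons.IH) (use Cons.prems in auto)
 ultimately show ?case by (simp add: p distrib_right sum.distrib)
qed simp

text \<open>At level n all times are rounded down to the grid. Past and increment then involve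
  disjoint blocks of \<open>dinc\<close>, and the factorization is exact; both sides pass to the
  limit by bounded convergence. The list \<open>L\<close> pairs times with frequencies.\<close>

lemma char_bm:
 assumes s: "0 <= s" "s < t" and L: "\<And>r l. (r, l) \<in> set L ==> 0 <= r \<and> r <= s"
  and [measurable]: "C \<in> sets borel"
 shows "(LINT w|M. indicator C (Z 0 w) * iexp (\<Sum>(r, l)\<leftarrow>L. l * bm w r) * iexp (u * (bm w t - bm w s)))
  = (LINT w|M. indicator C (Z 0 w) * iexp (\<Sum>(r, l)\<leftarrow>L. l * bm w r)) * complex_of_real (exp (- (u^2 * (t - s) / 2)))"
proof -
 define fl where "fl n r = nat \<lfloor>2 ^ n * r\<rfloor>" for n :: nat and r :: real
 have fl_mono: "fl n r <= fl n r'" if "r <= r'" for n r r'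
  unfolding fl_def using that by (intro nat_mono floor_mono mult_left_mono) auto
 define P where "P n w = (\<Sum>(r, l)\<leftarrow>L. l * walk n (fl n r) w)" for n w
 have slm: "(\<lambda>w. (\<Sum>(r, l)\<leftarrow>L. l * f r w)) \<in> borel_measurable M"
  if "\<And>r. f r \<in> borel_measurable M" for f :: "real => 'w => real"
 proof (induction L)
  case (Cons p L)
  obtain r l where p: "p = (r, l)" by force
  note [measurable] = that[of r] Cons
  show ?case by (simp add: p)
 qed simp
 have [measurable]: "P n \<in> borel_measurable M" for n unfolding P_def by (rule slm) measurable
 have [measurable]: "(\<lambda>w. (\<Sum>(r, l)\<leftarrow>L. l * bm w r)) \<in> borel_measurable M" by (rule slm) measurable
 have step: "(LINT w|M. indicator C (Z 0 w) * iexp (P n w) * iexp (u * (walk n (fl n t) w - walk n (fl n s) w)))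
  = (LINT w|M. indicator C (Z 0 w) * iexp (P n w)) *
   complex_of_real (exp (- (u^2 * (real (fl n t) / 2 ^ n - real (fl n s) / 2 ^ n) / 2)))" for n
 proof -
  define a b where "a = fl n s" and "b = fl n t"
  have ab: "a <= b" unfolding a_def b_def using s by (intro fl_mono) simp
  define \<beta> where "\<beta> j = (\<Sum>(r, l)\<leftarrow>L. if j < fl n r then l else 0)" for j
  have Pn: "P n w = (\<Sum>j<a. \<beta> j * dinc n j w)" for w
   unfolding P_def \<beta>_def fl_def
   by (rule sum_list_walk) (use L fl_mono in \<open>auto simp: a_def fl_def\<close>)
  define \<alpha> where "\<alpha> j = (if j < a then \<beta> j else u)" for j
  have un: "{..<b} = {..<a} \<union> {a..<b}" "{..<a} \<inter> {a..<b} = {}" using ab by auto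
  have sp: "(\<Sum>j<b. f j (\<alpha> j)) = (\<Sum>j<a. f j (\<beta> j)) + (\<Sum>j\<in>{a..<b}. f j u)" for f :: "nat => real => real"
   unfolding un(1) by (subst sum.union_disjoint) (auto simp: \<alpha>_def un(2))
  have wd: "walk n b w - walk n a w = (\<Sum>j\<in>{a..<b}. dinc n j w)" for w
   unfolding walk_def un(1) by (subst sum.union_disjoint) (auto simp: un(2))
  have "iexp (P n w) * iexp (u * (walk n b w - walk n a w)) = iexp (\<Sum>j<b. \<alpha> j * dinc n j w)" for w
   unfolding Pn wd sp[of "\<lambda>j v. v * dinc n j w"]
   by (simp add: sum_distrib_left exp_add[symmetric] distrib_left)
  then have "(LINT w|M. indicator C (Z 0 w) * iexp (P n w) * iexp (u * (walk n b w - walk n a w)))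
   = complex_of_real (prob {w\<in>space M. Z 0 w \<in> C} * exp (- ((\<Sum>j<b. (\<alpha> j)\<^sup>2) / 2 ^ n) / 2))"
   using char_dinc[where C=C and K=b and \<alpha>=\<alpha> and m=n] by (simp add: mult.assoc)
  also have "- ((\<Sum>j<b. (\<alpha> j)\<^sup>2) / 2 ^ n) / 2 = - ((\<Sum>j<a. (\<beta> j)\<^sup>2) / 2 ^ n) / 2 + - (u^2 * (real b / 2 ^ n - real a / 2 ^ n) / 2)"
   unfolding sp[of "\<lambda>j v. v\<^sup>2"] using ab by (simp add: field_simps of_nat_diff)
  also have "complex_of_real (prob {w\<in>space M. Z 0 w \<in> C} * exp (- ((\<Sum>j<a. (\<beta> j)\<^sup>2) / 2 ^ n) / 2 + - (u^2 * (real b / 2 ^ n - real a / 2 ^ n) / 2)))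
   = (LINT w|M. indicator C (Z 0 w) * iexp (P n w)) * complex_of_real (exp (- (u^2 * (real b / 2 ^ n - real a / 2 ^ n) / 2)))"
   unfolding Pn char_dinc[OF \<open>C \<in> sets borel\<close>] by (simp only: exp_add of_real_mult mult.assoc)
  finally show ?thesis by (simp add: a_def b_def)
 qed
 have Plim: "AE w in M. (\<lambda>n. P n w) \<longlonglongrightarrow> (\<Sum>(r, l)\<leftarrow>L. l * bm w r)"
  using AE_good
 proof eventually_elim
  case (elim w)
  from L show ?case unfolding P_def
  proof (induction L)
   case (Cons p L)
   obtain r l where p: "p = (r, l)" by force
   have "(\<lambda>n. walk n (fl n r) w) \<longlonglongrightarrow> bm w r"
    unfolding fl_def using Cons.prems[of r l] p elim by (intro walk_tendsto_bm) auto
   with Cons show ?case by (auto simp: p intro!: tendsto_intros)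
  qed simp
 qed
 have dlim: "AE w in M. (\<lambda>n. walk n (fl n t) w - walk n (fl n s) w) \<longlonglongrightarrow> bm w t - bm w s"
  using AE_good
 proof eventually_elim
  case (elim w)
  show ?case unfolding fl_def using elim s by (intro tendsto_diff walk_tendsto_bm) auto
 qed
 have l1: "(\<lambda>n. \<integral>w. indicator C (Z 0 w) * iexp (P n w) * iexp (u * (walk n (fl n t) w - walk n (fl n s) w)) \<partial>M)
  \<longlonglongrightarrow> (LINT w|M. indicator C (Z 0 w) * iexp (\<Sum>(r, l)\<leftarrow>L. l * bm w r) * iexp (u * (bm w t - bm w s)))"
 proof (rule integral_dominated_convergence[where w="\<lambda>_. 1"])
  show "AE w in M. (\<lambda>n. indicator C (Z 0 w) * iexp (P n w) * iexp (u * (walk n (fl n t) w - walk n (fl n s) w)))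
   \<longlonglongrightarrow> indicator C (Z 0 w) * iexp (\<Sum>(r, l)\<leftarrow>L. l * bm w r) * iexp (u * (bm w t - bm w s))"
   using Plim dlim by eventually_elim (intro tendsto_mult tendsto_const tendsto_exp tendsto_of_real)
 qed (auto simp: norm_mult indicator_def)
 have l2: "(\<lambda>n. \<integral>w. indicator C (Z 0 w) * iexp (P n w) \<partial>M)
  \<longlonglongrightarrow> (LINT w|M. indicator C (Z 0 w) * iexp (\<Sum>(r, l)\<leftarrow>L. l * bm w r))"
 proof (rule integral_dominated_convergence[where w="\<lambda>_. 1"])
  show "AE w in M. (\<lambda>n. indicator C (Z 0 w) * iexp (P n w))
   \<longlonglongrightarrow> indicator C (Z 0 w) * iexp (\<Sum>(r, l)\<leftarrow>L. l * bm w r)"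
   using Plim by eventually_elim (intro tendsto_intros)
 qed (auto simp: norm_mult indicator_def)
 have l3: "(\<lambda>n. complex_of_real (exp (- (u^2 * (real (fl n t) / 2 ^ n - real (fl n s) / 2 ^ n) / 2))))
  \<longlonglongrightarrow> complex_of_real (exp (- (u^2 * (t - s) / 2)))"
  unfolding fl_def using s by (intro tendsto_intros floor_dyadic_tendsto) auto
 show ?thesis
  by (rule LIMSEQ_unique[OF l1]) (unfold step, rule tendsto_mult[OF l2 l3])
qed

text \<open>Indicators of the past are brought in one time at a time: for a new time
  \<open>q\<close>, the induction hypothesis with \<open>(q, l)\<close> added to the list is
  precisely the orthogonality that \<open>char_orthogonal\<close> asks for.\<close>

lemma char_bm_cylinder:
 assumes s: "0 <= s" "s < t" and J: "finite J" "J \<subseteq> {0..s}"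
  and [measurable]: "C0 \<in> sets borel" "\<And>r. C r \<in> sets borel"
  and L: "\<And>r l. (r, l) \<in> set L ==> 0 <= r \<and> r <= s"
 shows "(LINT w|M. (\<Prod>r\<in>J. indicator (C r) (bm w r)) * (indicator C0 (Z 0 w) * iexp (\<Sum>(r, l)\<leftarrow>L. l * bm w r) *
   (iexp (u * (bm w t - bm w s)) - complex_of_real (exp (- (u^2 * (t - s) / 2)))))) = 0"
proof -
 have slm: "(\<lambda>w. (\<Sum>(r, l)\<leftarrow>L. l * bm w r)) \<in> borel_measurable M" for L
 proof (induction L)
  case (Cons p L)
  obtain r l where p: "p = (r, l)" by force
  note [measurable] = Cons
  show ?case by (simp add: p)
 qed simp
 note [measurable] = slm
 have e1: "\<bar>exp (- (u^2 * (t - s) / 2))\<bar> <= 1" using s by simp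
 show ?thesis using J L
 proof (induction J arbitrary: L rule: finite_induct)
  case empty
  have i: "integrable M (\<lambda>w. indicator C0 (Z 0 w) * iexp (\<Sum>(r, l)\<leftarrow>L. l * bm w r) * iexp (u * (bm w t - bm w s)))"
   "integrable M (\<lambda>w. indicator C0 (Z 0 w) * iexp (\<Sum>(r, l)\<leftarrow>L. l * bm w r))"
   by (auto intro!: integrable_const_bound[where B=1] simp: norm_mult indicator_def)
  show ?case using char_bm[OF s empty.prems(2), where C=C0 and u=u] i by (simp add: right_diff_distrib)
 next
  case (insert q J)
  have "(LINT w|M. indicator (C q) (bm w q) * ((\<Prod>r\<in>J. indicator (C r) (bm w r)) *
    (indicator C0 (Z 0 w) * iexp (\<Sum>(r, l)\<leftarrow>L. l * bm w r) *
    (iexp (u * (bm w t - bm w s)) - complex_of_real (exp (- (u^2 * (t - s) / 2))))))) = 0"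
  proof (rule char_orthogonal[where K="1 * (1 * 2)"])
   fix l
   have "(LINT w|M. (\<Prod>r\<in>J. indicator (C r) (bm w r)) * (indicator C0 (Z 0 w) * iexp (\<Sum>(r, l)\<leftarrow>(q, l) # L. l * bm w r) *
    (iexp (u * (bm w t - bm w s)) - complex_of_real (exp (- (u^2 * (t - s) / 2)))))) = 0"
    by (rule insert.IH) (use insert.prems in auto)
   then show "(LINT w|M. iexp (l * bm w q) * ((\<Prod>r\<in>J. indicator (C r) (bm w r)) *
    (indicator C0 (Z 0 w) * iexp (\<Sum>(r, l)\<leftarrow>L. l * bm w r) *
    (iexp (u * (bm w t - bm w s)) - complex_of_real (exp (- (u^2 * (t - s) / 2))))))) = 0"
    by (simp add: distrib_left exp_add mult_ac)
  next
   fix w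
   have "norm (\<Prod>r\<in>J. indicator (C r) (bm w r) :: complex) <= 1"
    unfolding prod_norm[symmetric] by (rule prod_le_1) (auto simp: indicator_def)
   moreover have "norm (indicator C0 (Z 0 w) * iexp (\<Sum>(r, l)\<leftarrow>L. l * bm w r)) <= 1"
    by (simp add: norm_mult indicator_def)
   moreover have "norm (iexp (u * (bm w t - bm w s)) - complex_of_real (exp (- (u^2 * (t - s) / 2)))) <= 2"
    using norm_triangle_ineq4[of "iexp (u * (bm w t - bm w s))" "complex_of_real (exp (- (u^2 * (t - s) / 2)))"] e1
    unfolding norm_of_real norm_exp_i_times by linarith
   ultimately show "norm ((\<Prod>r\<in>J. indicator (C r) (bm w r)) * (indicator C0 (Z 0 w) * iexp (\<Sum>(r, l)\<leftarrow>L. l * bm w r) *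
    (iexp (u * (bm w t - bm w s)) - complex_of_real (exp (- (u^2 * (t - s) / 2)))))) <= 1 * (1 * 2)"
    unfolding norm_mult by (intro mult_mono) (auto simp: norm_mult[symmetric])
  qed measurable
  then show ?case using insert.hyps by (simp add: mult.assoc)
 qed
qed

lemma bm_pair_bm:
 assumes [measurable]: "d \<in> borel_measurable borel"
 shows "bm_pair M (\<lambda>w. d (Z 0 w) :: 'a::euclidean_space) bm"
proof (unfold_locales)
 fix s t :: real and J :: "real set" and C0 :: "'a set" and C :: "real => real set" and D :: "real set"
 assume s: "0 <= s" "s < t" and J: "finite J" "J \<subseteq> {0..s}" and C0[measurable]: "C0 \<in> sets (borel :: 'a measure)"
  and C[measurable]: "\<And>r. C r \<in> sets borel" and D[measurable]: "D \<in> sets (borel :: real measure)"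
 define A where "A = {w\<in>space M. d (Z 0 w) \<in> C0 \<and> (\<forall>r\<in>J. bm w r \<in> C r)}"
 have [measurable]: "A \<in> events" unfolding A_def using J(1) by measurable
 have pre: "d -` C0 \<in> sets borel" using measurable_sets[OF assms C0] by simp
 have char: "(LINT w|M. iexp (u * (bm w t - bm w s)) * indicator A w) = complex_of_real (exp (- (u^2 * (t - s) / 2))) * prob A" for u
 proof -
  have i: "integrable M (\<lambda>w. iexp (u * (bm w t - bm w s)) * indicator A w)" "integrable M (\<lambda>w. complex_of_real (indicator A w))"
   by (auto intro!: integrable_const_bound[where B=1] simp: norm_mult indicator_def)
  have ind: "(indicator A w :: complex) = (\<Prod>r\<in>J. indicator (C r) (bm w r)) * indicator (d -` C0) (Z 0 w)"
   if "w \<in> space M" for w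
   using that J(1) by (cases "\<forall>r\<in>J. bm w r \<in> C r") (auto simp: A_def indicator_def)
  have "0 = (LINT w|M. (\<Prod>r\<in>J. indicator (C r) (bm w r)) * (indicator (d -` C0) (Z 0 w) * iexp (\<Sum>(r, l)\<leftarrow>[]. l * bm w r) *
   (iexp (u * (bm w t - bm w s)) - complex_of_real (exp (- (u^2 * (t - s) / 2))))))"
   by (rule char_bm_cylinder[OF s J pre C, symmetric]) auto
  also have "\<dots> = (LINT w|M. iexp (u * (bm w t - bm w s)) * indicator A w - complex_of_real (exp (- (u^2 * (t - s) / 2))) * complex_of_real (indicator A w))"
  proof (rule Bochner_Integration.integral_cong[OF refl])
   fix w assume "w \<in> space M"
   have "complex_of_real (indicator A w) = indicator A w" by (simp add: indicator_def)
   then show "(\<Prod>r\<in>J. indicator (C r) (bm w r)) * (indicator (d -` C0) (Z 0 w) * iexp (\<Sum>(r, l)\<leftarrow>[]. l * bm w r) *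
    (iexp (u * (bm w t - bm w s)) - complex_of_real (exp (- (u^2 * (t - s) / 2)))))
    = iexp (u * (bm w t - bm w s)) * indicator A w - complex_of_real (exp (- (u^2 * (t - s) / 2))) * complex_of_real (indicator A w)"
    using ind[OF \<open>w \<in> space M\<close>] by (simp add: algebra_simps)
  qed
  also have "\<dots> = (LINT w|M. iexp (u * (bm w t - bm w s)) * indicator A w) - complex_of_real (exp (- (u^2 * (t - s) / 2))) * (LINT w|M. complex_of_real (indicator A w))"
   using i by (subst Bochner_Integration.integral_diff) auto
  also have "(LINT w|M. complex_of_real (indicator A w)) = complex_of_real (prob A)"
   unfolding integral_complex_of_real by (simp add: A_def Int_absorb2 Collect_conj_eq)
  finally show ?thesis by simp
 qed
 have char1: "(LINT w|M. iexp (u * (bm w t - bm w s))) = complex_of_real (exp (- (u^2 * (t - s) / 2)))" for u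
  using char_bm[OF s, where L="[]" and C=UNIV and u=u] by (simp add: prob_space)
 have "prob {w\<in>space M. w \<in> A \<and> bm w t - bm w s \<in> D} = prob A * measure (gauss (t - s)) D"
  by (rule indep_gauss_of_char(1)[OF _ _ _ _ char1 char]) (use s in auto)
 moreover have "{w\<in>space M. w \<in> A \<and> bm w t - bm w s \<in> D}
  = {w\<in>space M. (d (Z 0 w) \<in> C0 \<and> (\<forall>r\<in>J. bm w r \<in> C r)) \<and> bm w t - bm w s \<in> D}"
  by (auto simp: A_def)
 ultimately show "prob {w\<in>space M. (d (Z 0 w) \<in> C0 \<and> (\<forall>r\<in>J. bm w r \<in> C r)) \<and> bm w t - bm w s \<in> D}
  = prob {w\<in>space M. d (Z 0 w) \<in> C0 \<and> (\<forall>r\<in>J. bm w r \<in> C r)} * measure (gauss (t - s)) D"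
  by (simp add: A_def)
qed (auto intro: bm_zero bm_continuous)

end

theorem bm_pair_exists:
 fixes \<mu> :: "'a::euclidean_space measure"
 assumes "prob_space \<mu>" "sets \<mu> = sets borel"
 obtains M :: "real measure" and X :: "real => 'a" and B where "bm_pair M X B" "distr M borel X = \<mu>"
proof -
 obtain e :: "'a => real" and d where e[measurable]: "e \<in> borel_measurable borel" and d[measurable]: "d \<in> borel_measurable borel"
  and de: "\<And>x. d (e x) = x" using euclidean_coding by metis
 \<comment> \<open>The law at index 0 is the image of \<open>\<mu>\<close> under the code; decoding
   \<open>Z 0\<close> returns a variable with law \<open>\<mu>\<close>.\<close>
 define m where "m i = (case i of 0 => distr \<mu> borel e | Suc _ => gauss 1)" for i :: nat
 have e\<mu>: "e \<in> \<mu> \<rightarrow>\<^sub>M borel" using e by (simp add: measurable_cong_sets[OF assms(2) refl])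
 have "prob_space (m i)" "sets (m i) = sets borel" for i
  using prob_space.prob_space_distr[OF assms(1) e\<mu>] prob_space_gauss[of 1] by (auto simp: m_def split: nat.split)
 then obtain M :: "real measure" and Z where M: "prob_space M" "prob_space.indep_vars M (\<lambda>_. borel) Z UNIV"
  and Z: "\<And>i. distr M borel (Z i) = m i" using independent_sequence_on_real[of m] by metis
 interpret gaussian_sequence M Z
  using M Z by (auto simp: gaussian_sequence_def gaussian_sequence_axioms_def m_def)
 have "distr M borel (\<lambda>w. d (Z 0 w)) = distr (distr M borel (Z 0)) borel d"
  by (subst distr_distr) (auto simp: comp_def)
 also have "\<dots> = distr \<mu> borel (\<lambda>x. x)" unfolding Z m_def using e\<mu> by (simp add: distr_distr comp_def de)
 also have "\<dots> = \<mu>" by (rule distr_id2) (simp add: assms)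
 finally show ?thesis using that[OF bm_pair_bm[OF d]] by blast
qed

section \<open>Brownian increments relative to the filtration of \<open>X\<close> and
  \<open>B\<close>\<close>

context bm_pair
begin

abbreviation MT :: "('w \<times> real) measure" where
 "MT \<equiv> M \<Otimes>\<^sub>M lborel"

text \<open>Generates the sigma-algebra of an observer who sees \<open>X\<close> itself besides
  \<open>B\<close>; the observation filtration \<open>F\<close> defined later is coarser.\<close>

definition cylG :: "real => 'w set set" where
 "cylG s = {{w\<in>space M. X w \<in> C0 \<and> (\<forall>r\<in>J. B w r \<in> C r)} | C0 J C.
   finite J \<and> J \<subseteq> {0..s} \<and> C0 \<in> sets borel \<and> (\<forall>r. C r \<in> sets borel)}"

definition G :: "real => 'w measure" where
 "G s = sigma (space M) (cylG s)"

lemma cylG_Pow: "cylG s \<subseteq> Pow (space M)"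
 by (auto simp: cylG_def)

lemma space_G [simp]: "space (G s) = space M"
 by (simp add: G_def space_measure_of cylG_Pow)

lemma sets_G: "sets (G s) = sigma_sets (space M) (cylG s)"
 by (simp add: G_def sets_measure_of cylG_Pow)

lemma cylG_events: "cylG s \<subseteq> events"
proof
 fix A assume "A \<in> cylG s"
 then obtain C0 J C where A: "A = {w\<in>space M. X w \<in> C0 \<and> (\<forall>r\<in>J. B w r \<in> C r)}"
  and J: "finite J" "J \<subseteq> {0..s}" and [measurable]: "C0 \<in> sets borel" "\<And>r. C r \<in> sets borel" by (auto simp: cylG_def)
 have "{w\<in>space M. \<forall>r\<in>J. B w r \<in> C r} \<in> events"
 proof (rule sets.sets_Collect_finite_All)
  fix r assume "r \<in> J"
  then have [measurable]: "(\<lambda>w. B w r) \<in> borel_measurable M" using J by (intro B_meas) auto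
  show "{w\<in>space M. B w r \<in> C r} \<in> events" by measurable
 qed (rule J)
 moreover have "{w\<in>space M. X w \<in> C0} \<in> events" by measurable
 ultimately show "A \<in> events" unfolding A by (intro sets.sets_Collect_conj)
qed

lemma subalgebra_G: "subalgebra M (G s)"
 unfolding subalgebra_def using sets.sigma_sets_subset[OF cylG_events] by (simp add: sets_G)

lemma Int_stable_cylG: "Int_stable (cylG s)"
proof (rule Int_stableI)
 fix A A' assume "A \<in> cylG s" "A' \<in> cylG s"
 then obtain C0 J C C0' J' C' where A: "A = {w\<in>space M. X w \<in> C0 \<and> (\<forall>r\<in>J. B w r \<in> C r)}"
  "A' = {w\<in>space M. X w \<in> C0' \<and> (\<forall>r\<in>J'. B w r \<in> C' r)}"
  and J: "finite J" "J \<subseteq> {0..s}" "finite J'" "J' \<subseteq> {0..s}"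
  and C: "C0 \<in> sets borel" "\<And>r. C r \<in> sets borel" "C0' \<in> sets borel" "\<And>r. C' r \<in> sets borel"
  by (auto simp: cylG_def)
 let ?C = "\<lambda>r. (if r \<in> J then C r else UNIV) \<inter> (if r \<in> J' then C' r else UNIV)"
 have "A \<inter> A' = {w\<in>space M. X w \<in> C0 \<inter> C0' \<and> (\<forall>r\<in>J \<union> J'. B w r \<in> ?C r)}"
  unfolding A by auto
 moreover have "?C r \<in> sets borel" for r using C by auto
 ultimately show "A \<inter> A' \<in> cylG s" unfolding cylG_def using J C
  by (intro CollectI exI[of _ "C0 \<inter> C0'"] exI[of _ "J \<union> J'"] exI[of _ ?C]) auto
qed

lemma G_mono:
 assumes "s <= t" shows "sets (G s) \<subseteq> sets (G t)"
proof -
 have "cylG s \<subseteq> cylG t"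
 proof
  fix A assume "A \<in> cylG s"
  then obtain C0 J C where "A = {w\<in>space M. X w \<in> C0 \<and> (\<forall>r\<in>J. B w r \<in> C r)}" "finite J" "J \<subseteq> {0..s}"
   "C0 \<in> sets borel" "\<forall>r. C r \<in> sets borel"
   by (auto simp: cylG_def)
  moreover from this(3) have "J \<subseteq> {0..t}" using assms by auto
  ultimately show "A \<in> cylG t" unfolding cylG_def by blast
 qed
 then show ?thesis unfolding sets_G by (rule sigma_sets_mono')
qed

lemma X_meas_G [measurable]: "X \<in> borel_measurable (G s)"
proof (rule measurableI)
 fix C assume "C \<in> sets (borel :: 'a measure)"
 then have "{w\<in>space M. X w \<in> C \<and> (\<forall>r\<in>{}. B w r \<in> UNIV)} \<in> cylG s" unfolding cylG_def by fastforce
 moreover have "X -` C \<inter> space (G s) = {w\<in>space M. X w \<in> C \<and> (\<forall>r\<in>{}. B w r \<in> UNIV)}" by auto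
 ultimately show "X -` C \<inter> space (G s) \<in> sets (G s)" by (simp add: sets_G sigma_sets.Basic)
qed simp

lemma B_meas_G:
 assumes "0 <= r" "r <= s" shows "(\<lambda>w. B w r) \<in> borel_measurable (G s)"
proof (rule measurableI)
 fix C assume "C \<in> sets (borel :: real measure)"
 then have "{w\<in>space M. X w \<in> UNIV \<and> (\<forall>q\<in>{r}. B w q \<in> (\<lambda>_. C) q)} \<in> cylG s"
  unfolding cylG_def using assms by (intro CollectI exI[of _ UNIV] exI[of _ "{r}"] exI[of _ "\<lambda>_. C"]) auto
 moreover have "(\<lambda>w. B w r) -` C \<inter> space (G s) = {w\<in>space M. X w \<in> UNIV \<and> (\<forall>q\<in>{r}. B w q \<in> (\<lambda>_. C) q)}" by auto
 ultimately show "(\<lambda>w. B w r) -` C \<inter> space (G s) \<in> sets (G s)" by (simp add: sets_G sigma_sets.Basic)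
qed simp

text \<open>Cylinders are stable under intersection, so the axiom of the locale extends to the
  generated sigma-algebra by Dynkin's argument.\<close>

lemma indep_increment:
 assumes s: "0 <= s" "s < t" and A: "A \<in> sets (G s)" and D[measurable]: "D \<in> sets borel"
 shows "prob {w\<in>space M. w \<in> A \<and> B w t - B w s \<in> D} = prob A * measure (gauss (t - s)) D"
proof -
 have [measurable]: "(\<lambda>w. B w t) \<in> borel_measurable M" "(\<lambda>w. B w s) \<in> borel_measurable M"
  using s by (auto intro!: B_meas)
 define E where "E = {w\<in>space M. B w t - B w s \<in> D}"
 have E: "E \<in> events" unfolding E_def by measurable
 have sub: "A \<in> events" if "A \<in> sigma_sets (space M) (cylG s)" for A
  using that subalgebra_G[of s] by (auto simp: subalgebra_def sets_G)
 have "prob (A \<inter> E) = prob A * measure (gauss (t - s)) D"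
  using Int_stable_cylG cylG_Pow A[unfolded sets_G]
 proof (induction rule: sigma_sets_induct_disjoint)
  case (basic A)
  then obtain C0 J C where A: "A = {w\<in>space M. X w \<in> C0 \<and> (\<forall>r\<in>J. B w r \<in> C r)}"
   and J: "finite J" "J \<subseteq> {0..s}" and C: "C0 \<in> sets borel" "\<And>r. C r \<in> sets borel" by (auto simp: cylG_def)
  have "A \<inter> E = {w\<in>space M. (X w \<in> C0 \<and> (\<forall>r\<in>J. B w r \<in> C r)) \<and> B w t - B w s \<in> D}"
   by (auto simp: A E_def)
  with B_indep[OF s J C D] show ?case by (simp add: A)
 next
  case (compl A)
  have "{w\<in>space M. (X w \<in> UNIV \<and> (\<forall>r\<in>{}. B w r \<in> UNIV)) \<and> B w t - B w s \<in> D} = E" by (auto simp: E_def)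
  with B_indep[OF s, of "{}" UNIV "\<lambda>_. UNIV" D] have "prob E = measure (gauss (t - s)) D" by (simp add: prob_space)
  moreover have "prob ((space M - A) \<inter> E) = prob E - prob (A \<inter> E)"
   using finite_measure_Diff'[OF E sub[OF compl(1)]] E
   by (metis Diff_Int_distrib2 E Int_Diff Int_commute sets.Int_space_eq1)
  moreover have "prob (space M - A) = 1 - prob A" using sub[OF compl(1)] by (rule prob_compl)
  ultimately show ?case using compl(2) by (simp add: left_diff_distrib)
 next
  case (union A)
  have Ai: "range A \<subseteq> events" using union(2) sub by auto
  have "(\<lambda>i. prob (A i \<inter> E)) sums prob (\<Union>i. A i \<inter> E)"
   using Ai E union(1) by (intro finite_measure_UNION) (auto simp: disjoint_family_on_def)
  moreover have "(\<lambda>i. prob (A i) * measure (gauss (t - s)) D) sums (prob (\<Union>i. A i) * measure (gauss (t - s)) D)"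
   by (intro sums_mult2 finite_measure_UNION Ai union(1))
  ultimately show ?case unfolding union(3) by (simp add: sums_unique2)
 qed simp
 moreover have "{w\<in>space M. w \<in> A \<and> B w t - B w s \<in> D} = A \<inter> E" using sub A by (auto simp: E_def sets_G dest: sets.sets_into_space)
 ultimately show ?thesis by simp
qed

text \<open>Freezing: the sample point, seen through \<open>G s\<close>, and the increment have a
  product law. The first component carries \<open>X\<close>, the observation up to \<open>s\<close>
  and the indicators of past events all at once.\<close>

lemma nn_integral_increment:
 fixes f :: "'w \<times> real => ennreal"
 assumes s: "0 <= s" "s < t" and f: "f \<in> borel_measurable (G s \<Otimes>\<^sub>M borel)"
 shows "(\<integral>\<^sup>+w. f (w, B w t - B w s) \<partial>M) = (\<integral>\<^sup>+w. (\<integral>\<^sup>+dy. f (w, dy) \<partial>gauss (t - s)) \<partial>M)"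
proof -
 let ?R = "restr_to_subalg M (G s)"
 interpret g: prob_space "gauss (t - s)" using s by (intro prob_space_gauss) simp
 interpret R: prob_space ?R using prob_space_restr_to_subalg[OF subalgebra_G] prob_space_axioms by blast
 have sR: "sets ?R = sets (G s)" by (rule sets_restr_to_subalg[OF subalgebra_G])
 have [measurable]: "(\<lambda>w. B w t) \<in> borel_measurable M" "(\<lambda>w. B w s) \<in> borel_measurable M"
  using s by (auto intro!: B_meas)
 have sP: "sets (?R \<Otimes>\<^sub>M gauss (t - s)) = sets (G s \<Otimes>\<^sub>M borel)" using sR by (intro sets_pair_measure_cong) auto
 have id: "(\<lambda>w. w) \<in> M \<rightarrow>\<^sub>M G s" using subalgebra_G by (auto simp: subalgebra_def measurable_def Int_absorb2 dest: sets.sets_into_space)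
 have m: "(\<lambda>w. (w, B w t - B w s)) \<in> M \<rightarrow>\<^sub>M G s \<Otimes>\<^sub>M borel"
  by (intro measurable_Pair id) measurable
 have eq: "?R \<Otimes>\<^sub>M gauss (t - s) = distr M (G s \<Otimes>\<^sub>M borel) (\<lambda>w. (w, B w t - B w s))"
 proof (rule pair_measure_eqI)
  fix A D assume "A \<in> sets ?R" "D \<in> sets (gauss (t - s))"
  then have A: "A \<in> sets (G s)" and D: "D \<in> sets borel" by (simp_all add: sR)
  have "emeasure (distr M (G s \<Otimes>\<^sub>M borel) (\<lambda>w. (w, B w t - B w s))) (A \<times> D)
   = emeasure M {w\<in>space M. w \<in> A \<and> B w t - B w s \<in> D}"
   using A D m by (subst emeasure_distr) (auto intro!: arg_cong[where f="emeasure M"])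
  also have "\<dots> = ennreal (prob A * measure (gauss (t - s)) D)"
   unfolding indep_increment[OF s A D, symmetric] emeasure_eq_measure ..
  also have "\<dots> = emeasure ?R A * emeasure (gauss (t - s)) D"
   by (simp add: emeasure_restr_to_subalg[OF subalgebra_G A] emeasure_eq_measure g.emeasure_eq_measure ennreal_mult)
  finally show "emeasure ?R A * emeasure (gauss (t - s)) D
   = emeasure (distr M (G s \<Otimes>\<^sub>M borel) (\<lambda>w. (w, B w t - B w s))) (A \<times> D)" ..
 next
  show "sets (?R \<Otimes>\<^sub>M gauss (t - s)) = sets (distr M (G s \<Otimes>\<^sub>M borel) (\<lambda>w. (w, B w t - B w s)))"
   by (simp only: sP sets_distr)
 qed (rule R.sigma_finite_measure_axioms g.sigma_finite_measure_axioms)+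
 have fP: "f \<in> borel_measurable (?R \<Otimes>\<^sub>M gauss (t - s))" using f by (simp add: measurable_cong_sets[OF sP refl])
 have "(\<integral>\<^sup>+w. f (w, B w t - B w s) \<partial>M) = (\<integral>\<^sup>+p. f p \<partial>distr M (G s \<Otimes>\<^sub>M borel) (\<lambda>w. (w, B w t - B w s)))"
  using m f by (simp add: nn_integral_distr)
 also have "\<dots> = (\<integral>\<^sup>+w. (\<integral>\<^sup>+dy. f (w, dy) \<partial>gauss (t - s)) \<partial>?R)"
  unfolding eq[symmetric] by (rule g.nn_integral_fst[symmetric]) (rule fP)
 also have "\<dots> = (\<integral>\<^sup>+w. (\<integral>\<^sup>+dy. f (w, dy) \<partial>gauss (t - s)) \<partial>M)"
 proof (rule nn_integral_subalgebra2[OF subalgebra_G])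
  have "f \<in> borel_measurable (G s \<Otimes>\<^sub>M gauss (t - s))" using f by (simp cong: measurable_cong_sets)
  then show "(\<lambda>w. \<integral>\<^sup>+dy. f (w, dy) \<partial>gauss (t - s)) \<in> borel_measurable (G s)"
   by (rule g.borel_measurable_nn_integral_fst)
 qed
 finally show ?thesis .
qed

lemma increment_distr:
 assumes s: "0 <= s" "s < t"
 shows "distr M borel (\<lambda>w. B w t - B w s) = gauss (t - s)"
proof (rule measure_eqI)
 interpret g: prob_space "gauss (t - s)" using s by (intro prob_space_gauss) simp
 fix D assume "D \<in> sets (distr M borel (\<lambda>w. B w t - B w s))"
 then have D: "D \<in> sets borel" by simp
 have [measurable]: "(\<lambda>w. B w t) \<in> borel_measurable M" "(\<lambda>w. B w s) \<in> borel_measurable M"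
  using s by (auto intro!: B_meas)
 have sp: "space M \<in> sets (G s)" using sets.top[of "G s"] by simp
 have "emeasure (distr M borel (\<lambda>w. B w t - B w s)) D = emeasure M {w\<in>space M. w \<in> space M \<and> B w t - B w s \<in> D}"
  using D by (subst emeasure_distr) (auto intro!: arg_cong[where f="emeasure M"])
 also have "\<dots> = emeasure (gauss (t - s)) D"
  unfolding emeasure_eq_measure indep_increment[OF s sp D] by (simp add: prob_space g.emeasure_eq_measure)
 finally show "emeasure (distr M borel (\<lambda>w. B w t - B w s)) D = emeasure (gauss (t - s)) D" .
qed simp

end

section \<open>The posterior\<close>

text \<open>Likelihood ratio of drift \<open>r\<close> against drift 0 for a Brownian path that is
  found at \<open>y\<close> at time \<open>t\<close>.\<close>

definition tw :: "real => real => real => real" where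
 "tw r t y = exp (r * y - r^2 * t / 2)"

lemma tw_pos [simp]: "0 < tw r t y" and tw_nonneg [simp]: "0 <= tw r t y"
 by (simp_all add: tw_def)

text \<open>Consecutive observations multiply their likelihoods, which is why the posterior can be
  updated from its current value alone.\<close>

lemma tw_add: "tw r s y * tw r h dy = tw r (s + h) (y + dy)"
 by (simp add: tw_def exp_add[symmetric] algebra_simps add_divide_distrib)

lemma tw_zero [simp]: "tw r 0 0 = 1"
 by (simp add: tw_def)

lemma tw_meas [measurable]:
 assumes [measurable]: "f \<in> borel_measurable N" "g \<in> borel_measurable N" "h \<in> borel_measurable N"
 shows "(\<lambda>x. tw (f x) (g x) (h x)) \<in> borel_measurable N"
 unfolding tw_def by measurable

text \<open>Completing the square in \<open>r\<close>. The bound is uniform in \<open>r\<close>, so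
  at positive times the weight is bounded for every \<rho>.\<close>

lemma tw_le: "0 < t ==> tw r t y <= exp (y^2 / (2 * t))"
proof -
 assume t: "0 < t"
 have "0 <= (r * t - y)^2 / (2 * t)" using t by simp
 also have "\<dots> = y^2 / (2 * t) - (r * y - r^2 * t / 2)" using t by (simp add: field_simps power2_eq_square)
 finally show ?thesis by (simp add: tw_def)
qed

text \<open>Cameron-Martin in dimension one: the Gaussian shifted by \<open>r * h\<close> has
  density \<open>tw r h\<close> with respect to the unshifted one.\<close>

lemma gauss_shift:
 assumes h: "0 < h" and [measurable]: "g \<in> borel_measurable borel"
 shows "(\<integral>\<^sup>+dy. g (dy + r * h) \<partial>gauss h) = (\<integral>\<^sup>+dy. g dy * ennreal (tw r h dy) \<partial>gauss h)"
proof -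
 have pt: "normal_density 0 (sqrt h) (r * h + x) * tw r h (r * h + x) = normal_density 0 (sqrt h) x" for x
 proof -
  have "- (r * h + x)\<^sup>2 / (2 * h) + (r * (r * h + x) - r^2 * h / 2) = - x\<^sup>2 / (2 * h)"
   using h by (simp add: field_simps power2_eq_square)
  then show ?thesis using h by (simp add: normal_density_def tw_def exp_add[symmetric])
 qed
 have "(\<integral>\<^sup>+dy. g dy * ennreal (tw r h dy) \<partial>gauss h)
  = (\<integral>\<^sup>+dy. ennreal (normal_density 0 (sqrt h) dy) * (g dy * ennreal (tw r h dy)) \<partial>lborel)"
  unfolding gauss_def by (rule nn_integral_density) auto
 also have "\<dots> = (\<integral>\<^sup>+x. ennreal (normal_density 0 (sqrt h) (r * h + 1 * x)) * (g (r * h + 1 * x) * ennreal (tw r h (r * h + 1 * x))) \<partial>lborel)"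
  by (subst nn_integral_real_affine[where c=1 and t="r * h"]) auto
 also have "\<dots> = (\<integral>\<^sup>+x. ennreal (normal_density 0 (sqrt h) x) * g (x + r * h) \<partial>lborel)"
 proof (rule nn_integral_cong)
  fix x
  have "ennreal (normal_density 0 (sqrt h) (r * h + 1 * x)) * ennreal (tw r h (r * h + 1 * x)) = ennreal (normal_density 0 (sqrt h) x)"
   by (subst ennreal_mult[symmetric]) (auto simp: pt)
  then show "ennreal (normal_density 0 (sqrt h) (r * h + 1 * x)) * (g (r * h + 1 * x) * ennreal (tw r h (r * h + 1 * x)))
   = ennreal (normal_density 0 (sqrt h) x) * g (x + r * h)"
   by (simp add: mult_ac add.commute)
 qed
 also have "\<dots> = (\<integral>\<^sup>+dy. g (dy + r * h) \<partial>gauss h)"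
  unfolding gauss_def by (rule nn_integral_density[symmetric]) auto
 finally show ?thesis ..
qed

locale bm_filter = bm_pair M X B for M :: "'w measure" and X :: "'w => 'a::euclidean_space" and B +
 fixes \<rho> :: "'a => real"
 assumes rho_meas [measurable]: "\<rho> \<in> borel_measurable borel"
begin

abbreviation \<mu> :: "'a measure" where "\<mu> \<equiv> distr M borel X"

lemma prob_space_mu: "prob_space \<mu>"
 by (rule prob_space_distr) simp

definition Y :: "'w => real => real" where
 "Y w t = B w t + \<rho> (X w) * t"

text \<open>The pairs at which the weight is bounded in the drift. For t = 0 and y other than 0 it
  would be exp (r y), which need not be integrable. Paths of \<open>Y\<close> stay in this set by
  \<open>adm_Y\<close>.\<close>

definition adm :: "real => real => bool" where
 "adm t y \<longleftrightarrow> 0 < t \<or> t = 0 \<and> y = 0"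

definition Z :: "real => real => real" where
 "Z t y = (LINT x|\<mu>. tw (\<rho> x) t y)"

definition post :: "real => real => 'a measure" where
 "post t y = density \<mu> (\<lambda>x. ennreal (tw (\<rho> x) t y / Z t y))"

definition \<xi> :: "'w => real => 'a measure" where
 "\<xi> w t = post t (Y w t)"

lemma sets_post [simp, measurable_cong]: "sets (post t y) = sets borel"
 and space_post [simp]: "space (post t y) = UNIV"
 by (simp_all add: post_def)

lemma Y_zero: "w \<in> space M ==> Y w 0 = 0"
 by (simp add: Y_def B_zero)

lemma adm_Y: "w \<in> space M ==> 0 <= t ==> adm t (Y w t)"
 by (cases "t = 0") (auto simp: adm_def Y_zero)

lemma Y_cont: "w \<in> space M ==> continuous_on {0..} (Y w)"
 unfolding Y_def using B_cont by (intro continuous_intros) auto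

lemma Y_meas_G: "0 <= r ==> r <= s ==> (\<lambda>w. Y w r) \<in> borel_measurable (G s)"
 unfolding Y_def using B_meas_G[of r s] by measurable

lemma Y_meas: "0 <= r ==> (\<lambda>w. Y w r) \<in> borel_measurable M"
 unfolding Y_def using B_meas[of r] by measurable

lemma Z_meas [measurable]:
 assumes "f \<in> borel_measurable N" "g \<in> borel_measurable N"
 shows "(\<lambda>x. Z (f x) (g x)) \<in> borel_measurable N"
proof -
 interpret mu: prob_space \<mu> by (rule prob_space_mu)
 have "(\<lambda>p. \<integral>x. tw (\<rho> x) (fst p) (snd p) \<partial>\<mu>) \<in> borel_measurable (borel \<Otimes>\<^sub>M borel)"
  by measurable
 from measurable_compose[OF measurable_Pair[OF assms] this] show ?thesis by (simp add: Z_def)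
qed

lemma tw_bounded: "adm t y ==> \<exists>K. \<forall>r. tw r t y <= K"
 unfolding adm_def using tw_le[of t _ y] by fastforce

lemma tw_integrable: assumes "adm t y" shows "integrable \<mu> (\<lambda>x. tw (\<rho> x) t y)"
proof -
 interpret mu: prob_space \<mu> by (rule prob_space_mu)
 from tw_bounded[OF assms] obtain K where "\<And>r. tw r t y <= K" by blast
 then show ?thesis by (intro mu.integrable_const_bound[where B=K]) auto
qed

lemma Z_pos: assumes "adm t y" shows "0 < Z t y"
proof -
 interpret mu: prob_space \<mu> by (rule prob_space_mu)
 have "Z t y \<noteq> 0"
 proof
  assume "Z t y = 0"
  then have "AE x in \<mu>. tw (\<rho> x) t y = 0"
   unfolding Z_def using integral_nonneg_eq_0_iff_AE[OF tw_integrable[OF assms]] by simp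
  then have "AE x in \<mu>. False" by eventually_elim (use tw_pos in \<open>metis less_irrefl\<close>)
  then show False by (simp add: mu.AE_False)
 qed
 moreover have "0 <= Z t y" unfolding Z_def by simp
 ultimately show ?thesis by simp
qed

lemma Z_zero [simp]: "Z 0 0 = 1"
proof -
 interpret mu: prob_space \<mu> by (rule prob_space_mu)
 show ?thesis using mu.prob_space by (simp add: Z_def)
qed

lemma post_zero: "post 0 0 = \<mu>"
 by (simp add: post_def density_1)

lemma prob_space_post: assumes "adm t y" shows "prob_space (post t y)"
proof
 have "(\<integral>\<^sup>+x. ennreal (tw (\<rho> x) t y / Z t y) \<partial>\<mu>) = ennreal (LINT x|\<mu>. tw (\<rho> x) t y / Z t y)"
  using tw_integrable[OF assms] Z_pos[OF assms] by (intro nn_integral_eq_integral) (auto intro!: AE_I2)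
 also have "(LINT x|\<mu>. tw (\<rho> x) t y / Z t y) = 1" using Z_pos[OF assms] by (simp add: Z_def[symmetric])
 finally show "emeasure (post t y) (space (post t y)) = 1"
  by (simp add: post_def emeasure_density)
qed

lemma nn_integral_post:
 "\<psi> \<in> borel_measurable borel ==> (\<integral>\<^sup>+x. \<psi> x \<partial>post t y) = (\<integral>\<^sup>+x. ennreal (tw (\<rho> x) t y / Z t y) * \<psi> x \<partial>\<mu>)"
 unfolding post_def by (rule nn_integral_density) auto

lemma nn_integral_post_meas:
 fixes \<Psi> :: "'b \<times> 'a => ennreal"
 assumes [measurable]: "f \<in> borel_measurable N" "g \<in> borel_measurable N" and P[measurable]: "\<Psi> \<in> borel_measurable (N \<Otimes>\<^sub>M borel)"
 shows "(\<lambda>y. \<integral>\<^sup>+x. \<Psi> (y, x) \<partial>post (f y) (g y)) \<in> borel_measurable N"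
proof -
 interpret mu: prob_space \<mu> by (rule prob_space_mu)
 have "(\<lambda>y. \<integral>\<^sup>+x. ennreal (tw (\<rho> x) (f y) (g y) / Z (f y) (g y)) * \<Psi> (y, x) \<partial>\<mu>) \<in> borel_measurable N"
  by measurable
 moreover have "(\<integral>\<^sup>+x. \<Psi> (y, x) \<partial>post (f y) (g y)) = (\<integral>\<^sup>+x. ennreal (tw (\<rho> x) (f y) (g y) / Z (f y) (g y)) * \<Psi> (y, x) \<partial>\<mu>)"
  if "y \<in> space N" for y
  using that by (intro nn_integral_post) measurable
 ultimately show ?thesis by (subst measurable_cong) auto
qed

text \<open>Bayes' rule as an identity of measures: the current posterior times the likelihood of
  the increment equals the updated posterior times the predictive density.\<close>

lemma post_update:
 assumes a: "adm s y" and h: "0 < h" and [measurable]: "\<psi> \<in> borel_measurable borel"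
 shows "(\<integral>\<^sup>+x. \<psi> x * ennreal (tw (\<rho> x) h dy) \<partial>post s y)
  = (\<integral>\<^sup>+x. \<psi> x \<partial>post (s + h) (y + dy)) * ennreal (Z (s + h) (y + dy) / Z s y)"
proof -
 have a': "adm (s + h) (y + dy)" using a h by (auto simp: adm_def)
 note z = Z_pos[OF a] Z_pos[OF a']
 have "(\<integral>\<^sup>+x. \<psi> x \<partial>post (s + h) (y + dy)) * ennreal (Z (s + h) (y + dy) / Z s y)
   = (\<integral>\<^sup>+x. ennreal (tw (\<rho> x) (s + h) (y + dy) / Z (s + h) (y + dy)) * \<psi> x * ennreal (Z (s + h) (y + dy) / Z s y) \<partial>\<mu>)"
  by (subst nn_integral_post) (auto intro!: nn_integral_multc[symmetric])
 also have "\<dots> = (\<integral>\<^sup>+x. ennreal (tw (\<rho> x) s y / Z s y) * (\<psi> x * ennreal (tw (\<rho> x) h dy)) \<partial>\<mu>)"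
 proof (rule nn_integral_cong)
  fix x
  have "ennreal (tw (\<rho> x) (s + h) (y + dy) / Z (s + h) (y + dy)) * ennreal (Z (s + h) (y + dy) / Z s y)
   = ennreal (tw (\<rho> x) s y / Z s y) * ennreal (tw (\<rho> x) h dy)"
   using z by (simp add: ennreal_mult[symmetric] tw_add[symmetric])
  then show "ennreal (tw (\<rho> x) (s + h) (y + dy) / Z (s + h) (y + dy)) * \<psi> x * ennreal (Z (s + h) (y + dy) / Z s y)
   = ennreal (tw (\<rho> x) s y / Z s y) * (\<psi> x * ennreal (tw (\<rho> x) h dy))"
   by (simp only: mult_ac)
 qed
 also have "\<dots> = (\<integral>\<^sup>+x. \<psi> x * ennreal (tw (\<rho> x) h dy) \<partial>post s y)"
  by (rule nn_integral_post[symmetric]) measurable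
 finally show ?thesis ..
qed

text \<open>\<open>\<Psi>\<close> may depend on \<open>Y w t\<close> besides \<open>X w\<close>, so
  that the property survives intersecting \<open>A\<close> with an event of \<open>Y w t\<close>.
  Nonnegative integrals make it meaningful whatever the moments of \<rho> are.\<close>

definition bayes :: "real => 'w set => bool" where
 "bayes t A \<longleftrightarrow> (\<forall>\<Psi>\<in>borel_measurable (borel \<Otimes>\<^sub>M borel).
  (\<integral>\<^sup>+w. \<Psi> (Y w t, X w) * indicator A w \<partial>M) = (\<integral>\<^sup>+w. (\<integral>\<^sup>+x. \<Psi> (Y w t, x) \<partial>post t (Y w t)) * indicator A w \<partial>M))"

text \<open>Integrate out the Gaussian increment, turn the drift shift into the factor
  \<open>tw\<close> by \<open>gauss_shift\<close>, average over \<open>X\<close> under the posterior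
  at time \<open>s\<close>, and update by \<open>post_update\<close>.\<close>

lemma bayes_transition:
 fixes \<Psi> :: "real \<times> 'a => ennreal"
 assumes s: "0 <= s" "0 < h" and A: "A \<in> sets (G s)" and b: "bayes s A"
  and P[measurable]: "\<Psi> \<in> borel_measurable (borel \<Otimes>\<^sub>M borel)"
 shows "(\<integral>\<^sup>+w. \<Psi> (Y w (s + h), X w) * indicator A w \<partial>M)
  = (\<integral>\<^sup>+w. (\<integral>\<^sup>+dy. (\<integral>\<^sup>+x. \<Psi> (Y w s + dy, x) \<partial>post (s + h) (Y w s + dy)) * ennreal (Z (s + h) (Y w s + dy) / Z s (Y w s)) \<partial>gauss h)
    * indicator A w \<partial>M)"
proof -
 interpret mu: prob_space \<mu> by (rule prob_space_mu)
 interpret g: prob_space "gauss h" using s by (intro prob_space_gauss) simp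
 interpret gm: pair_sigma_finite "gauss h" \<mu> ..
 have [measurable]: "(\<lambda>w. Y w s) \<in> borel_measurable (G s)" using s by (intro Y_meas_G) auto
 have [measurable]: "A \<in> sets (G s)" by fact
 let ?f = "\<lambda>(w, dy). \<Psi> (Y w s + (dy + \<rho> (X w) * h), X w) * indicator A w"
 have "(\<integral>\<^sup>+w. \<Psi> (Y w (s + h), X w) * indicator A w \<partial>M) = (\<integral>\<^sup>+w. ?f (w, B w (s + h) - B w s) \<partial>M)"
  by (intro nn_integral_cong) (simp add: Y_def algebra_simps)
 also have "\<dots> = (\<integral>\<^sup>+w. (\<integral>\<^sup>+dy. ?f (w, dy) \<partial>gauss (s + h - s)) \<partial>M)"
  by (rule nn_integral_increment) (use s in \<open>auto\<close>)
 also have "\<dots> = (\<integral>\<^sup>+w. (\<integral>\<^sup>+dy. \<Psi> (Y w s + dy, X w) * ennreal (tw (\<rho> (X w)) h dy) \<partial>gauss h) * indicator A w \<partial>M)"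
 proof (rule nn_integral_cong)
  fix w
  have "(\<integral>\<^sup>+dy. ?f (w, dy) \<partial>gauss (s + h - s)) = (\<integral>\<^sup>+dy. \<Psi> (Y w s + (dy + \<rho> (X w) * h), X w) \<partial>gauss h) * indicator A w"
   by (simp add: nn_integral_multc)
  also have "(\<integral>\<^sup>+dy. \<Psi> (Y w s + (dy + \<rho> (X w) * h), X w) \<partial>gauss h) = (\<integral>\<^sup>+dy. \<Psi> (Y w s + dy, X w) * ennreal (tw (\<rho> (X w)) h dy) \<partial>gauss h)"
   by (rule gauss_shift[OF s(2)]) measurable
  finally show "(\<integral>\<^sup>+dy. ?f (w, dy) \<partial>gauss (s + h - s))
   = (\<integral>\<^sup>+dy. \<Psi> (Y w s + dy, X w) * ennreal (tw (\<rho> (X w)) h dy) \<partial>gauss h) * indicator A w" .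
 qed
 also have "\<dots> = (\<integral>\<^sup>+w. (\<integral>\<^sup>+x. (\<integral>\<^sup>+dy. \<Psi> (Y w s + dy, x) * ennreal (tw (\<rho> x) h dy) \<partial>gauss h) \<partial>post s (Y w s)) * indicator A w \<partial>M)"
 proof -
  have m: "(\<lambda>(y, x). \<integral>\<^sup>+dy. \<Psi> (y + dy, x) * ennreal (tw (\<rho> x) h dy) \<partial>gauss h) \<in> borel_measurable (borel \<Otimes>\<^sub>M borel)"
   by measurable
  from b[unfolded bayes_def, rule_format, OF m] show ?thesis by simp
 qed
 also have "\<dots> = (\<integral>\<^sup>+w. (\<integral>\<^sup>+dy. (\<integral>\<^sup>+x. \<Psi> (Y w s + dy, x) \<partial>post (s + h) (Y w s + dy)) * ennreal (Z (s + h) (Y w s + dy) / Z s (Y w s)) \<partial>gauss h)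
    * indicator A w \<partial>M)"
 proof (rule nn_integral_cong)
  fix w assume dy: "w \<in> space M"
  let ?y = "Y w s"
  have "(\<integral>\<^sup>+x. (\<integral>\<^sup>+dy. \<Psi> (?y + dy, x) * ennreal (tw (\<rho> x) h dy) \<partial>gauss h) \<partial>post s ?y)
   = (\<integral>\<^sup>+x. (\<integral>\<^sup>+dy. ennreal (tw (\<rho> x) s ?y / Z s ?y) * (\<Psi> (?y + dy, x) * ennreal (tw (\<rho> x) h dy)) \<partial>gauss h) \<partial>\<mu>)"
   by (subst nn_integral_post) (auto intro!: nn_integral_cong nn_integral_cmult[symmetric])
  also have "\<dots> = (\<integral>\<^sup>+dy. (\<integral>\<^sup>+x. ennreal (tw (\<rho> x) s ?y / Z s ?y) * (\<Psi> (?y + dy, x) * ennreal (tw (\<rho> x) h dy)) \<partial>\<mu>) \<partial>gauss h)"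
   by (rule gm.Fubini') measurable
  also have "\<dots> = (\<integral>\<^sup>+dy. (\<integral>\<^sup>+x. \<Psi> (?y + dy, x) * ennreal (tw (\<rho> x) h dy) \<partial>post s ?y) \<partial>gauss h)"
   by (intro nn_integral_cong nn_integral_post[symmetric]) measurable
  also have "\<dots> = (\<integral>\<^sup>+dy. (\<integral>\<^sup>+x. \<Psi> (?y + dy, x) \<partial>post (s + h) (?y + dy)) * ennreal (Z (s + h) (?y + dy) / Z s ?y) \<partial>gauss h)"
   by (intro nn_integral_cong post_update adm_Y dy s) measurable
  finally show "(\<integral>\<^sup>+x. (\<integral>\<^sup>+dy. \<Psi> (?y + dy, x) * ennreal (tw (\<rho> x) h dy) \<partial>gauss h) \<partial>post s ?y) * indicator A w
   = (\<integral>\<^sup>+dy. (\<integral>\<^sup>+x. \<Psi> (?y + dy, x) \<partial>post (s + h) (?y + dy)) * ennreal (Z (s + h) (?y + dy) / Z s ?y) \<partial>gauss h) * indicator A w"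
   by simp
 qed
 finally show ?thesis .
qed

text \<open>The transition formula sees \<open>\<Psi>\<close> only through its posterior average at
  time s + h. Applied to that average itself it gives the same value, because a function constant in
  \<open>x\<close> is its own average.\<close>

lemma bayes_step:
 assumes s: "0 <= s" "0 < h" and A: "A \<in> sets (G s)" and b: "bayes s A"
 shows "bayes (s + h) A"
 unfolding bayes_def
proof
 fix \<Psi> :: "real \<times> 'a => ennreal" assume P[measurable]: "\<Psi> \<in> borel_measurable (borel \<Otimes>\<^sub>M borel)"
 define \<Phi> where "\<Phi> y = (\<integral>\<^sup>+x. \<Psi> (y, x) \<partial>post (s + h) y)" for y
 have [measurable]: "\<Phi> \<in> borel_measurable borel"
  unfolding \<Phi>_def by (rule nn_integral_post_meas) measurable
 have c: "(\<integral>\<^sup>+x. \<Phi> y \<partial>post (s + h) y) = \<Phi> y" for y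
 proof -
  interpret p: prob_space "post (s + h) y" using s by (intro prob_space_post) (auto simp: adm_def)
  show ?thesis using p.emeasure_space_1 by simp
 qed
 have "(\<integral>\<^sup>+w. (\<lambda>(y, x). \<Phi> y) (Y w (s + h), X w) * indicator A w \<partial>M) = (\<integral>\<^sup>+w. \<Psi> (Y w (s + h), X w) * indicator A w \<partial>M)"
  using bayes_transition[OF s A b, of "\<lambda>(y, x). \<Phi> y"] bayes_transition[OF s A b P]
  unfolding \<Phi>_def[symmetric] prod.case c by simp
 then show "(\<integral>\<^sup>+w. \<Psi> (Y w (s + h), X w) * indicator A w \<partial>M)
  = (\<integral>\<^sup>+w. (\<integral>\<^sup>+x. \<Psi> (Y w (s + h), x) \<partial>post (s + h) (Y w (s + h))) * indicator A w \<partial>M)"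
  by (simp add: \<Phi>_def)
qed

definition cylF :: "real => 'w set set" where
 "cylF t = {{w\<in>space M. \<forall>r\<in>J. Y w r \<in> C r} | J C. finite J \<and> J \<subseteq> {0..t} \<and> (\<forall>r. C r \<in> sets borel)}"

definition F :: "real => 'w measure" where
 "F t = sigma (space M) (cylF t)"

lemma cylF_Pow: "cylF s \<subseteq> Pow (space M)"
 by (auto simp: cylF_def)

lemma space_F [simp]: "space (F s) = space M"
 by (simp add: F_def space_measure_of cylF_Pow)

lemma sets_F: "sets (F s) = sigma_sets (space M) (cylF s)"
 by (simp add: F_def sets_measure_of cylF_Pow)

lemma Int_stable_cylF: "Int_stable (cylF s)"
proof (rule Int_stableI)
 fix A A' assume "A \<in> cylF s" "A' \<in> cylF s"
 then obtain J C J' C' where A: "A = {w\<in>space M. \<forall>r\<in>J. Y w r \<in> C r}"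
  "A' = {w\<in>space M. \<forall>r\<in>J'. Y w r \<in> C' r}"
  and J: "finite J" "J \<subseteq> {0..s}" "finite J'" "J' \<subseteq> {0..s}"
  and C: "\<And>r. C r \<in> sets borel" "\<And>r. C' r \<in> sets borel"
  by (auto simp: cylF_def)
 let ?C = "\<lambda>r. (if r \<in> J then C r else UNIV) \<inter> (if r \<in> J' then C' r else UNIV)"
 have "A \<inter> A' = {w\<in>space M. \<forall>r\<in>J \<union> J'. Y w r \<in> ?C r}"
  unfolding A by auto
 moreover have "?C r \<in> sets borel" for r using C by auto
 ultimately show "A \<inter> A' \<in> cylF s" unfolding cylF_def using J C
  by (intro CollectI exI[of _ "J \<union> J'"] exI[of _ ?C]) auto
qed

lemma space_in_cylF: "space M \<in> cylF s"
 unfolding cylF_def by (intro CollectI exI[of _ "{}"] exI[of _ "\<lambda>_. UNIV"]) auto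

text \<open>Induction on the largest observation time \<open>b\<close>: carry the property up to
  \<open>b\<close>, intersect with the event at \<open>b\<close>, then carry it on to
  \<open>t\<close>. At time 0 nothing has been observed and the posterior is the prior.\<close>

lemma cylinder_bayes:
 assumes "finite J" "J \<subseteq> {0..}" and C: "\<And>r. C r \<in> sets borel"
 shows "0 <= t ==> J \<subseteq> {..t} ==> {w\<in>space M. \<forall>r\<in>J. Y w r \<in> C r} \<in> sets (G t) \<and> bayes t {w\<in>space M. \<forall>r\<in>J. Y w r \<in> C r}"
 using assms(1,2)
proof (induction J arbitrary: t rule: finite_linorder_max_induct)
 case empty
 have b0: "bayes 0 (space M)"
  unfolding bayes_def
 proof
  fix \<Psi> :: "real \<times> 'a => ennreal" assume [measurable]: "\<Psi> \<in> borel_measurable (borel \<Otimes>\<^sub>M borel)"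
  have "(\<integral>\<^sup>+w. \<Psi> (Y w 0, X w) * indicator (space M) w \<partial>M) = (\<integral>\<^sup>+w. \<Psi> (0, X w) \<partial>M)"
   by (intro nn_integral_cong) (simp add: Y_zero)
  also have "\<dots> = (\<integral>\<^sup>+x. \<Psi> (0, x) \<partial>\<mu>)" by (subst nn_integral_distr) auto
  also have "\<dots> = (\<integral>\<^sup>+w. (\<integral>\<^sup>+x. \<Psi> (0, x) \<partial>\<mu>) \<partial>M)" using emeasure_space_1 by simp
  also have "\<dots> = (\<integral>\<^sup>+w. (\<integral>\<^sup>+x. \<Psi> (Y w 0, x) \<partial>post 0 (Y w 0)) * indicator (space M) w \<partial>M)"
   by (intro nn_integral_cong) (simp add: Y_zero post_zero)
  finally show "(\<integral>\<^sup>+w. \<Psi> (Y w 0, X w) * indicator (space M) w \<partial>M)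
   = (\<integral>\<^sup>+w. (\<integral>\<^sup>+x. \<Psi> (Y w 0, x) \<partial>post 0 (Y w 0)) * indicator (space M) w \<partial>M)" .
 qed
 have sp: "space M \<in> sets (G r)" for r using sets.top[of "G r"] by simp
 have "bayes t (space M)"
  using b0 bayes_step[of 0 t "space M"] sp empty.prems(1) by (cases "t = 0") auto
 with sp show ?case by simp
next
 case (insert b A)
 let ?A = "{w\<in>space M. \<forall>r\<in>A. Y w r \<in> C r}"
 let ?A' = "{w\<in>space M. \<forall>r\<in>insert b A. Y w r \<in> C r}"
 have b: "0 <= b" "b <= t" using insert.prems by auto
 have "A \<subseteq> {..b}" using insert.hyps by force
 with insert.IH[of b] insert.prems have IH: "?A \<in> sets (G b)" "bayes b ?A" by auto
 have eq: "?A' = ?A \<inter> {w\<in>space (G b). Y w b \<in> C b}" by auto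
 have g: "?A' \<in> sets (G b)"
  unfolding eq using IH(1) Y_meas_G[OF b(1) order_refl] C[of b] by measurable
 have bb: "bayes b ?A'" unfolding bayes_def
 proof
  fix \<Psi> :: "real \<times> 'a => ennreal" assume [measurable]: "\<Psi> \<in> borel_measurable (borel \<Otimes>\<^sub>M borel)"
  note [measurable] = C[of b]
  have m: "(\<lambda>(y, x). \<Psi> (y, x) * indicator (C b) y) \<in> borel_measurable (borel \<Otimes>\<^sub>M borel)" by measurable
  have "(\<integral>\<^sup>+w. \<Psi> (Y w b, X w) * indicator ?A' w \<partial>M) = (\<integral>\<^sup>+w. \<Psi> (Y w b, X w) * indicator (C b) (Y w b) * indicator ?A w \<partial>M)"
   by (intro nn_integral_cong) (auto simp: indicator_def)
  also have "\<dots> = (\<integral>\<^sup>+w. (\<integral>\<^sup>+x. \<Psi> (Y w b, x) * indicator (C b) (Y w b) \<partial>post b (Y w b)) * indicator ?A w \<partial>M)"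
   using IH(2)[unfolded bayes_def, rule_format, OF m] by simp
  also have "\<dots> = (\<integral>\<^sup>+w. (\<integral>\<^sup>+x. \<Psi> (Y w b, x) \<partial>post b (Y w b)) * indicator ?A' w \<partial>M)"
   by (intro nn_integral_cong) (auto simp: indicator_def)
  finally show "(\<integral>\<^sup>+w. \<Psi> (Y w b, X w) * indicator ?A' w \<partial>M)
   = (\<integral>\<^sup>+w. (\<integral>\<^sup>+x. \<Psi> (Y w b, x) \<partial>post b (Y w b)) * indicator ?A' w \<partial>M)" .
 qed
 have "bayes t ?A'"
  using bb bayes_step[OF b(1) _ g bb, of "t - b"] b by (cases "t = b") auto
 moreover have "sets (G b) \<subseteq> sets (G t)"
  by (rule G_mono[OF b(2)])
 ultimately show ?case using g by blast
qed

lemma cylF_bayes: "0 <= t ==> A \<in> cylF t ==> bayes t A"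
 and cylF_G: "0 <= t ==> A \<in> cylF t ==> A \<in> sets (G t)"
proof -
 assume t: "0 <= t" and "A \<in> cylF t"
 then obtain J C where A: "A = {w\<in>space M. \<forall>r\<in>J. Y w r \<in> C r}"
  and J: "finite J" "J \<subseteq> {0..t}" and C: "\<And>r. C r \<in> sets borel" by (auto simp: cylF_def)
 have "J \<subseteq> {0..}" "J \<subseteq> {..t}" using J by auto
 from cylinder_bayes[OF J(1) this(1) C t this(2)] show "bayes t A" "A \<in> sets (G t)" by (auto simp: A)
qed

lemma subalgebra_G_F: "0 <= t ==> subalgebra (G t) (F t)"
 unfolding subalgebra_def sets_F
 using sets.sigma_sets_subset[of "cylF t" "G t"] cylF_G[of t] by auto

lemma subalgebra_F: "0 <= t ==> subalgebra M (F t)"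
 using subalgebra_G_F[of t] subalgebra_G[of t] by (auto simp: subalgebra_def)

lemma F_mono:
 assumes "s <= t" shows "sets (F s) \<subseteq> sets (F t)"
proof -
 have "cylF s \<subseteq> cylF t"
 proof
  fix A assume "A \<in> cylF s"
  then obtain J C where "A = {w\<in>space M. \<forall>r\<in>J. Y w r \<in> C r}" "finite J" "J \<subseteq> {0..s}" "\<forall>r. C r \<in> sets borel"
   by (auto simp: cylF_def)
  moreover from this(3) have "J \<subseteq> {0..t}" using assms by auto
  ultimately show "A \<in> cylF t" unfolding cylF_def by blast
 qed
 then show ?thesis unfolding sets_F by (rule sigma_sets_mono')
qed

lemma subalgebra_F_F: "s <= t ==> subalgebra (F t) (F s)"
 using F_mono by (simp add: subalgebra_def)

lemma Y_meas_F:
 assumes "0 <= r" "r <= s" shows "(\<lambda>w. Y w r) \<in> borel_measurable (F s)"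
proof (rule measurableI)
 fix C assume "C \<in> sets (borel :: real measure)"
 then have "{w\<in>space M. \<forall>q\<in>{r}. Y w q \<in> (\<lambda>_. C) q} \<in> cylF s"
  unfolding cylF_def using assms by (intro CollectI exI[of _ "{r}"] exI[of _ "\<lambda>_. C"]) auto
 moreover have "(\<lambda>w. Y w r) -` C \<inter> space (F s) = {w\<in>space M. \<forall>q\<in>{r}. Y w q \<in> (\<lambda>_. C) q}" by auto
 ultimately show "(\<lambda>w. Y w r) -` C \<inter> space (F s) \<in> sets (F s)" by (simp add: sets_F sigma_sets.Basic)
qed simp

lemma nn_post_meas_F:
 fixes \<psi> :: "'a => ennreal"
 assumes "0 <= t" and [measurable]: "\<psi> \<in> borel_measurable borel"
 shows "(\<lambda>w. \<integral>\<^sup>+x. \<psi> x \<partial>\<xi> w t) \<in> borel_measurable (F t)"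
proof -
 have [measurable]: "(\<lambda>w. Y w t) \<in> borel_measurable (F t)" using assms by (intro Y_meas_F) auto
 show ?thesis unfolding \<xi>_def
  by (rule nn_integral_post_meas[where \<Psi>="\<lambda>(y, x). \<psi> x", simplified]) measurable
qed

text \<open>Both sides are integrals of \<open>g\<close> under measures with a density, and these
  measures agree on cylinders, hence on \<open>F t\<close>. The bound on \<open>\<psi>\<close> makes
  them finite, as uniqueness from a generator requires.\<close>

lemma nn_bayes_bounded:
 fixes \<psi> :: "'a => ennreal"
 assumes t: "0 <= t" and [measurable]: "\<psi> \<in> borel_measurable borel" and bd: "\<And>x. \<psi> x <= of_nat n"
  and g: "g \<in> borel_measurable (F t)"
 shows "(\<integral>\<^sup>+w. \<psi> (X w) * g w \<partial>M) = (\<integral>\<^sup>+w. (\<integral>\<^sup>+x. \<psi> x \<partial>\<xi> w t) * g w \<partial>M)"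
proof -
 note pm = nn_post_meas_F[OF t \<open>\<psi> \<in> borel_measurable borel\<close>]
 have [measurable]: "(\<lambda>w. \<integral>\<^sup>+x. \<psi> x \<partial>\<xi> w t) \<in> borel_measurable M" "g \<in> borel_measurable M"
  using measurable_from_subalg[OF subalgebra_F[OF t]] pm g by auto
 let ?D1 = "density M (\<lambda>w. \<psi> (X w))" and ?D2 = "density M (\<lambda>w. \<integral>\<^sup>+x. \<psi> x \<partial>\<xi> w t)"
 have s1: "subalgebra ?D1 (F t)" and s2: "subalgebra ?D2 (F t)"
  using subalgebra_F[OF t] by (auto simp: subalgebra_def)
 have FM: "A \<in> sets M" if "A \<in> sets (F t)" for A using that subalgebra_F[OF t] by (auto simp: subalgebra_def)
 have eq: "restr_to_subalg ?D1 (F t) = restr_to_subalg ?D2 (F t)"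
 proof (rule measure_eqI_generator_eq[OF Int_stable_cylF cylF_Pow, of t])
  fix A assume A: "A \<in> cylF t"
  then have AF: "A \<in> sets (F t)" by (simp add: sets_F sigma_sets.Basic)
  from FM[OF AF] have [measurable]: "A \<in> sets M" .
  have m: "(\<lambda>(y, x). \<psi> x) \<in> borel_measurable ((borel :: real measure) \<Otimes>\<^sub>M borel)" by measurable
  have "emeasure (restr_to_subalg ?D1 (F t)) A = (\<integral>\<^sup>+w. \<psi> (X w) * indicator A w \<partial>M)"
   by (simp add: emeasure_restr_to_subalg[OF s1 AF] emeasure_density)
  also have "\<dots> = (\<integral>\<^sup>+w. (\<integral>\<^sup>+x. \<psi> x \<partial>\<xi> w t) * indicator A w \<partial>M)"
   using cylF_bayes[OF t A, unfolded bayes_def, rule_format, OF m] by (simp add: \<xi>_def)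
  also have "\<dots> = emeasure (restr_to_subalg ?D2 (F t)) A"
   by (simp add: emeasure_restr_to_subalg[OF s2 AF] emeasure_density)
  finally show "emeasure (restr_to_subalg ?D1 (F t)) A = emeasure (restr_to_subalg ?D2 (F t)) A" .
 next
  show "range (\<lambda>_::nat. space M) \<subseteq> cylF t" using space_in_cylF by auto
  have sp: "space M \<in> sets (F t)" using sets.top[of "F t"] by simp
  have "emeasure (restr_to_subalg ?D1 (F t)) (space M) = (\<integral>\<^sup>+w. \<psi> (X w) * indicator (space M) w \<partial>M)"
   by (simp add: emeasure_restr_to_subalg[OF s1 sp] emeasure_density)
  also have "\<dots> <= (\<integral>\<^sup>+w. of_nat n \<partial>M)" by (intro nn_integral_mono) (simp add: bd)
  also have "\<dots> < \<infinity>" using emeasure_space_1 by (simp add: of_nat_less_top)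
  finally show "emeasure (restr_to_subalg ?D1 (F t)) (space M) \<noteq> \<infinity>" by simp
 qed (auto simp: sets_restr_to_subalg[OF s1] sets_restr_to_subalg[OF s2] sets_F)
 have "(\<integral>\<^sup>+w. \<psi> (X w) * g w \<partial>M) = (\<integral>\<^sup>+w. g w \<partial>?D1)" by (simp add: nn_integral_density)
 also have "\<dots> = (\<integral>\<^sup>+w. g w \<partial>?D2)"
  using nn_integral_subalgebra2[OF s1 g] nn_integral_subalgebra2[OF s2 g] eq by simp
 also have "\<dots> = (\<integral>\<^sup>+w. (\<integral>\<^sup>+x. \<psi> x \<partial>\<xi> w t) * g w \<partial>M)" by (simp add: nn_integral_density)
 finally show ?thesis .
qed

lemma nn_bayes:
 fixes \<psi> :: "'a => ennreal"
 assumes t: "0 <= t" and [measurable]: "\<psi> \<in> borel_measurable borel" and g: "g \<in> borel_measurable (F t)"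
 shows "(\<integral>\<^sup>+w. \<psi> (X w) * g w \<partial>M) = (\<integral>\<^sup>+w. (\<integral>\<^sup>+x. \<psi> x \<partial>\<xi> w t) * g w \<partial>M)"
proof -
 have [measurable]: "g \<in> borel_measurable M"
  using measurable_from_subalg[OF subalgebra_F[OF t] g] .
 have sup: "a = (SUP n. min a (of_nat n))" for a :: ennreal
  using inf_SUP[of a "\<lambda>n. of_nat n" UNIV] by (simp add: ennreal_SUP_of_nat_eq_top inf_min)
 have inc: "incseq (\<lambda>n. min a (of_nat n))" for a :: ennreal
  unfolding incseq_def by (intro allI impI min.mono order_refl of_nat_mono)
 define \<psi>n where "\<psi>n n x = min (\<psi> x) (of_nat n)" for n x
 have [measurable]: "\<psi>n n \<in> borel_measurable borel" for n unfolding \<psi>n_def by measurable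
 have incn: "incseq \<psi>n" using inc by (auto simp: incseq_def le_fun_def \<psi>n_def)
 have "(\<integral>\<^sup>+w. \<psi> (X w) * g w \<partial>M) = (\<integral>\<^sup>+w. (SUP n. \<psi>n n (X w) * g w) \<partial>M)"
  unfolding \<psi>n_def SUP_mult_right_ennreal[symmetric] sup[symmetric] ..
 also have "\<dots> = (SUP n. \<integral>\<^sup>+w. \<psi>n n (X w) * g w \<partial>M)"
  using incn by (intro nn_integral_monotone_convergence_SUP) (auto simp: incseq_def le_fun_def intro!: mult_right_mono)
 also have "\<dots> = (SUP n. \<integral>\<^sup>+w. (\<integral>\<^sup>+x. \<psi>n n x \<partial>\<xi> w t) * g w \<partial>M)"
  by (intro SUP_cong refl nn_bayes_bounded[OF t _ _ g]) (simp, unfold \<psi>n_def, rule min.cobounded2)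
 also have "\<dots> = (\<integral>\<^sup>+w. (SUP n. (\<integral>\<^sup>+x. \<psi>n n x \<partial>\<xi> w t) * g w) \<partial>M)"
 proof (rule nn_integral_monotone_convergence_SUP[symmetric])
  show "incseq (\<lambda>n w. (\<integral>\<^sup>+x. \<psi>n n x \<partial>\<xi> w t) * g w)"
   using incn by (auto simp: incseq_def le_fun_def intro!: mult_right_mono nn_integral_mono)
  show "(\<lambda>w. (\<integral>\<^sup>+x. \<psi>n n x \<partial>\<xi> w t) * g w) \<in> borel_measurable M" for n
   using measurable_from_subalg[OF subalgebra_F[OF t] nn_post_meas_F[OF t, of "\<psi>n n"]] by measurable
 qed
 also have "\<dots> = (\<integral>\<^sup>+w. (\<integral>\<^sup>+x. \<psi> x \<partial>\<xi> w t) * g w \<partial>M)"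
 proof (rule nn_integral_cong)
  fix w
  have "(\<integral>\<^sup>+x. \<psi> x \<partial>\<xi> w t) = (\<integral>\<^sup>+x. (SUP n. \<psi>n n x) \<partial>\<xi> w t)" unfolding \<psi>n_def sup[symmetric] ..
  also have "\<dots> = (SUP n. \<integral>\<^sup>+x. \<psi>n n x \<partial>\<xi> w t)"
   by (intro nn_integral_monotone_convergence_SUP incn) (simp add: \<xi>_def)
  finally show "(SUP n. (\<integral>\<^sup>+x. \<psi>n n x \<partial>\<xi> w t) * g w) = (\<integral>\<^sup>+x. \<psi> x \<partial>\<xi> w t) * g w"
   by (simp add: SUP_mult_right_ennreal)
 qed
 finally show ?thesis .
qed

end

section \<open>Posterior moments at positive times\<close>

lemma tw_growth:
 assumes t0: "0 < t0" "t0 <= t" and y: "\<bar>y\<bar> <= K"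
 shows "(1 + r^2) * tw r t y <= (1 + 4 / t0) * exp (K^2 / t0)"
proof -
 \<comment> \<open>Half of the quadratic exponent absorbs the factor r^2, the other half absorbs the
   linear term: |r| K - r^2 t0 / 4 <= K^2 / t0.\<close>
 define z where "z = r^2 * t0 / 4"
 have z0: "0 <= z" using t0 by (simp add: z_def)
 have "r^2 = 4 / t0 * z" using t0 by (simp add: z_def)
 moreover have "z <= exp z" using exp_ge_add_one_self[of z] by linarith
 ultimately have "r^2 <= 4 / t0 * exp z" using t0 by (simp add: divide_right_mono)
 moreover have "1 <= exp z" using z0 by simp
 moreover have "(1 + 4 / t0) * exp z = exp z + 4 / t0 * exp z" by (simp add: distrib_right)
 ultimately have a: "1 + r^2 <= (1 + 4 / t0) * exp z" by linarith
 have "r * y <= \<bar>r\<bar> * K"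
  using mult_left_mono[OF y, of "\<bar>r\<bar>"] abs_ge_self[of "r * y"] by (simp add: abs_mult)
 moreover have "r^2 * t0 / 2 <= r^2 * t / 2" using t0 by (simp add: mult_left_mono)
 ultimately have b: "tw r t y <= exp (\<bar>r\<bar> * K - r^2 * t0 / 2)" by (simp add: tw_def)
 have "0 <= (\<bar>r\<bar> * t0 / 2 - K)^2 / t0" using t0 by simp
 also have "\<dots> = K^2 / t0 - (\<bar>r\<bar> * K - r^2 * t0 / 4)"
  using t0 by (simp add: field_simps power2_eq_square)
 finally have c: "z + (\<bar>r\<bar> * K - r^2 * t0 / 2) <= K^2 / t0" by (simp add: z_def mult.commute)
 have "(1 + r^2) * tw r t y <= (1 + 4 / t0) * exp z * exp (\<bar>r\<bar> * K - r^2 * t0 / 2)"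
  using t0 by (intro mult_mono a b) auto
 also have "\<dots> = (1 + 4 / t0) * exp (z + (\<bar>r\<bar> * K - r^2 * t0 / 2))" by (simp only: exp_add mult.assoc)
 also have "\<dots> <= (1 + 4 / t0) * exp (K^2 / t0)" using c t0 by (intro mult_left_mono) auto
 finally show ?thesis .
qed

context bm_filter
begin

text \<open>Exactly what the Gaussian weight absorbs for \<open>t > 0\<close>; no integrability under the prior law is implied.\<close>

definition mild :: "('a => real) => bool" where
 "mild \<psi> \<longleftrightarrow> \<psi> \<in> borel_measurable borel \<and> (\<exists>C. \<forall>x. \<bar>\<psi> x\<bar> <= C * (1 + (\<rho> x)^2))"

lemma mild_meas: "mild \<psi> ==> \<psi> \<in> borel_measurable borel"
 by (simp add: mild_def)

lemma mildE:
 assumes "mild \<psi>" obtains C where "0 <= C" "\<And>x. \<bar>\<psi> x\<bar> <= C * (1 + (\<rho> x)^2)"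
proof -
 from assms obtain C where C: "\<And>x. \<bar>\<psi> x\<bar> <= C * (1 + (\<rho> x)^2)" by (auto simp: mild_def)
 have "\<bar>\<psi> x\<bar> <= \<bar>C\<bar> * (1 + (\<rho> x)^2)" for x
  by (rule order_trans[OF C]) (intro mult_right_mono, auto)
 then show ?thesis using that[of "\<bar>C\<bar>"] by auto
qed

lemma mild_bounded:
 assumes [measurable]: "\<psi> \<in> borel_measurable borel" and b: "\<And>x. \<bar>\<psi> x\<bar> <= C" shows "mild \<psi>"
proof -
 have "0 <= C" using b[of undefined] by linarith
 then have "C <= C * (1 + (\<rho> x)^2)" for x by (simp add: algebra_simps)
 then show ?thesis unfolding mild_def using b by (auto intro!: exI[of _ C] intro: order_trans)
qed

lemma mild_mult_rho:
 assumes [measurable]: "\<psi> \<in> borel_measurable borel" and b: "\<And>x. \<bar>\<psi> x\<bar> <= C" shows "mild (\<lambda>x. \<psi> x * \<rho> x)"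
proof -
 have C: "0 <= C" using b[of undefined] by linarith
 have "\<bar>\<psi> x * \<rho> x\<bar> <= C * (1 + (\<rho> x)^2)" for x
 proof -
  have "\<bar>\<rho> x\<bar> <= 1 + (\<rho> x)^2"
  proof -
   have "0 <= (\<bar>\<rho> x\<bar> - 1)^2" by simp
   also have "\<dots> = (\<rho> x)^2 + 1 - 2 * \<bar>\<rho> x\<bar>" by (simp add: power2_diff)
   finally show ?thesis using abs_ge_zero[of "\<rho> x"] zero_le_power2[of "\<rho> x"] by linarith
  qed
  then show ?thesis unfolding abs_mult using b C by (intro mult_mono) auto
 qed
 then show ?thesis unfolding mild_def by auto
qed

lemma mild_rho: "mild \<rho>"
 using mild_mult_rho[of "\<lambda>_. 1" 1] by simp

lemma mild_rho2: "mild (\<lambda>x. (\<rho> x)^2)"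
 unfolding mild_def by (auto intro!: exI[of _ 1])

definition Zf :: "('a => real) => real => real => real" where
 "Zf \<psi> t y = (LINT x|\<mu>. \<psi> x * tw (\<rho> x) t y)"

definition pE :: "('a => real) => real => real => real" where
 "pE \<psi> t y = (LINT x|post t y. \<psi> x)"

text \<open>A version of the conditional expectation of \<psi>(X) given \<open>F t\<close>, as
  \<open>bayes_real\<close> shows.\<close>

abbreviation cE :: "('a => real) => 'w => real => real" where
 "cE \<psi> w t \<equiv> pE \<psi> t (Y w t)"

lemma Zf_meas [measurable]:
 assumes [measurable]: "\<psi> \<in> borel_measurable borel" and fg: "f \<in> borel_measurable N" "g \<in> borel_measurable N"
 shows "(\<lambda>x. Zf \<psi> (f x) (g x)) \<in> borel_measurable N"
proof -
 interpret mu: prob_space \<mu> by (rule prob_space_mu)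
 have "(\<lambda>p. \<integral>x. \<psi> x * tw (\<rho> x) (fst p) (snd p) \<partial>\<mu>) \<in> borel_measurable (borel \<Otimes>\<^sub>M borel)"
  by measurable
 from measurable_compose[OF measurable_Pair[OF fg] this] show ?thesis by (simp add: Zf_def)
qed

lemma pE_eq: "\<psi> \<in> borel_measurable borel ==> adm t y ==> pE \<psi> t y = Zf \<psi> t y / Z t y"
 using Z_pos[of t y] unfolding pE_def post_def Zf_def
 by (subst integral_density) (auto intro!: AE_I2 less_imp_le simp: mult.commute)

lemma pE_Zf: "\<psi> \<in> borel_measurable borel ==> 0 < t ==> pE \<psi> t y = Zf \<psi> t y / Z t y"
 by (rule pE_eq) (auto simp: adm_def)

lemma mild_integrable_tw:
 assumes m: "mild \<psi>" and t: "0 < t" shows "integrable \<mu> (\<lambda>x. \<psi> x * tw (\<rho> x) t y)"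
proof -
 interpret mu: prob_space \<mu> by (rule prob_space_mu)
 obtain C where C: "0 <= C" "\<And>x. \<bar>\<psi> x\<bar> <= C * (1 + (\<rho> x)^2)" using mildE[OF m] by blast
 note [measurable] = mild_meas[OF m]
 have "\<bar>\<psi> x * tw (\<rho> x) t y\<bar> <= C * ((1 + 4 / t) * exp (\<bar>y\<bar>\<^sup>2 / t))" for x
 proof -
  have "\<bar>\<psi> x * tw (\<rho> x) t y\<bar> <= C * (1 + (\<rho> x)^2) * tw (\<rho> x) t y"
   unfolding abs_mult using C by (simp add: mult_right_mono)
  also have "\<dots> <= C * ((1 + 4 / t) * exp (\<bar>y\<bar>\<^sup>2 / t))"
   unfolding mult.assoc using tw_growth[OF t order_refl order_refl, of "\<rho> x" y] C by (intro mult_left_mono) auto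
  finally show ?thesis .
 qed
 then show ?thesis by (intro mu.integrable_const_bound[where B="C * ((1 + 4 / t) * exp (\<bar>y\<bar>\<^sup>2 / t))"]) auto
qed

lemma mild_integrable_post:
 assumes m: "mild \<psi>" and t: "0 < t" shows "integrable (post t y) \<psi>"
proof -
 note [measurable] = mild_meas[OF m]
 have "adm t y" using t by (simp add: adm_def)
 from Z_pos[OF this] show ?thesis unfolding post_def using mild_integrable_tw[OF m t, of y]
  by (subst integrable_density) (auto intro!: AE_I2 less_imp_le simp: mult.commute)
qed

lemma bounded_integrable_post:
 fixes \<psi> :: "'a => real"
 assumes [measurable]: "\<psi> \<in> borel_measurable borel" and "\<And>x. \<bar>\<psi> x\<bar> <= C" and a: "adm t y"
 shows "integrable (post t y) \<psi>"
proof -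
 interpret p: prob_space "post t y" by (rule prob_space_post[OF a])
 show ?thesis using assms by (intro p.integrable_const_bound[where B=C]) (auto intro!: AE_I2)
qed

lemma pE_bounded:
 assumes [measurable]: "\<psi> \<in> borel_measurable borel" and b: "\<And>x. \<bar>\<psi> x\<bar> <= C" and a: "adm t y"
 shows "\<bar>pE \<psi> t y\<bar> <= C"
proof -
 interpret p: prob_space "post t y" by (rule prob_space_post[OF a])
 have i: "integrable (post t y) \<psi>" by (rule bounded_integrable_post[OF _ b a]) measurable
 have "\<bar>pE \<psi> t y\<bar> <= (LINT x|post t y. \<bar>\<psi> x\<bar>)" unfolding pE_def by (rule integral_abs_bound)
 also have "\<dots> <= (LINT x|post t y. C)" using i b by (intro integral_mono) auto
 also have "\<dots> = C" using p.prob_space by simp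
 finally show ?thesis .
qed

text \<open>Along the sequences the times stay above \<open>inverse L\<close> and the observations
  stay bounded by \<open>K\<close>, where \<open>tw_growth\<close> provides a constant
  dominator.\<close>

lemma Zf_tendsto:
 assumes m: "mild \<psi>" and tn: "\<And>n. 0 < t n" "t \<longlonglongrightarrow> t'" "0 < t'" and yn: "y \<longlonglongrightarrow> y'"
 shows "(\<lambda>n. Zf \<psi> (t n) (y n)) \<longlonglongrightarrow> Zf \<psi> t' y'"
proof -
 interpret mu: prob_space \<mu> by (rule prob_space_mu)
 obtain C where C: "0 <= C" "\<And>x. \<bar>\<psi> x\<bar> <= C * (1 + (\<rho> x)^2)" using mildE[OF m] by blast
 note [measurable] = mild_meas[OF m]
 have "Bseq y" using yn by (rule convergent_imp_Bseq[OF convergentI])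
 then obtain K where K: "\<And>n. \<bar>y n\<bar> <= K" by (auto simp: Bseq_def)
 have "(\<lambda>n. inverse (t n)) \<longlonglongrightarrow> inverse t'" using tn by (intro tendsto_inverse) auto
 then have "Bseq (\<lambda>n. inverse (t n))" by (rule convergent_imp_Bseq[OF convergentI])
 then obtain L where L: "0 < L" "\<And>n. \<bar>inverse (t n)\<bar> <= L" by (auto simp: Bseq_def)
 have t0: "inverse L <= t n" for n
 proof -
  have "inverse (t n) <= L" using L(2)[of n] tn(1)[of n] by simp
  then show ?thesis using tn(1)[of n] L(1) by (simp add: field_simps)
 qed
 let ?B = "C * ((1 + 4 / inverse L) * exp (K^2 / inverse L))"
 show ?thesis unfolding Zf_def
 proof (rule integral_dominated_convergence[where w="\<lambda>_. ?B"])
  show "AE x in \<mu>. (\<lambda>n. \<psi> x * tw (\<rho> x) (t n) (y n)) \<longlonglongrightarrow> \<psi> x * tw (\<rho> x) t' y'"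
   unfolding tw_def by (intro AE_I2 tendsto_intros tn yn) simp
  show "AE x in \<mu>. norm (\<psi> x * tw (\<rho> x) (t n) (y n)) <= ?B" for n
  proof (rule AE_I2)
   fix x
   have "\<bar>\<psi> x * tw (\<rho> x) (t n) (y n)\<bar> <= C * (1 + (\<rho> x)^2) * tw (\<rho> x) (t n) (y n)"
    unfolding abs_mult using C by (simp add: mult_right_mono)
   also have "\<dots> <= ?B"
    unfolding mult.assoc using tw_growth[OF _ t0 K, of "\<rho> x" n n] C L by (intro mult_left_mono) auto
   finally show "norm (\<psi> x * tw (\<rho> x) (t n) (y n)) <= ?B" by simp
  qed
 qed auto
qed

lemma Z_Zf: "Z t y = Zf (\<lambda>_. 1) t y"
 by (simp add: Z_def Zf_def)

lemma mild_one: "mild (\<lambda>_. 1)"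
 by (rule mild_bounded[of _ 1]) auto

lemma pE_tendsto:
 assumes m: "mild \<psi>" and tn: "\<And>n. 0 < t n" "t \<longlonglongrightarrow> t'" "0 < t'" and yn: "y \<longlonglongrightarrow> y'"
 shows "(\<lambda>n. pE \<psi> (t n) (y n)) \<longlonglongrightarrow> pE \<psi> t' y'"
proof -
 have "Z t' y' \<noteq> 0" using Z_pos[of t' y'] tn(3) by (auto simp: adm_def)
 then have "(\<lambda>n. Zf \<psi> (t n) (y n) / Z (t n) (y n)) \<longlonglongrightarrow> Zf \<psi> t' y' / Z t' y'"
  unfolding Z_Zf by (intro tendsto_divide Zf_tendsto m mild_one tn yn)
 then show ?thesis using tn(1,3) by (simp add: pE_Zf[OF mild_meas[OF m]])
qed

lemma pE_path_cont:
 assumes m: "mild \<psi>" and dy: "w \<in> space M"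
 shows "continuous_on {0<..} (\<lambda>t. cE \<psi> w t)"
 unfolding continuous_on_sequentially comp_def
proof (intro allI ballI impI)
 fix t and t' :: real assume t': "t' \<in> {0<..}" and t: "(\<forall>n. t n \<in> {0<..}) \<and> t \<longlonglongrightarrow> t'"
 have "(\<lambda>n. Y w (t n)) \<longlonglongrightarrow> Y w t'"
  using t t' by (intro continuous_on_tendsto_compose[OF Y_cont[OF dy]] always_eventually) (auto intro: less_imp_le)
 with t t' show "(\<lambda>n. cE \<psi> w (t n)) \<longlonglongrightarrow> cE \<psi> w t'"
  by (intro pE_tendsto[OF m]) auto
qed

text \<open>A version of \<open>pE\<close> that is a quotient everywhere, hence jointly measurable
  in time and observation; the two agree at admissible pairs by \<open>pE_eq\<close>.\<close>

definition pEm :: "('a => real) => real => real => real" where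
 "pEm \<psi> t y = Zf \<psi> t y / Z t y"

lemma pEm_meas [measurable]:
 assumes [measurable]: "\<psi> \<in> borel_measurable borel" "f \<in> borel_measurable N" "g \<in> borel_measurable N"
 shows "(\<lambda>x. pEm \<psi> (f x) (g x)) \<in> borel_measurable N"
 unfolding pEm_def by measurable

lemma pE_meas_F:
 assumes t: "0 <= t" and [measurable]: "\<psi> \<in> borel_measurable borel"
 shows "(\<lambda>w. cE \<psi> w t) \<in> borel_measurable (F t)"
proof -
 have [measurable]: "(\<lambda>w. Y w t) \<in> borel_measurable (F t)" using t by (intro Y_meas_F) auto
 have "(\<lambda>w. pEm \<psi> t (Y w t)) \<in> borel_measurable (F t)" by measurable
 then show ?thesis using t by (subst measurable_cong[where g="\<lambda>w. pEm \<psi> t (Y w t)"]) (auto simp: pE_eq adm_Y pEm_def)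
qed

lemma from_F: "0 <= t ==> f \<in> borel_measurable (F t) ==> f \<in> borel_measurable M"
 using measurable_from_subalg[OF subalgebra_F] .

lemma F_lift: "s <= t ==> f \<in> borel_measurable (F s) ==> f \<in> borel_measurable (F t)"
 using measurable_from_subalg[OF subalgebra_F_F] .

lemma bayes_real_nonneg:
 assumes t: "0 <= t" and [measurable]: "\<psi> \<in> borel_measurable borel" and g: "g \<in> borel_measurable (F t)"
  and pos: "\<And>x. 0 <= \<psi> x" "\<And>w. 0 <= g w"
  and ip: "\<And>w. w \<in> space M ==> integrable (\<xi> w t) \<psi>"
  and i: "integrable M (\<lambda>w. g w * \<psi> (X w))"
 shows "has_bochner_integral M (\<lambda>w. g w * cE \<psi> w t) (LINT w|M. g w * \<psi> (X w))"
proof -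
 note [measurable] = from_F[OF t g] from_F[OF t pE_meas_F[OF t]]
 have nn: "(\<integral>\<^sup>+x. ennreal (\<psi> x) \<partial>\<xi> w t) = ennreal (cE \<psi> w t)" if "w \<in> space M" for w
  using nn_integral_eq_integral[OF ip[OF that]] pos by (simp add: pE_def \<xi>_def)
 have p0: "0 <= pE \<psi> t y" for y unfolding pE_def using pos by simp
 have gm: "(\<lambda>w. ennreal (g w)) \<in> borel_measurable (F t)" using g by measurable
 have "(\<integral>\<^sup>+w. ennreal (g w * cE \<psi> w t) \<partial>M) = (\<integral>\<^sup>+w. (\<integral>\<^sup>+x. ennreal (\<psi> x) \<partial>\<xi> w t) * ennreal (g w) \<partial>M)"
  by (intro nn_integral_cong) (simp add: nn ennreal_mult' pos p0 mult.commute)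
 also have "\<dots> = (\<integral>\<^sup>+w. ennreal (\<psi> (X w)) * ennreal (g w) \<partial>M)"
  by (rule nn_bayes[OF t _ gm, symmetric]) measurable
 also have "\<dots> = (\<integral>\<^sup>+w. ennreal (g w * \<psi> (X w)) \<partial>M)"
  by (intro nn_integral_cong) (simp add: ennreal_mult' pos mult.commute)
 also have "\<dots> = ennreal (LINT w|M. g w * \<psi> (X w))"
  using i pos by (intro nn_integral_eq_integral) (auto intro!: AE_I2 mult_nonneg_nonneg)
 finally show ?thesis
  using pos p0 by (intro has_bochner_integral_nn_integral) (auto intro!: AE_I2 mult_nonneg_nonneg integral_nonneg)
qed

text \<open>Four applications of the nonnegative case, one for each combination of the signs of
  \<open>g\<close> and \<open>\<psi>\<close>.\<close>

lemma bayes_real: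
 assumes t: "0 <= t" and \<psi>[measurable]: "\<psi> \<in> borel_measurable borel" and g: "g \<in> borel_measurable (F t)"
  and ip: "\<And>w. w \<in> space M ==> integrable (\<xi> w t) \<psi>"
  and i: "integrable M (\<lambda>w. g w * \<psi> (X w))"
 shows "integrable M (\<lambda>w. g w * cE \<psi> w t)" (is ?g1)
  and "(LINT w|M. g w * cE \<psi> w t) = (LINT w|M. g w * \<psi> (X w))"
proof -
 note [measurable] = from_F[OF t g] from_F[OF t pE_meas_F[OF t]] g
 have split: "cE \<psi> w t = cE (\<lambda>x. max 0 (\<psi> x)) w t - cE (\<lambda>x. max 0 (- \<psi> x)) w t" if "w \<in> space M" for w
 proof -
  have "cE (\<lambda>x. max 0 (\<psi> x)) w t - cE (\<lambda>x. max 0 (- \<psi> x)) w t = (LINT x|\<xi> w t. max 0 (\<psi> x) - max 0 (- \<psi> x))"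
   unfolding pE_def \<xi>_def[symmetric] using ip[OF that] by (intro Bochner_Integration.integral_diff[symmetric]) auto
  also have "\<dots> = cE \<psi> w t" unfolding pE_def \<xi>_def by (intro Bochner_Integration.integral_cong) auto
  finally show ?thesis ..
 qed
 have base: "has_bochner_integral M (\<lambda>w. max 0 (a * g w) * cE (\<lambda>x. max 0 (c * \<psi> x)) w t)
   (LINT w|M. max 0 (a * g w) * max 0 (c * \<psi> (X w)))
   \<and> integrable M (\<lambda>w. max 0 (a * g w) * max 0 (c * \<psi> (X w)))"
  if "\<bar>a\<bar> = 1" "\<bar>c\<bar> = 1" for a c :: real
 proof -
  have i': "integrable M (\<lambda>w. max 0 (a * g w) * max 0 (c * \<psi> (X w)))"
  proof (rule Bochner_Integration.integrable_bound[OF i])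
   have le: "max 0 (e * u) <= \<bar>u\<bar>" if "\<bar>e\<bar> = 1" for e u :: real using that abs_ge_self[of "e * u"] by (simp add: abs_mult)
   show "AE w in M. norm (max 0 (a * g w) * max 0 (c * \<psi> (X w))) <= norm (g w * \<psi> (X w))"
    unfolding real_norm_def abs_mult using le that by (intro AE_I2 mult_mono) auto
  qed measurable
  have "integrable (\<xi> w t) (\<lambda>x. max 0 (c * \<psi> x))" if "w \<in> space M" for w
   using ip[OF that] by auto
  with i' show ?thesis by (intro conjI bayes_real_nonneg[OF t]) auto
 qed
 note b = base[of 1 1] base[of 1 "-1"] base[of "-1" 1] base[of "-1" "-1"]
 let ?h = "\<lambda>u v. max 0 u * max 0 v - max 0 u * max 0 (- v) - (max 0 (- u) * max 0 v - max 0 (- u) * max 0 (- v))"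
 have mm: "u * v = ?h u v" for u v :: real
  by (cases "0 <= u"; cases "0 <= v") (auto simp: max_def)
 have mm': "u * (p - q) = max 0 u * p - max 0 u * q - (max 0 (- u) * p - max 0 (- u) * q)" for u p q :: real
  by (cases "0 <= u") (auto simp: max_def algebra_simps)
 have "has_bochner_integral M (\<lambda>w. max 0 (g w) * cE (\<lambda>x. max 0 (\<psi> x)) w t - max 0 (g w) * cE (\<lambda>x. max 0 (- \<psi> x)) w t
   - (max 0 (- g w) * cE (\<lambda>x. max 0 (\<psi> x)) w t - max 0 (- g w) * cE (\<lambda>x. max 0 (- \<psi> x)) w t))
  ((LINT w|M. max 0 (g w) * max 0 (\<psi> (X w))) - (LINT w|M. max 0 (g w) * max 0 (- \<psi> (X w)))
   - ((LINT w|M. max 0 (- g w) * max 0 (\<psi> (X w))) - (LINT w|M. max 0 (- g w) * max 0 (- \<psi> (X w)))))"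
  using b by (intro has_bochner_integral_diff) auto
 also have "((LINT w|M. max 0 (g w) * max 0 (\<psi> (X w))) - (LINT w|M. max 0 (g w) * max 0 (- \<psi> (X w)))
   - ((LINT w|M. max 0 (- g w) * max 0 (\<psi> (X w))) - (LINT w|M. max 0 (- g w) * max 0 (- \<psi> (X w)))))
   = (LINT w|M. ?h (g w) (\<psi> (X w)))"
  using b by simp
 also have "\<dots> = (LINT w|M. g w * \<psi> (X w))" by (simp only: mm[symmetric])
 finally have fin: "has_bochner_integral M (\<lambda>w. max 0 (g w) * cE (\<lambda>x. max 0 (\<psi> x)) w t - max 0 (g w) * cE (\<lambda>x. max 0 (- \<psi> x)) w t
   - (max 0 (- g w) * cE (\<lambda>x. max 0 (\<psi> x)) w t - max 0 (- g w) * cE (\<lambda>x. max 0 (- \<psi> x)) w t)) (LINT w|M. g w * \<psi> (X w))" .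
 have "has_bochner_integral M (\<lambda>w. g w * cE \<psi> w t) (LINT w|M. g w * \<psi> (X w))"
  by (rule iffD1[OF has_bochner_integral_cong fin]) (simp_all only: mm'[symmetric] split)
 then show ?g1
  and "(LINT w|M. g w * cE \<psi> w t) = (LINT w|M. g w * \<psi> (X w))"
  by (auto simp: has_bochner_integral_iff)
qed

text \<open>On this event \<open>\<rho>(X)\<close> is square integrable if \<open>s > 0\<close>, although it need not be so globally.\<close>

definition cut :: "real => real => 'w set" where
 "cut s K = {w\<in>space M. \<bar>Y w s\<bar> <= K}"

lemma cut_F: assumes "0 <= s" shows "cut s K \<in> sets (F s)"
proof -
 have [measurable]: "(\<lambda>w. Y w s) \<in> borel_measurable (F s)" using assms by (intro Y_meas_F) auto
 have "{w\<in>space (F s). \<bar>Y w s\<bar> <= K} \<in> sets (F s)" by measurable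
 then show ?thesis by (simp add: cut_def)
qed

text \<open>The posterior second moment of \<rho> is continuous in the observation, hence bounded
  where |y| <= K; the Bayes formula carries this bound over to \<rho>(X).\<close>

lemma integrable_cut_rho2:
 assumes s: "0 < s" shows "integrable M (\<lambda>w. indicator (cut s K) w * (\<rho> (X w))^2)"
proof -
 have c: "cut s K \<in> sets (F s)" using s by (intro cut_F) simp
 then have [measurable]: "cut s K \<in> sets M" using subalgebra_F[of s] s by (auto simp: subalgebra_def)
 have "continuous_on {-K..K} (pE (\<lambda>x. (\<rho> x)^2) s)"
  unfolding continuous_on_sequentially comp_def using pE_tendsto[OF mild_rho2, of "\<lambda>_. s" s] s by auto
 then have "bounded (pE (\<lambda>x. (\<rho> x)^2) s ` {-K..K})"
  by (intro compact_imp_bounded compact_continuous_image) auto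
 then obtain C where C: "\<And>y. \<bar>y\<bar> <= K ==> \<bar>pE (\<lambda>x. (\<rho> x)^2) s y\<bar> <= C"
  unfolding bounded_iff by (force simp: abs_le_iff)
 have "(\<integral>\<^sup>+w. ennreal (norm (indicator (cut s K) w * (\<rho> (X w))^2)) \<partial>M) = (\<integral>\<^sup>+w. ennreal ((\<rho> (X w))^2) * indicator (cut s K) w \<partial>M)"
  by (intro nn_integral_cong) (auto simp: indicator_def)
 also have "\<dots> = (\<integral>\<^sup>+w. (\<integral>\<^sup>+x. ennreal ((\<rho> x)^2) \<partial>\<xi> w s) * indicator (cut s K) w \<partial>M)"
  using s c by (intro nn_bayes) auto
 also have "\<dots> <= (\<integral>\<^sup>+w. ennreal C \<partial>M)"
 proof (rule nn_integral_mono)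
  fix w assume "w \<in> space M"
  have "(\<integral>\<^sup>+x. ennreal ((\<rho> x)^2) \<partial>\<xi> w s) = ennreal (cE (\<lambda>x. (\<rho> x)^2) w s)"
   unfolding pE_def \<xi>_def by (rule nn_integral_eq_integral[OF mild_integrable_post[OF mild_rho2 s]]) auto
  also have "\<dots> <= ennreal C" if "w \<in> cut s K" using C[of "Y w s"] that by (intro ennreal_leI) (auto simp: cut_def)
  finally show "(\<integral>\<^sup>+x. ennreal ((\<rho> x)^2) \<partial>\<xi> w s) * indicator (cut s K) w <= ennreal C" by (auto simp: indicator_def)
 qed
 also have "\<dots> < \<infinity>" using emeasure_space_1 by simp
 finally show ?thesis by (intro integrableI_bounded) auto
qed

text \<open>Clamping the time to [s, t] turns the path into one that is continuous on the whole line
  and \<open>F t\<close>-measurable at each time, so that \<open>caratheodory_measurable\<close>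
  applies.\<close>

lemma path_measurable:
 fixes h :: "real => real => real"
 assumes s: "0 <= s" "s <= t" and h: "(\<lambda>p. h (fst p) (snd p)) \<in> borel_measurable (borel \<Otimes>\<^sub>M borel)"
 shows "(\<lambda>p. indicator {s..t} (snd p) * h (snd p) (Y (fst p) (snd p))) \<in> borel_measurable (F t \<Otimes>\<^sub>M lborel)"
proof -
 define c where "c r = max s (min t r)" for r
 have c: "0 <= c r" "c r <= t" for r using s by (auto simp: c_def)
 have "(\<lambda>p. Y (fst p) (c (snd p))) \<in> borel_measurable (F t \<Otimes>\<^sub>M borel)"
 proof (rule caratheodory_measurable)
  show "(\<lambda>w. Y w (c r)) \<in> borel_measurable (F t)" for r using c by (intro Y_meas_F) auto
  show "continuous_on UNIV (\<lambda>r. Y w (c r))" if "w \<in> space (F t)" for w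
   by (rule continuous_on_compose2[OF Y_cont]) (use that c in \<open>auto simp: c_def intro!: continuous_intros\<close>)
 qed
 note [measurable] = this
 have "(\<lambda>p. (snd p, Y (fst p) (c (snd p)))) \<in> (F t \<Otimes>\<^sub>M borel) \<rightarrow>\<^sub>M (borel \<Otimes>\<^sub>M borel)" by measurable
 from measurable_compose[OF this h]
 have [measurable]: "(\<lambda>p. h (snd p) (Y (fst p) (c (snd p)))) \<in> borel_measurable (F t \<Otimes>\<^sub>M borel)" by simp
 have "(\<lambda>p. indicator {s..t} (snd p) * h (snd p) (Y (fst p) (c (snd p)))) \<in> borel_measurable (F t \<Otimes>\<^sub>M borel)"
  by measurable
 then have "(\<lambda>p. indicator {s..t} (snd p) * h (snd p) (Y (fst p) (c (snd p)))) \<in> borel_measurable (F t \<Otimes>\<^sub>M lborel)"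
  by (subst measurable_cong_sets[OF sets_pair_measure_cong[OF refl sets_lborel] refl])
 moreover have "(\<lambda>p. indicator {s..t} (snd p) * h (snd p) (Y (fst p) (c (snd p))))
  = (\<lambda>p. indicator {s..t} (snd p) * h (snd p) (Y (fst p) (snd p)))"
  by (auto simp: fun_eq_iff indicator_def c_def)
 ultimately show ?thesis by simp
qed

end

section \<open>Functionals of the observed path and their time integrals\<close>

lemma integral_indicator_Icc:
 fixes f :: "real => real"
 assumes "continuous_on {s..t} f"
 shows "integrable lborel (\<lambda>r. indicator {s..t} r * f r)"
  and "(LINT r|lborel. indicator {s..t} r * f r) = integral {s..t} f"
 using borel_integrable_atLeastAtMost'[OF assms] set_borel_integral_eq_integral(2)[OF borel_integrable_atLeastAtMost'[OF assms]]
 by (simp_all add: set_integrable_def set_lebesgue_integral_def)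

lemma integral_Icc_square_le:
 fixes f :: "real => real"
 assumes c: "continuous_on {s..s + h} f" and h: "0 < h"
 shows "(LINT r|lborel. indicator {s..s + h} r * f r)^2 <= h * (LINT r|lborel. indicator {s..s + h} r * (f r)^2)"
proof -
 define I where "I = (LINT r|lborel. indicator {s..s + h} r * f r)"
 define Q where "Q = (LINT r|lborel. indicator {s..s + h} r * (f r)^2)"
 \<comment> \<open>Cauchy-Schwarz as nonnegativity of the variance of \<open>f\<close> about its
   mean over the interval.\<close>
 define m where "m = I / h"
 have i1: "integrable lborel (\<lambda>r. indicator {s..s + h} r * f r)" by (rule integral_indicator_Icc[OF c])
 have i2: "integrable lborel (\<lambda>r. indicator {s..s + h} r * (f r)^2)"
  by (rule integral_indicator_Icc) (intro continuous_intros c)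
 have i3: "integrable lborel (\<lambda>r. indicator {s..s + h} r * (1::real))"
  by (rule integral_indicator_Icc) (intro continuous_intros)
 have I3: "(LINT r|lborel. indicator {s..s + h} r * (1::real)) = h" using h by simp
 have "0 <= (LINT r|lborel. indicator {s..s + h} r * (f r - m)^2)" by (rule Bochner_Integration.integral_nonneg) simp
 also have "\<dots> = (LINT r|lborel. indicator {s..s + h} r * (f r)^2 - 2 * m * (indicator {s..s + h} r * f r) + m^2 * (indicator {s..s + h} r * 1))"
  by (intro Bochner_Integration.integral_cong) (auto simp: power2_eq_square algebra_simps)
 also have "\<dots> = Q - 2 * m * I + m^2 * h"
  using i1 i2 i3 I3 by (simp add: I_def Q_def)
 also have "\<dots> = Q - I^2 / h" using h by (simp add: m_def power2_eq_square field_simps)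
 finally show ?thesis using h by (simp add: I_def Q_def field_simps)
qed

lemma (in prob_space) expectation_square_le:
 fixes f :: "'a => real"
 assumes "integrable M f" "integrable M (\<lambda>x. (f x)^2)"
 shows "(expectation f)^2 <= expectation (\<lambda>x. (f x)^2)"
 using variance_positive[of f] variance_eq[OF assms] by simp

context bm_filter
begin

text \<open>Functions that are read along the observed path at positive times. The measurable
  companion has to agree only there, because \<open>pE\<close> is identified with a measurable
  quotient only at admissible pairs.\<close>

definition pathfun :: "(real => real => real) => bool" where
 "pathfun h \<longleftrightarrow> (\<exists>h'. (\<lambda>p. h' (fst p) (snd p)) \<in> borel_measurable (borel \<Otimes>\<^sub>M borel) \<and> (\<forall>t>0. \<forall>y. h t y = h' t y)) \<and>
   (\<forall>w\<in>space M. continuous_on {0<..} (\<lambda>t. h t (Y w t)))"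

lemma pathfun_pE: assumes "mild \<psi>" shows "pathfun (pE \<psi>)"
proof -
 note [measurable] = mild_meas[OF assms]
 have "(\<lambda>p. pEm \<psi> (fst p) (snd p)) \<in> borel_measurable (borel \<Otimes>\<^sub>M borel)" by measurable
 then show ?thesis unfolding pathfun_def using pE_path_cont[OF assms]
  by (auto intro!: exI[of _ "pEm \<psi>"] simp: pEm_def pE_Zf)
qed

lemma pathfun_comp:
 assumes f: "pathfun f" and g: "pathfun g" and c: "continuous_on UNIV (\<lambda>p. op (fst p) (snd p) :: real)"
 shows "pathfun (\<lambda>t y. op (f t y) (g t y))"
proof -
 from f g obtain f' g' where m: "(\<lambda>p. f' (fst p) (snd p)) \<in> borel_measurable (borel \<Otimes>\<^sub>M borel)"
   "(\<lambda>p. g' (fst p) (snd p)) \<in> borel_measurable (borel \<Otimes>\<^sub>M borel)"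
  and e: "\<forall>t>0. \<forall>y. f t y = f' t y" "\<forall>t>0. \<forall>y. g t y = g' t y"
  and fc: "\<And>w. w \<in> space M ==> continuous_on {0<..} (\<lambda>t. f t (Y w t))"
  and gc: "\<And>w. w \<in> space M ==> continuous_on {0<..} (\<lambda>t. g t (Y w t))"
  unfolding pathfun_def by blast
 have "(\<lambda>p. op (fst p) (snd p)) \<in> borel_measurable (borel \<Otimes>\<^sub>M borel)"
  using borel_measurable_continuous_onI[OF c] by (simp add: borel_prod)
 from measurable_compose[OF measurable_Pair[OF m] this]
 have "(\<lambda>p. op (f' (fst p) (snd p)) (g' (fst p) (snd p))) \<in> borel_measurable (borel \<Otimes>\<^sub>M borel)" by simp
 moreover have "continuous_on {0<..} (\<lambda>t. op (f t (Y w t)) (g t (Y w t)))" if "w \<in> space M" for w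
  using continuous_on_compose2[OF c continuous_on_Pair[OF fc[OF that] gc[OF that]]] by simp
 ultimately show ?thesis unfolding pathfun_def using e
  by (intro conjI exI[of _ "\<lambda>t y. op (f' t y) (g' t y)"]) auto
qed

lemma pathfun_diff: "pathfun f ==> pathfun g ==> pathfun (\<lambda>t y. f t y - g t y)"
 and pathfun_mult: "pathfun f ==> pathfun g ==> pathfun (\<lambda>t y. f t y * g t y)"
 by (rule pathfun_comp; assumption?; intro continuous_intros)+

lemma pathfun_power2: "pathfun f ==> pathfun (\<lambda>t y. (f t y)\<^sup>2)"
 using pathfun_mult[of f f] by (simp add: power2_eq_square)

lemma pathfun_cont:
 assumes "pathfun h" "w \<in> space M" "0 < s" shows "continuous_on {s..t} (\<lambda>r. h r (Y w r))"
 by (rule continuous_on_subset[of "{0<..}"]) (use assms in \<open>auto simp: pathfun_def\<close>)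

lemma pathfun_meas_F:
 assumes h: "pathfun h" and t: "0 < t" shows "(\<lambda>w. h t (Y w t)) \<in> borel_measurable (F t)"
proof -
 have [measurable]: "(\<lambda>w. Y w t) \<in> borel_measurable (F t)" using t by (intro Y_meas_F) auto
 from h obtain h' where m: "(\<lambda>p. h' (fst p) (snd p)) \<in> borel_measurable (borel \<Otimes>\<^sub>M borel)"
  and e: "\<forall>t>0. \<forall>y. h t y = h' t y" unfolding pathfun_def by blast
 have "(\<lambda>w. (t, Y w t)) \<in> F t \<rightarrow>\<^sub>M borel \<Otimes>\<^sub>M borel" by measurable
 from measurable_compose[OF this m] e t show ?thesis by simp
qed

lemma pathfun_meas_pair:
 assumes h: "pathfun h" and s: "0 < s" "s <= t"
 shows "(\<lambda>p. indicator {s..t} (snd p) * h (snd p) (Y (fst p) (snd p))) \<in> borel_measurable (F t \<Otimes>\<^sub>M lborel)" (is ?g1)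
  and "(\<lambda>p. indicator {s..t} (snd p) * h (snd p) (Y (fst p) (snd p))) \<in> borel_measurable MT" (is ?g2)
proof -
 from h obtain h' where m: "(\<lambda>p. h' (fst p) (snd p)) \<in> borel_measurable (borel \<Otimes>\<^sub>M borel)"
  and e: "\<forall>t>0. \<forall>y. h t y = h' t y" unfolding pathfun_def by blast
 have eq: "(\<lambda>p. indicator {s..t} (snd p) * h' (snd p) (Y (fst p) (snd p)))
  = (\<lambda>p. indicator {s..t} (snd p) * h (snd p) (Y (fst p) (snd p)))"
  using e s by (auto simp: fun_eq_iff indicator_def)
 show 1: ?g1
  using path_measurable[OF _ s(2) m] s unfolding eq by simp
 have id: "(\<lambda>w. w) \<in> M \<rightarrow>\<^sub>M F t"
  using subalgebra_F[of t] s by (auto simp: subalgebra_def measurable_def Int_absorb2 dest: sets.sets_into_space)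
 have "(\<lambda>p. (fst p, snd p)) \<in> MT \<rightarrow>\<^sub>M F t \<Otimes>\<^sub>M lborel"
  by (intro measurable_Pair measurable_compose[OF measurable_fst id] measurable_snd)
 from measurable_compose[OF this 1]
 show ?g2 by simp
qed

definition pint :: "(real => real => real) => real => real => 'w => real" where
 "pint h s t w = (LINT r|lborel. indicator {s..t} r * h r (Y w r))"

lemma pint_meas_F:
 assumes "pathfun h" "0 < s" "s <= t" shows "pint h s t \<in> borel_measurable (F t)"
proof -
 have "(\<lambda>w. \<integral>r. (\<lambda>p. indicator {s..t} (snd p) * h (snd p) (Y (fst p) (snd p))) (w, r) \<partial>lborel) \<in> borel_measurable (F t)"
  by (rule lborel.borel_measurable_lebesgue_integral)
   (use pathfun_meas_pair(1)[OF assms] in \<open>simp add: case_prod_beta'\<close>)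
 then show ?thesis by (simp add: pint_def[abs_def])
qed

lemma pint_integral:
 assumes "pathfun h" "w \<in> space M" "0 < s"
 shows "integrable lborel (\<lambda>r. indicator {s..t} r * h r (Y w r))"
  and "pint h s t w = integral {s..t} (\<lambda>r. h r (Y w r))"
 using integral_indicator_Icc[OF pathfun_cont[OF assms, of t]] by (simp_all add: pint_def)

lemma pint_combine:
 assumes h: "pathfun h" "w \<in> space M" and s: "0 < s" "s <= t" "t <= u"
 shows "pint h s t w + pint h t u w = pint h s u w"
proof -
 have t: "0 < t" using s by simp
 show ?thesis unfolding pint_integral(2)[OF h s(1)] pint_integral(2)[OF h t]
  by (rule Henstock_Kurzweil_Integration.integral_combine[OF s(2,3) integrable_continuous_real[OF pathfun_cont[OF h s(1)]]])
qed

lemma pint_cont: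
 assumes h: "pathfun h" "w \<in> space M" and s: "0 < s"
 shows "continuous_on {s..u} (\<lambda>t. pint h s t w)"
 unfolding pint_integral(2)[OF h s]
 by (rule indefinite_integral_continuous_1[OF integrable_continuous_real[OF pathfun_cont[OF h s]]])

text \<open>For each q in [r, u] the variable \<open>g\<close> is \<open>F q\<close>-measurable, so
  the posterior mean of \<open>\<psi>\<close> at time q may be replaced by \<psi>(X); what remains
  is constant in q. The support in \<open>cut s K\<close> supplies the integrability for
  Fubini.\<close>

lemma Fubini_bayes:
 assumes s: "0 < s" "s <= r" "r <= u" and G: "g \<in> borel_measurable (F r)"
  and gb: "\<And>w. \<bar>g w\<bar> <= c * indicator (cut s K) w" and m: "mild \<psi>"
 shows "integrable M (\<lambda>w. g w * \<psi> (X w))" (is ?g1)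
  and "integrable MT (\<lambda>p. g (fst p) * (indicator {r..u} (snd p) * cE \<psi> (fst p) (snd p)))" (is ?g2)
  and "integrable M (\<lambda>w. g w * pint (pE \<psi>) r u w)" (is ?g3)
  and "(LINT w|M. g w * pint (pE \<psi>) r u w) = (u - r) * (LINT w|M. g w * \<psi> (X w))" (is ?g4)
proof -
 interpret P: pair_sigma_finite M lborel ..
 have r: "0 < r" using s by simp
 obtain C where C: "0 <= C" "\<And>x. \<bar>\<psi> x\<bar> <= C * (1 + (\<rho> x)^2)" using mildE[OF m] by blast
 note [measurable] = mild_meas[OF m]
 have gM[measurable]: "g \<in> borel_measurable M" using G r by (intro from_F[of r]) auto
 have cutM[measurable]: "cut s K \<in> sets M" using cut_F[of s K] subalgebra_F[of s] s by (auto simp: subalgebra_def)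
 \<comment> \<open>This dominator is itself \<open>mild\<close>, so by Bayes its posterior mean
   tested against |g| is the same finite number \<open>c0\<close> at every time.\<close>
 let ?\<psi> = "\<lambda>x. C * (1 + (\<rho> x)^2)"
 have mb: "mild ?\<psi>" unfolding mild_def using C(1) by (auto intro!: exI[of _ C] simp: abs_mult)
 have int: "integrable M (\<lambda>w. g w * \<phi> (X w))" if p: "mild \<phi>" for \<phi>
 proof -
  obtain D where D: "0 <= D" "\<And>x. \<bar>\<phi> x\<bar> <= D * (1 + (\<rho> x)^2)" using mildE[OF p] by blast
  note [measurable] = mild_meas[OF p]
  have i: "integrable M (\<lambda>w. \<bar>c\<bar> * D * (indicator (cut s K) w + indicator (cut s K) w * (\<rho> (X w))^2))"
   using integrable_cut_rho2[OF s(1), of K]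
   by (intro integrable_mult_right Bochner_Integration.integrable_add) (auto intro!: integrable_real_indicator simp: emeasure_eq_measure)
  show ?thesis
  proof (rule Bochner_Integration.integrable_bound[OF i])
   show "AE w in M. norm (g w * \<phi> (X w)) <= norm (\<bar>c\<bar> * D * (indicator (cut s K) w + indicator (cut s K) w * (\<rho> (X w))^2))"
   proof (rule AE_I2)
    fix w
    have "\<bar>g w\<bar> <= \<bar>c\<bar> * indicator (cut s K) w"
     using gb[of w] by (auto simp: indicator_def split: if_splits)
    then have "\<bar>g w\<bar> * \<bar>\<phi> (X w)\<bar> <= (\<bar>c\<bar> * indicator (cut s K) w) * (D * (1 + (\<rho> (X w))^2))"
     using D by (intro mult_mono) auto
    also have "\<dots> = \<bar>c\<bar> * D * (indicator (cut s K) w + indicator (cut s K) w * (\<rho> (X w))^2)" by (simp add: algebra_simps)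
    finally show "norm (g w * \<phi> (X w)) <= norm (\<bar>c\<bar> * D * (indicator (cut s K) w + indicator (cut s K) w * (\<rho> (X w))^2))"
     using D(1) by (simp add: abs_mult)
   qed
  qed measurable
 qed
 show i1: ?g1 by (rule int[OF m])
 define f where "f w q = g w * (indicator {r..u} q * cE \<psi> w q)" for w q
 have fm[measurable]: "case_prod f \<in> borel_measurable MT"
  unfolding f_def case_prod_beta' using pathfun_meas_pair(2)[OF pathfun_pE[OF m] r s(3)] by measurable
 define c0 where "c0 = (\<integral>\<^sup>+w. ennreal (C * (1 + (\<rho> (X w))^2)) * ennreal \<bar>g w\<bar> \<partial>M)"
 have c0: "c0 < \<infinity>"
 proof -
  have "integrable M (\<lambda>w. norm (g w * ?\<psi> (X w)))" by (rule integrable_norm[OF int[OF mb]])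
  then have "(\<integral>\<^sup>+w. ennreal (norm (g w * ?\<psi> (X w))) \<partial>M) < \<infinity>" by (simp add: integrable_iff_bounded)
  also have "(\<integral>\<^sup>+w. ennreal (norm (g w * ?\<psi> (X w))) \<partial>M) = c0"
   unfolding c0_def using C(1) by (intro nn_integral_cong) (simp add: abs_mult ennreal_mult'[symmetric] mult.commute)
  finally show ?thesis .
 qed
 have bound: "(\<integral>\<^sup>+w. ennreal (norm (f w q)) \<partial>M) <= c0 * indicator {r..u} q" for q
 proof (cases "q \<in> {r..u}")
  case True
  then have q: "0 < q" "r <= q" using r by auto
  have gq: "(\<lambda>w. ennreal \<bar>g w\<bar>) \<in> borel_measurable (F q)" using F_lift[OF q(2) G] by measurable
  have pb: "\<bar>pE \<psi> q y\<bar> <= pE ?\<psi> q y" for y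
  proof -
   have "\<bar>pE \<psi> q y\<bar> <= (LINT x|post q y. \<bar>\<psi> x\<bar>)" unfolding pE_def by (rule integral_abs_bound)
   also have "\<dots> <= pE ?\<psi> q y" unfolding pE_def using C
    by (intro integral_mono integrable_abs mild_integrable_post m mb q) auto
   finally show ?thesis .
  qed
  have "(\<integral>\<^sup>+w. ennreal (norm (f w q)) \<partial>M) <= (\<integral>\<^sup>+w. (\<integral>\<^sup>+x. ennreal (?\<psi> x) \<partial>\<xi> w q) * ennreal \<bar>g w\<bar> \<partial>M)"
  proof (rule nn_integral_mono)
   fix w
   have "(\<integral>\<^sup>+x. ennreal (?\<psi> x) \<partial>\<xi> w q) = ennreal (pE ?\<psi> q (Y w q))"
    unfolding pE_def \<xi>_def using C(1) by (intro nn_integral_eq_integral mild_integrable_post mb q) auto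
   then show "ennreal (norm (f w q)) <= (\<integral>\<^sup>+x. ennreal (?\<psi> x) \<partial>\<xi> w q) * ennreal \<bar>g w\<bar>"
    using pb[of "Y w q"] order_trans[OF abs_ge_zero pb[of "Y w q"]] True
    by (simp add: f_def abs_mult ennreal_mult'[symmetric] ennreal_leI mult.commute mult_right_mono mult_left_mono)
  qed
  also have "\<dots> = c0" unfolding c0_def using q by (intro nn_bayes[symmetric] gq) auto
  finally show ?thesis using True by simp
 next
  case False then show ?thesis by (simp add: f_def)
 qed
 have "(\<integral>\<^sup>+p. ennreal (norm (case_prod f p)) \<partial>MT) = (\<integral>\<^sup>+q. (\<integral>\<^sup>+w. ennreal (norm (f w q)) \<partial>M) \<partial>lborel)"
  by (subst P.nn_integral_snd[symmetric]) (simp_all add: case_prod_beta')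
 also have "\<dots> <= (\<integral>\<^sup>+q. c0 * indicator {r..u} q \<partial>lborel)" by (intro nn_integral_mono bound)
 also have "\<dots> = c0 * ennreal (u - r)" using s by (simp add: nn_integral_cmult_indicator)
 also have "\<dots> < \<infinity>" using c0 by (simp add: ennreal_mult_less_top)
 finally have fi: "integrable MT (case_prod f)" using fm by (intro integrableI_bounded) auto
 then show ?g2
  by (simp add: f_def case_prod_beta')
 have pe: "(LINT q|lborel. f w q) = g w * pint (pE \<psi>) r u w" for w by (simp add: f_def pint_def)
 show ?g3
  using P.integrable_fst'[OF fi] by (simp add: pe)
 have "(LINT w|M. g w * pint (pE \<psi>) r u w) = (LINT q|lborel. (LINT w|M. f w q))"
  unfolding pe[symmetric] using P.Fubini_integral[OF fi] by simp
 also have "\<dots> = (LINT q|lborel. indicator {r..u} q * (LINT w|M. g w * \<psi> (X w)))"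
 proof (rule Bochner_Integration.integral_cong[OF refl])
  fix q
  show "(LINT w|M. f w q) = indicator {r..u} q * (LINT w|M. g w * \<psi> (X w))"
  proof (cases "q \<in> {r..u}")
   case True
   then have q: "0 < q" "r <= q" using r by auto
   have "(LINT w|M. g w * cE \<psi> w q) = (LINT w|M. g w * \<psi> (X w))"
    using q by (intro bayes_real(2) F_lift[OF q(2) G] i1) (auto simp: \<xi>_def intro: mild_integrable_post[OF m])
   then show ?thesis using True by (simp add: f_def)
  qed (simp add: f_def)
 qed
 also have "\<dots> = (u - r) * (LINT w|M. g w * \<psi> (X w))" using s by simp
 finally show ?g4 .
qed

text \<open>Increment of the innovation. It is only meaningful for \<open>s > 0\<close>: the drift need not be integrable at 0.\<close>

definition V :: "real => real => 'w => real" where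
 "V s t w = Y w t - Y w s - pint (pE \<rho>) s t w"

lemma V_meas_F: assumes "0 < s" "s <= t" shows "V s t \<in> borel_measurable (F t)"
 unfolding V_def[abs_def] using assms
 by (intro borel_measurable_diff pint_meas_F[OF pathfun_pE[OF mild_rho]] Y_meas_F) auto

lemma V_add:
 assumes "w \<in> space M" "0 < s" "s <= t" "t <= u" shows "V s t w + V t u w = V s u w"
 using pint_combine[OF pathfun_pE[OF mild_rho] assms] by (simp add: V_def)

lemma V_cont: assumes "w \<in> space M" "0 < s" shows "continuous_on {s..u} (\<lambda>t. V s t w)"
 unfolding V_def using pint_cont[OF pathfun_pE[OF mild_rho] assms]
 by (intro continuous_intros continuous_on_subset[OF Y_cont[OF assms(1)]]) (use assms in auto)

lemma V_self: "V s s w = 0"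
proof -
 have "AE r in lborel. indicator {s..s} r * cE \<rho> w r = 0"
  using AE_lborel_singleton[of s] by eventually_elim (simp add: indicator_def)
 then show ?thesis by (simp add: V_def pint_def integral_eq_zero_AE)
qed

text \<open>True drift minus estimated drift, accumulated over the interval. By \<open>V_eq\<close>
  the innovation is a Brownian increment of the larger filtration plus this error.\<close>

definition Rem :: "real => real => 'w => real" where
 "Rem s t w = \<rho> (X w) * (t - s) - pint (pE \<rho>) s t w"

lemma V_eq: "V s t w = (B w t - B w s) + Rem s t w"
 by (simp add: V_def Rem_def Y_def algebra_simps)

text \<open>Cauchy-Schwarz in time, then Jensen for the posterior mean of \<rho>.\<close>

lemma Rem_square_le:
 assumes dy: "w \<in> space M" and s: "0 < s" and h: "0 < h"
 shows "(Rem s (s + h) w)^2 <= h * (2 * h * (\<rho> (X w))^2 + 2 * pint (pE (\<lambda>x. (\<rho> x)^2)) s (s + h) w)"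
proof -
 let ?I = "indicator {s..s + h} :: real => real"
 have pf: "pathfun (pE \<rho>)" "pathfun (pE (\<lambda>x. (\<rho> x)^2))" by (rule pathfun_pE, rule mild_rho mild_rho2)+
 have c: "continuous_on {s..s + h} (\<lambda>r. \<rho> (X w) - cE \<rho> w r)"
  by (intro continuous_intros pathfun_cont[OF pf(1) dy s])
 have i3: "integrable lborel (\<lambda>r. ?I r * \<rho> (X w))" by (rule integral_indicator_Icc) (intro continuous_intros)
 have "(LINT r|lborel. ?I r * (\<rho> (X w) - cE \<rho> w r)) = (LINT r|lborel. ?I r * \<rho> (X w) - ?I r * cE \<rho> w r)"
  by (simp add: right_diff_distrib)
 also have "\<dots> = (LINT r|lborel. ?I r * \<rho> (X w)) - (LINT r|lborel. ?I r * cE \<rho> w r)"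
  by (rule Bochner_Integration.integral_diff[OF i3 pint_integral(1)[OF pf(1) dy s]])
 also have "\<dots> = Rem s (s + h) w" using h by (simp add: Rem_def pint_def)
 finally have R: "(LINT r|lborel. ?I r * (\<rho> (X w) - cE \<rho> w r)) = Rem s (s + h) w" .
 have "(Rem s (s + h) w)^2 <= h * (LINT r|lborel. ?I r * (\<rho> (X w) - cE \<rho> w r)^2)"
  using integral_Icc_square_le[OF c h] unfolding R .
 also have "(LINT r|lborel. ?I r * (\<rho> (X w) - cE \<rho> w r)^2)
  <= (LINT r|lborel. 2 * (?I r * (\<rho> (X w))^2) + 2 * (?I r * cE (\<lambda>x. (\<rho> x)^2) w r))"
 proof (rule integral_mono)
  show "integrable lborel (\<lambda>r. ?I r * (\<rho> (X w) - cE \<rho> w r)^2)"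
   by (rule integral_indicator_Icc) (intro continuous_intros pathfun_cont[OF pf(1) dy s])
  have "integrable lborel (\<lambda>r. ?I r * (\<rho> (X w))^2)" by (rule integral_indicator_Icc) (intro continuous_intros)
  then show "integrable lborel (\<lambda>r. 2 * (?I r * (\<rho> (X w))^2) + 2 * (?I r * cE (\<lambda>x. (\<rho> x)^2) w r))"
   using pint_integral(1)[OF pf(2) dy s] by auto
  fix r
  show "?I r * (\<rho> (X w) - cE \<rho> w r)^2 <= 2 * (?I r * (\<rho> (X w))^2) + 2 * (?I r * cE (\<lambda>x. (\<rho> x)^2) w r)"
  proof (cases "r \<in> {s..s + h}")
   case True
   then have r: "0 < r" using s by auto
   interpret p: prob_space "post r (Y w r)" using r by (intro prob_space_post) (simp add: adm_def)
   have "(cE \<rho> w r)^2 <= cE (\<lambda>x. (\<rho> x)^2) w r"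
    unfolding pE_def by (intro p.expectation_square_le mild_integrable_post r mild_rho mild_rho2)
   moreover have "(a - b)^2 <= 2 * a^2 + 2 * b^2" for a b :: real
    using zero_le_power2[of "a + b"] by (simp add: power2_eq_square algebra_simps)
   from this[of "\<rho> (X w)" "cE \<rho> w r"] calculation
   have "(\<rho> (X w) - cE \<rho> w r)^2 <= 2 * (\<rho> (X w))^2 + 2 * cE (\<lambda>x. (\<rho> x)^2) w r" by linarith
   then show ?thesis using True by simp
  qed simp
 qed
 also have "\<dots> = 2 * h * (\<rho> (X w))^2 + 2 * pint (pE (\<lambda>x. (\<rho> x)^2)) s (s + h) w"
 proof -
  have "integrable lborel (\<lambda>r. ?I r * (\<rho> (X w))^2)" by (rule integral_indicator_Icc) (intro continuous_intros)
  then show ?thesis using pint_integral(1)[OF pf(2) dy s] h by (simp add: pint_def)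
 qed
 finally show ?thesis using h by simp
qed

text \<open>Given \<open>F r\<close>, the true drift and its estimate have the same mean, so the
  error is centred; its second moment is of order h^2, against the variance h of the Brownian part.
  Both are stated on the cut, where \<rho>(X) is square integrable.\<close>

lemma Rem_cut:
 assumes s: "0 < s" "s <= r" and h: "0 < h" and G: "g \<in> borel_measurable (F r)" and gb: "\<And>w. \<bar>g w\<bar> <= indicator (cut s K) w"
 shows "integrable M (\<lambda>w. g w * Rem r (r + h) w)" (is ?g1) "(LINT w|M. g w * Rem r (r + h) w) = 0" (is ?g2)
  and "integrable M (\<lambda>w. indicator (cut s K) w * (Rem r (r + h) w)^2)" (is ?g3)
  and "(LINT w|M. indicator (cut s K) w * (Rem r (r + h) w)^2) <= h^2 * (4 * (LINT w|M. indicator (cut s K) w * (\<rho> (X w))^2))" (is ?g4)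
proof -
 have r: "0 < r" "r <= r + h" using s h by auto
 have gb': "\<bar>g w\<bar> <= 1 * indicator (cut s K) w" for w using gb[of w] by simp
 note fb = Fubini_bayes[OF s r(2) G gb' mild_rho]
 have eq: "g w * Rem r (r + h) w = h * (g w * \<rho> (X w)) - g w * pint (pE \<rho>) r (r + h) w" for w
  by (simp add: Rem_def algebra_simps)
 show ?g1 ?g2
  unfolding eq using fb by auto
 have cF: "indicator (cut s K) \<in> borel_measurable (F r)"
  using F_mono[of s r] cut_F[of s K] s by (intro borel_measurable_indicator) auto
 have cb: "\<bar>indicator (cut s K) w\<bar> <= 1 * (indicator (cut s K) w :: real)" for w by simp
 note fb2 = Fubini_bayes[OF s r(2) cF cb mild_rho2]
 let ?U = "\<lambda>w. h * (2 * h * (indicator (cut s K) w * (\<rho> (X w))^2) + 2 * (indicator (cut s K) w * pint (pE (\<lambda>x. (\<rho> x)^2)) r (r + h) w))"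
 have U: "integrable M ?U" using fb2 by (intro integrable_mult_right Bochner_Integration.integrable_add) auto
 have le: "indicator (cut s K) w * (Rem r (r + h) w)^2 <= ?U w" if "w \<in> space M" for w
  using Rem_square_le[OF that r(1) h] by (auto simp: indicator_def)
 have RM: "Rem r (r + h) \<in> borel_measurable M"
  unfolding Rem_def[abs_def]
  by (intro borel_measurable_diff from_F[OF _ pint_meas_F[OF pathfun_pE[OF mild_rho] r]]) (use r h in auto)
 have cM: "cut s K \<in> sets M" using cut_F[of s K] subalgebra_F[of s] s by (auto simp: subalgebra_def)
 show i: ?g3
  by (rule Bochner_Integration.integrable_bound[OF U]) (use RM cM le in \<open>auto intro!: AE_I2 intro: order_trans abs_ge_self\<close>)
 have "(LINT w|M. indicator (cut s K) w * (Rem r (r + h) w)^2) <= (LINT w|M. ?U w)"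
  by (rule integral_mono[OF i U]) (rule le)
 also have "\<dots> = h^2 * (4 * (LINT w|M. indicator (cut s K) w * (\<rho> (X w))^2))"
  using fb2 by (simp add: power2_eq_square algebra_simps)
 finally show ?g4 .
qed

end

section \<open>The law of the innovation increments\<close>

lemma (in prob_space) indep_var_of_subalgebra:
 assumes S: "subalgebra M S" and U: "U \<in> S \<rightarrow>\<^sub>M N" and V: "V \<in> M \<rightarrow>\<^sub>M K"
  and ind: "\<And>A D. A \<in> sets S ==> D \<in> sets K ==>
   prob {w\<in>space M. w \<in> A \<and> V w \<in> D} = prob A * prob {w\<in>space M. V w \<in> D}"
 shows "indep_var N U K V"
proof -
 have sp: "space S = space M" and sub: "sets S \<subseteq> events" using S by (auto simp: subalgebra_def)
 have UM: "U \<in> M \<rightarrow>\<^sub>M N" using measurable_from_subalg[OF S U] .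
 have gU: "sigma_sets (space M) {U -` A \<inter> space M |A. A \<in> sets N} \<subseteq> sets S"
  using sets.sigma_sets_subset[of "{U -` A \<inter> space M |A. A \<in> sets N}" S] measurable_sets[OF U] sp by auto
 have gV: "sigma_sets (space M) {V -` A \<inter> space M |A. A \<in> sets K} = {V -` A \<inter> space M |A. A \<in> sets K}"
  using sets_vimage_algebra[of "space M" V K] sets_vimage_algebra2[of V "space M" K] measurable_space[OF V] by auto
 have "indep_set (sigma_sets (space M) {U -` A \<inter> space M |A. A \<in> sets N}) (sigma_sets (space M) {V -` A \<inter> space M |A. A \<in> sets K})"
  unfolding gV
 proof (rule indep_setI)
  show "sigma_sets (space M) {U -` A \<inter> space M |A. A \<in> sets N} \<subseteq> events" using gU sub by blast
  show "{V -` A \<inter> space M |A. A \<in> sets K} \<subseteq> events" using measurable_sets[OF V] by auto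
  fix a b assume a: "a \<in> sigma_sets (space M) {U -` A \<inter> space M |A. A \<in> sets N}" and "b \<in> {V -` A \<inter> space M |A. A \<in> sets K}"
  then obtain D where D: "D \<in> sets K" "b = V -` D \<inter> space M" by auto
  have aS: "a \<in> sets S" using a gU by auto
  have "a \<inter> b = {w\<in>space M. w \<in> a \<and> V w \<in> D}" "b = {w\<in>space M. V w \<in> D}" using D by auto
  then show "prob (a \<inter> b) = prob a * prob b" using ind[OF aS D(1)] by simp
 qed
 then show ?thesis unfolding indep_var_eq using UM V by auto
qed

lemma gauss_moments:
 assumes "0 < h"
 shows "integrable (gauss h) (\<lambda>x. x)" (is ?g1) "(LINT x|gauss h. x) = 0" (is ?g2)
  "integrable (gauss h) (\<lambda>x. x^2)" (is ?g3) "(LINT x|gauss h. x^2) = h" (is ?g4)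
proof -
 have i1: "integrable std_normal_distribution (\<lambda>x. x)" using integrable_std_normal_distribution_moment[of 1] by simp
 have e1: "(LINT x|std_normal_distribution. x) = 0" using integral_std_normal_distribution_moment_odd[of 1] by simp
 have i2: "integrable std_normal_distribution (\<lambda>x. x^2)" by (rule integrable_std_normal_distribution_moment)
 have e2: "(LINT x|std_normal_distribution. x^2) = 1" using std_normal_distribution_even_moments(1)[of 1] by simp
 let ?f = "\<lambda>x::real. sqrt h * x"
 have m: "?f \<in> borel_measurable std_normal_distribution" by measurable
 show ?g1
  unfolding gauss_eq_distr[OF assms] by (subst integrable_distr_eq[OF m]) (simp, rule integrable_mult_right[OF i1])
 show ?g2
  unfolding gauss_eq_distr[OF assms] by (subst integral_distr[OF m]) (simp, simp only: integral_mult_right_zero e1 mult_zero_right)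
 show ?g3
  unfolding gauss_eq_distr[OF assms] by (subst integrable_distr_eq[OF m]) (simp, simp only: power_mult_distrib, rule integrable_mult_right[OF i2])
 show ?g4
  unfolding gauss_eq_distr[OF assms] by (subst integral_distr[OF m]) (simp, simp only: power_mult_distrib integral_mult_right_zero e2, use assms in simp)
qed

context bm_pair
begin

lemma increment_meas: "0 <= s ==> s < t ==> (\<lambda>w. B w t - B w s) \<in> borel_measurable M"
 using B_meas[of s] B_meas[of t] by simp

lemma increment_indep_var:
 assumes s: "0 <= s" "s < t" and U: "U \<in> G s \<rightarrow>\<^sub>M N" and f: "f \<in> borel \<rightarrow>\<^sub>M K"
 shows "indep_var N U K (\<lambda>w. f (B w t - B w s))"
proof (rule indep_var_of_subalgebra[OF subalgebra_G U measurable_compose[OF increment_meas[OF s] f]])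
 fix A D assume A: "A \<in> sets (G s)" and D: "D \<in> sets K"
 have sp: "space M \<in> sets (G s)" using sets.top[of "G s"] by simp
 have D': "f -` D \<in> sets borel" using measurable_sets[OF f D] by simp
 show "prob {w\<in>space M. w \<in> A \<and> f (B w t - B w s) \<in> D} = prob A * prob {w\<in>space M. f (B w t - B w s) \<in> D}"
  using indep_increment[OF s A D'] indep_increment[OF s sp D'] by (simp add: prob_space)
qed

lemma increment_moments:
 assumes s: "0 <= s" "s < t"
 shows "integrable M (\<lambda>w. B w t - B w s)" (is ?g1) "(LINT w|M. B w t - B w s) = 0" (is ?g2)
  "integrable M (\<lambda>w. (B w t - B w s)^2)" "(LINT w|M. (B w t - B w s)^2) = t - s"
  "(LINT w|M. iexp (l * (B w t - B w s))) = complex_of_real (exp (- (l^2 * (t - s) / 2)))" (is ?g3)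
proof -
 note [measurable] = increment_meas[OF s]
 have h: "0 < t - s" using s by simp
 note g = gauss_moments[OF h, folded increment_distr[OF s]]
 show ?g1 ?g2
  "integrable M (\<lambda>w. (B w t - B w s)^2)" "(LINT w|M. (B w t - B w s)^2) = t - s"
  using g by (simp_all add: integrable_distr_eq integral_distr)
 have "(LINT w|M. iexp (l * (B w t - B w s))) = char (distr M borel (\<lambda>w. B w t - B w s)) l"
  unfolding char_def by (subst integral_distr) auto
 then show ?g3
  unfolding increment_distr[OF s] char_gauss[OF h] .
qed

end

lemma iexp_second_order: "cmod (iexp x - 1 - \<i> * x) <= x^2 / 2"
 using iexp_approx1[of x 1] by (simp add: power2_eq_square algebra_simps)

lemma iexp_first_order: "cmod (iexp x - 1) <= \<bar>x\<bar>"
 using iexp_approx1[of x 0] by simp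

context bm_filter
begin

lemma F_G_meas: "0 <= s ==> f \<in> F s \<rightarrow>\<^sub>M N ==> f \<in> G s \<rightarrow>\<^sub>M N"
 using measurable_from_subalg[OF subalgebra_G_F] .

lemma F_events: "0 <= s ==> A \<in> sets (F s) ==> A \<in> events"
 using subalgebra_F[of s] by (auto simp: subalgebra_def)

text \<open>Write V = D + R with D the Brownian increment and R the drift error, and expand in R
  only. D is independent of \<open>\<eta>\<close> and contributes the Gaussian factor exactly, the
  term linear in R has mean 0, and the rest is bounded by R^2 and |D| |R|.\<close>

lemma char_step:
 fixes \<eta> :: "'w => complex"
 assumes s: "0 < s" "s <= r" and h: "0 < h" "h <= 1" and \<eta>: "\<eta> \<in> borel_measurable (F r)"
  and b: "\<And>w. norm (\<eta> w) <= indicator (cut s K) w"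
 shows "norm ((LINT w|M. \<eta> w * iexp (l * V r (r + h) w)) - complex_of_real (exp (- (l^2 * h / 2))) * (LINT w|M. \<eta> w))
  <= l^2 * (1 / 2 + 4 * (LINT w|M. indicator (cut s K) w * (\<rho> (X w))^2)) * (h * sqrt h)"
proof -
 define c where "c = (LINT w|M. indicator (cut s K) w * (\<rho> (X w))^2)"
 have c0: "0 <= c" unfolding c_def by (rule Bochner_Integration.integral_nonneg) simp
 have r: "0 < r" "0 <= r" "r < r + h" "r <= r + h" using s h by auto
 define D where "D w = B w (r + h) - B w r" for w
 define R where "R = Rem r (r + h)"
 have VD: "V r (r + h) w = D w + R w" for w by (simp add: V_eq D_def R_def)
 have [measurable]: "\<eta> \<in> borel_measurable M" using from_F[OF r(2)] \<eta> measurable_from_subalg[OF subalgebra_F[OF r(2)] \<eta>] by simp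
 have [measurable]: "D \<in> borel_measurable M" unfolding D_def using increment_meas[OF r(2,3)] .
 have Vm[measurable]: "V r (r + h) \<in> borel_measurable M" using V_meas_F[OF r(1,4)] r by (intro from_F[of "r + h"]) auto
 have [measurable]: "R \<in> borel_measurable M"
 proof -
  have "R = (\<lambda>w. V r (r + h) w - D w)" by (simp add: VD fun_eq_iff)
  then show ?thesis by simp
 qed
 have cM[measurable]: "cut s K \<in> events" using cut_F[of s K] s by (intro F_events[of s]) auto
 have re: "(\<lambda>w. Re (\<eta> w)) \<in> borel_measurable (F r)" "(\<lambda>w. Im (\<eta> w)) \<in> borel_measurable (F r)" using \<eta> by measurable
 have rb: "\<bar>Re (\<eta> w)\<bar> <= indicator (cut s K) w" "\<bar>Im (\<eta> w)\<bar> <= indicator (cut s K) w" for w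
  using b[of w] abs_Re_le_cmod[of "\<eta> w"] abs_Im_le_cmod[of "\<eta> w"] by linarith+
 note R1 = Rem_cut[OF s h(1) re(1) rb(1), folded R_def] and R2 = Rem_cut[OF s h(1) re(2) rb(2), folded R_def]
 have \<eta>R: "\<eta> w * complex_of_real (R w) = complex_of_real (Re (\<eta> w) * R w) + \<i> * complex_of_real (Im (\<eta> w) * R w)" for w
  by (simp add: complex_eq_iff)
 have iR: "integrable M (\<lambda>w. \<eta> w * complex_of_real (R w))"
  unfolding \<eta>R using R1(1) R2(1)
  by (intro Bochner_Integration.integrable_add integrable_mult_right integrable_of_real)
 have ER: "(LINT w|M. \<eta> w * complex_of_real (R w)) = 0"
  unfolding \<eta>R using R1(1,2) R2(1,2)
  by (subst Bochner_Integration.integral_add) (auto simp: integral_complex_of_real simp del: of_real_mult)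
 have i\<eta>: "integrable M \<eta>" using b by (intro integrable_const_bound[where B=1]) (auto intro!: AE_I2 order_trans[OF b] simp: indicator_def)
 have b1: "norm (\<eta> w) <= 1" for w by (rule order_trans[OF b]) (simp add: indicator_def)
 have iV: "integrable M (\<lambda>w. \<eta> w * iexp (l * V r (r + h) w))"
  by (rule integrable_const_bound[where B=1]) (auto simp: norm_mult b1)
 have iD: "integrable M (\<lambda>w. \<eta> w * iexp (l * D w))"
  by (rule integrable_const_bound[where B=1]) (auto simp: norm_mult b1)
 have ED: "(LINT w|M. \<eta> w * iexp (l * D w)) = (LINT w|M. \<eta> w) * complex_of_real (exp (- (l^2 * h / 2)))"
 proof -
  have "indep_var borel \<eta> borel (\<lambda>w. iexp (l * D w))"
   unfolding D_def by (rule increment_indep_var[OF r(2,3) F_G_meas[OF r(2) \<eta>], where f="\<lambda>x. iexp (l * x)"]) measurable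
  from indep_var_lebesgue_integral[OF this i\<eta> integrable_const_bound[where B=1]]
  have "(LINT w|M. \<eta> w * iexp (l * D w)) = (LINT w|M. \<eta> w) * (LINT w|M. iexp (l * D w))"
   by auto
  then show ?thesis using increment_moments(5)[OF r(2,3), of l] by (simp add: D_def)
 qed
 define T where "T w = \<eta> w * iexp (l * V r (r + h) w) - \<eta> w * iexp (l * D w) - \<i> * l * (\<eta> w * complex_of_real (R w))" for w
 have ET: "(LINT w|M. T w) = (LINT w|M. \<eta> w * iexp (l * V r (r + h) w)) - complex_of_real (exp (- (l^2 * h / 2))) * (LINT w|M. \<eta> w)"
 proof -
  have "(LINT w|M. T w) = (LINT w|M. \<eta> w * iexp (l * V r (r + h) w)) - (LINT w|M. \<eta> w * iexp (l * D w))
    - \<i> * l * (LINT w|M. \<eta> w * complex_of_real (R w))"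
   unfolding T_def
   using Bochner_Integration.integral_diff[OF Bochner_Integration.integrable_diff[OF iV iD] integrable_mult_right[OF iR, of "\<i> * l"]]
    Bochner_Integration.integral_diff[OF iV iD] by (simp only: integral_mult_right_zero)
  then show ?thesis unfolding ED ER by (simp only: mult_zero_right diff_zero mult.commute[of "expectation \<eta>"])
 qed
 \<comment> \<open>The product |D| |R| is split with the weight sqrt h: since E D^2 = h and E R^2 =
   O(h^2) on the cut, both halves are of order h^(3/2).\<close>
 define Q where "Q w = l^2 * (1 / 2 * (indicator (cut s K) w * (R w)^2)
   + 1 / 2 * (sqrt h * (D w)^2 + indicator (cut s K) w * (R w)^2 / sqrt h))" for w
 have T_le: "norm (T w) <= Q w" for w
 proof (cases "w \<in> cut s K")
  case True
  define a where "a = l * D w"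
  define e where "e = l * R w"
  have "T w = \<eta> w * (iexp a * (iexp e - 1 - \<i> * e) + (iexp a - 1) * (\<i> * e))"
   unfolding T_def VD a_def e_def by (simp add: algebra_simps exp_add)
  then have "norm (T w) = norm (\<eta> w) * norm (iexp a * (iexp e - 1 - \<i> * e) + (iexp a - 1) * (\<i> * e))" by (simp only: norm_mult)
  also have "\<dots> <= 1 * norm (iexp a * (iexp e - 1 - \<i> * e) + (iexp a - 1) * (\<i> * e))"
   by (intro mult_right_mono b1) simp
  also have "\<dots> <= norm (iexp a * (iexp e - 1 - \<i> * e)) + norm ((iexp a - 1) * (\<i> * e))"
   using norm_triangle_ineq by simp
  also have "\<dots> = norm (iexp e - 1 - \<i> * e) + norm (iexp a - 1) * \<bar>e\<bar>" by (simp add: norm_mult)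
  also have "\<dots> <= e^2 / 2 + \<bar>a\<bar> * \<bar>e\<bar>"
   by (intro add_mono mult_right_mono iexp_second_order iexp_first_order) simp
  also have "\<dots> = l^2 * (1 / 2 * (R w)^2 + \<bar>D w\<bar> * \<bar>R w\<bar>)"
   by (simp add: a_def e_def abs_mult power_mult_distrib algebra_simps power2_eq_square)
  also have "\<dots> <= l^2 * (1 / 2 * (R w)^2 + 1 / 2 * (sqrt h * (D w)^2 + (R w)^2 / sqrt h))"
  proof -
   define q where "q = sqrt h"
   have q: "0 < q" using h by (simp add: q_def)
   have "0 <= (q * \<bar>D w\<bar> - \<bar>R w\<bar>)^2 / q" using q by simp
   also have "\<dots> = q * (D w)^2 + (R w)^2 / q - 2 * (\<bar>D w\<bar> * \<bar>R w\<bar>)"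
    using q by (simp add: power2_diff power_mult_distrib field_simps) (simp add: power2_eq_square)
   finally have "\<bar>D w\<bar> * \<bar>R w\<bar> <= 1 / 2 * (q * (D w)^2 + (R w)^2 / q)" by simp
   then show ?thesis unfolding q_def by (intro mult_left_mono add_left_mono) auto
  qed
  also have "\<dots> = Q w" using True by (simp add: Q_def)
  finally show ?thesis .
 next
  case False
  then have "\<eta> w = 0" using b[of w] by simp
  then show ?thesis using False h by (simp add: T_def Q_def)
 qed
 have iQ: "integrable M Q" unfolding Q_def
  using R1(3) increment_moments(3)[OF r(2,3)] by (auto simp: D_def)
 have iT: "integrable M T" unfolding T_def using iV iD iR by auto
 have "norm (LINT w|M. T w) <= (LINT w|M. Q w)"
  by (rule order_trans[OF integral_norm_bound], rule integral_mono) (use iT iQ T_le in auto)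
 also have "\<dots> = l^2 * (1 / 2 * (LINT w|M. indicator (cut s K) w * (R w)^2)
   + 1 / 2 * (sqrt h * h + (LINT w|M. indicator (cut s K) w * (R w)^2) / sqrt h))"
  unfolding Q_def using R1(3) increment_moments(3,4)[OF r(2,3)] by (simp add: D_def)
 also have "\<dots> <= l^2 * (1 / 2 * (h^2 * (4 * c)) + 1 / 2 * (sqrt h * h + (h^2 * (4 * c)) / sqrt h))"
  using R1(4) h by (intro mult_left_mono add_mono divide_right_mono order_refl) (auto simp: c_def)
 also have "\<dots> <= l^2 * ((1 / 2 + 4 * c) * (h * sqrt h))"
 proof (rule mult_left_mono)
  define q where "q = sqrt h"
  have q: "0 < q" "q^2 = h" "q <= 1" using h by (auto simp: q_def)
  have "h^2 = (h * q) * q" using q(2) by (simp add: power2_eq_square mult.assoc)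
  also have "\<dots> <= (h * q) * 1" using q h by (intro mult_left_mono) auto
  finally have h2: "h^2 <= h * q" by simp
  have hq: "h^2 / q = h * q" using q by (simp add: field_simps power2_eq_square)
  have "1 / 2 * (h^2 * (4 * c)) + 1 / 2 * (q * h + (h^2 * (4 * c)) / q) = 2 * c * h^2 + 1 / 2 * (h * q) + 2 * c * (h^2 / q)"
   by (simp add: field_simps)
  also have "\<dots> <= 2 * c * (h * q) + 1 / 2 * (h * q) + 2 * c * (h * q)"
   unfolding hq using h2 c0 h q by (intro add_mono mult_left_mono) auto
  also have "\<dots> = (1 / 2 + 4 * c) * (h * q)" by (simp add: algebra_simps)
  finally show "1 / 2 * (h^2 * (4 * c)) + 1 / 2 * (sqrt h * h + (h^2 * (4 * c)) / sqrt h) <= (1 / 2 + 4 * c) * (h * sqrt h)"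
   by (simp only: q_def)
 qed simp
 finally show ?thesis unfolding ET by (simp add: c_def mult.assoc)
qed

text \<open>Divided by the expected Gaussian factor, the characteristic function of the innovation
  up to a running end time has increments of order 3/2 by \<open>char_step\<close>, hence it is
  constant.\<close>

lemma V_char_cut:
 assumes s: "0 < s" "s <= t" and A: "A \<in> sets (F s)" and AK: "A \<subseteq> cut s K"
 shows "(LINT w|M. indicator A w * iexp (l * V s t w)) = complex_of_real (exp (- (l^2 * (t - s) / 2))) * prob A"
proof -
 define c where "c = l^2 * (1 / 2 + 4 * (LINT w|M. indicator (cut s K) w * (\<rho> (X w))^2))"
 have c0: "0 <= c" unfolding c_def by (intro mult_nonneg_nonneg add_nonneg_nonneg Bochner_Integration.integral_nonneg) auto
 define m where "m r = (LINT w|M. indicator A w * iexp (l * V s r w))" for r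
 define f where "f r = complex_of_real (exp (l^2 * (r - s) / 2)) * m r" for r
 have AM: "A \<in> events" using A s by (intro F_events[of s]) auto
 have "f t = f s"
 proof (rule constant_of_superlinear_increments)
  fix x y assume xy: "s <= x" "x <= y" "y <= t" "y - x <= 1"
  show "norm (f y - f x) <= (exp (l^2 * (t - s) / 2) * c) * ((y - x) * sqrt (y - x))"
  proof (cases "x = y")
   case False
   define h where "h = y - x"
   have h: "0 < h" "h <= 1" "y = x + h" using xy False by (auto simp: h_def)
   define \<eta> where "\<eta> w = indicator A w * iexp (l * V s x w)" for w
   have x0: "0 <= x" using s xy by simp
   have [measurable]: "A \<in> sets (F x)" using A F_mono[OF xy(1)] by auto
   have [measurable]: "V s x \<in> borel_measurable (F x)" by (rule V_meas_F[OF s(1) xy(1)])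
   have \<eta>: "\<eta> \<in> borel_measurable (F x)" unfolding \<eta>_def by measurable
   have b: "norm (\<eta> w) <= indicator (cut s K) w" for w
    using AK by (auto simp: \<eta>_def norm_mult indicator_def)
   have my: "m y = (LINT w|M. \<eta> w * iexp (l * V x (x + h) w))"
    unfolding m_def \<eta>_def
   proof (rule Bochner_Integration.integral_cong[OF refl])
    fix w assume "w \<in> space M"
    have "V s y w = V s x w + V x (x + h) w" using V_add[OF \<open>w \<in> space M\<close> s(1) xy(1), of y] xy h by simp
    then show "indicator A w * iexp (l * V s y w) = indicator A w * iexp (l * V s x w) * iexp (l * V x (x + h) w)"
     by (simp add: distrib_left exp_add mult.assoc)
   qed
   have mx: "m x = (LINT w|M. \<eta> w)" by (simp add: m_def \<eta>_def)
   have "f y - f x = complex_of_real (exp (l^2 * (y - s) / 2)) * (m y - complex_of_real (exp (- (l^2 * h / 2))) * m x)"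
   proof -
    have "l^2 * (x - s) / 2 = l^2 * (y - s) / 2 + - (l^2 * h / 2)" by (simp add: h field_simps)
    then have "exp (l^2 * (x - s) / 2) = exp (l^2 * (y - s) / 2) * exp (- (l^2 * h / 2))" by (simp only: exp_add)
    then show ?thesis by (simp only: f_def of_real_mult right_diff_distrib mult.assoc)
   qed
   then have "norm (f y - f x) = exp (l^2 * (y - s) / 2) * norm (m y - complex_of_real (exp (- (l^2 * h / 2))) * m x)"
    by (simp add: norm_mult)
   also have "\<dots> <= exp (l^2 * (t - s) / 2) * (c * (h * sqrt h))"
    unfolding my mx using char_step[OF s(1) xy(1) h(1,2) \<eta> b, of l] xy
    by (intro mult_mono) (auto simp: c_def mult_left_mono)
   finally show ?thesis by (simp add: h_def mult.assoc)
  qed simp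
 qed (use s in simp)
 then have ft: "complex_of_real (exp (l^2 * (t - s) / 2)) * m t = m s" by (simp add: f_def)
 have ms: "m s = prob A"
 proof -
  have "m s = (LINT w|M. complex_of_real (indicator A w))"
   unfolding m_def by (intro Bochner_Integration.integral_cong) (auto simp: V_self indicator_def)
  also have "\<dots> = prob (A \<inter> space M)" unfolding integral_complex_of_real by simp
  also have "A \<inter> space M = A" using AM sets.sets_into_space by blast
  finally show ?thesis .
 qed
 have "m t = complex_of_real (exp (- (l^2 * (t - s) / 2))) * (complex_of_real (exp (l^2 * (t - s) / 2)) * m t)"
  by (simp add: mult.assoc[symmetric] of_real_mult[symmetric] exp_add[symmetric] del: of_real_mult)
 then show ?thesis unfolding ft ms by (simp add: m_def)
qed

text \<open>The cuts exhaust the space, and both sides are continuous along the increasing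
  events.\<close>

lemma V_char:
 assumes s: "0 < s" "s <= t" and A: "A \<in> sets (F s)"
 shows "(LINT w|M. indicator A w * iexp (l * V s t w)) = complex_of_real (exp (- (l^2 * (t - s) / 2))) * prob A"
proof -
 define An where "An n = A \<inter> cut s (real n)" for n
 have AnF: "An n \<in> sets (F s)" for n unfolding An_def using A cut_F[of s "real n"] s by auto
 have AnM[measurable]: "An n \<in> events" "A \<in> events" for n using AnF A s by (auto intro: F_events[of s])
 have [measurable]: "V s t \<in> borel_measurable M" using V_meas_F[OF s] s by (intro from_F[of t]) auto
 have U: "(\<Union>n. An n) = A"
  using sets.sets_into_space[OF AnM(2)] real_arch_simple by (fastforce simp: An_def cut_def)
 have inc: "incseq An" unfolding An_def cut_def incseq_def by auto
 have "(\<lambda>n. prob (An n)) \<longlonglongrightarrow> prob A"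
  using finite_Lim_measure_incseq[OF _ inc] AnM U by (simp add: image_subset_iff)
 then have l2: "(\<lambda>n. complex_of_real (exp (- (l^2 * (t - s) / 2))) * prob (An n)) \<longlonglongrightarrow> complex_of_real (exp (- (l^2 * (t - s) / 2))) * prob A"
  by (intro tendsto_intros)
 have l1: "(\<lambda>n. \<integral>w. indicator (An n) w * iexp (l * V s t w) \<partial>M) \<longlonglongrightarrow> (LINT w|M. indicator A w * iexp (l * V s t w))"
 proof (rule integral_dominated_convergence[where w="\<lambda>_. 1"])
  have "(\<lambda>n. indicator (An n) w :: complex) \<longlonglongrightarrow> indicator A w" for w
   using LIMSEQ_indicator_incseq[OF inc, of w] unfolding U .
  then show "AE w in M. (\<lambda>n. indicator (An n) w * iexp (l * V s t w)) \<longlonglongrightarrow> indicator A w * iexp (l * V s t w)"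
   by (intro AE_I2 tendsto_mult tendsto_const)
 qed (auto simp: norm_mult indicator_def)
 have "(LINT w|M. indicator (An n) w * iexp (l * V s t w)) = complex_of_real (exp (- (l^2 * (t - s) / 2))) * prob (An n)" for n
  by (rule V_char_cut[OF s AnF]) (auto simp: An_def)
 with l1 have "(\<lambda>n. complex_of_real (exp (- (l^2 * (t - s) / 2))) * prob (An n)) \<longlonglongrightarrow> (LINT w|M. indicator A w * iexp (l * V s t w))" by simp
 from LIMSEQ_unique[OF this l2] show ?thesis .
qed

lemma V_gauss:
 assumes s: "0 < s" "s < t"
 shows "A \<in> sets (F s) ==> D \<in> sets borel ==> prob {w\<in>space M. w \<in> A \<and> V s t w \<in> D} = prob A * measure (gauss (t - s)) D"
  and "distr M borel (V s t) = gauss (t - s)" (is ?g1)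
proof -
 have sp: "space M \<in> sets (F s)" using sets.top[of "F s"] by simp
 have st: "s <= t" using s by simp
 have Vm: "V s t \<in> borel_measurable M" using V_meas_F[OF s(1) st] s by (intro from_F[of t]) auto
 have c1: "(LINT w|M. iexp (l * V s t w)) = complex_of_real (exp (- (l^2 * (t - s) / 2)))" for l
 proof -
  have "(LINT w|M. iexp (l * V s t w)) = (LINT w|M. indicator (space M) w * iexp (l * V s t w))"
   by (intro Bochner_Integration.integral_cong) auto
  then show ?thesis unfolding V_char[OF s(1) st sp] by (simp add: prob_space)
 qed
 have c2: "(LINT w|M. iexp (l * V s t w) * indicator A w) = complex_of_real (exp (- (l^2 * (t - s) / 2))) * prob A" if "A \<in> sets (F s)" for A l
  using V_char[OF s(1) st that, of l] by (simp only: mult.commute)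
 have ev: "A \<in> events" if "A \<in> sets (F s)" for A using F_events[OF _ that] s by simp
 have h: "0 < t - s" using s by simp
 show "prob {w\<in>space M. w \<in> A \<and> V s t w \<in> D} = prob A * measure (gauss (t - s)) D" if "A \<in> sets (F s)" "D \<in> sets borel"
  by (rule indep_gauss_of_char(1)[OF Vm ev[OF that(1)] that(2) h c1 c2[OF that(1)]])
 show ?g1
  by (rule indep_gauss_of_char(2)[OF Vm ev[OF sp] sets.top[of borel] h c1 c2[OF sp]])
qed

lemma V_moments:
 assumes s: "0 < s" "s < t"
 shows "integrable M (V s t)" "(LINT w|M. V s t w) = 0" (is ?g1)
  "integrable M (\<lambda>w. (V s t w)^2)" "(LINT w|M. (V s t w)^2) = t - s"
proof -
 have [measurable]: "V s t \<in> borel_measurable M" using V_meas_F[of s t] s by (intro from_F[of t]) auto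
 have h: "0 < t - s" using s by simp
 note g = gauss_moments[OF h, folded V_gauss(2)[OF s]]
 show "integrable M (V s t)" ?g1
  "integrable M (\<lambda>w. (V s t w)^2)" "(LINT w|M. (V s t w)^2) = t - s"
  using g by (simp_all add: integrable_distr_eq integral_distr)
qed

lemma V_indep_var:
 assumes s: "0 < s" "s < t" and U: "U \<in> F s \<rightarrow>\<^sub>M N"
 shows "indep_var N U borel (V s t)"
proof (rule indep_var_of_subalgebra[OF subalgebra_F U])
 show "V s t \<in> borel_measurable M" using V_meas_F[of s t] s by (intro from_F[of t]) auto
 fix A D assume A: "A \<in> sets (F s)" and D: "D \<in> sets (borel :: real measure)"
 have sp: "space M \<in> sets (F s)" using sets.top[of "F s"] by simp
 show "prob {w\<in>space M. w \<in> A \<and> V s t w \<in> D} = prob A * prob {w\<in>space M. V s t w \<in> D}"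
  using V_gauss(1)[OF s A D] V_gauss(1)[OF s sp D] by (simp add: prob_space)
qed (use s in simp)

lemma V_orthogonal:
 assumes s: "0 < s" "s < t" and g: "g \<in> borel_measurable (F s)" and i: "integrable M g"
 shows "integrable M (\<lambda>w. g w * V s t w)" (is ?g1) "(LINT w|M. g w * V s t w) = 0" (is ?g2)
  and "integrable M (\<lambda>w. g w * (V s t w)^2)" (is ?g3) "(LINT w|M. g w * (V s t w)^2) = (t - s) * (LINT w|M. g w)" (is ?g4)
proof -
 note iv = V_indep_var[OF s g]
 show ?g1 by (rule indep_var_integrable[OF iv i V_moments(1)[OF s]])
 show ?g2
  using indep_var_lebesgue_integral[OF iv i V_moments(1)[OF s]] V_moments(2)[OF s] by simp
 have "indep_var borel ((\<lambda>z. z) \<circ> g) borel ((\<lambda>x. x^2) \<circ> V s t)" by (rule indep_var_compose[OF iv]) measurable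
 then have iv2: "indep_var borel g borel (\<lambda>w. (V s t w)^2)" by (simp add: comp_def)
 show ?g3 by (rule indep_var_integrable[OF iv2 i V_moments(3)[OF s]])
 show ?g4
  using indep_var_lebesgue_integral[OF iv2 i V_moments(3)[OF s]] V_moments(4)[OF s] by simp
qed

end

section \<open>Second-order expansion of the Bayes update, and the isometry for bounded
  \<rho>\<close>

lemma integral_of_local_increments:
 fixes q \<kappa> :: "real => real"
 assumes \<kappa>: "continuous_on {a..b} \<kappa>" and ab: "a <= b"
  and loc: "\<And>x h. a <= x ==> 0 < h ==> h <= 1 ==> x + h <= b ==> \<bar>q (x + h) - q x - h * \<kappa> x\<bar> <= K * (h * sqrt h)"
 shows "integral {a..b} \<kappa> = q b - q a"
proof -
 have "(\<kappa> has_integral (q b - q a)) {a..b}"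
 proof (rule fundamental_theorem_of_calculus[OF ab])
  fix x assume x: "x \<in> {a..b}"
  have e: "\<bar>(q y - q x - (y - x) * \<kappa> x) / \<bar>y - x\<bar>\<bar> <= \<bar>K\<bar> * sqrt \<bar>y - x\<bar> + \<bar>\<kappa> y - \<kappa> x\<bar>"
   if y: "y \<in> {a..b}" "y \<noteq> x" "\<bar>y - x\<bar> < 1" for y
  proof -
   define h where "h = \<bar>y - x\<bar>"
   have h: "0 < h" "h <= 1" using y by (auto simp: h_def)
   have KK: "K * (h * sqrt h) <= \<bar>K\<bar> * (h * sqrt h)" using h by (intro mult_right_mono) auto
   have "\<bar>q y - q x - (y - x) * \<kappa> x\<bar> <= \<bar>K\<bar> * (h * sqrt h) + h * \<bar>\<kappa> y - \<kappa> x\<bar>"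
   \<comment> \<open>The assumed expansion looks forward from the left endpoint. For y < x it is
     used at \<open>y\<close>, and the continuity of \<open>\<kappa>\<close> pays for replacing
     \<open>\<kappa> y\<close> by \<open>\<kappa> x\<close>.\<close>
   proof (cases "x < y")
    case True
    then have "y = x + h" by (simp add: h_def)
    then have "\<bar>q y - q x - (y - x) * \<kappa> x\<bar> <= K * (h * sqrt h)" using loc[of x h] x y h by simp
    moreover have "0 <= h * \<bar>\<kappa> y - \<kappa> x\<bar>" using h by simp
    ultimately show ?thesis using KK by linarith
   next
    case False
    then have xy: "x = y + h" using y by (simp add: h_def)
    then have l: "\<bar>q x - q y - h * \<kappa> y\<bar> <= K * (h * sqrt h)" using loc[of y h] x y h by simp
    have "q y - q x - (y - x) * \<kappa> x = - (q x - q y - h * \<kappa> y) - h * (\<kappa> y - \<kappa> x)" using xy by (simp add: algebra_simps)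
    then have "\<bar>q y - q x - (y - x) * \<kappa> x\<bar> <= \<bar>q x - q y - h * \<kappa> y\<bar> + \<bar>h * (\<kappa> y - \<kappa> x)\<bar>" by linarith
    also have "\<bar>h * (\<kappa> y - \<kappa> x)\<bar> = h * \<bar>\<kappa> y - \<kappa> x\<bar>" using h by (simp add: abs_mult)
    finally show ?thesis using l KK by linarith
   qed
   then have "\<bar>q y - q x - (y - x) * \<kappa> x\<bar> / h <= (\<bar>K\<bar> * (h * sqrt h) + h * \<bar>\<kappa> y - \<kappa> x\<bar>) / h"
    using h by (intro divide_right_mono) auto
   also have "\<dots> = \<bar>K\<bar> * sqrt h + \<bar>\<kappa> y - \<kappa> x\<bar>" using h by (simp add: field_simps)
   finally show ?thesis by (simp add: h_def abs_divide)
  qed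
  have "((\<lambda>y. (q y - q x - (y - x) * \<kappa> x) / \<bar>y - x\<bar>) \<longlongrightarrow> 0) (at x within {a..b})"
  proof (rule Lim_null_comparison)
   have "\<forall>\<^sub>F y in at x within {a..b}. \<bar>y - x\<bar> < 1"
    using eventually_at_ball'[of 1 x "{a..b}"] by (auto simp: dist_real_def abs_minus_commute elim: eventually_mono)
   moreover have "\<forall>\<^sub>F y in at x within {a..b}. y \<in> {a..b} \<and> y \<noteq> x" by (simp add: eventually_at_filter)
   ultimately show "\<forall>\<^sub>F y in at x within {a..b}. norm ((q y - q x - (y - x) * \<kappa> x) / \<bar>y - x\<bar>) <= \<bar>K\<bar> * sqrt \<bar>y - x\<bar> + \<bar>\<kappa> y - \<kappa> x\<bar>"
    by eventually_elim (use e in auto)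
   have "(\<kappa> \<longlongrightarrow> \<kappa> x) (at x within {a..b})" using \<kappa> x by (auto simp: continuous_on_def)
   then have "((\<lambda>y. \<bar>K\<bar> * sqrt \<bar>y - x\<bar> + \<bar>\<kappa> y - \<kappa> x\<bar>) \<longlongrightarrow> \<bar>K\<bar> * sqrt \<bar>x - x\<bar> + \<bar>\<kappa> x - \<kappa> x\<bar>) (at x within {a..b})"
    by (intro tendsto_intros)
   then show "((\<lambda>y. \<bar>K\<bar> * sqrt \<bar>y - x\<bar> + \<bar>\<kappa> y - \<kappa> x\<bar>) \<longlongrightarrow> 0) (at x within {a..b})" by simp
  qed
  then show "(q has_vector_derivative \<kappa> x) (at x within {a..b})"
   by (simp add: has_vector_derivative_def has_derivative_within bounded_linear_mult_left divide_inverse mult.commute diff_diff_eq)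
 qed
 then show ?thesis by (rule integral_unique)
qed

lemma gauss_tw:
 assumes "0 < h" shows "integrable (gauss h) (\<lambda>dy. tw r h dy)" (is ?g1) "(LINT dy|gauss h. tw r h dy) = 1" (is ?g2)
  "(\<integral>\<^sup>+dy. ennreal (tw r h dy) \<partial>gauss h) = 1" (is ?g3)
proof -
 interpret g: prob_space "gauss h" by (rule prob_space_gauss[OF assms])
 show nn: ?g3
  using gauss_shift[OF assms, of "\<lambda>_. 1" r] g.emeasure_space_1 by simp
 have "has_bochner_integral (gauss h) (\<lambda>dy. tw r h dy) 1"
  by (rule has_bochner_integral_nn_integral) (auto simp: nn)
 then show ?g1 ?g2
  by (auto simp: has_bochner_integral_iff)
qed

lemma gauss_exp_abs:
 assumes "0 < h" "0 <= k" shows "integrable (gauss h) (\<lambda>dy. exp (k * \<bar>dy\<bar>))"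
proof (rule Bochner_Integration.integrable_bound)
 show "integrable (gauss h) (\<lambda>dy. exp (k^2 * h / 2) * (tw k h dy + tw (- k) h dy))"
  using gauss_tw(1)[OF assms(1)] by auto
 show "AE dy in gauss h. norm (exp (k * \<bar>dy\<bar>)) <= norm (exp (k^2 * h / 2) * (tw k h dy + tw (- k) h dy))"
 proof (rule AE_I2)
  fix dy
  have "exp (k^2 * h / 2) * (tw k h dy + tw (- k) h dy) = exp (k * dy) + exp (- (k * dy))"
   by (simp add: tw_def distrib_left exp_add[symmetric])
  moreover have "exp (k * \<bar>dy\<bar>) <= exp (k * dy) + exp (- (k * dy))"
   by (cases "0 <= dy") (auto simp: abs_if intro: add_increasing add_increasing2)
  ultimately show "norm (exp (k * \<bar>dy\<bar>)) <= norm (exp (k^2 * h / 2) * (tw k h dy + tw (- k) h dy))" by simp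
 qed
qed measurable

text \<open>Rescaling to the standard Gaussian extracts the cube of sqrt h; the remaining integral
  is bounded uniformly for h <= 1.\<close>

lemma gauss_cubic_bound:
 assumes k: "0 <= k"
 obtains K where "\<And>h. 0 < h ==> h <= 1 ==> integrable (gauss h) (\<lambda>dy. (\<bar>dy\<bar> + sqrt h) ^ 3 * exp (k * (\<bar>dy\<bar> + sqrt h)))"
  "\<And>h. 0 < h ==> h <= 1 ==> (LINT dy|gauss h. (\<bar>dy\<bar> + sqrt h) ^ 3 * exp (k * (\<bar>dy\<bar> + sqrt h))) <= K * (h * sqrt h)"
proof -
 define d where "d u = 6 * exp ((k + 1) * (\<bar>u\<bar> + 1))" for u :: real
 have "integrable (gauss 1) (\<lambda>u. 6 * exp (k + 1) * exp ((k + 1) * \<bar>u\<bar>))"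
  using gauss_exp_abs[of 1 "k + 1"] k by auto
 moreover have "d = (\<lambda>u. 6 * exp (k + 1) * exp ((k + 1) * \<bar>u\<bar>))"
  by (simp add: d_def fun_eq_iff exp_add[symmetric] algebra_simps)
 ultimately have "integrable (gauss 1) d" by simp
 then have di: "integrable std_normal_distribution d" by (simp add: gauss_def)
 have pw: "(\<bar>sqrt h * u\<bar> + sqrt h) ^ 3 * exp (k * (\<bar>sqrt h * u\<bar> + sqrt h)) <= (h * sqrt h) * d u" if h: "0 < h" "h <= 1" for h u :: real
 proof -
  define v where "v = \<bar>u\<bar> + 1"
  have v: "0 <= v" by (simp add: v_def)
  have s: "\<bar>sqrt h * u\<bar> + sqrt h = sqrt h * v" using h by (simp add: v_def abs_mult algebra_simps)
  have h1: "sqrt h <= 1" "0 <= sqrt h" using h by auto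
  have "(sqrt h * v) ^ 3 = (h * sqrt h) * v ^ 3" using h by (simp add: power_mult_distrib power3_eq_cube)
  moreover have "exp (k * (sqrt h * v)) <= exp (k * v)" using h1 v k by (simp add: mult_left_mono mult_left_le_one_le)
  \<comment> \<open>A single term of the exponential series; it moves the cube into the exponent,
    which becomes k + 1 in \<open>d\<close>.\<close>
  moreover have "v ^ 3 <= 6 * exp v"
   using exp_lower_Taylor_quadratic[OF v] v
  proof -
   have "v ^ 3 / fact 3 <= exp v"
    using sum_le_suminf[of "\<lambda>n. v ^ n /\<^sub>R fact n" "{3}"] summable_exp_generic[of v] v by (simp add: exp_def divide_inverse mult.commute)
   then show ?thesis by (simp add: fact_numeral)
  qed
  ultimately have "(sqrt h * v) ^ 3 * exp (k * (sqrt h * v)) <= ((h * sqrt h) * (6 * exp v)) * exp (k * v)"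
   using h v by (intro mult_mono) auto
  also have "\<dots> = (h * sqrt h) * d u" by (simp add: d_def v_def exp_add[symmetric] algebra_simps)
  finally show ?thesis unfolding s .
 qed
 define K where "K = (LINT u|std_normal_distribution. d u)"
 have main: "integrable (gauss h) (\<lambda>dy. (\<bar>dy\<bar> + sqrt h) ^ 3 * exp (k * (\<bar>dy\<bar> + sqrt h))) \<and>
  (LINT dy|gauss h. (\<bar>dy\<bar> + sqrt h) ^ 3 * exp (k * (\<bar>dy\<bar> + sqrt h))) <= K * (h * sqrt h)" if h: "0 < h" "h <= 1" for h
 proof -
  have m: "(\<lambda>u. sqrt h * u) \<in> borel_measurable std_normal_distribution" by measurable
  have i: "integrable std_normal_distribution (\<lambda>u. (\<bar>sqrt h * u\<bar> + sqrt h) ^ 3 * exp (k * (\<bar>sqrt h * u\<bar> + sqrt h)))"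
  proof (rule Bochner_Integration.integrable_bound)
   show "integrable std_normal_distribution (\<lambda>u. (h * sqrt h) * d u)" by (rule integrable_mult_right[OF di])
   show "AE u in std_normal_distribution. norm ((\<bar>sqrt h * u\<bar> + sqrt h) ^ 3 * exp (k * (\<bar>sqrt h * u\<bar> + sqrt h))) <= norm ((h * sqrt h) * d u)"
    using pw[OF h] h by (intro AE_I2) (auto simp: abs_mult d_def)
  qed measurable
  have "(LINT u|std_normal_distribution. (\<bar>sqrt h * u\<bar> + sqrt h) ^ 3 * exp (k * (\<bar>sqrt h * u\<bar> + sqrt h))) <= (LINT u|std_normal_distribution. (h * sqrt h) * d u)"
   by (rule integral_mono[OF i integrable_mult_right[OF di] pw[OF h]])
  also have "\<dots> = K * (h * sqrt h)" by (simp add: K_def)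
  finally show ?thesis unfolding gauss_eq_distr[OF h(1)]
   by (subst integrable_distr_eq[OF m], simp, subst integral_distr[OF m], simp) (use i in blast)
 qed
 show ?thesis by (rule that[of K]) (use main in blast)+
qed

text \<open>Fubini and the unit mean of \<open>tw\<close> under the Gaussian: averaged over the
  increment, the unnormalized update changes nothing.\<close>

lemma gauss_average:
 fixes r \<psi> :: "'a::euclidean_space => real"
 assumes \<nu>: "prob_space \<nu>" "sets \<nu> = sets borel" and h: "0 < h"
  and [measurable]: "r \<in> borel_measurable borel" "\<psi> \<in> borel_measurable borel" and b: "\<And>x. \<bar>\<psi> x\<bar> <= L"
 shows "integrable (gauss h) (\<lambda>dy. \<integral>x. \<psi> x * tw (r x) h dy \<partial>\<nu>)" (is ?g1)
  "(LINT dy|gauss h. (LINT x|\<nu>. \<psi> x * tw (r x) h dy)) = (LINT x|\<nu>. \<psi> x)" (is ?g2)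
proof -
 interpret n: prob_space \<nu> by fact
 interpret g: prob_space "gauss h" by (rule prob_space_gauss[OF h])
 interpret P: pair_sigma_finite "gauss h" \<nu> ..
 note [measurable_cong] = \<nu>(2)
 have m: "(\<lambda>(dy, x). \<psi> x * tw (r x) h dy) \<in> borel_measurable (gauss h \<Otimes>\<^sub>M \<nu>)" by measurable
 have "(\<integral>\<^sup>+p. ennreal (norm ((\<lambda>(dy, x). \<psi> x * tw (r x) h dy) p)) \<partial>(gauss h \<Otimes>\<^sub>M \<nu>))
   = (\<integral>\<^sup>+x. (\<integral>\<^sup>+dy. ennreal \<bar>\<psi> x\<bar> * ennreal (tw (r x) h dy) \<partial>gauss h) \<partial>\<nu>)"
  by (subst P.nn_integral_snd[symmetric]) (auto simp: abs_mult ennreal_mult case_prod_beta' intro!: nn_integral_cong)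
 also have "\<dots> = (\<integral>\<^sup>+x. ennreal \<bar>\<psi> x\<bar> \<partial>\<nu>)" by (simp add: nn_integral_cmult gauss_tw(3)[OF h])
 also have "\<dots> <= (\<integral>\<^sup>+x. ennreal L \<partial>\<nu>)" by (intro nn_integral_mono ennreal_leI b)
 also have "\<dots> < \<infinity>" using n.emeasure_space_1 by simp
 finally have i: "integrable (gauss h \<Otimes>\<^sub>M \<nu>) (\<lambda>(dy, x). \<psi> x * tw (r x) h dy)" using m by (intro integrableI_bounded)
 show ?g1 using P.integrable_fst'[OF i] by simp
 have "(LINT dy|gauss h. (LINT x|\<nu>. \<psi> x * tw (r x) h dy)) = (LINT x|\<nu>. (LINT dy|gauss h. \<psi> x * tw (r x) h dy))"
  using P.Fubini_integral[OF i] by simp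
 then show ?g2
  by (simp add: gauss_tw[OF h])
qed

lemma exp_minus_one_le: "\<bar>exp u - 1\<bar> <= \<bar>u\<bar> * exp \<bar>u\<bar>" for u :: real
proof (cases "0 <= u")
 case True
 have "exp (- u) \<ge> 1 - u" using exp_ge_add_one_self[of "- u"] by simp
 then have "exp u * exp (- u) \<ge> exp u * (1 - u)" by (intro mult_left_mono) auto
 then have "1 \<ge> exp u - u * exp u" by (simp add: exp_minus algebra_simps)
 then show ?thesis using True by simp
next
 case False
 have "1 - exp u <= - u" using exp_ge_add_one_self[of u] by linarith
 also have "\<dots> <= - u * exp (- u)" using False by (simp add: mult_left_le)
 finally show ?thesis using False by simp
qed

lemma exp_second_order_le: "\<bar>exp u - 1 - u\<bar> <= u^2 * exp \<bar>u\<bar>" for u :: real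
proof -
 have "exp u - 1 - u \<ge> 0" using exp_ge_add_one_self[of u] by linarith
 moreover have "exp u - 1 - u <= u * (exp u - 1)"
 proof -
  have "exp (- u) \<ge> 1 - u" using exp_ge_add_one_self[of "- u"] by simp
  then have "exp u * exp (- u) \<ge> exp u * (1 - u)" by (intro mult_left_mono) auto
  then show ?thesis by (simp add: exp_minus algebra_simps)
 qed
 moreover have "u * (exp u - 1) <= \<bar>u\<bar> * \<bar>exp u - 1\<bar>" using abs_ge_self[of "u * (exp u - 1)"] by (simp add: abs_mult)
 moreover have "\<bar>u\<bar> * \<bar>exp u - 1\<bar> <= \<bar>u\<bar> * (\<bar>u\<bar> * exp \<bar>u\<bar>)" by (intro mult_left_mono exp_minus_one_le) simp
 ultimately show ?thesis by (simp add: power2_eq_square)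
qed

lemma (in prob_space) abs_expectation_le:
 fixes f :: "'a => real"
 assumes [measurable]: "f \<in> borel_measurable M" and "\<And>x. x \<in> space M ==> \<bar>f x\<bar> <= c" shows "\<bar>expectation f\<bar> <= c"
proof -
 have i: "integrable M f" using assms by (intro integrable_const_bound[where B=c]) auto
 have "\<bar>expectation f\<bar> <= expectation (\<lambda>x. \<bar>f x\<bar>)" by (rule integral_abs_bound)
 also have "\<dots> <= expectation (\<lambda>_. c)" using i assms by (intro integral_mono) auto
 finally show ?thesis by (simp add: prob_space)
qed

text \<open>With \<open>f\<close> the centred \<open>\<phi>\<close> the numerator is a + p z, and
  its square over z is a^2 / z + 2 p a + p^2 z. The last two terms average exactly to 0 and p^2. In
  the first, a is H dy and z is 1 up to higher order, where H is the covariance, so it averages to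
  about H^2 h. The constant is uniform in \<open>\<nu>\<close>, which will be a random
  posterior.\<close>

lemma local_variance:
 fixes r \<phi> :: "'a::euclidean_space => real"
 assumes [measurable]: "r \<in> borel_measurable borel" "\<phi> \<in> borel_measurable borel"
  and C: "\<And>x. \<bar>r x\<bar> <= C" and L: "\<And>x. \<bar>\<phi> x\<bar> <= L"
 obtains K where "\<And>\<nu> h. prob_space \<nu> ==> sets \<nu> = sets borel ==> 0 < h ==> h <= 1 ==>
  \<bar>(LINT dy|gauss h. (LINT x|\<nu>. \<phi> x * tw (r x) h dy)^2 / (LINT x|\<nu>. tw (r x) h dy)) - (LINT x|\<nu>. \<phi> x)\<^sup>2
   - h * ((LINT x|\<nu>. \<phi> x * r x) - (LINT x|\<nu>. \<phi> x) * (LINT x|\<nu>. r x))\<^sup>2\<bar> <= K * (h * sqrt h)"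
proof -
 have C0: "0 <= C" and L0: "0 <= L" using C[of undefined] L[of undefined] by linarith+
 \<comment> \<open>The exponent of \<open>tw\<close> is at most C |dy| + C^2 h / 2, hence at most c
   (|dy| + sqrt h) for h <= 1.\<close>
 define c where "c = C + C^2"
 have c0: "0 <= c" using C0 by (simp add: c_def)
 obtain K where K: "\<And>h. 0 < h ==> h <= 1 ==> integrable (gauss h) (\<lambda>dy. (\<bar>dy\<bar> + sqrt h) ^ 3 * exp ((3 * c) * (\<bar>dy\<bar> + sqrt h)))"
  "\<And>h. 0 < h ==> h <= 1 ==> (LINT dy|gauss h. (\<bar>dy\<bar> + sqrt h) ^ 3 * exp ((3 * c) * (\<bar>dy\<bar> + sqrt h))) <= K * (h * sqrt h)"
  by (rule gauss_cubic_bound[of "3 * c"]) (use c0 in auto)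
 \<comment> \<open>The first summand comes from |a - H dy| times |a| + |H dy|, the second from H^2
   dy^2 times |z - 1|. Both are cubic in |dy| + sqrt h, and three exponential factors, one of them
   from 1 / z, give the exponent 3 c.\<close>
 define K' where "K' = (2 * L * (C^2 + c^2)) * (4 * L * c) + (2 * L * c)^2 * c"
 show ?thesis
 proof (rule that[of "K' * K"])
  fix \<nu> :: "'a measure" and h :: real
  assume \<nu>: "prob_space \<nu>" "sets \<nu> = sets borel" and h: "0 < h" "h <= 1"
  interpret n: prob_space \<nu> by fact
  interpret g: prob_space "gauss h" by (rule prob_space_gauss[OF h(1)])
  note [measurable_cong] = \<nu>(2)
  define p where "p = (LINT x|\<nu>. \<phi> x)"
  define f where "f x = \<phi> x - p" for x
  have [measurable]: "f \<in> borel_measurable borel" unfolding f_def by measurable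
  have pL: "\<bar>p\<bar> <= L" unfolding p_def by (rule n.abs_expectation_le) (use L in auto)
  have fL: "\<bar>f x\<bar> <= 2 * L" for x using L[of x] pL unfolding f_def by linarith
  have ib: "integrable \<nu> \<psi>" if [measurable]: "\<psi> \<in> borel_measurable borel" and "\<And>x. \<bar>\<psi> x\<bar> <= b" for \<psi> :: "'a => real" and b
   using that(2) by (intro n.integrable_const_bound[where B=b]) auto
  have i\<phi>: "integrable \<nu> \<phi>" by (rule ib[OF _ L]) measurable
  have ir: "integrable \<nu> r" by (rule ib[OF _ C]) measurable
  have i\<phi>r: "integrable \<nu> (\<lambda>x. \<phi> x * r x)"
   by (rule ib[of _ "L * C"]) (auto simp: abs_mult intro!: mult_mono L C L0)
  have f0: "(LINT x|\<nu>. f x) = 0" unfolding f_def using i\<phi> by (simp add: p_def n.prob_space)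
  define H where "H = (LINT x|\<nu>. f x * r x)"
  have Heq: "H = (LINT x|\<nu>. \<phi> x * r x) - p * (LINT x|\<nu>. r x)"
   unfolding H_def f_def using i\<phi>r ir by (simp add: left_diff_distrib)
  have HL: "\<bar>H\<bar> <= 2 * L * C" unfolding H_def
   by (rule n.abs_expectation_le) (auto simp: abs_mult intro!: mult_mono fL C L0)
  define a where "a dy = (LINT x|\<nu>. f x * tw (r x) h dy)" for dy
  define z where "z dy = (LINT x|\<nu>. tw (r x) h dy)" for dy
  define s where "s dy = \<bar>dy\<bar> + sqrt h" for dy
  have sq: "0 < sqrt h" "sqrt h <= 1" using h by auto
  have s0: "0 <= s dy" "\<bar>dy\<bar> <= s dy" for dy using sq by (auto simp: s_def)
  have hs: "h <= s dy" "h <= (s dy)^2" for dy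
  proof -
   have "h = sqrt h * sqrt h" using h by simp
   then have "h <= sqrt h * 1" using sq by (metis mult_left_mono less_imp_le)
   then show "h <= s dy" by (simp add: s_def)
   have "(sqrt h)^2 <= (s dy)^2" using sq by (intro power_mono) (auto simp: s_def)
   then show "h <= (s dy)^2" using h by simp
  qed
  define u where "u x dy = r x * dy - (r x)^2 * h / 2" for x dy
  have twu: "tw (r x) h dy = exp (u x dy)" for x dy by (simp add: tw_def u_def)
  have r2: "(r x)^2 <= C^2" for x using power_mono[OF C[of x], of 2] by simp
  have ub: "\<bar>u x dy\<bar> <= c * s dy" for x dy
  proof -
   have "\<bar>u x dy\<bar> <= \<bar>r x\<bar> * \<bar>dy\<bar> + (r x)^2 * h / 2"
    unfolding u_def using abs_triangle_ineq4[of "r x * dy" "(r x)^2 * h / 2"] h by (simp add: abs_mult)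
   also have "\<dots> <= C * s dy + C^2 * s dy"
   proof (rule add_mono)
    show "\<bar>r x\<bar> * \<bar>dy\<bar> <= C * s dy" by (intro mult_mono C s0 C0) auto
    have "(r x)^2 * h <= C^2 * s dy" by (intro mult_mono r2 hs) (use h in auto)
    moreover have "0 <= C^2 * s dy" using s0 by simp
    ultimately show "(r x)^2 * h / 2 <= C^2 * s dy" by linarith
   qed
   finally show ?thesis by (simp add: c_def distrib_right)
  qed
  define e where "e dy = exp (c * s dy)" for dy
  have e1: "1 <= e dy" for dy using c0 s0 by (simp add: e_def)
  have eu: "exp \<bar>u x dy\<bar> <= e dy" for x dy using ub[of x dy] by (simp add: e_def)
  have twe: "tw (r x) h dy <= e dy" for x dy
   unfolding twu by (rule order_trans[OF _ eu[of x dy]]) simp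
  have t1: "\<bar>tw (r x) h dy - 1\<bar> <= c * s dy * e dy" for x dy
   unfolding twu by (rule order_trans[OF exp_minus_one_le]) (intro mult_mono ub eu, auto simp: c0 s0)
  have t2: "\<bar>tw (r x) h dy - 1 - r x * dy\<bar> <= (C^2 + c^2) * (s dy)^2 * e dy" for x dy
  proof -
   have "\<bar>tw (r x) h dy - 1 - r x * dy\<bar> <= \<bar>exp (u x dy) - 1 - u x dy\<bar> + (r x)^2 * h / 2"
    unfolding twu u_def using abs_triangle_ineq4[of "exp (r x * dy - (r x)^2 * h / 2) - 1 - (r x * dy - (r x)^2 * h / 2)" "(r x)^2 * h / 2"] h by simp
   also have "\<dots> <= (c * s dy)^2 * e dy + C^2 * (s dy)^2 * e dy"
   proof (rule add_mono)
    have "(u x dy)^2 <= (c * s dy)^2" using power_mono[OF ub[of x dy], of 2] by simp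
    then show "\<bar>exp (u x dy) - 1 - u x dy\<bar> <= (c * s dy)^2 * e dy"
     by (intro order_trans[OF exp_second_order_le] mult_mono eu) auto
    have "(r x)^2 * h <= C^2 * (s dy)^2" by (intro mult_mono r2 hs) (use h in auto)
    also have "\<dots> <= C^2 * (s dy)^2 * e dy" using mult_left_mono[OF e1[of dy], of "C^2 * (s dy)^2"] by simp
    finally have "(r x)^2 * h <= C^2 * (s dy)^2 * e dy" .
    moreover have "0 <= (r x)^2 * h" using h by simp
    ultimately show "(r x)^2 * h / 2 <= C^2 * (s dy)^2 * e dy" by linarith
   qed
   finally show ?thesis by (simp add: power_mult_distrib algebra_simps)
  qed
  have itw: "integrable \<nu> (\<lambda>x. tw (r x) h dy)" for dy
   by (rule ib[of _ "e dy"]) (measurable, simp add: twe)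
  have iftw: "integrable \<nu> (\<lambda>x. f x * tw (r x) h dy)" for dy
   by (rule ib[of _ "2 * L * e dy"]) (measurable, auto simp: abs_mult intro!: mult_mono fL L0 twe)
  have ifr: "integrable \<nu> (\<lambda>x. f x * r x)"
   by (rule ib[of _ "2 * L * C"]) (auto simp: abs_mult intro!: mult_mono fL C L0)
  have if': "integrable \<nu> f" by (rule ib[OF _ fL]) measurable
  have a1: "\<bar>a dy\<bar> <= 2 * L * c * s dy * e dy" for dy
  proof -
   have "a dy = (LINT x|\<nu>. f x * (tw (r x) h dy - 1))" unfolding a_def using iftw[of dy] if' by (simp add: right_diff_distrib f0)
   also have "\<bar>\<dots>\<bar> <= (2 * L) * (c * s dy * e dy)"
    by (rule n.abs_expectation_le) (auto simp: abs_mult intro!: mult_mono fL t1 L0)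
   finally show ?thesis by (simp add: mult.assoc)
  qed
  have a2: "\<bar>a dy - H * dy\<bar> <= 2 * L * (C^2 + c^2) * (s dy)^2 * e dy" for dy
  proof -
   have "(LINT x|\<nu>. f x * (tw (r x) h dy - 1 - r x * dy)) = (LINT x|\<nu>. f x * tw (r x) h dy - f x - (f x * r x) * dy)"
    by (intro Bochner_Integration.integral_cong) (auto simp: algebra_simps)
   also have "\<dots> = a dy - H * dy" unfolding a_def H_def using iftw[of dy] if' ifr by (simp add: f0)
   finally have "\<bar>a dy - H * dy\<bar> = \<bar>\<integral>x. f x * (tw (r x) h dy - 1 - r x * dy) \<partial>\<nu>\<bar>" by simp
   also have "\<dots> <= (2 * L) * ((C^2 + c^2) * (s dy)^2 * e dy)"
    by (rule n.abs_expectation_le) (auto simp: abs_mult intro!: mult_mono fL t2 L0)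
   finally show ?thesis by (simp add: mult.assoc)
  qed
  have z1: "\<bar>z dy - 1\<bar> <= c * s dy * e dy" for dy
  proof -
   have "z dy - 1 = (LINT x|\<nu>. tw (r x) h dy - 1)" unfolding z_def using itw[of dy] by (simp add: n.prob_space)
   also have "\<bar>\<dots>\<bar> <= c * s dy * e dy" by (rule n.abs_expectation_le) (auto intro!: t1)
   finally show ?thesis .
  qed
  have z2: "inverse (e dy) <= z dy" for dy
  proof -
   have "inverse (e dy) = (LINT x|\<nu>. inverse (e dy))" by (simp add: n.prob_space)
   also have "\<dots> <= z dy" unfolding z_def
   proof (rule integral_mono[OF _ itw])
    fix x
    have "- (c * s dy) <= u x dy" using ub[of x dy] by linarith
    then show "inverse (e dy) <= tw (r x) h dy" by (simp add: e_def twu exp_minus[symmetric])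
   qed simp
   finally show ?thesis .
  qed
  have epos: "0 < e dy" for dy by (simp add: e_def)
  have zpos: "0 < z dy" for dy using z2[of dy] epos[of dy] by (meson inverse_positive_iff_positive less_le_trans)
  have iz: "1 / z dy <= e dy" for dy
   using le_imp_inverse_le[OF z2[of dy]] epos[of dy] by (simp add: divide_inverse)
  have main: "\<bar>(a dy)\<^sup>2 / z dy - H^2 * dy\<^sup>2\<bar> <= K' * ((\<bar>dy\<bar> + sqrt h) ^ 3 * exp ((3 * c) * (\<bar>dy\<bar> + sqrt h)))" for dy
  proof -
   have Hw: "\<bar>H * dy\<bar> <= 2 * L * c * s dy * e dy"
   proof -
    have "\<bar>H * dy\<bar> <= (2 * L * C) * s dy" unfolding abs_mult using HL s0 C0 L0 by (intro mult_mono) auto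
    also have "\<dots> <= (2 * L * c) * s dy" using L0 C0 s0 by (intro mult_right_mono mult_left_mono) (auto simp: c_def)
    also have "\<dots> <= (2 * L * c * s dy) * e dy" using mult_left_mono[OF e1[of dy], of "2 * L * c * s dy"] L0 c0 s0 by simp
    finally show ?thesis .
   qed
   have Hw2: "H^2 * dy^2 <= (2 * L * c)^2 * (s dy)^2 * e dy"
   proof -
    have "\<bar>H * dy\<bar> <= 2 * L * c * s dy"
     unfolding abs_mult using HL s0 C0 L0 c0 by (intro mult_mono order_trans[OF HL]) (auto simp: c_def intro!: mult_left_mono)
    then have "(H * dy)^2 <= (2 * L * c * s dy)^2" using power_mono[of "\<bar>H * dy\<bar>" _ 2] by simp
    also have "\<dots> <= (2 * L * c * s dy)^2 * e dy" using mult_left_mono[OF e1[of dy], of "(2 * L * c * s dy)^2"] by simp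
    finally show ?thesis by (simp add: power_mult_distrib)
   qed
   have "(a dy)^2 / z dy - H^2 * dy^2 = ((a dy - H * dy) * (a dy + H * dy) + H^2 * dy^2 * (1 - z dy)) * (1 / z dy)"
    using zpos[of dy] by (simp add: field_simps power2_eq_square)
   then have "\<bar>(a dy)\<^sup>2 / z dy - H^2 * dy\<^sup>2\<bar> = \<bar>(a dy - H * dy) * (a dy + H * dy) + H^2 * dy^2 * (1 - z dy)\<bar> * (1 / z dy)"
    using zpos[of dy] by (simp add: abs_mult)
   also have "\<dots> <= (\<bar>a dy - H * dy\<bar> * (\<bar>a dy\<bar> + \<bar>H * dy\<bar>) + H^2 * dy^2 * \<bar>z dy - 1\<bar>) * e dy"
   proof (rule mult_mono)
    have "\<bar>(a dy - H * dy) * (a dy + H * dy) + H^2 * dy^2 * (1 - z dy)\<bar> <= \<bar>a dy - H * dy\<bar> * \<bar>a dy + H * dy\<bar> + H^2 * dy^2 * \<bar>1 - z dy\<bar>"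
     using abs_triangle_ineq[of "(a dy - H * dy) * (a dy + H * dy)" "H^2 * dy^2 * (1 - z dy)"] by (simp add: abs_mult)
    also have "\<dots> <= \<bar>a dy - H * dy\<bar> * (\<bar>a dy\<bar> + \<bar>H * dy\<bar>) + H^2 * dy^2 * \<bar>z dy - 1\<bar>"
     by (intro add_mono mult_left_mono) (auto simp: abs_minus_commute)
    finally show "\<bar>(a dy - H * dy) * (a dy + H * dy) + H^2 * dy^2 * (1 - z dy)\<bar> <= \<bar>a dy - H * dy\<bar> * (\<bar>a dy\<bar> + \<bar>H * dy\<bar>) + H^2 * dy^2 * \<bar>z dy - 1\<bar>" .
   qed (use iz zpos[of dy] in auto)
   also have "\<dots> <= ((2 * L * (C^2 + c^2) * (s dy)^2 * e dy) * (2 * L * c * s dy * e dy + 2 * L * c * s dy * e dy)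
     + ((2 * L * c)^2 * (s dy)^2 * e dy) * (c * s dy * e dy)) * e dy"
   proof (intro mult_right_mono add_mono)
    show "\<bar>a dy - H * dy\<bar> * (\<bar>a dy\<bar> + \<bar>H * dy\<bar>)
     <= (2 * L * (C^2 + c^2) * (s dy)^2 * e dy) * (2 * L * c * s dy * e dy + 2 * L * c * s dy * e dy)"
     by (rule mult_mono[OF a2 add_mono[OF a1 Hw]]) (use epos[of dy] L0 in auto)
    show "H^2 * dy^2 * \<bar>z dy - 1\<bar> <= ((2 * L * c)^2 * (s dy)^2 * e dy) * (c * s dy * e dy)"
     by (rule mult_mono[OF Hw2 z1]) (use epos[of dy] in auto)
   qed (use epos[of dy] in auto)
   also have "\<dots> = K' * ((s dy) ^ 3 * (e dy * e dy * e dy))"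
    by (simp add: K'_def power2_eq_square power3_eq_cube algebra_simps)
   also have "e dy * e dy * e dy = exp ((3 * c) * s dy)" by (simp add: e_def exp_add[symmetric] algebra_simps)
   finally show ?thesis by (simp add: s_def)
  qed
  have K'0: "0 <= K'" using L0 c0 by (simp add: K'_def)
  have [measurable]: "a \<in> borel_measurable borel" "z \<in> borel_measurable borel" unfolding a_def z_def by measurable
  have iH: "integrable (gauss h) (\<lambda>dy. H^2 * dy^2)" using gauss_moments(3)[OF h(1)] by auto
  have iD: "integrable (gauss h) (\<lambda>dy. (a dy)^2 / z dy - H^2 * dy^2)"
   by (rule Bochner_Integration.integrable_bound[OF integrable_mult_right[OF K(1)[OF h], of K']])
    (measurable, unfold real_norm_def, intro AE_I2 order_trans[OF main abs_ge_self])
  have iq: "integrable (gauss h) (\<lambda>dy. (a dy)^2 / z dy)"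
   using Bochner_Integration.integrable_add[OF iD iH] by simp
  have ia: "integrable (gauss h) a" "(LINT dy|gauss h. a dy) = 0"
   using gauss_average[OF \<nu> h(1), of r f "2 * L"] fL f0 by (auto simp: a_def[abs_def])
  have iz': "integrable (gauss h) z" "(LINT dy|gauss h. z dy) = 1"
   using gauss_average[OF \<nu> h(1), of r "\<lambda>_. 1" 1] by (auto simp: z_def[abs_def] n.prob_space)
  have split: "(LINT x|\<nu>. \<phi> x * tw (r x) h dy)^2 / (LINT x|\<nu>. tw (r x) h dy) = (a dy)^2 / z dy + 2 * p * a dy + p^2 * z dy" for dy
  proof -
   have "(LINT x|\<nu>. \<phi> x * tw (r x) h dy) = (LINT x|\<nu>. f x * tw (r x) h dy + p * tw (r x) h dy)"
    by (intro Bochner_Integration.integral_cong) (auto simp: f_def algebra_simps)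
   also have "\<dots> = a dy + p * z dy" unfolding a_def z_def using iftw[of dy] itw[of dy] by simp
   finally have "(LINT x|\<nu>. \<phi> x * tw (r x) h dy) = a dy + p * z dy" .
   then show ?thesis using zpos[of dy] by (simp add: z_def[symmetric] field_simps power2_eq_square)
  qed
  have "(LINT dy|gauss h. (LINT x|\<nu>. \<phi> x * tw (r x) h dy)^2 / (LINT x|\<nu>. tw (r x) h dy)) - p^2 - h * H\<^sup>2
   = (LINT dy|gauss h. (a dy)^2 / z dy - H^2 * dy^2)"
   unfolding split using iq ia iz' iH gauss_moments(4)[OF h(1)] by simp
  also have "\<bar>\<dots>\<bar> <= (LINT dy|gauss h. K' * ((\<bar>dy\<bar> + sqrt h) ^ 3 * exp ((3 * c) * (\<bar>dy\<bar> + sqrt h))))"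
   by (rule order_trans[OF integral_abs_bound integral_mono[OF integrable_abs[OF iD] integrable_mult_right[OF K(1)[OF h]] main]])
  also have "\<dots> <= K' * K * (h * sqrt h)" using K(2)[OF h] K'0 by (simp add: mult.assoc mult_left_mono)
  finally show "\<bar>(LINT dy|gauss h. (LINT x|\<nu>. \<phi> x * tw (r x) h dy)^2 / (LINT x|\<nu>. tw (r x) h dy)) - (LINT x|\<nu>. \<phi> x)\<^sup>2
   - h * ((LINT x|\<nu>. \<phi> x * r x) - (LINT x|\<nu>. \<phi> x) * (LINT x|\<nu>. r x))\<^sup>2\<bar> <= K' * K * (h * sqrt h)"
   unfolding p_def[symmetric] Heq[symmetric] .
 qed
qed

context bm_filter
begin

text \<open>The posterior covariance of \<open>\<phi>\<close> and \<rho>, that is, the integrand of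
  the equation as a function of the observation; see \<open>meas_cov_eq\<close>.\<close>

definition Hc :: "('a => real) => real => real => real" where
 "Hc \<phi> t y = pE (\<lambda>x. \<phi> x * \<rho> x) t y - pE \<phi> t y * pE \<rho> t y"

abbreviation HY :: "('a => real) => 'w \<times> real => real" where
 "HY \<phi> p \<equiv> Hc \<phi> (snd p) (Y (fst p) (snd p))"

lemma Hc_pathfun:
 assumes "\<phi> \<in> borel_measurable borel" "\<And>x. \<bar>\<phi> x\<bar> <= L" shows "pathfun (Hc \<phi>)"
 unfolding Hc_def[abs_def]
 by (intro pathfun_diff pathfun_mult pathfun_pE mild_rho mild_mult_rho[OF assms] mild_bounded[OF assms])

text \<open>Centre \<open>\<phi>\<close> and apply Jensen. The right-hand side serves as dominator
  when the truncation is removed, because \<open>Fubini_bayes\<close> evaluates its integral on a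
  cut.\<close>

lemma Hc_square_le:
 assumes [measurable]: "\<phi> \<in> borel_measurable borel" and L: "\<And>x. \<bar>\<phi> x\<bar> <= L" and t: "0 < t"
 shows "(Hc \<phi> t y)^2 <= 4 * L^2 * pE (\<lambda>x. (\<rho> x)^2) t y"
proof -
 have a: "adm t y" using t by (simp add: adm_def)
 interpret p: prob_space "post t y" by (rule prob_space_post[OF a])
 define c where "c = pE \<phi> t y"
 have cL: "\<bar>c\<bar> <= L" unfolding c_def by (rule pE_bounded[OF _ L a]) measurable
 have L0: "0 <= L" using L[of undefined] by linarith
 have d: "\<bar>\<phi> x - c\<bar> <= 2 * L" for x using L[of x] cL by linarith
 have i1: "integrable (post t y) (\<lambda>x. \<phi> x * \<rho> x)" by (rule mild_integrable_post[OF mild_mult_rho[OF _ L] t]) measurable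
 have i2: "integrable (post t y) \<rho>" by (rule mild_integrable_post[OF mild_rho t])
 have i3: "integrable (post t y) (\<lambda>x. (\<rho> x)^2)" by (rule mild_integrable_post[OF mild_rho2 t])
 have eq: "Hc \<phi> t y = (LINT x|post t y. (\<phi> x - c) * \<rho> x)"
  unfolding Hc_def pE_def[of "\<lambda>x. \<phi> x * \<rho> x"] pE_def[of \<rho>] c_def[symmetric] using i1 i2 by (simp add: left_diff_distrib)
 have sqle: "((\<phi> x - c) * \<rho> x)^2 <= 4 * L^2 * (\<rho> x)^2" for x
  unfolding power_mult_distrib using power_mono[OF d[of x], of 2] by (intro mult_right_mono) (auto simp: power_mult_distrib)
 have i4: "integrable (post t y) (\<lambda>x. 4 * L^2 * (\<rho> x)^2)" using i3 by auto
 have i5: "integrable (post t y) (\<lambda>x. ((\<phi> x - c) * \<rho> x)^2)"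
  by (rule Bochner_Integration.integrable_bound[OF i4]) (use sqle in \<open>auto intro!: AE_I2\<close>)
 have "(Hc \<phi> t y)^2 <= (LINT x|post t y. ((\<phi> x - c) * \<rho> x)^2)"
  unfolding eq using i1 i2 i5 by (intro p.expectation_square_le) (auto simp: left_diff_distrib)
 also have "\<dots> <= (LINT x|post t y. 4 * L^2 * (\<rho> x)^2)" by (rule integral_mono[OF i5 i4 sqle])
 finally show ?thesis by (simp add: pE_def)
qed

text \<open>Conditional law of the next observation given \<open>F t\<close>: a Gaussian step
  weighted by the predictive density, which is the posterior average of the likelihood of the unseen
  \<open>X\<close>.\<close>

lemma transition:
 fixes \<Phi> :: "real => ennreal"
 assumes t: "0 <= t" and h: "0 < h" and A: "A \<in> sets (F t)" and [measurable]: "\<Phi> \<in> borel_measurable borel"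
 shows "(\<integral>\<^sup>+w. \<Phi> (Y w (t + h)) * indicator A w \<partial>M)
  = (\<integral>\<^sup>+w. (\<integral>\<^sup>+dy. \<Phi> (Y w t + dy) * (\<integral>\<^sup>+x. ennreal (tw (\<rho> x) h dy) \<partial>\<xi> w t) \<partial>gauss h) * indicator A w \<partial>M)"
proof -
 interpret g: prob_space "gauss h" by (rule prob_space_gauss[OF h])
 interpret P: pair_sigma_finite M "gauss h" ..
 have YF[measurable]: "(\<lambda>w. Y w t) \<in> borel_measurable (F t)" using t by (intro Y_meas_F) auto
 have [measurable]: "(\<lambda>w. Y w t) \<in> borel_measurable (G t)" using t by (intro Y_meas_G) auto
 have [measurable]: "(\<lambda>w. Y w t) \<in> borel_measurable M" using t by (intro Y_meas) auto
 have AM[measurable]: "A \<in> sets M" using F_events[OF t A] .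
 have [measurable]: "A \<in> sets (G t)" using A subalgebra_G_F[OF t] by (auto simp: subalgebra_def)
 let ?f = "\<lambda>(w, dy). \<Phi> (Y w t + (dy + \<rho> (X w) * h)) * indicator A w"
 have "(\<integral>\<^sup>+w. \<Phi> (Y w (t + h)) * indicator A w \<partial>M) = (\<integral>\<^sup>+w. ?f (w, B w (t + h) - B w t) \<partial>M)"
  by (intro nn_integral_cong) (simp add: Y_def algebra_simps)
 also have "\<dots> = (\<integral>\<^sup>+w. (\<integral>\<^sup>+dy. ?f (w, dy) \<partial>gauss (t + h - t)) \<partial>M)"
  by (rule nn_integral_increment) (use t h in auto)
 also have "\<dots> = (\<integral>\<^sup>+w. (\<integral>\<^sup>+dy. \<Phi> (Y w t + dy) * ennreal (tw (\<rho> (X w)) h dy) * indicator A w \<partial>gauss h) \<partial>M)"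
 proof (rule nn_integral_cong)
  fix w
  have "(\<integral>\<^sup>+dy. ?f (w, dy) \<partial>gauss (t + h - t)) = (\<integral>\<^sup>+dy. \<Phi> (Y w t + dy) * indicator A w * ennreal (tw (\<rho> (X w)) h dy) \<partial>gauss h)"
   using gauss_shift[OF h, of "\<lambda>dy. \<Phi> (Y w t + dy) * indicator A w" "\<rho> (X w)"] by simp
  then show "(\<integral>\<^sup>+dy. ?f (w, dy) \<partial>gauss (t + h - t)) = (\<integral>\<^sup>+dy. \<Phi> (Y w t + dy) * ennreal (tw (\<rho> (X w)) h dy) * indicator A w \<partial>gauss h)"
   by (simp add: mult_ac)
 qed
 also have "\<dots> = (\<integral>\<^sup>+dy. (\<integral>\<^sup>+w. \<Phi> (Y w t + dy) * ennreal (tw (\<rho> (X w)) h dy) * indicator A w \<partial>M) \<partial>gauss h)"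
  by (rule P.Fubini'[symmetric]) measurable
 also have "\<dots> = (\<integral>\<^sup>+dy. (\<integral>\<^sup>+w. \<Phi> (Y w t + dy) * (\<integral>\<^sup>+x. ennreal (tw (\<rho> x) h dy) \<partial>\<xi> w t) * indicator A w \<partial>M) \<partial>gauss h)"
 proof (rule nn_integral_cong)
  fix dy
  have gF: "(\<lambda>w. \<Phi> (Y w t + dy) * indicator A w) \<in> borel_measurable (F t)" using A by measurable
  have "(\<integral>\<^sup>+w. ennreal (tw (\<rho> (X w)) h dy) * (\<Phi> (Y w t + dy) * indicator A w) \<partial>M)
   = (\<integral>\<^sup>+w. (\<integral>\<^sup>+x. ennreal (tw (\<rho> x) h dy) \<partial>\<xi> w t) * (\<Phi> (Y w t + dy) * indicator A w) \<partial>M)"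
   by (rule nn_bayes[OF t _ gF]) measurable
  then show "(\<integral>\<^sup>+w. \<Phi> (Y w t + dy) * ennreal (tw (\<rho> (X w)) h dy) * indicator A w \<partial>M)
   = (\<integral>\<^sup>+w. \<Phi> (Y w t + dy) * (\<integral>\<^sup>+x. ennreal (tw (\<rho> x) h dy) \<partial>\<xi> w t) * indicator A w \<partial>M)"
   by (simp add: mult_ac)
 qed
 also have "\<dots> = (\<integral>\<^sup>+w. (\<integral>\<^sup>+dy. \<Phi> (Y w t + dy) * (\<integral>\<^sup>+x. ennreal (tw (\<rho> x) h dy) \<partial>\<xi> w t) * indicator A w \<partial>gauss h) \<partial>M)"
 proof (rule P.Fubini')
  have [measurable]: "(\<lambda>p. \<integral>\<^sup>+x. (\<lambda>(p, x). ennreal (tw (\<rho> x) h (snd p))) (p, x) \<partial>post t (Y (fst p) t)) \<in> borel_measurable (M \<Otimes>\<^sub>M gauss h)"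
   by (rule nn_integral_post_meas) measurable
  then show "(\<lambda>(w, dy). \<Phi> (Y w t + dy) * (\<integral>\<^sup>+x. ennreal (tw (\<rho> x) h dy) \<partial>\<xi> w t) * indicator A w) \<in> borel_measurable (M \<Otimes>\<^sub>M gauss h)"
   unfolding \<xi>_def case_prod_beta' by simp
 qed
 also have "\<dots> = (\<integral>\<^sup>+w. (\<integral>\<^sup>+dy. \<Phi> (Y w t + dy) * (\<integral>\<^sup>+x. ennreal (tw (\<rho> x) h dy) \<partial>\<xi> w t) \<partial>gauss h) * indicator A w \<partial>M)"
 proof (rule nn_integral_cong)
  fix w
  have [measurable]: "(\<lambda>dy. \<integral>\<^sup>+x. (\<lambda>(dy, x). ennreal (tw (\<rho> x) h dy)) (dy, x) \<partial>post t (Y w t)) \<in> borel_measurable (gauss h)"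
   by (rule nn_integral_post_meas) measurable
  show "(\<integral>\<^sup>+dy. \<Phi> (Y w t + dy) * (\<integral>\<^sup>+x. ennreal (tw (\<rho> x) h dy) \<partial>\<xi> w t) * indicator A w \<partial>gauss h)
   = (\<integral>\<^sup>+dy. \<Phi> (Y w t + dy) * (\<integral>\<^sup>+x. ennreal (tw (\<rho> x) h dy) \<partial>\<xi> w t) \<partial>gauss h) * indicator A w"
   using \<open>(\<lambda>dy. \<integral>\<^sup>+x. (\<lambda>(dy, x). ennreal (tw (\<rho> x) h dy)) (dy, x) \<partial>post t (Y w t)) \<in> borel_measurable (gauss h)\<close>
   unfolding \<xi>_def by (intro nn_integral_multc) simp
 qed
 finally show ?thesis .
qed

lemma integral_post_tw:
 assumes [measurable]: "\<psi> \<in> borel_measurable borel" and a: "adm t y"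
 shows "(LINT x|post t y. \<psi> x * tw (\<rho> x) h dy) = Zf \<psi> (t + h) (y + dy) / Z t y"
proof -
 have "(LINT x|post t y. \<psi> x * tw (\<rho> x) h dy) = (LINT x|\<mu>. (tw (\<rho> x) t y / Z t y) * (\<psi> x * tw (\<rho> x) h dy))"
  unfolding post_def using Z_pos[OF a] by (subst integral_density) (auto intro!: AE_I2 less_imp_le)
 also have "\<dots> = (LINT x|\<mu>. (\<psi> x * tw (\<rho> x) (t + h) (y + dy)) / Z t y)"
  by (intro Bochner_Integration.integral_cong) (auto simp: tw_add[symmetric])
 finally show ?thesis by (simp add: Zf_def)
qed

text \<open>The updated posterior mean is a / z and the step has density z, so the conditional
  second moment is the Gaussian mean of a^2 / z. This is the quantity expanded in
  \<open>local_variance\<close>, with \<open>post t y\<close> for the measure.\<close>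

lemma second_moment_step:
 assumes [measurable]: "\<phi> \<in> borel_measurable borel" and L: "\<And>x. \<bar>\<phi> x\<bar> <= L" and t: "0 <= t" and h: "0 < h" and A: "A \<in> sets (F t)"
 defines "J \<equiv> \<lambda>y. \<integral>dy. (LINT x|post t y. \<phi> x * tw (\<rho> x) h dy)^2 / (LINT x|post t y. tw (\<rho> x) h dy) \<partial>gauss h"
 shows "integrable M (\<lambda>w. indicator A w * J (Y w t))" (is ?g1)
  "(LINT w|M. indicator A w * (cE \<phi> w (t + h))^2) = (LINT w|M. indicator A w * J (Y w t))" (is ?g2)
proof -
 interpret g: prob_space "gauss h" by (rule prob_space_gauss[OF h])
 have L0: "0 <= L" using L[of undefined] by linarith
 have AM[measurable]: "A \<in> sets M" using F_events[OF t A] .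
 have th: "0 < t + h" "0 <= t + h" using t h by auto
 have YM[measurable]: "(\<lambda>w. Y w t) \<in> borel_measurable M" "(\<lambda>w. Y w (t + h)) \<in> borel_measurable M" using t h by (auto intro!: Y_meas)
 define a where "a y dy = Zf \<phi> (t + h) (y + dy) / Z t y" for y dy
 define z where "z y dy = Z (t + h) (y + dy) / Z t y" for y dy
 have aeq: "(LINT x|post t y. \<phi> x * tw (\<rho> x) h dy) = a y dy" if "adm t y" for y dy
  unfolding a_def by (rule integral_post_tw[OF _ that]) measurable
 have zeq: "(LINT x|post t y. tw (\<rho> x) h dy) = z y dy" if "adm t y" for y dy
  using integral_post_tw[OF _ that, of "\<lambda>_. 1"] by (simp add: z_def Z_Zf)
 have zpos: "0 < z y dy" if "adm t y" for y dy
  unfolding z_def using Z_pos[OF that] Z_pos[of "t + h" "y + dy"] th by (simp add: adm_def)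
 have Jeq: "J y = (LINT dy|gauss h. (a y dy)^2 / z y dy)" if "adm t y" for y
  unfolding J_def aeq[OF that] zeq[OF that] ..
 have Jm: "(\<lambda>w. \<integral>dy. (a (Y w t) dy)^2 / z (Y w t) dy \<partial>gauss h) \<in> borel_measurable M"
  unfolding a_def z_def by measurable
 have le: "(a y dy)^2 / z y dy <= L^2 * z y dy" "0 <= (a y dy)^2 / z y dy" if y: "adm t y" for y dy
 proof -
  have a': "adm (t + h) (y + dy)" using th by (simp add: adm_def)
  have p: "pE \<phi> (t + h) (y + dy) = a y dy / z y dy"
   using Z_pos[OF y] Z_pos[OF a'] by (simp add: pE_eq[OF _ a'] a_def z_def)
  have "\<bar>a y dy / z y dy\<bar> <= L" unfolding p[symmetric] by (rule pE_bounded[OF _ L a']) measurable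
  from power_mono[OF this abs_ge_zero, of 2] have "(a y dy / z y dy)^2 <= L^2" unfolding power2_abs .
  then have "(a y dy / z y dy)^2 * z y dy <= L^2 * z y dy" using zpos[OF y, of dy] by (intro mult_right_mono) auto
  then show "(a y dy)^2 / z y dy <= L^2 * z y dy" using zpos[OF y, of dy] by (simp add: power2_eq_square field_simps)
  show "0 <= (a y dy)^2 / z y dy" using zpos[OF y, of dy] by simp
 qed
 have ze: "integrable (gauss h) (z y)" "(LINT dy|gauss h. z y dy) = 1" if y: "adm t y" for y
 proof -
  interpret p: prob_space "post t y" by (rule prob_space_post[OF y])
  show "integrable (gauss h) (z y)" "(LINT dy|gauss h. z y dy) = 1"
   using gauss_average[OF p.prob_space_axioms sets_post h, of \<rho> "\<lambda>_. 1" 1] p.prob_space by (auto simp: zeq[OF y] )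
 qed
 have ie: "integrable (gauss h) (\<lambda>dy. (a y dy)^2 / z y dy)" if y: "adm t y" for y
  by (rule Bochner_Integration.integrable_bound[OF integrable_mult_right[OF ze(1)[OF y], of "L^2"]])
   (unfold a_def z_def, measurable, fold a_def z_def, unfold real_norm_def abs_of_nonneg[OF le(2)[OF y]],
    intro AE_I2 order_trans[OF le(1)[OF y] abs_ge_self])
 have Jb: "0 <= J y" "J y <= L^2" if y: "adm t y" for y
 proof -
  show "0 <= J y" unfolding Jeq[OF y] by (rule Bochner_Integration.integral_nonneg) (use le[OF y] in auto)
  have "J y <= (LINT dy|gauss h. L^2 * z y dy)" unfolding Jeq[OF y] by (intro integral_mono ie[OF y] integrable_mult_right[OF ze(1)[OF y]] le[OF y])
  then show "J y <= L^2" by (simp add: ze[OF y])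
 qed
 have JM: "(\<lambda>w. J (Y w t)) \<in> borel_measurable M"
  using Jm by (subst measurable_cong[OF Jeq[OF adm_Y[OF _ t]]])
 show iJ: ?g1
  using Jb adm_Y[OF _ t] JM by (intro integrable_const_bound[where B="L^2"]) (auto simp: indicator_def intro!: AE_I2)
 define \<Phi> where "\<Phi> y = ennreal ((pEm \<phi> (t + h) y)^2)" for y
 have [measurable]: "\<Phi> \<in> borel_measurable borel" unfolding \<Phi>_def by measurable
 have \<Phi>: "\<Phi> y = ennreal ((pE \<phi> (t + h) y)^2)" for y using th by (simp add: \<Phi>_def pEm_def pE_Zf)
 have iN: "integrable M (\<lambda>w. indicator A w * (cE \<phi> w (t + h))^2)"
 proof (rule integrable_const_bound[where B="L^2"])
  show "AE w in M. norm (indicator A w * (cE \<phi> w (t + h))^2) <= L^2"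
  proof (rule AE_I2)
   fix w assume "w \<in> space M"
   then have "\<bar>cE \<phi> w (t + h)\<bar> <= L" by (intro pE_bounded[OF _ L adm_Y]) (use th in auto)
   from power_mono[OF this, of 2] show "norm (indicator A w * (cE \<phi> w (t + h))^2) <= L^2" by (simp add: indicator_def)
  qed
  show "(\<lambda>w. indicator A w * (cE \<phi> w (t + h))^2) \<in> borel_measurable M"
   using from_F[OF th(2) pE_meas_F[OF th(2)]] by measurable
 qed
 have "ennreal (LINT w|M. indicator A w * (cE \<phi> w (t + h))^2) = (\<integral>\<^sup>+w. ennreal (indicator A w * (cE \<phi> w (t + h))^2) \<partial>M)"
  by (rule nn_integral_eq_integral[OF iN, symmetric]) auto
 also have "\<dots> = (\<integral>\<^sup>+w. \<Phi> (Y w (t + h)) * indicator A w \<partial>M)"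
  by (intro nn_integral_cong) (auto simp: \<Phi> indicator_def)
 also have "\<dots> = (\<integral>\<^sup>+w. (\<integral>\<^sup>+dy. \<Phi> (Y w t + dy) * (\<integral>\<^sup>+x. ennreal (tw (\<rho> x) h dy) \<partial>\<xi> w t) \<partial>gauss h) * indicator A w \<partial>M)"
  by (rule transition[OF t h A]) measurable
 also have "\<dots> = (\<integral>\<^sup>+w. ennreal (indicator A w * J (Y w t)) \<partial>M)"
 proof (rule nn_integral_cong)
  fix w assume dy: "w \<in> space M"
  have y: "adm t (Y w t)" by (rule adm_Y[OF dy t])
  interpret p: prob_space "post t (Y w t)" by (rule prob_space_post[OF y])
  have "(\<integral>\<^sup>+dy. \<Phi> (Y w t + dy) * (\<integral>\<^sup>+x. ennreal (tw (\<rho> x) h dy) \<partial>\<xi> w t) \<partial>gauss h) = (\<integral>\<^sup>+dy. ennreal ((a (Y w t) dy)^2 / z (Y w t) dy) \<partial>gauss h)"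
  proof (rule nn_integral_cong)
   fix v
   have a': "adm (t + h) (Y w t + v)" using th by (simp add: adm_def)
   have itw: "integrable (post t (Y w t)) (\<lambda>x. tw (\<rho> x) h v)"
    by (rule p.integrable_const_bound[where B="exp (v^2 / (2 * h))"]) (auto intro!: AE_I2 tw_le[OF h])
   have "(\<integral>\<^sup>+x. ennreal (tw (\<rho> x) h v) \<partial>\<xi> w t) = ennreal (z (Y w t) v)"
    unfolding \<xi>_def zeq[OF y, symmetric] by (rule nn_integral_eq_integral[OF itw]) auto
   moreover have "pE \<phi> (t + h) (Y w t + v) = a (Y w t) v / z (Y w t) v"
    using Z_pos[OF y] Z_pos[OF a'] by (simp add: pE_eq[OF _ a'] a_def z_def)
   ultimately show "\<Phi> (Y w t + v) * (\<integral>\<^sup>+x. ennreal (tw (\<rho> x) h v) \<partial>\<xi> w t) = ennreal ((a (Y w t) v)^2 / z (Y w t) v)"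
    using zpos[OF y, of v] by (simp add: \<Phi> ennreal_mult'[symmetric] power2_eq_square)
  qed
  also have "\<dots> = ennreal (J (Y w t))" unfolding Jeq[OF y]
   by (rule nn_integral_eq_integral[OF ie[OF y]]) (use le[OF y] in auto)
  finally show "(\<integral>\<^sup>+dy. \<Phi> (Y w t + dy) * (\<integral>\<^sup>+x. ennreal (tw (\<rho> x) h dy) \<partial>\<xi> w t) \<partial>gauss h) * indicator A w = ennreal (indicator A w * J (Y w t))"
   by (simp add: indicator_def)
 qed
 also have "\<dots> = ennreal (LINT w|M. indicator A w * J (Y w t))"
  by (rule nn_integral_eq_integral[OF iJ]) (use Jb adm_Y[OF _ t] in \<open>auto intro!: AE_I2 mult_nonneg_nonneg\<close>)
 finally show ?g2
  by (subst (asm) ennreal_inj) (auto intro!: Bochner_Integration.integral_nonneg mult_nonneg_nonneg Jb adm_Y t)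
qed

text \<open>The second moment of \<xi> t(\<phi>) on \<open>A\<close> has the mean of the squared
  covariance on \<open>A\<close> as derivative in t, by \<open>second_moment_step\<close> and
  \<open>local_variance\<close>; \<open>integral_of_local_increments\<close> integrates this. The
  bound on \<rho> enters through the constant of \<open>local_variance\<close>.\<close>

lemma isometry_bounded:
 assumes \<phi>[measurable]: "\<phi> \<in> borel_measurable borel" and L: "\<And>x. \<bar>\<phi> x\<bar> <= L" and C: "\<And>x. \<bar>\<rho> x\<bar> <= C"
  and s: "0 < s" "s <= T" and A: "A \<in> sets (F s)"
 shows "integrable MT (\<lambda>p. indicator A (fst p) * (indicator {s..T} (snd p) * (HY \<phi> p)^2))" (is ?g1)
  "(LINT p|MT. indicator A (fst p) * (indicator {s..T} (snd p) * (HY \<phi> p)^2))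
   = (LINT w|M. indicator A w * (cE \<phi> w T)^2) - (LINT w|M. indicator A w * (cE \<phi> w s)^2)" (is ?g2)
proof -
 interpret P: pair_sigma_finite M lborel ..
 have AM[measurable]: "A \<in> events" using F_events[of s A] A s by simp
 have L0: "0 <= L" and C0: "0 <= C" using L[of undefined] C[of undefined] by linarith+
 define B0 where "B0 = (2 * L * C)^2"
 have Hb: "(Hc \<phi> t y)^2 <= B0" if "0 < t" for t y
 proof -
  have a: "adm t y" using that by (simp add: adm_def)
  have "\<bar>pE (\<lambda>x. \<phi> x * \<rho> x) t y\<bar> <= L * C" by (rule pE_bounded[OF _ _ a]) (auto simp: abs_mult intro!: mult_mono L C L0)
  moreover have "\<bar>pE \<phi> t y * pE \<rho> t y\<bar> <= L * C" unfolding abs_mult by (intro mult_mono pE_bounded[OF _ _ a] L C L0) auto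
  ultimately have "\<bar>Hc \<phi> t y\<bar> <= 2 * L * C" unfolding Hc_def by linarith
  from power_mono[OF this, of 2] show ?thesis by (simp add: B0_def)
 qed
 note pf = pathfun_power2[OF Hc_pathfun[OF \<phi> L]]
 define q where "q t = (LINT w|M. indicator A w * (cE \<phi> w t)^2)" for t
 define \<kappa> where "\<kappa> t = (LINT w|M. indicator A w * (Hc \<phi> t (Y w t))^2)" for t
 have Hm: "(\<lambda>w. (Hc \<phi> t (Y w t))^2) \<in> borel_measurable M" if "0 < t" for t
  using from_F[OF _ pathfun_meas_F[OF pf that]] that by simp
 have iH: "integrable M (\<lambda>w. indicator A w * (Hc \<phi> t (Y w t))^2)" if t: "0 < t" for t
  by (rule integrable_const_bound[where B=B0]) (use Hb[OF t] Hm[OF t] in \<open>auto simp: indicator_def B0_def intro!: AE_I2\<close>)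
 have iN: "integrable M (\<lambda>w. indicator A w * (cE \<phi> w t)^2)" if t: "0 < t" for t
 proof (rule integrable_const_bound[where B="L^2"])
  show "AE w in M. norm (indicator A w * (cE \<phi> w t)^2) <= L^2"
  proof (rule AE_I2)
   fix w assume "w \<in> space M"
   then have "\<bar>cE \<phi> w t\<bar> <= L" by (intro pE_bounded[OF _ L adm_Y]) (use t in auto)
   from power_mono[OF this, of 2] show "norm (indicator A w * (cE \<phi> w t)^2) <= L^2" by (simp add: indicator_def)
  qed
  show "(\<lambda>w. indicator A w * (cE \<phi> w t)^2) \<in> borel_measurable M"
   using from_F[OF less_imp_le[OF t] pE_meas_F[OF less_imp_le[OF t] \<phi>]] by measurable
 qed
 obtain K where K: "\<And>\<nu> h. prob_space \<nu> ==> sets \<nu> = sets borel ==> 0 < h ==> h <= 1 ==>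
  \<bar>(LINT dy|gauss h. (LINT x|\<nu>. \<phi> x * tw (\<rho> x) h dy)^2 / (LINT x|\<nu>. tw (\<rho> x) h dy)) - (LINT x|\<nu>. \<phi> x)\<^sup>2
   - h * ((LINT x|\<nu>. \<phi> x * \<rho> x) - (LINT x|\<nu>. \<phi> x) * (LINT x|\<nu>. \<rho> x))\<^sup>2\<bar> <= K * (h * sqrt h)"
  using local_variance[OF rho_meas \<phi> C L] by blast
 have \<kappa>c: "continuous_on {s..T} \<kappa>" unfolding continuous_on_sequentially comp_def
  proof (intro allI ballI impI)
   fix u and t assume t: "t \<in> {s..T}" and u: "(\<forall>n. u n \<in> {s..T}) \<and> u \<longlonglongrightarrow> t"
   have up: "0 < u n" for n using u s by (meson atLeastAtMost_iff less_le_trans)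
   have tp: "0 < t" using t s by auto
   show "(\<lambda>n. \<kappa> (u n)) \<longlonglongrightarrow> \<kappa> t" unfolding \<kappa>_def
   proof (rule integral_dominated_convergence[where w="\<lambda>_. B0"])
    show "AE w in M. (\<lambda>n. indicator A w * (Hc \<phi> (u n) (Y w (u n)))^2) \<longlonglongrightarrow> indicator A w * (Hc \<phi> t (Y w t))^2"
    proof (rule AE_I2)
     fix w assume dy: "w \<in> space M"
     have "(\<lambda>n. (Hc \<phi> (u n) (Y w (u n)))^2) \<longlonglongrightarrow> (Hc \<phi> t (Y w t))\<^sup>2"
      by (rule continuous_on_tendsto_compose[OF pathfun_cont[OF pf dy s(1), of T]]) (use u t in auto)
     then show "(\<lambda>n. indicator A w * (Hc \<phi> (u n) (Y w (u n)))^2) \<longlonglongrightarrow> indicator A w * (Hc \<phi> t (Y w t))^2"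
      by (intro tendsto_mult tendsto_const)
    qed
    show "AE w in M. norm (indicator A w * (Hc \<phi> (u n) (Y w (u n)))^2) <= B0" for n
     using Hb[OF up] by (auto simp: indicator_def B0_def intro!: AE_I2)
   qed (use Hm[OF tp] Hm[OF up] in auto)
  qed
 have main: "integral {s..T} \<kappa> = q T - q s"
 proof (rule integral_of_local_increments[OF \<kappa>c s(2), where K=K])
  fix t h :: real assume t: "s <= t" and h: "0 < h" "h <= 1" "t + h <= T"
  have t0: "0 < t" "0 <= t" using t s by auto
  have At: "A \<in> sets (F t)" using A F_mono[OF t] by auto
  define J where "J y = (LINT dy|gauss h. (LINT x|post t y. \<phi> x * tw (\<rho> x) h dy)^2 / (LINT x|post t y. tw (\<rho> x) h dy))" for y
  note sm = second_moment_step[OF \<phi> L t0(2) h(1) At, folded J_def]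
  have "q (t + h) - q t - h * \<kappa> t = (LINT w|M. indicator A w * J (Y w t)) - (LINT w|M. indicator A w * (cE \<phi> w t)^2)
    - h * (LINT w|M. indicator A w * (Hc \<phi> t (Y w t))^2)" unfolding q_def \<kappa>_def sm(2) ..
  also have "\<dots> = (LINT w|M. indicator A w * J (Y w t) - indicator A w * (cE \<phi> w t)^2 - h * (indicator A w * (Hc \<phi> t (Y w t))^2))"
   using sm(1) iN[OF t0(1)] iH[OF t0(1)] by simp
  also have "\<bar>\<dots>\<bar> <= K * (h * sqrt h)"
  proof (rule abs_expectation_le)
   show "(\<lambda>w. indicator A w * J (Y w t) - indicator A w * (cE \<phi> w t)^2 - h * (indicator A w * (Hc \<phi> t (Y w t))^2)) \<in> borel_measurable M"
    using borel_measurable_integrable[OF sm(1)] borel_measurable_integrable[OF iN[OF t0(1)]] borel_measurable_integrable[OF iH[OF t0(1)]] by measurable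
   fix w assume dy: "w \<in> space M"
   have k: "\<bar>J (Y w t) - (cE \<phi> w t)^2 - h * (Hc \<phi> t (Y w t))\<^sup>2\<bar> <= K * (h * sqrt h)"
    using K[OF prob_space_post[OF adm_Y[OF dy t0(2)]] sets_post h(1,2)] by (simp add: J_def Hc_def pE_def)
   then show "\<bar>indicator A w * J (Y w t) - indicator A w * (cE \<phi> w t)^2 - h * (indicator A w * (Hc \<phi> t (Y w t))^2)\<bar> <= K * (h * sqrt h)"
    using order_trans[OF abs_ge_zero k] by (cases "w \<in> A") auto
  qed
  finally show "\<bar>q (t + h) - q t - h * \<kappa> t\<bar> <= K * (h * sqrt h)" .
 qed
 define f where "f w r = indicator A w * (indicator {s..T} r * (Hc \<phi> r (Y w r))^2)" for w r
 have fm: "case_prod f \<in> borel_measurable MT"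
  unfolding f_def case_prod_beta' using pathfun_meas_pair(2)[OF pf s] by measurable
 have "(\<integral>\<^sup>+p. ennreal (norm (case_prod f p)) \<partial>MT) = (\<integral>\<^sup>+r. (\<integral>\<^sup>+w. ennreal (norm (f w r)) \<partial>M) \<partial>lborel)"
  using fm by (subst P.nn_integral_snd[symmetric]) (simp_all add: case_prod_beta')
 also have "\<dots> <= (\<integral>\<^sup>+r. ennreal B0 * indicator {s..T} r \<partial>lborel)"
 proof (rule nn_integral_mono)
  fix r
  have "(\<integral>\<^sup>+w. ennreal (norm (f w r)) \<partial>M) <= (\<integral>\<^sup>+w. ennreal B0 * indicator {s..T} r \<partial>M)"
   using Hb s by (intro nn_integral_mono) (auto simp: f_def indicator_def intro!: ennreal_leI)
  then show "(\<integral>\<^sup>+w. ennreal (norm (f w r)) \<partial>M) <= ennreal B0 * indicator {s..T} r"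
   using emeasure_space_1 by simp
 qed
 also have "\<dots> < \<infinity>" using s by (simp add: nn_integral_cmult_indicator ennreal_mult_less_top)
 finally have fi: "integrable MT (case_prod f)" using fm by (intro integrableI_bounded)
 then show ?g1
  by (simp add: f_def case_prod_beta')
 have "integral\<^sup>L MT (case_prod f) = (LINT r|lborel. (LINT w|M. f w r))"
  using P.integral_snd[OF fi] by simp
 also have "\<dots> = (LINT r|lborel. indicator {s..T} r * \<kappa> r)"
  by (intro Bochner_Integration.integral_cong) (auto simp: f_def \<kappa>_def indicator_def)
 also have "\<dots> = q T - q s"
  using main integral_indicator_Icc(2)[OF \<kappa>c] by simp
 finally show ?g2
  by (simp add: f_def case_prod_beta' q_def)
qed

end

section \<open>The isometry for unbounded \<rho>\<close>

context bm_filter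
begin

text \<open>Large values are sent to 0 rather than clamped: there the weight becomes
  \<open>tw 0 t y = 1\<close>, which bounds the truncated integrands by the original ones plus a
  constant.\<close>

definition rcut :: "nat => 'a => real" where
 "rcut n x = (if \<bar>\<rho> x\<bar> <= real n then \<rho> x else 0)"

lemma rcut_meas [measurable]: "rcut n \<in> borel_measurable borel"
 unfolding rcut_def by measurable

lemma rcut_filter: "bm_filter M X B (rcut n)"
 by unfold_locales measurable

lemma rcut_eq: "\<bar>\<rho> x\<bar> <= real n ==> rcut n x = \<rho> x"
 by (simp add: rcut_def)

lemma rcut_tendsto_Zf:
 assumes m: "mild \<psi>" and [measurable]: "\<And>n. \<psi>n n \<in> borel_measurable borel"
  and e: "\<And>n x. \<bar>\<rho> x\<bar> <= real n ==> \<psi>n n x = \<psi> x" and b: "\<And>n x. real n < \<bar>\<rho> x\<bar> ==> \<bar>\<psi>n n x\<bar> <= D"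
  and D: "0 <= D" and t: "0 < t"
 shows "(\<lambda>n. bm_filter.Zf M X (rcut n) (\<psi>n n) t y) \<longlonglongrightarrow> Zf \<psi> t y"
proof -
 interpret T: bm_filter M X B "rcut n" for n by (rule rcut_filter)
 interpret mu: prob_space \<mu> by (rule prob_space_mu)
 note [measurable] = mild_meas[OF m]
 show ?thesis unfolding T.Zf_def Zf_def
 proof (rule integral_dominated_convergence[where w="\<lambda>x. \<bar>\<psi> x * tw (\<rho> x) t y\<bar> + D"])
  show "integrable \<mu> (\<lambda>x. \<bar>\<psi> x * tw (\<rho> x) t y\<bar> + D)" using mild_integrable_tw[OF m t, of y] by auto
  show "AE x in \<mu>. (\<lambda>n. \<psi>n n x * tw (rcut n x) t y) \<longlonglongrightarrow> \<psi> x * tw (\<rho> x) t y"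
  proof (rule AE_I2)
   fix x
   obtain N :: nat where N: "\<bar>\<rho> x\<bar> <= real N" using real_arch_simple by blast
   have "\<forall>\<^sub>F n in sequentially. \<psi> x * tw (\<rho> x) t y = \<psi>n n x * tw (rcut n x) t y"
    using eventually_ge_at_top[of N]
   proof eventually_elim
    case (elim n)
    then have "\<bar>\<rho> x\<bar> <= real n" using N by linarith
    then show ?case by (simp add: e rcut_eq)
   qed
   then show "(\<lambda>n. \<psi>n n x * tw (rcut n x) t y) \<longlonglongrightarrow> \<psi> x * tw (\<rho> x) t y" by (rule tendsto_eventually[OF eventually_mono]) simp
  qed
  show "AE x in \<mu>. norm (\<psi>n n x * tw (rcut n x) t y) <= \<bar>\<psi> x * tw (\<rho> x) t y\<bar> + D" for n
  proof (rule AE_I2)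
   fix x
   have tw0: "tw 0 t y = 1" by (simp add: tw_def)
   show "norm (\<psi>n n x * tw (rcut n x) t y) <= \<bar>\<psi> x * tw (\<rho> x) t y\<bar> + D"
    using e[of x n] b[of n x] D by (cases "\<bar>\<rho> x\<bar> <= real n") (auto simp: rcut_def tw0 intro: add_increasing)
  qed
 qed measurable
qed

lemma rcut_tendsto_pE:
 assumes m: "mild \<psi>" and meas: "\<And>n. \<psi>n n \<in> borel_measurable borel"
  and e: "\<And>n x. \<bar>\<rho> x\<bar> <= real n ==> \<psi>n n x = \<psi> x" and b: "\<And>n x. real n < \<bar>\<rho> x\<bar> ==> \<bar>\<psi>n n x\<bar> <= D"
  and D: "0 <= D" and t: "0 < t"
 shows "(\<lambda>n. bm_filter.pE M X (rcut n) (\<psi>n n) t y) \<longlonglongrightarrow> pE \<psi> t y"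
proof -
 interpret T: bm_filter M X B "rcut n" for n by (rule rcut_filter)
 have z: "(\<lambda>n. T.Z n t y) \<longlonglongrightarrow> Z t y" unfolding T.Z_Zf Z_Zf
  by (rule rcut_tendsto_Zf[OF mild_one, where D=1]) (use t in auto)
 have "Z t y \<noteq> 0" using Z_pos[of t y] t by (auto simp: adm_def)
 then have "(\<lambda>n. T.Zf n (\<psi>n n) t y / T.Z n t y) \<longlonglongrightarrow> Zf \<psi> t y / Z t y"
  by (intro tendsto_divide z rcut_tendsto_Zf[OF m meas e b D t])
 then show ?thesis by (simp add: pE_Zf[OF mild_meas[OF m] t] T.pE_Zf[OF meas t])
qed

text \<open>Truncate \<rho> and keep \<open>X\<close> and \<open>B\<close>. At each sample point the
  truncated observation eventually equals \<open>Y\<close>, so the integrands converge pointwise.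
  The convergence of their integrals is \<open>pratt\<close>, with dominators from
  \<open>Hc_square_le\<close> whose integrals reduce by Bayes to the mean of the truncated
  \<rho>(X)^2 on the cut.\<close>

lemma isometry_cut:
 assumes \<phi>[measurable]: "\<phi> \<in> borel_measurable borel" and L: "\<And>x. \<bar>\<phi> x\<bar> <= L" and s: "0 < s" "s <= u"
 shows "integrable MT (\<lambda>p. indicator (cut s K) (fst p) * (indicator {s..u} (snd p) * (HY \<phi> p)^2))" (is ?g1)
  "(LINT p|MT. indicator (cut s K) (fst p) * (indicator {s..u} (snd p) * (HY \<phi> p)^2))
   = (LINT w|M. indicator (cut s K) w * (cE \<phi> w u)^2) - (LINT w|M. indicator (cut s K) w * (cE \<phi> w s)^2)" (is ?g2)
proof -
 interpret P: pair_sigma_finite M lborel ..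
 interpret T: bm_filter M X B "rcut n" for n by (rule rcut_filter)
 have L0: "0 <= L" using L[of undefined] by linarith
 have bn: "\<bar>rcut n x\<bar> <= real n" for n x by (simp add: rcut_def)
 have s0: "0 <= s" using s by simp
 have cutM: "cut s K \<in> events" using F_events[OF s0 cut_F[OF s0]] .
 have TcutF: "T.cut n s K \<in> sets (T.F n s)" for n by (rule T.cut_F[OF s0])
 have TcutM: "T.cut n s K \<in> events" for n using T.F_events[OF s0 TcutF] .
 define f where "f n p = indicator (T.cut n s K) (fst p) * (indicator {s..u} (snd p) * (T.Hc n \<phi> (snd p) (T.Y n (fst p) (snd p)))^2)" for n p
 define f' where "f' p = indicator (cut s K) (fst p) * (indicator {s..u} (snd p) * (HY \<phi> p)^2)" for p
 define g where "g n p = (4 * L^2) * (indicator (T.cut n s K) (fst p) * (indicator {s..u} (snd p) * T.pE n (\<lambda>x. (rcut n x)^2) (snd p) (T.Y n (fst p) (snd p))))" for n p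
 define g' where "g' p = (4 * L^2) * (indicator (cut s K) (fst p) * (indicator {s..u} (snd p) * cE (\<lambda>x. (\<rho> x)^2) (fst p) (snd p)))" for p
 have cb: "\<bar>indicator A w\<bar> <= 1 * (indicator A w :: real)" for A and w :: 'w by simp
 have cF: "indicator (cut s K) \<in> borel_measurable (F s)" using cut_F[OF s0] by simp
 have TcF: "indicator (T.cut n s K) \<in> borel_measurable (T.F n s)" for n using TcutF by simp
 note FB = Fubini_bayes[OF s(1) order_refl s(2) cF cb mild_rho2]
 note TFB = T.Fubini_bayes[OF s(1) order_refl s(2) TcF cb T.mild_rho2]
 have ev: "\<forall>\<^sub>F n in sequentially. rcut n (X w) = \<rho> (X w)" for w
 proof -
  obtain N :: nat where N: "\<bar>\<rho> (X w)\<bar> <= real N" using real_arch_simple by blast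
  show ?thesis using eventually_ge_at_top[of N] by eventually_elim (rule rcut_eq, use N in linarith)
 qed
 have evY: "\<forall>\<^sub>F n in sequentially. T.Y n w = Y w \<and> (w \<in> T.cut n s K \<longleftrightarrow> w \<in> cut s K)" for w
  using ev[of w] by eventually_elim (auto simp: fun_eq_iff T.Y_def Y_def T.cut_def cut_def)
 have limpE: "(\<lambda>n. T.pE n \<phi> t y) \<longlonglongrightarrow> pE \<phi> t y" if "0 < t" for t y
  by (rule rcut_tendsto_pE[OF mild_bounded[OF \<phi> L], where D=L]) (use L L0 that in auto)
 have limr: "(\<lambda>n. T.pE n (rcut n) t y) \<longlonglongrightarrow> pE \<rho> t y" if "0 < t" for t y
  by (rule rcut_tendsto_pE[OF mild_rho, where D=0]) (use that in \<open>auto simp: rcut_def\<close>)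
 have limpr: "(\<lambda>n. T.pE n (\<lambda>x. \<phi> x * rcut n x) t y) \<longlonglongrightarrow> pE (\<lambda>x. \<phi> x * \<rho> x) t y" if "0 < t" for t y
  by (rule rcut_tendsto_pE[OF mild_mult_rho[OF \<phi> L], where D=0]) (use that in \<open>auto simp: rcut_def\<close>)
 have limr2: "(\<lambda>n. T.pE n (\<lambda>x. (rcut n x)^2) t y) \<longlonglongrightarrow> pE (\<lambda>x. (\<rho> x)^2) t y" if "0 < t" for t y
  by (rule rcut_tendsto_pE[OF mild_rho2, where D=0]) (use that in \<open>auto simp: rcut_def\<close>)
 have limH: "(\<lambda>n. T.Hc n \<phi> t y) \<longlonglongrightarrow> Hc \<phi> t y" if "0 < t" for t y
  unfolding T.Hc_def Hc_def by (intro tendsto_diff tendsto_mult limpr limpE limr that)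
 have f'm: "f' \<in> borel_measurable MT"
  unfolding f'_def using pathfun_meas_pair(2)[OF pathfun_power2[OF Hc_pathfun[OF \<phi> L]] s] cutM by measurable
 have if': "integrable MT (f n)" for n unfolding f_def by (rule T.isometry_bounded(1)[OF \<phi> L bn s TcutF])
 have ig: "integrable MT (g n)" for n unfolding g_def by (rule integrable_mult_right[OF TFB(2)])
 have ig': "integrable MT g'" unfolding g'_def by (rule integrable_mult_right[OF FB(2)])
 have fg: "AE p in MT. 0 <= f n p \<and> f n p <= g n p" for n
 proof (rule AE_I2)
  fix p
  have "(T.Hc n \<phi> (snd p) (T.Y n (fst p) (snd p)))^2 <= 4 * L^2 * T.pE n (\<lambda>x. (rcut n x)^2) (snd p) (T.Y n (fst p) (snd p))" if "snd p \<in> {s..u}"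
   using that s by (intro T.Hc_square_le[OF \<phi> L]) auto
  then show "0 <= f n p \<and> f n p <= g n p" by (auto simp: f_def g_def indicator_def)
 qed
 have lf: "AE p in MT. (\<lambda>n. f n p) \<longlonglongrightarrow> f' p"
 proof (rule AE_I2)
  fix p
  show "(\<lambda>n. f n p) \<longlonglongrightarrow> f' p"
  proof (cases "snd p \<in> {s..u}")
   case True
   then have "0 < snd p" using s by auto
   then have "(\<lambda>n. indicator (cut s K) (fst p) * (indicator {s..u} (snd p) * (T.Hc n \<phi> (snd p) (Y (fst p) (snd p)))^2)) \<longlonglongrightarrow> f' p"
    unfolding f'_def by (intro tendsto_mult tendsto_const tendsto_power limH)
   moreover have "\<forall>\<^sub>F n in sequentially. indicator (cut s K) (fst p) * (indicator {s..u} (snd p) * (T.Hc n \<phi> (snd p) (Y (fst p) (snd p)))^2) = f n p"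
    using evY[of "fst p"] by eventually_elim (simp add: f_def indicator_def)
   ultimately show ?thesis by (rule Lim_transform_eventually)
  qed (simp add: f_def f'_def)
 qed
 have lg: "AE p in MT. (\<lambda>n. g n p) \<longlonglongrightarrow> g' p"
 proof (rule AE_I2)
  fix p
  show "(\<lambda>n. g n p) \<longlonglongrightarrow> g' p"
  proof (cases "snd p \<in> {s..u}")
   case True
   then have "0 < snd p" using s by auto
   then have "(\<lambda>n. (4 * L^2) * (indicator (cut s K) (fst p) * (indicator {s..u} (snd p) * T.pE n (\<lambda>x. (rcut n x)^2) (snd p) (Y (fst p) (snd p))))) \<longlonglongrightarrow> g' p"
    unfolding g'_def by (intro tendsto_mult tendsto_const tendsto_power limr2)
   moreover have "\<forall>\<^sub>F n in sequentially. (4 * L^2) * (indicator (cut s K) (fst p) * (indicator {s..u} (snd p) * T.pE n (\<lambda>x. (rcut n x)^2) (snd p) (Y (fst p) (snd p)))) = g n p"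
    using evY[of "fst p"] by eventually_elim (simp add: g_def indicator_def)
   ultimately show ?thesis by (rule Lim_transform_eventually)
  qed (simp add: g_def g'_def)
 qed
 have Ig: "integral\<^sup>L MT (g n) = (4 * L^2) * ((u - s) * (LINT w|M. indicator (T.cut n s K) w * (rcut n (X w))^2))" for n
  unfolding g_def integral_mult_right_zero P.integral_fst'[OF TFB(2), symmetric] TFB(4)[symmetric] by (simp add: T.pint_def)
 have Ig': "integral\<^sup>L MT g' = (4 * L^2) * ((u - s) * (LINT w|M. indicator (cut s K) w * (\<rho> (X w))^2))"
  unfolding g'_def integral_mult_right_zero P.integral_fst'[OF FB(2), symmetric] FB(4)[symmetric] by (simp add: pint_def)
 have lr: "(\<lambda>n. \<integral>w. indicator (T.cut n s K) w * (rcut n (X w))^2 \<partial>M) \<longlonglongrightarrow> (LINT w|M. indicator (cut s K) w * (\<rho> (X w))^2)"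
 proof (rule integral_dominated_convergence[where w="\<lambda>w. indicator (cut s K) w * (\<rho> (X w))^2"])
  show "integrable M (\<lambda>w. indicator (cut s K) w * (\<rho> (X w))^2)" by (rule integrable_cut_rho2[OF s(1)])
  show "AE w in M. (\<lambda>n. indicator (T.cut n s K) w * (rcut n (X w))^2) \<longlonglongrightarrow> indicator (cut s K) w * (\<rho> (X w))^2"
  proof (rule AE_I2)
   fix w
   have "\<forall>\<^sub>F n in sequentially. indicator (T.cut n s K) w * (rcut n (X w))^2 = indicator (cut s K) w * (\<rho> (X w))^2"
    using evY[of w] ev[of w] by eventually_elim (simp add: indicator_def)
   then show "(\<lambda>n. indicator (T.cut n s K) w * (rcut n (X w))^2) \<longlonglongrightarrow> indicator (cut s K) w * (\<rho> (X w))^2" by (rule tendsto_eventually)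
  qed
  \<comment> \<open>If |\<rho>(X)| <= n, the two observations coincide and so do the cuts; otherwise
    the truncated value is 0.\<close>
  show "AE w in M. norm (indicator (T.cut n s K) w * (rcut n (X w))^2) <= indicator (cut s K) w * (\<rho> (X w))^2" for n
  proof (rule AE_I2)
   fix w
   show "norm (indicator (T.cut n s K) w * (rcut n (X w))^2) <= indicator (cut s K) w * (\<rho> (X w))^2"
    by (cases "\<bar>\<rho> (X w)\<bar> <= real n") (auto simp: rcut_def T.cut_def cut_def T.Y_def Y_def indicator_def)
  qed
 qed (use cutM TcutM in measurable)
 have li: "(\<lambda>n. integral\<^sup>L MT (g n)) \<longlonglongrightarrow> integral\<^sup>L MT g'"
  unfolding Ig Ig' by (intro tendsto_mult tendsto_const lr)
 note pr = pratt[OF if' ig ig' f'm fg lf lg li]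
 show ?g1
  using pr(1) unfolding f'_def .
 have lN: "(\<lambda>n. \<integral>w. indicator (T.cut n s K) w * (T.pE n \<phi> t (T.Y n w t))^2 \<partial>M) \<longlonglongrightarrow> (LINT w|M. indicator (cut s K) w * (cE \<phi> w t)^2)"
  if t: "0 < t" for t
 proof (rule integral_dominated_convergence[where w="\<lambda>w. L^2"])
  have t0: "0 <= t" using t by simp
  show "AE w in M. (\<lambda>n. indicator (T.cut n s K) w * (T.pE n \<phi> t (T.Y n w t))^2) \<longlonglongrightarrow> indicator (cut s K) w * (cE \<phi> w t)^2"
  proof (rule AE_I2)
   fix w
   have "(\<lambda>n. indicator (cut s K) w * (T.pE n \<phi> t (Y w t))^2) \<longlonglongrightarrow> indicator (cut s K) w * (cE \<phi> w t)^2"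
    by (intro tendsto_mult tendsto_const tendsto_power limpE t)
   moreover have "\<forall>\<^sub>F n in sequentially. indicator (cut s K) w * (T.pE n \<phi> t (Y w t))^2 = indicator (T.cut n s K) w * (T.pE n \<phi> t (T.Y n w t))^2"
    using evY[of w] by eventually_elim (simp add: indicator_def)
   ultimately show "(\<lambda>n. indicator (T.cut n s K) w * (T.pE n \<phi> t (T.Y n w t))^2) \<longlonglongrightarrow> indicator (cut s K) w * (cE \<phi> w t)^2"
    by (rule Lim_transform_eventually)
  qed
  show "AE w in M. norm (indicator (T.cut n s K) w * (T.pE n \<phi> t (T.Y n w t))^2) <= L^2" for n
  proof (rule AE_I2)
   fix w assume "w \<in> space M"
   then have "\<bar>T.pE n \<phi> t (T.Y n w t)\<bar> <= L" by (intro T.pE_bounded[OF \<phi> L T.adm_Y] t0)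
   from power_mono[OF this, of 2] show "norm (indicator (T.cut n s K) w * (T.pE n \<phi> t (T.Y n w t))^2) <= L^2" by (simp add: indicator_def)
  qed
  show "(\<lambda>w. indicator (cut s K) w * (cE \<phi> w t)^2) \<in> borel_measurable M"
   using from_F[OF t0 pE_meas_F[OF t0 \<phi>]] cutM by measurable
  show "(\<lambda>w. indicator (T.cut n s K) w * (T.pE n \<phi> t (T.Y n w t))^2) \<in> borel_measurable M" for n
   using T.from_F[OF t0 T.pE_meas_F[OF t0 \<phi>]] TcutM[of n] by measurable
 qed simp
 have u: "0 < u" using s by simp
 have "(\<lambda>n. integral\<^sup>L MT (f n)) \<longlonglongrightarrow> (LINT w|M. indicator (cut s K) w * (cE \<phi> w u)^2) - (LINT w|M. indicator (cut s K) w * (cE \<phi> w s)^2)"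
  unfolding f_def T.isometry_bounded(2)[OF \<phi> L bn s TcutF] by (intro tendsto_diff lN u s)
 from LIMSEQ_unique[OF pr(2) this]
 show ?g2
  unfolding f'_def .
qed

lemma cut_incseq: "incseq (\<lambda>n. cut s (real n))"
 unfolding incseq_def cut_def by auto

lemma cut_tendsto: "w \<in> space M ==> (\<lambda>n. indicator (cut s (real n)) w :: real) \<longlonglongrightarrow> 1"
proof -
 assume dy: "w \<in> space M"
 obtain N :: nat where N: "\<bar>Y w s\<bar> <= real N" using real_arch_simple by blast
 have "\<forall>\<^sub>F n in sequentially. indicator (cut s (real n)) w = (1 :: real)"
  using eventually_ge_at_top[of N] by eventually_elim (use N dy in \<open>auto simp: cut_def indicator_def\<close>)
 then show ?thesis by (rule tendsto_eventually)
qed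

text \<open>The cuts increase to the whole space: monotone convergence on the left, bounded
  convergence on the right.\<close>

lemma isometry:
 assumes \<phi>[measurable]: "\<phi> \<in> borel_measurable borel" and L: "\<And>x. \<bar>\<phi> x\<bar> <= L" and s: "0 < s" "s <= u"
 shows "integrable MT (\<lambda>p. indicator {s..u} (snd p) * (HY \<phi> p)^2)" (is ?g1)
  "(LINT p|MT. indicator {s..u} (snd p) * (HY \<phi> p)^2)
   = (LINT w|M. (cE \<phi> w u)^2) - (LINT w|M. (cE \<phi> w s)^2)" (is ?g2)
proof -
 define f where "f n p = indicator (cut s (real n)) (fst p) * (indicator {s..u} (snd p) * (HY \<phi> p)^2)" for n p
 define f' where "f' p = indicator {s..u} (snd p) * (HY \<phi> p)^2" for p
 have s0: "0 <= s" using s by simp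
 have cutM: "cut s K \<in> events" for K using F_events[OF s0 cut_F[OF s0]] .
 have f'm: "f' \<in> borel_measurable MT"
  unfolding f'_def by (rule pathfun_meas_pair(2)[OF pathfun_power2[OF Hc_pathfun[OF \<phi> L]] s])
 have lN: "(\<lambda>n. \<integral>w. indicator (cut s (real n)) w * (cE \<phi> w t)^2 \<partial>M) \<longlonglongrightarrow> (LINT w|M. (cE \<phi> w t)^2)" if t: "0 <= t" for t
 proof (rule integral_dominated_convergence[where w="\<lambda>w. L^2"])
  show "AE w in M. (\<lambda>n. indicator (cut s (real n)) w * (cE \<phi> w t)^2) \<longlonglongrightarrow> (cE \<phi> w t)\<^sup>2"
  proof (rule AE_I2)
   fix w assume "w \<in> space M"
   from tendsto_mult[OF cut_tendsto[OF this, of s] tendsto_const, of "(cE \<phi> w t)^2"]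
   show "(\<lambda>n. indicator (cut s (real n)) w * (cE \<phi> w t)^2) \<longlonglongrightarrow> (cE \<phi> w t)\<^sup>2" by simp
  qed
  show "AE w in M. norm (indicator (cut s (real n)) w * (cE \<phi> w t)^2) <= L^2" for n
  proof (rule AE_I2)
   fix w assume "w \<in> space M"
   then have "\<bar>cE \<phi> w t\<bar> <= L" by (intro pE_bounded[OF \<phi> L adm_Y] t)
   from power_mono[OF this, of 2] show "norm (indicator (cut s (real n)) w * (cE \<phi> w t)^2) <= L^2" by (simp add: indicator_def)
  qed
 qed (use from_F[OF t pE_meas_F[OF t \<phi>]] cutM in measurable)
 have inc: "AE p in MT. mono (\<lambda>n. f n p)"
  using cut_incseq[of s] by (intro AE_I2) (auto simp: f_def mono_def incseq_def indicator_def le_fun_def intro!: mult_right_mono)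
 have lim: "AE p in MT. (\<lambda>n. f n p) \<longlonglongrightarrow> f' p"
 proof (rule AE_I2)
  fix p assume "p \<in> space MT"
  then have "fst p \<in> space M" by (auto simp: space_pair_measure)
  from tendsto_mult[OF cut_tendsto[OF this, of s] tendsto_const, of "f' p"]
  show "(\<lambda>n. f n p) \<longlonglongrightarrow> f' p" by (simp add: f_def f'_def)
 qed
 have i: "integrable MT (f n)" for n unfolding f_def by (rule isometry_cut(1)[OF \<phi> L s])
 have li: "(\<lambda>n. integral\<^sup>L MT (f n)) \<longlonglongrightarrow> (LINT w|M. (cE \<phi> w u)^2) - (LINT w|M. (cE \<phi> w s)^2)"
  unfolding f_def isometry_cut(2)[OF \<phi> L s] by (intro tendsto_diff lN) (use s in auto)
 show ?g1
  using integrable_monotone_convergence[OF i inc lim li f'm] unfolding f'_def .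
 show ?g2
  using integral_monotone_convergence[OF i inc lim li f'm] unfolding f'_def .
qed

end

section \<open>Square integrable martingales and the mixed moment with the innovation\<close>

lemma integrable_mult_L2:
 fixes f g :: "'a => real"
 assumes [measurable]: "f \<in> borel_measurable M" "g \<in> borel_measurable M"
  and "integrable M (\<lambda>x. (f x)^2)" "integrable M (\<lambda>x. (g x)^2)"
 shows "integrable M (\<lambda>x. f x * g x)"
proof (rule Bochner_Integration.integrable_bound[OF Bochner_Integration.integrable_add[OF assms(3,4)]])
 have "\<bar>a * b\<bar> <= a^2 + b^2" for a b :: real
 proof -
  have "0 <= (\<bar>a\<bar> - \<bar>b\<bar>)^2" by simp
  also have "\<dots> = a^2 + b^2 - 2 * (\<bar>a\<bar> * \<bar>b\<bar>)" by (simp add: power2_diff)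
  finally show ?thesis using mult_nonneg_nonneg[OF abs_ge_zero[of a] abs_ge_zero[of b]] unfolding abs_mult by linarith
 qed
 then show "AE x in M. norm (f x * g x) <= norm ((f x)^2 + (g x)^2)" by (intro AE_I2) simp
qed measurable

context bm_filter
begin

lemma bounded_post:
 fixes \<phi> :: "'a => real"
 assumes "\<phi> \<in> borel_measurable borel" "\<And>x. \<bar>\<phi> x\<bar> <= L" "w \<in> space M" "0 <= t"
 shows "integrable (\<xi> w t) \<phi>"
 unfolding \<xi>_def by (rule bounded_integrable_post[OF assms(1,2) adm_Y[OF assms(3,4)]])

lemma N_bounded: "\<phi> \<in> borel_measurable borel ==> (\<And>x. \<bar>\<phi> x\<bar> <= L) ==> w \<in> space M ==> 0 <= t ==> \<bar>cE \<phi> w t\<bar> <= L"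
 by (rule pE_bounded[OF _ _ adm_Y])

lemma integrable_mult_bounded:
 fixes g f :: "'w => real"
 assumes g: "integrable M g" and [measurable]: "f \<in> borel_measurable M" and b: "\<And>w. w \<in> space M ==> \<bar>f w\<bar> <= c"
 shows "integrable M (\<lambda>w. g w * f w)"
proof (rule Bochner_Integration.integrable_bound[OF integrable_mult_right[OF g, of c]])
 have [measurable]: "g \<in> borel_measurable M" using g by simp
 show "(\<lambda>w. g w * f w) \<in> borel_measurable M" by measurable
 show "AE w in M. norm (g w * f w) <= norm (c * g w)"
 proof (rule AE_I2)
  fix w assume "w \<in> space M"
  then have "\<bar>g w\<bar> * \<bar>f w\<bar> <= \<bar>g w\<bar> * \<bar>c\<bar>" using b[of w] by (intro mult_left_mono) auto
  then show "norm (g w * f w) <= norm (c * g w)" by (simp add: abs_mult mult.commute)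
 qed
qed

lemma N_bayes:
 assumes \<phi>[measurable]: "\<phi> \<in> borel_measurable borel" and L: "\<And>x. \<bar>\<phi> x\<bar> <= L" and t: "0 <= t"
  and g: "g \<in> borel_measurable (F t)" and i: "integrable M g"
 shows "integrable M (\<lambda>w. g w * cE \<phi> w t)" (is ?g1) "(LINT w|M. g w * cE \<phi> w t) = (LINT w|M. g w * \<phi> (X w))" (is ?g2)
proof -
 have "integrable M (\<lambda>w. g w * \<phi> (X w))" by (rule integrable_mult_bounded[OF i, of _ L]) (auto simp: L)
 then show ?g1 ?g2
  using bayes_real[OF t \<phi> g bounded_post[OF \<phi> L _ t]] by auto
qed

lemma N_martingale:
 assumes \<phi>: "\<phi> \<in> borel_measurable borel" and L: "\<And>x. \<bar>\<phi> x\<bar> <= L" and s: "0 <= s" "s <= t"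
  and g: "g \<in> borel_measurable (F s)" and i: "integrable M g"
 shows "(LINT w|M. g w * cE \<phi> w t) = (LINT w|M. g w * cE \<phi> w s)"
 using N_bayes(2)[OF \<phi> L _ F_lift[OF s(2) g] i] N_bayes(2)[OF \<phi> L s(1) g i] s by simp

lemma N_integrable:
 assumes \<phi>: "\<phi> \<in> borel_measurable borel" and L: "\<And>x. \<bar>\<phi> x\<bar> <= L" and t: "0 <= t"
 shows "integrable M (\<lambda>w. cE \<phi> w t)" (is ?g1) "integrable M (\<lambda>w. (cE \<phi> w t)^2)" (is ?g2)
proof -
 note m = from_F[OF t pE_meas_F[OF t \<phi>]]
 show 1: ?g1
  using N_bounded[OF \<phi> L _ t] m by (intro integrable_const_bound[where B=L]) (auto intro!: AE_I2)
 show ?g2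
  using integrable_mult_bounded[OF 1 m N_bounded[OF \<phi> L _ t]] by (simp add: power2_eq_square)
qed

text \<open>The martingale property as orthogonality of increments to the square integrable past. In
  this form it passes to linear combinations and yields Pythagoras without conditional
  expectations.\<close>

definition L2mart :: "(real => 'w => real) => bool" where
 "L2mart D \<longleftrightarrow> (\<forall>r\<ge>0. D r \<in> borel_measurable (F r) \<and> integrable M (\<lambda>w. (D r w)^2)) \<and>
   (\<forall>r t g. 0 <= r \<longrightarrow> r <= t \<longrightarrow> g \<in> borel_measurable (F r) \<longrightarrow> integrable M (\<lambda>w. (g w)^2) \<longrightarrow>
    (LINT w|M. g w * (D t w - D r w)) = 0)"

lemma L2mart_F: "L2mart D ==> 0 <= r ==> D r \<in> borel_measurable (F r)"
 and L2mart_L2: "L2mart D ==> 0 <= r ==> integrable M (\<lambda>w. (D r w)^2)"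
 and L2mart_orth: "L2mart D ==> 0 <= r ==> r <= t ==> g \<in> borel_measurable (F r) ==> integrable M (\<lambda>w. (g w)^2) ==>
    (LINT w|M. g w * (D t w - D r w)) = 0"
 by (auto simp: L2mart_def)

lemma L2mart_M: "L2mart D ==> 0 <= r ==> D r \<in> borel_measurable M"
 by (rule from_F[OF _ L2mart_F])

lemma integrable_add_square:
 fixes f g :: "'w => real"
 assumes [measurable]: "f \<in> borel_measurable M" "g \<in> borel_measurable M"
  and "integrable M (\<lambda>x. (f x)^2)" "integrable M (\<lambda>x. (g x)^2)"
 shows "integrable M (\<lambda>x. (f x + c * g x)^2)"
proof -
 have "integrable M (\<lambda>x. (f x)^2 + (2 * c) * (f x * g x) + c^2 * (g x)^2)"
  by (intro Bochner_Integration.integrable_add integrable_mult_right integrable_mult_L2 assms)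
 then show ?thesis by (simp add: power2_sum power_mult_distrib algebra_simps)
qed

lemma L2mart_add_scaled:
 assumes D: "L2mart D" and E: "L2mart E"
 shows "L2mart (\<lambda>r w. D r w + c * E r w)"
proof -
 have "(LINT w|M. g w * ((D t w + c * E t w) - (D r w + c * E r w))) = 0"
  if r: "0 <= r" "r <= t" and g: "g \<in> borel_measurable (F r)" and i: "integrable M (\<lambda>w. (g w)^2)" for r t g
 proof -
  have t: "0 <= t" using r by simp
  note gM = from_F[OF r(1) g]
  have p: "integrable M (\<lambda>w. g w * (K t w - K r w))" if "L2mart K" for K
   unfolding right_diff_distrib
   by (intro Bochner_Integration.integrable_diff integrable_mult_L2 gM i L2mart_M L2mart_L2 that r t)
  have "(LINT w|M. g w * ((D t w + c * E t w) - (D r w + c * E r w)))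
   = (LINT w|M. g w * (D t w - D r w) + c * (g w * (E t w - E r w)))" by (simp add: algebra_simps)
  also have "\<dots> = 0"
   using p[OF D] p[OF E] L2mart_orth[OF D r g i] L2mart_orth[OF E r g i] by simp
  finally show ?thesis .
 qed
 then show ?thesis unfolding L2mart_def
  by (intro conjI allI impI integrable_add_square borel_measurable_add borel_measurable_times borel_measurable_const
   L2mart_F[OF D] L2mart_F[OF E] L2mart_M[OF D] L2mart_M[OF E] L2mart_L2[OF D] L2mart_L2[OF E]) auto
qed

lemma L2mart_const: "L2mart (\<lambda>_ _. c)"
 by (simp add: L2mart_def)

lemma L2mart_sum: "(\<And>i. i < n ==> L2mart (D i)) ==> L2mart (\<lambda>r w. \<Sum>i<n. D i r w)" for n :: nat
proof (induction n)
 case (Suc n)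
 then have "L2mart (\<lambda>r w. (\<Sum>i<n. D i r w) + 1 * D n r w)" by (intro L2mart_add_scaled) auto
 then show ?case by simp
qed (simp add: L2mart_const)

lemma L2mart_N:
 assumes \<phi>: "\<phi> \<in> borel_measurable borel" and L: "\<And>x. \<bar>\<phi> x\<bar> <= L"
 shows "L2mart (\<lambda>r w. cE \<phi> w r)"
 unfolding L2mart_def
proof (intro conjI allI impI)
 fix r t :: real and g :: "'w => real"
 assume r: "0 <= r" "r <= t" and g: "g \<in> borel_measurable (F r)" and i: "integrable M (\<lambda>w. (g w)^2)"
 have ig: "integrable M g" by (rule square_integrable_imp_integrable[OF from_F[OF r(1) g] i])
 have t: "0 <= t" using r by simp
 show "(LINT w|M. g w * (cE \<phi> w t - cE \<phi> w r)) = 0"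
  unfolding right_diff_distrib
  using N_martingale[OF \<phi> L r g ig] N_bayes(1)[OF \<phi> L r(1) g ig] N_bayes(1)[OF \<phi> L t F_lift[OF r(2) g] ig] by simp
qed (use pE_meas_F[OF _ \<phi>] N_integrable(2)[OF \<phi> L] in auto)

text \<open>The integral of the simple integrand that equals \<open>h\<close> on (s, t]: clamping
  the time to [s, t] freezes the process before \<open>s\<close> and after \<open>t\<close>.\<close>

lemma L2mart_V:
 assumes s: "0 < s" "s < t" and h: "h \<in> borel_measurable (F s)" and hb: "\<And>w. \<bar>h w\<bar> <= c"
 shows "L2mart (\<lambda>r w. h w * V s (max s (min r t)) w)"
proof -
 define k where "k r = max s (min r t)" for r
 have ks: "s <= k r" "0 < k r" for r using s by (auto simp: k_def)
 have h2: "(\<lambda>w. (h w)^2) \<in> borel_measurable (F s)" using h by measurable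
 have "(h w)^2 <= c^2" for w using hb[of w] by (metis abs_ge_zero power2_abs power_mono)
 then have ih2: "integrable M (\<lambda>w. (h w)^2)"
  using from_F[OF _ h2] s by (intro integrable_const_bound[where B="c^2"]) auto
 have V0: "V s s w = 0" for w by (rule V_self)
 have a: "(\<lambda>w. h w * V s (k r) w) \<in> borel_measurable (F r)" for r
 proof (cases "r <= s")
  case True
  then have "k r = s" using s by (auto simp: k_def)
  then show ?thesis by (simp add: V0)
 next
  case False
  then have "k r <= r" "s <= r" using s by (auto simp: k_def)
  then show ?thesis by (intro borel_measurable_times F_lift[OF _ h] F_lift[OF _ V_meas_F[OF s(1) ks(1)]])
 qed
 have b: "integrable M (\<lambda>w. (h w * V s (k r) w)^2)" for r
 proof (cases "k r = s")
  case False
  then have "s < k r" using ks[of r] by simp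
  from V_orthogonal(3)[OF s(1) this h2 ih2] show ?thesis by (simp add: power_mult_distrib)
 qed (simp add: V0)
 have "(LINT w|M. g w * (h w * V s (k q) w - h w * V s (k r) w)) = 0"
  if r: "0 <= r" "r <= q" and g: "g \<in> borel_measurable (F r)" and i: "integrable M (\<lambda>w. (g w)^2)" for r q g
 proof (cases "k r = k q")
  case False
  then have rq: "k r < k q" "r <= k r" using r by (auto simp: k_def)
  have "(LINT w|M. g w * (h w * V s (k q) w - h w * V s (k r) w)) = (LINT w|M. (g w * h w) * V (k r) (k q) w)"
  proof (intro Bochner_Integration.integral_cong refl)
   fix w assume "w \<in> space M"
   then have "V s (k q) w = V s (k r) w + V (k r) (k q) w" using V_add[OF _ s(1) ks(1), of w r "k q"] rq by simp
   then show "g w * (h w * V s (k q) w - h w * V s (k r) w) = (g w * h w) * V (k r) (k q) w"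
    by (simp add: algebra_simps)
  qed
  also have "\<dots> = 0"
  proof (rule V_orthogonal(2)[OF ks(2) rq(1)])
   show "(\<lambda>w. g w * h w) \<in> borel_measurable (F (k r))"
    by (intro borel_measurable_times F_lift[OF rq(2) g] F_lift[OF ks(1) h])
   show "integrable M (\<lambda>w. g w * h w)"
    using s by (intro integrable_mult_L2 from_F[OF r(1) g] from_F[OF _ h] i ih2) auto
  qed
  finally show ?thesis .
 qed simp
 then show ?thesis using a b by (simp add: L2mart_def k_def)
qed

text \<open>Pythagoras on a past event: the cross term vanishes because the indicator of
  \<open>A\<close> times the value at \<open>r\<close> is an admissible test variable.\<close>

lemma L2mart_increment:
 assumes D: "L2mart D" and r: "0 <= r" "r <= t" and A: "A \<in> sets (F r)"
 shows "(LINT w|M. indicator A w * (D t w)^2) = (LINT w|M. indicator A w * (D r w)^2) + (LINT w|M. indicator A w * (D t w - D r w)^2)" (is ?g1)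
  "integrable M (\<lambda>w. indicator A w * (D t w)^2)" (is ?g2)
  "integrable M (\<lambda>w. (D t w - D r w)^2)" (is ?g3)
proof -
 have t: "0 <= t" using r by simp
 have AM[measurable]: "A \<in> events" by (rule F_events[OF r(1) A])
 note [measurable] = L2mart_M[OF D t] L2mart_M[OF D r(1)]
 have ia: "integrable M (\<lambda>w. indicator A w * f w)" if "integrable M f" for f :: "'w => real"
  using integrable_mult_bounded[OF that, of "indicator A" 1] by (auto simp: indicator_def mult.commute)
 have g: "(\<lambda>w. indicator A w * D r w) \<in> borel_measurable (F r)"
  by (intro borel_measurable_times borel_measurable_indicator A L2mart_F[OF D r(1)])
 have "(indicator A w * D r w)^2 = indicator A w * (D r w)^2" for w by (simp add: indicator_def)
 then have g2: "integrable M (\<lambda>w. (indicator A w * D r w)^2)" using ia[OF L2mart_L2[OF D r(1)]] by simp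
 have dm[measurable]: "(\<lambda>w. D t w - D r w) \<in> borel_measurable M" by measurable
 show d2: ?g3
  using integrable_add_square[OF _ _ L2mart_L2[OF D t] L2mart_L2[OF D r(1)], of "-1"] by simp
 have gd: "integrable M (\<lambda>w. indicator A w * D r w * (D t w - D r w))"
  by (rule integrable_mult_L2[OF _ dm g2 d2]) measurable
 have "(LINT w|M. indicator A w * (D t w)^2) = (LINT w|M. indicator A w * (D r w)^2 + indicator A w * (D t w - D r w)\<^sup>2
   + 2 * (indicator A w * D r w * (D t w - D r w)))"
  by (simp add: power2_eq_square algebra_simps)
 also have "\<dots> = (LINT w|M. indicator A w * (D r w)^2) + (LINT w|M. indicator A w * (D t w - D r w)^2)"
  using L2mart_orth[OF D r g g2] gd ia[OF d2] ia[OF L2mart_L2[OF D r(1)]] by simp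
 finally show ?g1 .
 show ?g2 by (rule ia[OF L2mart_L2[OF D t]])
qed

lemma L2mart_square_increment:
 assumes D: "L2mart D" and r: "0 <= r" "r <= t"
 shows "(LINT w|M. (D t w)^2) = (LINT w|M. (D r w)^2) + (LINT w|M. (D t w - D r w)^2)"
proof -
 have sp: "space M \<in> sets (F r)" using sets.top[of "F r"] by simp
 have e: "(LINT w|M. indicator (space M) w * f w) = (LINT w|M. f w)" for f :: "'w => real"
  by (intro Bochner_Integration.integral_cong) auto
 show ?thesis using L2mart_increment(1)[OF D r sp] unfolding e .
qed

lemma L2mart_maximal:
 assumes D: "L2mart D" and ab: "0 <= a" "a <= b" and c: "0 <= c"
  and cont: "\<And>w. w \<in> space M ==> continuous_on {a..b} (\<lambda>r. D r w)"
 shows "{w\<in>space M. \<exists>r\<in>{a..b}. c < \<bar>D r w\<bar>} \<in> events" (is ?g1)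
  and "c^2 * prob {w\<in>space M. \<exists>r\<in>{a..b}. c < \<bar>D r w\<bar>} <= (LINT w|M. (D b w)^2)" (is ?g2)
proof -
 have b: "0 <= b" using ab by simp
 note [measurable] = L2mart_M[OF D b]
 have le: "(\<integral>\<^sup>+w. ennreal ((D r w)^2) * indicator A w \<partial>M) <= (\<integral>\<^sup>+w. ennreal ((D b w)^2) * indicator A w \<partial>M)"
  if r: "r \<in> {a..b}" and A: "A \<in> sets (F r)" for r A
 proof -
  have r': "0 <= r" "r <= b" using r ab by auto
  have Ab: "A \<in> sets (F b)" using F_mono[of r b] r' A by auto
  have e: "(\<integral>\<^sup>+w. ennreal ((D q w)^2) * indicator A w \<partial>M) = ennreal (LINT w|M. indicator A w * (D q w)^2)"
   if "integrable M (\<lambda>w. indicator A w * (D q w)^2)" for q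
   by (subst nn_integral_eq_integral[symmetric, OF that]) (auto intro!: nn_integral_cong simp: indicator_def)
  have "0 <= (LINT w|M. indicator A w * (D b w - D r w)^2)" by (simp add: indicator_def)
  then show ?thesis
   unfolding e[OF L2mart_increment(2)[OF D r'(1) order_refl A]] e[OF L2mart_increment(2)[OF D r' A]] L2mart_increment(1)[OF D r' A]
   by (intro ennreal_leI) simp
 qed
 note m = maximal_inequality_continuous[where F=F and D=D and E="\<lambda>w. ennreal ((D b w)^2)", OF _ _ _ cont _ le c ab(2)]
 have mm: "{w\<in>space M. \<exists>r\<in>{a..b}. c < \<bar>D r w\<bar>} \<in> events \<and>
   ennreal (c^2) * emeasure M {w\<in>space M. \<exists>r\<in>{a..b}. c < \<bar>D r w\<bar>} <= (\<integral>\<^sup>+w. ennreal ((D b w)^2) \<partial>M)"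
  using ab by (intro conjI m subalgebra_F F_mono L2mart_F[OF D]) auto
 then show ?g1 by blast
 from mm show ?g2
  using nn_integral_eq_integral[OF L2mart_L2[OF D b]]
  by (simp add: emeasure_eq_measure ennreal_mult'[symmetric])
qed

text \<open>\<open>V s t\<close> is \<open>F t\<close>-measurable, so \<xi> t(\<phi>) may be
  replaced by \<phi>(X), and the term at \<open>s\<close> vanishes because \<open>V\<close> is
  centred given \<open>F s\<close>. Splitting \<open>V\<close> by \<open>V_eq\<close>, the Brownian
  part is independent of \<open>g\<close> and \<open>X\<close>, and the drift error leaves the
  posterior covariance integrated over time.\<close>

lemma cross_cut:
 assumes \<phi>[measurable]: "\<phi> \<in> borel_measurable borel" and L: "\<And>x. \<bar>\<phi> x\<bar> <= L" and s: "0 < s" "s < t"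
  and g: "g \<in> borel_measurable (F s)" and gb: "\<And>w. \<bar>g w\<bar> <= c * indicator (cut s K) w"
 shows "integrable MT (\<lambda>p. g (fst p) * (indicator {s..t} (snd p) * HY \<phi> p))" (is ?g1)
  "(LINT w|M. g w * (cE \<phi> w t - cE \<phi> w s) * V s t w)
  = (LINT p|MT. g (fst p) * (indicator {s..t} (snd p) * HY \<phi> p))" (is ?g2)
proof -
 interpret P: pair_sigma_finite M lborel ..
 have st: "s <= t" "0 <= s" "0 <= t" using s by auto
 have L0: "0 <= L" using L[of undefined] by linarith
 have gM[measurable]: "g \<in> borel_measurable M" by (rule from_F[OF st(2) g])
 have gG[measurable]: "g \<in> borel_measurable (G s)" by (rule F_G_meas[OF st(2) g])
 have [measurable]: "V s t \<in> borel_measurable M" by (rule from_F[OF st(3) V_meas_F[OF s(1) st(1)]])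
 have gc: "\<bar>g w\<bar> <= \<bar>c\<bar>" for w
  using gb[of w] by (cases "w \<in> cut s K") (auto intro: order_trans)
 have ig: "integrable M g" using gc by (intro integrable_const_bound[where B="\<bar>c\<bar>"]) (auto intro!: AE_I2)
 note FBr = Fubini_bayes[OF s(1) order_refl st(1) g gb mild_rho]
 note FBp = Fubini_bayes[OF s(1) order_refl st(1) g gb mild_mult_rho[OF \<phi> L]]
 note VO = V_orthogonal(1)[OF s g ig]
 \<comment> \<open>\<open>f1\<close> and \<open>f2\<close> differ by replacing \<phi>(X) with its
   posterior mean at time \<open>q\<close>. Their integrals agree because the remaining factors are
   \<open>F q\<close>-measurable.\<close>
 define f1 where "f1 w q = (g w * \<phi> (X w)) * (indicator {s..t} q * cE \<rho> w q)" for w q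
 define f2 where "f2 w q = g w * (indicator {s..t} q * (cE \<phi> w q * cE \<rho> w q))" for w q
 have bound: "\<bar>a * (g w * v)\<bar> <= \<bar>L * (g w * v)\<bar>" if "\<bar>a\<bar> <= L" for a v w
  unfolding abs_mult using that L0 by (intro mult_right_mono) auto
 have f1m: "case_prod f1 \<in> borel_measurable MT"
  unfolding f1_def case_prod_beta' using pathfun_meas_pair(2)[OF pathfun_pE[OF mild_rho] s(1) st(1)] by measurable
 have f2m: "case_prod f2 \<in> borel_measurable MT"
  unfolding f2_def case_prod_beta'
  using pathfun_meas_pair(2)[OF pathfun_mult[OF pathfun_pE[OF mild_bounded[OF \<phi> L]] pathfun_pE[OF mild_rho]] s(1) st(1)] by measurable
 have i1: "integrable MT (case_prod f1)"
 proof (rule Bochner_Integration.integrable_bound[OF integrable_mult_right[OF FBr(2), of L] f1m], rule AE_I2)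
  fix p
  have "case_prod f1 p = \<phi> (X (fst p)) * (g (fst p) * (indicator {s..t} (snd p) * cE \<rho> (fst p) (snd p)))"
   by (simp add: f1_def case_prod_beta' mult_ac)
  then show "norm (case_prod f1 p) <= norm (L * (g (fst p) * (indicator {s..t} (snd p) * cE \<rho> (fst p) (snd p))))"
   unfolding real_norm_def using bound[OF L] by simp
 qed
 have i2: "integrable MT (case_prod f2)"
 proof (rule Bochner_Integration.integrable_bound[OF integrable_mult_right[OF FBr(2), of L] f2m], rule AE_I2)
  fix p assume "p \<in> space MT"
  then have dy: "fst p \<in> space M" by (auto simp: space_pair_measure)
  have eq: "case_prod f2 p = cE \<phi> (fst p) (snd p) * (g (fst p) * (indicator {s..t} (snd p) * cE \<rho> (fst p) (snd p)))"
   by (simp add: f2_def case_prod_beta' mult_ac)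
  show "norm (case_prod f2 p) <= norm (L * (g (fst p) * (indicator {s..t} (snd p) * cE \<rho> (fst p) (snd p))))"
  proof (cases "snd p \<in> {s..t}")
   case True
   then have "\<bar>cE \<phi> (fst p) (snd p)\<bar> <= L" using s by (intro N_bounded[OF \<phi> L dy]) auto
   then show ?thesis unfolding real_norm_def eq by (rule bound)
  qed (simp add: eq)
 qed
 have Hsplit: "g (fst p) * (indicator {s..t} (snd p) * HY \<phi> p)
  = g (fst p) * (indicator {s..t} (snd p) * cE (\<lambda>x. \<phi> x * \<rho> x) (fst p) (snd p)) - case_prod f2 p" for p
  by (simp add: f2_def case_prod_beta' Hc_def algebra_simps)
 show ?g1
  unfolding Hsplit by (rule Bochner_Integration.integrable_diff[OF FBp(2) i2])
 have e12: "integral\<^sup>L MT (case_prod f1) = integral\<^sup>L MT (case_prod f2)"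
  unfolding P.integral_snd[OF i1, symmetric] P.integral_snd[OF i2, symmetric]
 proof (rule Bochner_Integration.integral_cong[OF refl])
  fix q
  show "(LINT w|M. f1 w q) = (LINT w|M. f2 w q)"
  proof (cases "q \<in> {s..t}")
   case True
   then have q: "s <= q" "0 < q" "0 <= q" using s by auto
   have gF: "(\<lambda>w. g w * cE \<rho> w q) \<in> borel_measurable (F q)"
    using F_lift[OF q(1) g] pE_meas_F[OF q(3) rho_meas] by measurable
   have gi: "integrable M (\<lambda>w. g w * cE \<rho> w q)"
    by (rule bayes_real(1)[OF q(3) rho_meas F_lift[OF q(1) g] _ FBr(1)])
     (auto simp: \<xi>_def intro: mild_integrable_post[OF mild_rho q(2)])
   have "(LINT w|M. g w * cE \<rho> w q * cE \<phi> w q) = (LINT w|M. g w * cE \<rho> w q * \<phi> (X w))"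
    by (rule N_bayes(2)[OF \<phi> L q(3) gF gi])
   then show ?thesis using True by (simp add: f1_def f2_def mult_ac)
  qed (simp add: f1_def f2_def)
 qed
 have "(LINT w|M. g w * (cE \<phi> w t - cE \<phi> w s) * V s t w)
  = (LINT w|M. (g w * V s t w) * cE \<phi> w t - (g w * cE \<phi> w s) * V s t w)"
  by (intro Bochner_Integration.integral_cong) (auto simp: algebra_simps)
 also have "\<dots> = (LINT w|M. (g w * V s t w) * cE \<phi> w t) - (LINT w|M. (g w * cE \<phi> w s) * V s t w)"
 proof (rule Bochner_Integration.integral_diff)
  show "integrable M (\<lambda>w. (g w * V s t w) * cE \<phi> w t)"
   by (intro N_bayes(1)[OF \<phi> L st(3)] VO borel_measurable_times F_lift[OF st(1) g] V_meas_F[OF s(1) st(1)])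
  show "integrable M (\<lambda>w. (g w * cE \<phi> w s) * V s t w)"
   by (intro V_orthogonal(1)[OF s] N_bayes(1)[OF \<phi> L st(2) g ig] borel_measurable_times g pE_meas_F[OF st(2) \<phi>])
 qed
 also have "(LINT w|M. (g w * cE \<phi> w s) * V s t w) = 0"
  by (intro V_orthogonal(2)[OF s] N_bayes(1)[OF \<phi> L st(2) g ig] borel_measurable_times g pE_meas_F[OF st(2) \<phi>])
 also have "(LINT w|M. (g w * V s t w) * cE \<phi> w t) = (LINT w|M. (g w * V s t w) * \<phi> (X w))"
  by (intro N_bayes(2)[OF \<phi> L st(3)] VO borel_measurable_times F_lift[OF st(1) g] V_meas_F[OF s(1) st(1)])
 also have "\<dots> = (LINT w|M. (g w * \<phi> (X w)) * (B w t - B w s) + ((t - s) * (g w * (\<phi> (X w) * \<rho> (X w))) - (LINT q|lborel. f1 w q)))"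
  by (intro Bochner_Integration.integral_cong) (auto simp: V_eq Rem_def pint_def f1_def algebra_simps)
 also have "\<dots> = (LINT w|M. (g w * \<phi> (X w)) * (B w t - B w s)) + ((t - s) * (LINT w|M. g w * (\<phi> (X w) * \<rho> (X w))) - (LINT w|M. (LINT q|lborel. f1 w q)))"
 proof -
  have ib: "integrable M (\<lambda>w. (B w t - B w s) * (g w * \<phi> (X w)))"
   by (rule integrable_mult_bounded[OF increment_moments(1)[OF st(2) s(2)], of _ "\<bar>c\<bar> * L"])
    (auto simp: abs_mult intro!: mult_mono gc L)
  have if1: "integrable M (\<lambda>w. \<integral>q. f1 w q \<partial>lborel)" using P.integrable_fst'[OF i1] by simp
  show ?thesis using ib if1 FBp(1) by (simp add: mult.commute)
 qed
 also have "(LINT w|M. (g w * \<phi> (X w)) * (B w t - B w s)) = 0"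
 proof -
  have i: "integrable M (\<lambda>w. g w * \<phi> (X w))" by (rule integrable_mult_bounded[OF ig, of _ L]) (auto simp: L)
  have "indep_var borel (\<lambda>w. g w * \<phi> (X w)) borel (\<lambda>w. (\<lambda>x. x) (B w t - B w s))"
   by (rule increment_indep_var[OF st(2) s(2)]) measurable
  from indep_var_lebesgue_integral[OF this i] increment_moments(1,2)[OF st(2) s(2)] show ?thesis by simp
 qed
 also have "(t - s) * (LINT w|M. g w * (\<phi> (X w) * \<rho> (X w)))
  = (LINT p|MT. g (fst p) * (indicator {s..t} (snd p) * cE (\<lambda>x. \<phi> x * \<rho> x) (fst p) (snd p)))"
  unfolding FBp(4)[symmetric] P.integral_fst'[OF FBp(2), symmetric] by (simp add: pint_def)
 also have "(LINT w|M. (LINT q|lborel. f1 w q)) = integral\<^sup>L MT (case_prod f2)"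
  unfolding e12[symmetric] P.integral_fst'[OF i1, symmetric] by simp
 finally show ?g2
  unfolding Hsplit using FBp(2) i2 by simp
qed

lemma integrable_pair_indicator:
 "s <= t ==> integrable MT (\<lambda>p. indicator {s..t} (snd p) :: real)"
 "s <= t ==> integrable M g ==> integrable MT (\<lambda>p. g (fst p) * (indicator {s..t} (snd p) :: real))"
 "s <= t ==> integrable M g ==> (LINT p|MT. g (fst p) * indicator {s..t} (snd p)) = (t - s) * (LINT w|M. g w)"
proof -
 interpret P: pair_sigma_finite M lborel ..
 have g: "integrable MT (\<lambda>p. g (fst p) * (indicator {s..t} (snd p) :: real))
   \<and> (LINT p|MT. g (fst p) * indicator {s..t} (snd p)) = (t - s) * (LINT w|M. g w)"
  if "s <= t" and i: "integrable M g" for g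
 proof -
  have [measurable]: "g \<in> borel_measurable M" using i by simp
  have "integrable MT (\<lambda>p. (\<lambda>(x, y). g x * (indicator {s..t} y :: real)) p)"
  proof (rule integrableI_bounded)
   have "(\<integral>\<^sup>+p. ennreal (norm ((\<lambda>(x, y). g x * indicator {s..t} y) p)) \<partial>MT)
    = (\<integral>\<^sup>+x. (\<integral>\<^sup>+y. ennreal \<bar>g x\<bar> * indicator {s..t} y \<partial>lborel) \<partial>M)"
    by (subst lborel.nn_integral_fst[symmetric]) (auto simp: abs_mult ennreal_mult case_prod_beta' ennreal_indicator intro!: nn_integral_cong)
   also have "\<dots> = (\<integral>\<^sup>+x. ennreal \<bar>g x\<bar> \<partial>M) * ennreal (t - s)"
    using that by (simp add: nn_integral_cmult_indicator nn_integral_multc)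
   also have "\<dots> < \<infinity>" using i by (simp add: integrable_iff_bounded ennreal_mult_less_top)
   finally show "(\<integral>\<^sup>+p. ennreal (norm ((\<lambda>(x, y). g x * indicator {s..t} y) p)) \<partial>MT) < \<infinity>" .
  qed measurable
  then have i': "integrable MT (\<lambda>p. g (fst p) * (indicator {s..t} (snd p) :: real))" by (simp add: case_prod_beta')
  have "(LINT p|MT. g (fst p) * indicator {s..t} (snd p)) = (LINT w|M. (t - s) * g w)"
   unfolding P.integral_fst'[OF i', symmetric] using that by (simp add: mult.commute)
  with i' show ?thesis by simp
 qed
 show "integrable MT (\<lambda>p. g (fst p) * (indicator {s..t} (snd p) :: real))" "(LINT p|MT. g (fst p) * indicator {s..t} (snd p)) = (t - s) * (LINT w|M. g w)"
  if "s <= t" "integrable M g" using g[OF that] by auto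
 show "integrable MT (\<lambda>p. indicator {s..t} (snd p) :: real)" if "s <= t" using g[OF that, of "\<lambda>_. 1"] by simp
qed

text \<open>The cut is removed by dominated convergence. The time integral is dominated thanks to
  \<open>isometry\<close> and |x| <= 1 + x^2.\<close>

lemma cross:
 assumes \<phi>[measurable]: "\<phi> \<in> borel_measurable borel" and L: "\<And>x. \<bar>\<phi> x\<bar> <= L" and s: "0 < s" "s < t"
  and g: "g \<in> borel_measurable (F s)" and gb: "\<And>w. \<bar>g w\<bar> <= c"
 shows "integrable MT (\<lambda>p. g (fst p) * (indicator {s..t} (snd p) * HY \<phi> p))"
  "integrable M (\<lambda>w. g w * (cE \<phi> w t - cE \<phi> w s) * V s t w)" (is ?g1)
  "(LINT w|M. g w * (cE \<phi> w t - cE \<phi> w s) * V s t w)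
  = (LINT p|MT. g (fst p) * (indicator {s..t} (snd p) * HY \<phi> p))"
proof -
 have st: "s <= t" "0 <= s" "0 <= t" using s by auto
 have c0: "0 <= c" using gb[of undefined] by linarith
 have gM[measurable]: "g \<in> borel_measurable M" by (rule from_F[OF st(2) g])
 have [measurable]: "V s t \<in> borel_measurable M" by (rule from_F[OF st(3) V_meas_F[OF s(1) st(1)]])
 note [measurable] = from_F[OF st(2) pE_meas_F[OF st(2) \<phi>]] from_F[OF st(3) pE_meas_F[OF st(3) \<phi>]]
 define gn where "gn n w = indicator (cut s (real n)) w * g w" for n w
 have cutM[measurable]: "cut s (real n) \<in> events" for n by (rule F_events[OF st(2) cut_F[OF st(2)]])
 have gnF: "gn n \<in> borel_measurable (F s)" for n unfolding gn_def using g cut_F[OF st(2)] by measurable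
 have gnb: "\<bar>gn n w\<bar> <= c * indicator (cut s (real n)) w" for n w using gb[of w] by (simp add: gn_def indicator_def)
 note cc = cross_cut[OF \<phi> L s gnF gnb]
 let ?H = "\<lambda>p. indicator {s..t} (snd p) * HY \<phi> p"
 have Hm[measurable]: "?H \<in> borel_measurable MT"
  by (rule pathfun_meas_pair(2)[OF Hc_pathfun[OF \<phi> L] s(1) st(1)])
 have iw: "integrable MT (\<lambda>p. c * (indicator {s..t} (snd p) + indicator {s..t} (snd p) * (HY \<phi> p)^2))"
  by (intro integrable_mult_right Bochner_Integration.integrable_add integrable_pair_indicator(1)[OF st(1)] isometry(1)[OF \<phi> L s(1) st(1)])
 have wb: "norm (v * ?H p) <= c * (indicator {s..t} (snd p) + indicator {s..t} (snd p) * (HY \<phi> p)^2)" if "\<bar>v\<bar> <= c" for v p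
 proof -
  have "\<bar>x\<bar> <= 1 + x^2" for x :: real
  proof -
   have "0 <= (\<bar>x\<bar> - 1)^2" by simp
   also have "\<dots> = x^2 + 1 - 2 * \<bar>x\<bar>" by (simp add: power2_diff)
   finally show ?thesis using abs_ge_zero[of x] zero_le_power2[of x] by linarith
  qed
  then have "\<bar>v\<bar> * \<bar>HY \<phi> p\<bar> <= c * (1 + (HY \<phi> p)^2)"
   using that c0 by (intro mult_mono) auto
  then show ?thesis by (simp add: indicator_def abs_mult)
 qed
 show "integrable MT (\<lambda>p. g (fst p) * ?H p)"
  by (rule Bochner_Integration.integrable_bound[OF iw]) (use wb[OF gb] in \<open>auto intro!: AE_I2 intro: order_trans[OF _ abs_ge_self]\<close>)
 have L0: "0 <= L" using L[of undefined] by linarith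
 have db: "\<bar>v * (cE \<phi> w t - cE \<phi> w s) * V s t w\<bar> <= (c * (2 * L)) * \<bar>V s t w\<bar>" if "\<bar>v\<bar> <= c" "w \<in> space M" for v w
 proof -
  have "\<bar>cE \<phi> w t - cE \<phi> w s\<bar> <= 2 * L"
   using N_bounded[OF \<phi> L that(2) st(2)] N_bounded[OF \<phi> L that(2) st(3)] by linarith
  then show ?thesis unfolding abs_mult using that c0 L0 by (intro mult_right_mono mult_mono) auto
 qed
 have iV: "integrable M (\<lambda>w. (c * (2 * L)) * \<bar>V s t w\<bar>)" using V_moments(1)[OF s] by auto
 show ?g1
  by (rule Bochner_Integration.integrable_bound[OF iV]) (measurable, unfold real_norm_def, intro AE_I2 order_trans[OF db[OF gb] abs_ge_self])
 have gnc: "\<bar>gn n w\<bar> <= c" for n w using gb[of w] c0 by (simp add: gn_def indicator_def)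
 have lim: "(\<lambda>n. gn n w) \<longlonglongrightarrow> g w" if "w \<in> space M" for w
  using tendsto_mult[OF cut_tendsto[OF that, of s] tendsto_const, of "g w"] by (simp add: gn_def)
 have l1: "(\<lambda>n. \<integral>w. gn n w * (cE \<phi> w t - cE \<phi> w s) * V s t w \<partial>M)
   \<longlonglongrightarrow> (LINT w|M. g w * (cE \<phi> w t - cE \<phi> w s) * V s t w)"
 proof (rule integral_dominated_convergence[OF _ _ iV])
  show "AE w in M. (\<lambda>n. gn n w * (cE \<phi> w t - cE \<phi> w s) * V s t w) \<longlonglongrightarrow> g w * (cE \<phi> w t - cE \<phi> w s) * V s t w"
   by (intro AE_I2 tendsto_mult tendsto_const lim)
  show "AE w in M. norm (gn n w * (cE \<phi> w t - cE \<phi> w s) * V s t w) <= (c * (2 * L)) * \<bar>V s t w\<bar>" for n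
   unfolding real_norm_def by (intro AE_I2 db[OF gnc])
  show "(\<lambda>w. gn n w * (cE \<phi> w t - cE \<phi> w s) * V s t w) \<in> borel_measurable M" for n
   unfolding gn_def by measurable
 qed measurable
 have l2: "(\<lambda>n. \<integral>p. gn n (fst p) * ?H p \<partial>MT) \<longlonglongrightarrow> (LINT p|MT. g (fst p) * ?H p)"
 proof (rule integral_dominated_convergence[OF _ _ iw])
  show "AE p in MT. (\<lambda>n. gn n (fst p) * ?H p) \<longlonglongrightarrow> g (fst p) * ?H p"
   by (intro AE_I2 tendsto_mult tendsto_const lim) (auto simp: space_pair_measure)
  show "AE p in MT. norm (gn n (fst p) * ?H p) <= c * (indicator {s..t} (snd p) + indicator {s..t} (snd p) * (HY \<phi> p)^2)" for n
   by (intro AE_I2 wb gnc)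
  show "(\<lambda>p. gn n (fst p) * ?H p) \<in> borel_measurable MT" for n unfolding gn_def by measurable
 qed measurable
 show "(LINT w|M. g w * (cE \<phi> w t - cE \<phi> w s) * V s t w) = (LINT p|MT. g (fst p) * ?H p)"
  using l1 unfolding cc(2) by (rule LIMSEQ_unique[OF _ l2])
qed

text \<open>Expanding the square gives three terms: the isometry, the mixed moment from
  \<open>cross\<close>, and the variance of \<open>V\<close>. It is the Ito isometry for an
  approximation error, obtained before any stochastic integral of the covariance exists.\<close>

lemma increment_isometry:
 assumes \<phi>[measurable]: "\<phi> \<in> borel_measurable borel" and L: "\<And>x. \<bar>\<phi> x\<bar> <= L" and s: "0 < s" "s < t"
  and g: "g \<in> borel_measurable (F s)" and gb: "\<And>w. \<bar>g w\<bar> <= c"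
 shows "integrable M (\<lambda>w. (cE \<phi> w t - cE \<phi> w s - g w * V s t w)^2)"
  "integrable MT (\<lambda>p. indicator {s..t} (snd p) * (HY \<phi> p - g (fst p))^2)"
  "(LINT w|M. (cE \<phi> w t - cE \<phi> w s - g w * V s t w)^2)
  = (LINT p|MT. indicator {s..t} (snd p) * (HY \<phi> p - g (fst p))^2)"
proof -
 have st: "s <= t" "0 <= s" "0 <= t" using s by auto
 note cr = cross[OF \<phi> L s g gb] and iso = isometry[OF \<phi> L s(1) st(1)]
 have gM[measurable]: "g \<in> borel_measurable M" by (rule from_F[OF st(2) g])
 have gF2: "(\<lambda>w. (g w)^2) \<in> borel_measurable (F s)" using g by measurable
 have c0: "0 <= c" using gb[of undefined] by linarith
 have ig2: "integrable M (\<lambda>w. (g w)^2)"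
  by (rule integrable_const_bound[where B="c^2"]) (auto intro!: AE_I2 simp: abs_le_square_iff[symmetric] gb c0)
 note VO = V_orthogonal(3,4)[OF s gF2 ig2]
 let ?N = "\<lambda>w. cE \<phi> w t - cE \<phi> w s"
 let ?H = "\<lambda>p. HY \<phi> p"
 let ?I = "\<lambda>p. indicator {s..t} (snd p) :: real"
 note i1 = N_integrable[OF \<phi> L st(2)] and i2 = N_integrable[OF \<phi> L st(3)]
 have iN: "integrable M (\<lambda>w. (?N w)^2)"
  using integrable_mult_bounded[OF Bochner_Integration.integrable_diff[OF i2(1) i1(1)], of ?N "2 * L"]
   borel_measurable_integrable[OF i1(1)] borel_measurable_integrable[OF i2(1)]
   N_bounded[OF \<phi> L _ st(2)] N_bounded[OF \<phi> L _ st(3)]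
  by (auto simp: power2_eq_square abs_le_iff intro: order_trans[OF abs_triangle_ineq4] add_mono)
   (smt (verit) abs_le_iff)+
 have EN: "(LINT w|M. (?N w)^2) = (LINT p|MT. ?I p * (?H p)^2)"
  using L2mart_square_increment[OF L2mart_N[OF \<phi> L] st(2,1)] unfolding iso(2) by simp
 have e1: "(?N w - g w * V s t w)^2 = (?N w)^2 - 2 * (g w * ?N w * V s t w) + (g w)^2 * (V s t w)^2" for w
  by (simp add: power2_eq_square algebra_simps)
 have e2: "?I p * (?H p - g (fst p))^2 = ?I p * (?H p)^2 - 2 * (g (fst p) * (?I p * ?H p)) + (g (fst p))^2 * ?I p" for p
  by (simp add: power2_eq_square algebra_simps)
 note ip = integrable_pair_indicator(2,3)[OF st(1) ig2]
 show "integrable M (\<lambda>w. (?N w - g w * V s t w)^2)" unfolding e1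
  by (intro Bochner_Integration.integrable_add Bochner_Integration.integrable_diff integrable_mult_right iN cr(2) VO(1))
 show "integrable MT (\<lambda>p. ?I p * (?H p - g (fst p))^2)" unfolding e2
  by (intro Bochner_Integration.integrable_add Bochner_Integration.integrable_diff integrable_mult_right iso(1) cr(1) ip(1))
 have "(LINT w|M. (?N w - g w * V s t w)^2) = (LINT w|M. (?N w)^2) - 2 * (LINT w|M. g w * ?N w * V s t w) + (LINT w|M. (g w)^2 * (V s t w)^2)"
  unfolding e1 using iN cr(2) VO(1) by simp
 also have "\<dots> = (LINT p|MT. ?I p * (?H p)^2) - 2 * (LINT p|MT. g (fst p) * (?I p * ?H p)) + (LINT p|MT. (g (fst p))^2 * ?I p)"
  unfolding EN cr(3) VO(2) ip(2) ..
 also have "\<dots> = (LINT p|MT. ?I p * (?H p - g (fst p))^2)"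
  unfolding e2 using iso(1) cr(1) ip(1) by simp
 finally show "(LINT w|M. (?N w - g w * V s t w)^2) = (LINT p|MT. ?I p * (?H p - g (fst p))^2)" .
qed

end

context bm_filter
begin

text \<open>The posterior mass of \<open>A\<close> is a martingale in [0, 1] with mean \<mu>(A), so
  its square at time 1 has mean at most \<mu>(A). Time 0 is approached by intervals bounded away
  from it, because path continuity is known only at positive times so far.\<close>

lemma far_maximal:
 assumes A[measurable]: "A \<in> sets borel" and c: "0 < c"
 shows "{w\<in>space M. \<exists>r\<in>{0<..1}. c < \<bar>cE (indicator A) w r\<bar>} \<in> events" (is "?S \<in> _")
  and "c^2 * prob {w\<in>space M. \<exists>r\<in>{0<..1}. c < \<bar>cE (indicator A) w r\<bar>} <= measure \<mu> A"
proof -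
 define D :: "real => 'w => real" where "D r w = cE (indicator A) w r" for r w
 have iA: "(indicator A :: 'a => real) \<in> borel_measurable borel" by measurable
 have i1: "\<bar>indicator A x :: real\<bar> <= 1" for x by (simp add: indicator_def)
 have D: "L2mart D" unfolding D_def by (rule L2mart_N[OF iA i1])
 define S where "S n = {w\<in>space M. \<exists>r\<in>{1 / real (Suc n)..1}. c < \<bar>D r w\<bar>}" for n
 have cont: "continuous_on {1 / real (Suc n)..1} (\<lambda>r. D r w)" if "w \<in> space M" for w n
  unfolding D_def by (rule pathfun_cont[OF pathfun_pE[OF mild_bounded[OF iA i1]] that]) simp
 have n1: "0 <= 1 / real (Suc n)" "1 / real (Suc n) <= 1" for n by (auto simp: field_simps)
 note mx = L2mart_maximal[OF D n1 less_imp_le[OF c] cont, folded S_def]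
 have U: "?S = (\<Union>n. S n)"
 proof (intro set_eqI iffI)
  fix w assume "w \<in> ?S"
  then obtain r where r: "w \<in> space M" "0 < r" "r <= 1" "c < \<bar>D r w\<bar>" by (auto simp: D_def)
  from reals_Archimedean[OF r(2)] obtain n where "inverse (real (Suc n)) < r" by blast
  then show "w \<in> (\<Union>n. S n)" using r by (auto simp: S_def inverse_eq_divide intro!: exI[of _ n] bexI[of _ r])
 next
  fix w assume "w \<in> (\<Union>n. S n)"
  then obtain n r where r: "w \<in> space M" "1 / real (Suc n) <= r" "r <= 1" "c < \<bar>D r w\<bar>" by (auto simp: S_def)
  then have "0 < r" by (intro less_le_trans[OF _ r(2)]) simp
  with r show "w \<in> ?S" by (auto simp: D_def)
 qed
 show "?S \<in> events" unfolding U using mx(1) by auto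
 have "(\<lambda>n. prob (S n)) \<longlonglongrightarrow> prob (\<Union>n. S n)"
 proof (rule finite_Lim_measure_incseq)
  show "incseq S"
  proof (rule incseq_SucI)
   fix n
   have "1 / real (Suc (Suc n)) <= 1 / real (Suc n)" by (simp add: field_simps)
   then have "{1 / real (Suc n)..1} \<subseteq> {1 / real (Suc (Suc n))..1}" by simp
   then show "S n \<subseteq> S (Suc n)" unfolding S_def by blast
  qed
  show "range S \<subseteq> events" using mx(1) by blast
 qed
 then have "(\<lambda>n. c^2 * prob (S n)) \<longlonglongrightarrow> c\<^sup>2 * prob ?S" unfolding U by (intro tendsto_intros)
 moreover have "c^2 * prob (S n) <= measure \<mu> A" for n
 proof -
  have "c^2 * prob (S n) <= (LINT w|M. (D 1 w)^2)" by (rule mx(2))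
  also have "\<dots> <= (LINT w|M. D 1 w)"
  proof (rule integral_mono)
   show "integrable M (\<lambda>w. (D 1 w)^2)" "integrable M (D 1)" unfolding D_def using N_integrable[OF iA i1, of 1] by auto
   fix w assume "w \<in> space M"
   then have "\<bar>D 1 w\<bar> <= 1" unfolding D_def by (intro N_bounded[OF iA i1]) auto
   moreover have "0 <= D 1 w" unfolding D_def pE_def by simp
   ultimately show "(D 1 w)^2 <= D 1 w" using mult_left_le[of "D 1 w" "D 1 w"] by (simp add: power2_eq_square)
  qed
  also have "\<dots> = (LINT w|M. 1 * D 1 w)" by simp
  also have "\<dots> = (LINT w|M. 1 * indicator A (X w))"
   unfolding D_def by (rule N_bayes(2)[OF iA i1]) auto
  also have "\<dots> = (LINT x|\<mu>. indicator A x)" by (subst integral_distr) (auto intro: iA)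
  also have "\<dots> = measure \<mu> A" by simp
  finally show ?thesis .
 qed
 ultimately show "c^2 * prob ?S <= measure \<mu> A" by (intro LIMSEQ_le_const2) auto
qed

section \<open>Continuity at time zero\<close>

definition tail :: "nat => 'a set" where
 "tail K = {x. real K < \<bar>\<rho> x\<bar>}"

lemma tail_sets [measurable]: "tail K \<in> sets borel"
 unfolding tail_def by measurable

lemma tail_tendsto: "(\<lambda>K. measure \<mu> (tail K)) \<longlonglongrightarrow> 0"
proof -
 interpret mu: prob_space \<mu> by (rule prob_space_mu)
 have "(\<lambda>K. measure \<mu> (tail K)) \<longlonglongrightarrow> measure \<mu> (\<Inter>K. tail K)"
 proof (rule mu.finite_Lim_measure_decseq)
  show "decseq tail" unfolding decseq_def tail_def by (auto intro: le_less_trans)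
 qed auto
 moreover have "(\<Inter>K. tail K) = {}"
 proof (rule ccontr)
  assume "(\<Inter>K. tail K) \<noteq> {}"
  then obtain x where "\<And>K. real K < \<bar>\<rho> x\<bar>" by (auto simp: tail_def)
  with real_arch_simple[of "\<bar>\<rho> x\<bar>"] show False by (meson not_less)
 qed
 ultimately show ?thesis by simp
qed

text \<open>The sample space is later restricted to the almost sure event where this and \<open>vanishing\<close> below hold, so that all
  paths are continuous.\<close>

definition tight :: "'w => bool" where
 "tight w \<longleftrightarrow> (\<forall>m. \<exists>K. \<forall>r\<in>{0<..1}. \<bar>cE (indicator (tail K)) w r\<bar> <= 1 / real (Suc m))"

text \<open>For fixed \<open>m\<close> the exceptional event for \<open>K\<close> has probability at
  most a constant times \<mu>(tail K), which tends to 0; hence the intersection over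
  \<open>K\<close> is null.\<close>

lemma AE_tight: "{w\<in>space M. tight w} \<in> events" "prob {w\<in>space M. tight w} = 1"
proof -
 define S where "S m K = {w\<in>space M. \<exists>r\<in>{0<..1}. 1 / real (Suc m) < \<bar>cE (indicator (tail K)) w r\<bar>}" for m K
 have c: "0 < 1 / real (Suc m)" for m by simp
 note fm = far_maximal[OF tail_sets c, folded S_def]
 note [measurable] = fm(1)
 have eq: "{w\<in>space M. tight w} = space M - (\<Union>m. \<Inter>K. S m K)"
  unfolding tight_def S_def not_less[symmetric] by blast
 show "{w\<in>space M. tight w} \<in> events" unfolding eq by measurable
 have z: "prob (\<Inter>K. S m K) = 0" for m
 proof -
  let ?c = "(1 / real (Suc m))^2"
  have "?c * prob (\<Inter>K. S m K) <= measure \<mu> (tail K)" for K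
   by (rule order_trans[OF mult_left_mono[OF finite_measure_mono] fm(2)]) auto
  from LIMSEQ_le_const[OF tail_tendsto, of "?c * prob (\<Inter>K. S m K)"] this
  have "?c * prob (\<Inter>K. S m K) <= 0" by blast
  then show ?thesis using measure_nonneg[of M "\<Inter>K. S m K"] by (auto simp: mult_le_0_iff intro: antisym)
 qed
 have "(\<Union>m. \<Inter>K. S m K) \<in> null_sets M"
  by (intro null_sets_UN) (auto simp: null_sets_def emeasure_eq_measure z)
 then have "prob (\<Union>m. \<Inter>K. S m K) = 0" by (simp add: measure_eq_0_null_sets)
 then show "prob {w\<in>space M. tight w} = 1" unfolding eq by (subst prob_compl) auto
qed

text \<open>Where |\<rho>| <= K the weight is bounded along bounded observations. This is the
  domination that is missing on the tail.\<close>

lemma Zf_zero_tendsto: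
 assumes [measurable]: "\<psi> \<in> borel_measurable borel" and L: "\<And>x. \<bar>\<psi> x\<bar> <= L" and K: "\<And>x. x \<in> tail K ==> \<psi> x = 0"
  and u: "\<And>n. 0 <= u n" "u \<longlonglongrightarrow> 0" and y: "y \<longlonglongrightarrow> 0"
 shows "(\<lambda>n. Zf \<psi> (u n) (y n)) \<longlonglongrightarrow> (LINT x|\<mu>. \<psi> x)"
proof -
 interpret mu: prob_space \<mu> by (rule prob_space_mu)
 have L0: "0 <= L" using L[of undefined] by linarith
 have "Bseq y" using y by (rule convergent_imp_Bseq[OF convergentI])
 then obtain C where C: "\<And>n. \<bar>y n\<bar> <= C" by (auto simp: Bseq_def)
 show ?thesis unfolding Zf_def
 proof (rule integral_dominated_convergence[where w="\<lambda>_. L * exp (real K * C)"])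
  have "(\<lambda>n. \<psi> x * tw (\<rho> x) (u n) (y n)) \<longlonglongrightarrow> \<psi> x * exp (\<rho> x * 0 - (\<rho> x)^2 * 0 / 2)" for x
   unfolding tw_def by (intro tendsto_intros u y) simp
  then show "AE x in \<mu>. (\<lambda>n. \<psi> x * tw (\<rho> x) (u n) (y n)) \<longlonglongrightarrow> \<psi> x" by simp
  show "AE x in \<mu>. norm (\<psi> x * tw (\<rho> x) (u n) (y n)) <= L * exp (real K * C)" for n
  proof (rule AE_I2)
   fix x
   show "norm (\<psi> x * tw (\<rho> x) (u n) (y n)) <= L * exp (real K * C)"
   proof (cases "x \<in> tail K")
    case True then show ?thesis using K L0 by simp
   next
    case False
    then have "\<bar>\<rho> x\<bar> * \<bar>y n\<bar> <= real K * C" using C[of n] by (intro mult_mono) (auto simp: tail_def)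
    then have "\<rho> x * y n <= real K * C" using abs_ge_self[of "\<rho> x * y n"] by (simp add: abs_mult)
    then have "\<rho> x * y n - (\<rho> x)^2 * u n / 2 <= real K * C" using u(1)[of n] zero_le_power2[of "\<rho> x"]
     by (smt (verit) divide_nonneg_nonneg mult_nonneg_nonneg)
    then have "tw (\<rho> x) (u n) (y n) <= exp (real K * C)" by (simp add: tw_def)
    then show ?thesis using L[of x] L0 by (auto simp: abs_mult intro!: mult_mono)
   qed
  qed
 qed auto
qed

text \<open>Restrict to the complement of \<open>tail K\<close>. The ratio of restricted numerator
  and restricted mass converges by \<open>Zf_zero_tendsto\<close>, and the full normalization
  cancels in it. Tightness bounds what the restriction discards from the posterior, smallness of the
  prior tail what it discards in the limit.\<close>

lemma tight_tendsto:
 assumes \<phi>[measurable]: "\<phi> \<in> borel_measurable borel" and L: "\<And>x. \<bar>\<phi> x\<bar> <= L" and dy: "w \<in> space M" "tight w"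
  and u: "\<And>n. 0 < u n" "u \<longlonglongrightarrow> 0"
 shows "(\<lambda>n. cE \<phi> w (u n)) \<longlonglongrightarrow> (LINT x|\<mu>. \<phi> x)"
proof (rule LIMSEQ_I)
 interpret mu: prob_space \<mu> by (rule prob_space_mu)
 have L0: "0 <= L" using L[of undefined] by linarith
 define y where "y n = Y w (u n)" for n
 have a: "adm (u n) (y n)" for n unfolding adm_def using u(1) by simp
 have u0: "0 <= u n" for n using u(1)[of n] by simp
 have "(\<lambda>n. Y w (u n)) \<longlonglongrightarrow> Y w 0"
  using u u0 by (intro continuous_on_tendsto_compose[OF Y_cont[OF dy(1)]] always_eventually) auto
 then have y: "y \<longlonglongrightarrow> 0" by (simp add: y_def[abs_def] Y_zero[OF dy(1)])
 fix e :: real assume e: "0 < e"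
 \<comment> \<open>Five errors add up to less than 4 L d + d: two from restricting, two from
   renormalizing, one from the convergence. The bound 1/2 keeps the restricted masses
   positive.\<close>
 define d where "d = min (1/2) (e / (8 * (L + 1)))"
 have d: "0 < d" "d <= 1/2" "8 * (L + 1) * d <= e"
 proof -
  show "0 < d" using e L0 by (auto simp: d_def)
  show "d <= 1/2" unfolding d_def by (rule min.cobounded1)
  have "d <= e / (8 * (L + 1))" unfolding d_def by (rule min.cobounded2)
  then show "8 * (L + 1) * d <= e" using L0 by (simp add: field_simps)
 qed
 from reals_Archimedean[OF d(1)] obtain m where m: "1 / real (Suc m) < d" by (auto simp: inverse_eq_divide)
 from dy(2) obtain K1 where K1: "\<And>r. r \<in> {0<..1} ==> \<bar>cE (indicator (tail K1)) w r\<bar> <= 1 / real (Suc m)"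
  unfolding tight_def by blast
 from LIMSEQ_D[OF tail_tendsto d(1)] obtain K2 where K2: "\<And>K. K2 <= K ==> measure \<mu> (tail K) < d" by auto
 define K where "K = max K1 K2"
 have tK: "tail K \<subseteq> tail K1" by (auto simp: K_def tail_def)
 define i where "i x = (indicator (- tail K) x :: real)" for x
 define j where "j x = (indicator (tail K) x :: real)" for x
 have m'[measurable]: "i \<in> borel_measurable borel" "j \<in> borel_measurable borel" unfolding i_def[abs_def] j_def[abs_def] by measurable
 have ij: "i x = 1 - j x" "0 <= j x" "j x <= 1" "0 <= i x" "i x <= 1" for x by (auto simp: i_def j_def indicator_def)
 have key: "\<bar>(LINT x|P. \<phi> x) - (LINT x|P. \<phi> x * i x)\<bar> <= L * (LINT x|P. j x) \<and> (LINT x|P. i x) = 1 - (LINT x|P. j x)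
   \<and> \<bar>(LINT x|P. \<phi> x * i x)\<bar> <= L * (LINT x|P. i x)"
  if P: "prob_space P" "sets P = sets borel" for P
 proof -
  interpret P: prob_space P by fact
  have [measurable_cong]: "sets P = sets borel" by fact
  have ii: "integrable P i" "integrable P j" "integrable P \<phi>"
   using ij L by (auto intro!: P.integrable_const_bound[where B=1 and f=i] P.integrable_const_bound[where B=1 and f=j]
    P.integrable_const_bound[where B=L and f=\<phi>] AE_I2 simp del: ij(1))
  have i\<phi>: "integrable P (\<lambda>x. \<phi> x * i x)" "integrable P (\<lambda>x. \<phi> x * j x)"
   using L L0 by (auto intro!: P.integrable_const_bound[where B=L] AE_I2 simp: i_def j_def indicator_def)
  have "(LINT x|P. \<phi> x) - (LINT x|P. \<phi> x * i x) = (LINT x|P. \<phi> x * j x)"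
   using ii i\<phi> by (simp add: Bochner_Integration.integral_diff[symmetric] ij(1) algebra_simps del: Bochner_Integration.integral_diff)
  moreover have "\<bar>\<integral>x. \<phi> x * j x \<partial>P\<bar> <= (LINT x|P. L * j x)"
   using L ij(2-5) by (intro order_trans[OF integral_abs_bound] integral_mono integrable_abs i\<phi> integrable_mult_right ii)
    (auto simp: abs_mult intro!: mult_right_mono)
  moreover have "\<bar>\<integral>x. \<phi> x * i x \<partial>P\<bar> <= (LINT x|P. L * i x)"
   using L ij(2-5) by (intro order_trans[OF integral_abs_bound] integral_mono integrable_abs i\<phi> integrable_mult_right ii)
    (auto simp: abs_mult intro!: mult_right_mono)
  moreover have "(LINT x|P. i x) = 1 - (LINT x|P. j x)" unfolding ij(1) using ii by (simp add: P.prob_space)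
  ultimately show ?thesis by simp
 qed
 define p where "p = (LINT x|\<mu>. i x)"
 define q where "q = (LINT x|\<mu>. \<phi> x * i x)"
 have jmu: "(LINT x|\<mu>. j x) = measure \<mu> (tail K)" by (simp add: j_def)
 have mu: "\<bar>(LINT x|\<mu>. \<phi> x) - q\<bar> <= L * d" "1 - d <= p" "p <= 1" "\<bar>q\<bar> <= L * p"
  using key[of \<mu>, OF prob_space_mu] K2[of K] mult_left_mono[OF less_imp_le[OF K2[of K]] L0] measure_nonneg[of \<mu> "tail K"]
  unfolding jmu p_def q_def by (auto simp: K_def)
 have p0: "0 < p" using mu(2) d(2) by simp
 have "(\<lambda>n. Zf (\<lambda>x. \<phi> x * i x) (u n) (y n) / Zf i (u n) (y n)) \<longlonglongrightarrow> q / p"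
  unfolding p_def q_def
 proof (intro tendsto_divide Zf_zero_tendsto[where K=K] u0 u(2) y)
  show "\<bar>\<phi> x * i x\<bar> <= L" for x using L[of x] L0 by (auto simp: i_def indicator_def)
  show "\<bar>i x\<bar> <= 1" for x by (simp add: i_def indicator_def)
  show "(LINT x|\<mu>. i x) \<noteq> 0" using p0 by (simp add: p_def)
 qed (auto simp: i_def)
 from LIMSEQ_D[OF this, of d] d obtain n1 where n1: "\<And>n. n1 <= n ==> \<bar>Zf (\<lambda>x. \<phi> x * i x) (u n) (y n) / Zf i (u n) (y n) - q / p\<bar> < d" by auto
 from LIMSEQ_D[OF u(2), of 1] obtain n2 where n2: "\<And>n. n2 <= n ==> \<bar>u n\<bar> < 1" by auto
 show "\<exists>no. \<forall>n\<ge>no. norm (cE \<phi> w (u n) - (LINT x|\<mu>. \<phi> x)) < e"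
 proof (intro exI[of _ "max n1 n2"] allI impI)
  fix n assume n: "max n1 n2 <= n"
  let ?P = "post (u n) (y n)"
  interpret P: prob_space ?P by (rule prob_space_post[OF a])
  define R where "R = Zf (\<lambda>x. \<phi> x * i x) (u n) (y n) / Zf i (u n) (y n)"
  have kP: "\<bar>pE \<phi> (u n) (y n) - pE (\<lambda>x. \<phi> x * i x) (u n) (y n)\<bar> <= L * pE j (u n) (y n)"
   "pE i (u n) (y n) = 1 - pE j (u n) (y n)" "\<bar>pE (\<lambda>x. \<phi> x * i x) (u n) (y n)\<bar> <= L * pE i (u n) (y n)"
   using key[of ?P, OF P.prob_space_axioms] by (auto simp: pE_def)
  have "pE j (u n) (y n) <= pE (indicator (tail K1)) (u n) (y n)"
   unfolding pE_def
  proof (rule integral_mono)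
   show "integrable ?P j" "integrable ?P (indicator (tail K1) :: 'a => real)"
    using ij by (auto intro!: P.integrable_const_bound[where B=1])
   show "j x <= indicator (tail K1) x" for x using tK by (auto simp: j_def indicator_def)
  qed
  also have "\<dots> <= d" using K1[of "u n"] n2[of n] n u(1)[of n] m by (auto simp: y_def)
  finally have jd: "pE j (u n) (y n) <= d" .
  have j0: "0 <= pE j (u n) (y n)" unfolding pE_def using ij by simp
  have i0: "0 < pE i (u n) (y n)" using kP(2) jd d by linarith
  have Zp: "0 < Z (u n) (y n)" by (rule Z_pos[OF a])
  have R: "R = pE (\<lambda>x. \<phi> x * i x) (u n) (y n) / pE i (u n) (y n)"
   unfolding R_def using Zp i0 by (simp add: pE_eq[OF _ a])
  have RL: "\<bar>R\<bar> <= L" unfolding R using kP(3) i0 by (simp add: abs_divide field_simps)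
  have "pE (\<lambda>x. \<phi> x * i x) (u n) (y n) - R = - (pE j (u n) (y n) * R)"
  proof -
   have "pE (\<lambda>x. \<phi> x * i x) (u n) (y n) = pE i (u n) (y n) * R" unfolding R using i0 by simp
   then show ?thesis unfolding kP(2) by (simp add: algebra_simps)
  qed
  then have c2: "\<bar>pE (\<lambda>x. \<phi> x * i x) (u n) (y n) - R\<bar> <= d * L"
   using mult_mono[OF jd RL] d(1) j0 by (simp add: abs_mult)
  have c1: "\<bar>pE \<phi> (u n) (y n) - pE (\<lambda>x. \<phi> x * i x) (u n) (y n)\<bar> <= L * d"
   by (rule order_trans[OF kP(1) mult_left_mono[OF jd L0]])
  have qp: "\<bar>q / p\<bar> <= L" using mu(4) p0 by (simp add: abs_divide field_simps)
  have "q / p - q = (1 - p) * (q / p)" using p0 by (simp add: field_simps)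
  then have c4: "\<bar>q / p - q\<bar> <= d * L" using mult_mono[of "1 - p" d "\<bar>q / p\<bar>" L] qp mu(2,3) d(1) by (simp add: abs_mult)
  have c3: "\<bar>R - q / p\<bar> < d" using n1[of n] n by (simp add: R_def)
  have "\<bar>pE \<phi> (u n) (y n) - (LINT x|\<mu>. \<phi> x)\<bar> < 4 * (L * d) + d"
   using c1 c2 c3 c4 mu(1) by (simp add: mult.commute)
  also have "\<dots> <= 8 * (L + 1) * d" using d(1) L0 by (simp add: algebra_simps)
  finally show "norm (cE \<phi> w (u n) - (LINT x|\<mu>. \<phi> x)) < e" using d(3) by (simp add: y_def)
 qed
qed

lemma tight_cont:
 assumes \<phi>[measurable]: "\<phi> \<in> borel_measurable borel" and L: "\<And>x. \<bar>\<phi> x\<bar> <= L" and dy: "w \<in> space M" "tight w"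
 shows "continuous_on {0..} (\<lambda>t. cE \<phi> w t)"
 unfolding continuous_on
proof (intro ballI)
 fix t :: real assume t: "t \<in> {0..}"
 show "((\<lambda>t. cE \<phi> w t) \<longlongrightarrow> cE \<phi> w t) (at t within {0..})"
 proof (cases "t = 0")
  case True
  have "((\<lambda>t. cE \<phi> w t) \<longlongrightarrow> (LINT x|\<mu>. \<phi> x)) (at 0 within {0..})"
   unfolding tendsto_at_iff_sequentially comp_def
   by (intro allI impI tight_tendsto[OF \<phi> L dy]) (auto simp: less_le)
  then show ?thesis using True by (simp add: pE_def Y_zero[OF dy(1)] post_zero)
 next
  case False
  then have "t \<in> {0<..}" using t by simp
  with pE_path_cont[OF mild_bounded[OF \<phi> L] dy(1)] have "((\<lambda>t. cE \<phi> w t) \<longlongrightarrow> cE \<phi> w t) (at t)"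
   by (metis at_within_open continuous_on_def open_greaterThan)
  then show ?thesis by (rule tendsto_within_subset) auto
 qed
qed

end

section \<open>The driving Brownian motion\<close>

context bm_filter
begin

text \<open>On [2^-(k+1), 2^-k] the innovation has variance 2^-(k+1). The threshold (3/4)^k is
  summable, and so is the variance divided by its square, which is of order (8/9)^k; hence
  Borel-Cantelli applies.\<close>

definition vanishing :: "'w => bool" where
 "vanishing w \<longleftrightarrow> (\<exists>n. \<forall>k\<ge>n. \<forall>r\<in>{(1/2) ^ Suc k..(1/2) ^ k}. \<not> (3/4) ^ k < \<bar>V ((1/2) ^ Suc k) r w\<bar>)"

lemma AE_vanishing: "{w\<in>space M. vanishing w} \<in> events" "prob {w\<in>space M. vanishing w} = 1"
proof -
 define a b :: "nat => real" where "a k = (1/2) ^ Suc k" and "b k = (1/2) ^ k" for k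
 have ab: "0 < a k" "a k < b k" "a k <= b k" "b k - a k = (1/2) ^ Suc k" for k by (auto simp: a_def b_def)
 define S where "S k = {w\<in>space M. \<exists>r\<in>{a k..b k}. (3/4) ^ k < \<bar>V (a k) r w\<bar>}" for k
 have S: "S k \<in> events \<and> prob (S k) <= (1/2) * (8/9) ^ k" for k
 proof -
  define D where "D r w = 1 * V (a k) (max (a k) (min r (b k))) w" for r w
  have D: "L2mart D" unfolding D_def by (rule L2mart_V[OF ab(1,2), where h="\<lambda>_. 1" and c=1]) auto
  have Deq: "D r w = V (a k) r w" if "r \<in> {a k..b k}" for r w using that by (simp add: D_def)
  have cont: "continuous_on {a k..b k} (\<lambda>r. D r w)" if "w \<in> space M" for w
   by (rule continuous_on_eq[OF V_cont[OF that ab(1)]]) (simp add: Deq)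
  have Seq: "{w\<in>space M. \<exists>r\<in>{a k..b k}. (3/4) ^ k < \<bar>D r w\<bar>} = S k" by (auto simp: S_def Deq)
  have a0: "0 <= a k" using ab(1)[of k] by simp
  note m = L2mart_maximal[where c="(3/4) ^ k", OF D a0 ab(3) _ cont, unfolded Seq]
  have "((3/4) ^ k)^2 * prob (S k) <= (LINT w|M. (D (b k) w)^2)" by (rule m(2)) auto
  also have "\<dots> = (LINT w|M. (V (a k) (b k) w)^2)" using ab(3)[of k] by (simp add: Deq)
  also have "\<dots> = (1/2) ^ Suc k" by (simp add: V_moments(4)[OF ab(1,2)] ab(4))
  also have "\<dots> = (9/16) ^ k * ((1/2) * (8/9) ^ k)" by (simp add: power_mult_distrib[symmetric])
  also have "((3/4::real) ^ k)^2 = (9/16) ^ k" by (simp add: power2_eq_square power_mult_distrib[symmetric])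
  finally have "(9/16) ^ k * prob (S k) <= (9/16) ^ k * ((1/2) * (8/9) ^ k)" .
  then have "prob (S k) <= (1/2) * (8/9) ^ k" by simp
  with m(1) show ?thesis by simp
 qed
 then have [measurable]: "S k \<in> events" for k by blast
 have "summable (\<lambda>k. prob (S k))"
  by (rule summable_comparison_test'[where g="\<lambda>k. (1/2) * (8/9) ^ k" and N=0]) (use S in \<open>auto intro!: summable_mult summable_geometric\<close>)
 from borel_cantelli_AE1[OF _ _ this] have AE: "AE w in M. eventually (\<lambda>k. w \<in> space M - S k) sequentially"
  by (simp add: emeasure_eq_measure)
 have v: "vanishing w \<longleftrightarrow> eventually (\<lambda>k. w \<in> space M - S k) sequentially" if "w \<in> space M" for w
  using that unfolding vanishing_def S_def a_def b_def eventually_sequentially by blast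
 have eq: "{w\<in>space M. vanishing w} = (\<Union>n. \<Inter>k\<in>{n..}. space M - S k)"
 proof -
  have "w \<in> (\<Union>n. \<Inter>k\<in>{n..}. space M - S k) \<longleftrightarrow> eventually (\<lambda>k. w \<in> space M - S k) sequentially" for w
   unfolding eventually_sequentially by (simp only: UN_iff INT_iff Ball_def atLeast_iff bex_UNIV)
  moreover have "eventually (\<lambda>k. w \<in> space M - S k) sequentially ==> w \<in> space M" for w
   by (auto simp: eventually_sequentially)
  ultimately show ?thesis using v by blast
 qed
 show ev: "{w\<in>space M. vanishing w} \<in> events" unfolding eq by measurable
 have "AE w in M. w \<in> {w\<in>space M. vanishing w}" using AE AE_space by eventually_elim (use v in auto)
 with ev show "prob {w\<in>space M. vanishing w} = 1" using prob_eq_1[OF ev] by blast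
qed

text \<open>An improper integral at 0, taken through dyadic starting times. The minimum keeps the
  start at or before \<open>t\<close>, so that every term is \<open>F t\<close>-measurable.\<close>

definition W :: "'w => real => real" where
 "W w t = lim (\<lambda>k. V (min t ((1/2) ^ k)) t w)"

lemma W_zero: "W w 0 = 0"
 by (simp add: W_def V_self min_def)

lemma W_meas: assumes "0 <= t" shows "(\<lambda>w. W w t) \<in> borel_measurable (F t)"
proof (cases "t = 0")
 case False
 then show ?thesis unfolding W_def using assms by (intro borel_measurable_lim_metric V_meas_F) auto
qed (simp add: W_zero)

end

lemma half_power_le_eventually: "0 < t ==> eventually (\<lambda>k. (1/2) ^ k <= (t::real)) sequentially"
 by (rule eventually_mono[OF order_tendstoD(2)[OF LIMSEQ_realpow_zero[of "1/2"], of t]]) auto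

text \<open>Regularity is assumed at every sample point; \<open>bm_solution_exists\<close> achieves
  this by shrinking the sample space.\<close>

locale bm_solution = bm_filter M X B \<rho> for M :: "'w measure" and X :: "'w => 'a::euclidean_space" and B \<rho> +
 assumes all_tight: "w \<in> space M ==> tight w"
  and all_vanishing: "w \<in> space M ==> vanishing w"
begin

text \<open>The increments over dyadic intervals telescope and are absolutely summable by
  \<open>vanishing\<close>; \<open>U\<close> moves the end time from 1 to \<open>t\<close>.\<close>

lemma W_tendsto:
 assumes dy: "w \<in> space M" and t: "0 < t"
 shows "(\<lambda>k. V (min t ((1/2) ^ k)) t w) \<longlonglongrightarrow> W w t"
proof -
 define a where "a k = V ((1/2) ^ Suc k) ((1/2) ^ k) w" for k :: nat
 from all_vanishing[OF dy] obtain n where n: "\<And>k. n <= k ==> \<bar>a k\<bar> <= (3/4) ^ k"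
  unfolding vanishing_def a_def by (force simp: not_less)
 have "summable a"
  by (rule summable_comparison_test'[where g="\<lambda>k. (3/4) ^ k" and N=n]) (use n in \<open>auto intro: summable_geometric\<close>)
 then have s: "(\<lambda>k. \<Sum>i<k. a i) \<longlonglongrightarrow> suminf a" by (rule summable_LIMSEQ)
 have v: "(\<Sum>i<k. a i) = V ((1/2) ^ k) 1 w" for k
 proof (induction k)
  case 0 then show ?case by (simp add: V_self)
 next
  case (Suc k)
  have "(1/2::real) ^ k <= 1" by (rule power_le_one) auto
  then have "V ((1/2) ^ Suc k) ((1/2) ^ k) w + V ((1/2) ^ k) 1 w = V ((1/2) ^ Suc k) 1 w" by (intro V_add[OF dy]) auto
  then show ?case using Suc by (simp add: a_def)
 qed
 define U where "U = (if 1 <= t then V 1 t w else - V t 1 w)"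
 have "eventually (\<lambda>k. V ((1/2) ^ k) 1 w + U = V (min t ((1/2) ^ k)) t w) sequentially"
  using half_power_le_eventually[OF t]
 proof eventually_elim
  case (elim k)
  then have m: "min t ((1/2) ^ k) = (1/2) ^ k" by simp
  have k1: "(1/2::real) ^ k <= 1" by (rule power_le_one) auto
  show ?case
  proof (cases "1 <= t")
   case True
   then show ?thesis unfolding m U_def using V_add[OF dy _ k1 True] by simp
  next
   case False
   then show ?thesis unfolding m U_def using V_add[OF dy _ elim, of 1] by simp
  qed
 qed
 moreover have "(\<lambda>k. V ((1/2) ^ k) 1 w + U) \<longlonglongrightarrow> suminf a + U" using s unfolding v by (intro tendsto_intros)
 ultimately have "(\<lambda>k. V (min t ((1/2) ^ k)) t w) \<longlonglongrightarrow> suminf a + U" by (rule Lim_transform_eventually[rotated])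
 then show ?thesis unfolding W_def by (metis limI)
qed

lemma W_increment:
 assumes dy: "w \<in> space M" and s: "0 < s" "s <= t"
 shows "W w t - W w s = V s t w"
proof -
 have t: "0 < t" using s by simp
 have "(\<lambda>k. V (min t ((1/2) ^ k)) t w - V (min s ((1/2) ^ k)) s w) \<longlonglongrightarrow> W w t - W w s"
  by (intro tendsto_diff W_tendsto dy s t)
 moreover have "eventually (\<lambda>k. V (min t ((1/2) ^ k)) t w - V (min s ((1/2) ^ k)) s w = V s t w) sequentially"
  using half_power_le_eventually[OF s(1)]
 proof eventually_elim
  case (elim k)
  then have m: "min t ((1/2) ^ k) = (1/2) ^ k" "min s ((1/2) ^ k) = (1/2) ^ k" using s by auto
  show ?case unfolding m using V_add[OF dy _ elim s(2)] by simp
 qed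
 ultimately have "(\<lambda>_. V s t w) \<longlonglongrightarrow> W w t - W w s" by (rule Lim_transform_eventually)
 then show ?thesis by (simp add: LIMSEQ_const_iff)
qed

text \<open>The factor 4 sums the geometric bounds: the powers of 3/4 from exponent \<open>k\<close>
  on add up to 4 times the first one.\<close>

lemma W_small:
 assumes dy: "w \<in> space M" and n: "\<And>k r. n <= k ==> r \<in> {(1/2) ^ Suc k..(1/2) ^ k} ==> \<bar>V ((1/2) ^ Suc k) r w\<bar> <= (3/4) ^ k"
  and k: "n <= k" and t: "t \<in> {(1/2) ^ Suc k..(1/2) ^ k}"
 shows "\<bar>W w t\<bar> <= 4 * (3/4) ^ k"
proof -
 have "(0::real) < (1/2) ^ Suc k" by simp
 also have "\<dots> <= t" using t by simp
 finally have t0: "0 < t" .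
 \<comment> \<open>The subtracted term is the part of the geometric sum that is still to come, which
   lets the induction close.\<close>
 have b: "\<bar>V ((1/2) ^ (Suc k + m)) t w\<bar> <= 4 * (3/4) ^ k - 4 * (3/4) ^ (Suc k + m)" for m
 proof (induction m)
  case 0 then show ?case using n[OF k t] by simp
 next
  case (Suc m)
  have le: "(1/2::real) ^ (Suc k + m) <= (1/2) ^ Suc k" by (rule power_decreasing) auto
  have "V ((1/2) ^ Suc (Suc k + m)) ((1/2) ^ (Suc k + m)) w + V ((1/2) ^ (Suc k + m)) t w = V ((1/2) ^ Suc (Suc k + m)) t w"
   using order_trans[OF le] t by (intro V_add[OF dy]) (auto simp del: power_Suc)
  moreover have "\<bar>V ((1/2) ^ Suc (Suc k + m)) ((1/2) ^ (Suc k + m)) w\<bar> <= (3/4) ^ (Suc k + m)"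
   using k by (intro n) auto
  moreover have "(3/4::real) ^ (Suc k + m) = 4 * (3/4) ^ (Suc k + m) - 4 * (3/4) ^ (Suc k + Suc m)" by simp
  ultimately show ?case using Suc.IH by (simp only: add_Suc_right)
 qed
 have "eventually (\<lambda>j. \<bar>V (min t ((1/2) ^ j)) t w\<bar> <= 4 * (3/4) ^ k) sequentially"
  using half_power_le_eventually[OF t0] eventually_ge_at_top[of "Suc k"]
 proof eventually_elim
  case (elim j)
  then have m: "min t ((1/2) ^ j) = (1/2) ^ j" "Suc k + (j - Suc k) = j" by auto
  have "\<bar>V ((1/2) ^ j) t w\<bar> <= 4 * (3/4) ^ k - 4 * (3/4) ^ j" using b[of "j - Suc k"] unfolding m(2) .
  moreover have "(0::real) <= 4 * (3/4) ^ j" by simp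
  ultimately show ?case unfolding m by linarith
 qed
 moreover have "(\<lambda>j. \<bar>V (min t ((1/2) ^ j)) t w\<bar>) \<longlonglongrightarrow> \<bar>W w t\<bar>" by (intro tendsto_rabs W_tendsto[OF dy t0])
 ultimately show ?thesis by (intro tendsto_upperbound) auto
qed

lemma W_cont: assumes dy: "w \<in> space M" shows "continuous_on {0..} (W w)"
 unfolding continuous_on
proof (intro ballI)
 fix t :: real assume t: "t \<in> {0..}"
 show "(W w \<longlongrightarrow> W w t) (at t within {0..})"
 proof (cases "t = 0")
  case False
  then have t0: "0 < t / 2" "t / 2 < t" using t by auto
  have "continuous_on {t / 2..t + 1} (\<lambda>r. W w (t / 2) + V (t / 2) r w)"
   by (intro continuous_intros V_cont[OF dy t0(1)])
  then have "continuous_on {t / 2..t + 1} (W w)"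
  proof (rule continuous_on_eq)
   fix r assume "r \<in> {t / 2..t + 1}"
   then have "W w r - W w (t / 2) = V (t / 2) r w" by (intro W_increment[OF dy t0(1)]) simp
   then show "W w (t / 2) + V (t / 2) r w = W w r" by linarith
  qed
  then have "isCont (W w) t" by (rule continuous_on_interior) (use t0 in simp)
  then show ?thesis unfolding isCont_def by (rule tendsto_within_subset) simp
 next
  case True
  from all_vanishing[OF dy] obtain n where n: "\<And>k r. n <= k ==> r \<in> {(1/2) ^ Suc k..(1/2) ^ k} ==> \<bar>V ((1/2) ^ Suc k) r w\<bar> <= (3/4) ^ k"
   unfolding vanishing_def not_less by blast
  have "(W w \<longlongrightarrow> 0) (at 0 within {0..})"
  proof (rule tendstoI)
   fix e :: real assume e: "0 < e"
   have "(\<lambda>k. (3/4::real) ^ k) \<longlonglongrightarrow> 0" by (intro LIMSEQ_realpow_zero) auto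
   from order_tendstoD(2)[OF this, of "e / 4"] e
   have "eventually (\<lambda>k. (3/4::real) ^ k < e / 4) sequentially" by simp
   then have "eventually (\<lambda>k. 4 * (3/4::real) ^ k < e \<and> n <= k) sequentially"
    using eventually_ge_at_top[of n] by eventually_elim auto
   then obtain K where K: "4 * (3/4::real) ^ K < e" "n <= K" by (auto simp: eventually_sequentially)
   have "\<bar>W w r\<bar> < e" if r: "0 < r" "r < (1/2) ^ K" for r
   proof -
    \<comment> \<open>Level of the dyadic interval that contains \<open>r\<close>; since r < 2^-K,
      it is at least \<open>K\<close>.\<close>
    define k where "k = (LEAST k. (1/2) ^ Suc k <= r)"
    obtain j where "(1/2) ^ j <= r" using half_power_le_eventually[OF r(1)] by (auto simp: eventually_sequentially)
    then have "(1/2) ^ Suc j <= r" using r(1) by simp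
    then have k1: "(1/2) ^ Suc k <= r" unfolding k_def by (rule LeastI)
    have k2: "r <= (1/2) ^ k"
    proof (cases k)
     case 0
     have "(1/2::real) ^ K <= 1" by (rule power_le_one) auto
     then show ?thesis using 0 r by simp
    next
     case (Suc k')
     then have "\<not> (1/2) ^ Suc k' <= r" using not_less_Least[of k' "\<lambda>k. (1/2) ^ Suc k <= r"] by (simp add: k_def)
     then show ?thesis using Suc by simp
    qed
    have kK: "K <= k"
    proof (rule ccontr)
     assume "\<not> K <= k"
     then have "(1/2::real) ^ K <= (1/2) ^ Suc k" by (intro power_decreasing) auto
     then show False using k1 r by linarith
    qed
    have "\<bar>W w r\<bar> <= 4 * (3/4) ^ k" by (rule W_small[OF dy n]) (use kK K k1 k2 in auto)
    also have "\<dots> <= 4 * (3/4) ^ K" using kK by (intro mult_left_mono power_decreasing) auto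
    finally show ?thesis using K by simp
   qed
   then show "\<forall>\<^sub>F r in at 0 within {0..}. dist (W w r) 0 < e"
    unfolding eventually_at by (intro exI[of _ "(1/2) ^ K"]) auto
  qed
  then show ?thesis using True by (simp add: W_zero)
 qed
qed

text \<open>For s > 0 the increment is \<open>V s t\<close>. For s = 0 it is the limit of
  \<open>V\<close> from dyadic starting times; an event of \<open>F 0\<close> belongs to the
  sigma-algebra of each of these times, so the characteristic functions pass to the limit.\<close>

lemma W_gauss:
 assumes s: "0 <= s" "s < t" and A: "A \<in> sets (F s)" and D: "D \<in> sets borel"
 shows "prob {w\<in>space M. w \<in> A \<and> W w t - W w s \<in> D} = prob A * measure (gauss (t - s)) D" (is ?g1)
  and "distr M borel (\<lambda>w. W w t - W w s) = gauss (t - s)" (is ?g2)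
proof -
 have t: "0 < t" using s by simp
 have AM[measurable]: "A \<in> events" by (rule F_events[OF s(1) A])
 have [measurable]: "(\<lambda>w. W w t) \<in> borel_measurable M" "(\<lambda>w. W w s) \<in> borel_measurable M"
  using s by (auto intro: from_F[OF _ W_meas])
 have Wm: "(\<lambda>w. W w t - W w s) \<in> borel_measurable M" by measurable
 have char: "(LINT w|M. iexp (l * (W w t - W w s)) * indicator C w) = complex_of_real (exp (- (l^2 * (t - s) / 2))) * prob C"
  if C: "C \<in> sets (F s)" for C l
 proof (cases "s = 0")
  case False
  then have s0: "0 < s" "s <= t" using s by auto
  have "(LINT w|M. iexp (l * (W w t - W w s)) * indicator C w) = (LINT w|M. indicator C w * iexp (l * V s t w))"
   by (intro Bochner_Integration.integral_cong) (auto simp: W_increment[OF _ s0] mult.commute)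
  then show ?thesis using V_char[OF s0 C] by simp
 next
  case True
  have [measurable]: "C \<in> events" by (rule F_events[OF s(1) C])
  define q where "q k = min t ((1/2) ^ k)" for k :: nat
  have q: "0 < q k" "q k <= t" for k using t by (auto simp: q_def)
  have [measurable]: "V (q k) t \<in> borel_measurable M" for k using q t by (intro from_F[OF _ V_meas_F]) auto
  have q0: "q \<longlonglongrightarrow> 0"
  proof (rule Lim_transform_eventually)
   show "(\<lambda>k. (1/2::real) ^ k) \<longlonglongrightarrow> 0" by (rule LIMSEQ_realpow_zero) auto
   show "eventually (\<lambda>k. (1/2) ^ k = q k) sequentially"
    using half_power_le_eventually[OF t] by eventually_elim (simp add: q_def)
  qed
  have "(\<lambda>k. \<integral>w. indicator C w * iexp (l * V (q k) t w) \<partial>M) \<longlonglongrightarrow> (LINT w|M. indicator C w * iexp (l * (W w t - W w s)))"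
  proof (rule integral_dominated_convergence[where w="\<lambda>_. 1"])
   have "(\<lambda>k. indicator C w * iexp (l * V (q k) t w)) \<longlonglongrightarrow> indicator C w * iexp (l * W w t)" if "w \<in> space M" for w
    using W_tendsto[OF that t] unfolding q_def[symmetric] by (intro tendsto_intros)
   then show "AE w in M. (\<lambda>k. indicator C w * iexp (l * V (q k) t w)) \<longlonglongrightarrow> indicator C w * iexp (l * (W w t - W w s))"
    using True by (auto simp: W_zero)
   show "AE w in M. norm (indicator C w * iexp (l * V (q k) t w)) <= 1" for k
    by (intro AE_I2) (simp add: norm_mult indicator_def)
  qed simp_all
  moreover have "(LINT w|M. indicator C w * iexp (l * V (q k) t w)) = complex_of_real (exp (- (l^2 * (t - q k) / 2))) * prob C" for k
   using F_mono[of s "q k"] True q[of k] C by (intro V_char q) auto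
  moreover have "(\<lambda>k. complex_of_real (exp (- (l^2 * (t - q k) / 2))) * prob C) \<longlonglongrightarrow> complex_of_real (exp (- (l^2 * (t - 0) / 2))) * prob C"
   by (intro tendsto_intros q0) auto
  ultimately show ?thesis using True LIMSEQ_unique by (auto simp: mult.commute)
 qed
 have c1: "(LINT w|M. iexp (l * (W w t - W w s))) = complex_of_real (exp (- (l^2 * (t - s) / 2)))" for l
 proof -
  have sp: "space M \<in> sets (F s)" using sets.top[of "F s"] by simp
  have "(LINT w|M. iexp (l * (W w t - W w s))) = (LINT w|M. iexp (l * (W w t - W w s)) * indicator (space M) w)"
   by (intro Bochner_Integration.integral_cong) auto
  then show ?thesis using char[OF sp] by (simp add: prob_space)
 qed
 have h: "0 < t - s" using s by simp
 note i = indep_gauss_of_char[OF Wm AM D h c1 char[OF A]]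
 show ?g1 by (rule i(1))
 show ?g2 by (rule i(2))
qed

lemma brownian_motion_W: "brownian_motion M F W"
 unfolding brownian_motion_def
proof (intro conjI allI impI)
 show "(\<lambda>w. W w t) \<in> borel_measurable (F t)" if "0 <= t" for t using W_meas[OF that] .
 show "AE w in M. W w 0 = 0" by (simp add: W_zero)
 show "AE w in M. continuous_on {0..} (W w)" using W_cont by (auto intro: AE_I2)
 fix s t :: real assume st: "0 <= s \<and> s < t"
 then have s: "0 <= s" "s < t" by auto
 have sp: "space M \<in> sets (F s)" using sets.top[of "F s"] by simp
 have Wm[measurable]: "(\<lambda>w. W w t - W w s) \<in> borel_measurable M"
  using s by (intro borel_measurable_diff from_F[OF _ W_meas]) auto
 have d: "distr M borel (\<lambda>w. W w t - W w s) = gauss (t - s)" by (rule W_gauss(2)[OF s sp, of "{}"]) simp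
 show "distributed M lborel (\<lambda>w. W w t - W w s) (normal_density 0 (sqrt (t - s)))"
  unfolding distributed_def
  using d by (auto simp: gauss_def cong: distr_cong)
 show "indep_of_subalg M (F s) (\<lambda>w. W w t - W w s)"
  unfolding indep_of_subalg_def
 proof (intro ballI)
  fix A D assume A: "A \<in> sets (F s)" and D[measurable]: "D \<in> sets (borel :: real measure)"
  have AM: "A \<in> events" by (rule F_events[OF s(1) A])
  have "A \<inter> ((\<lambda>w. W w t - W w s) -` D \<inter> space M) = {w\<in>space M. w \<in> A \<and> W w t - W w s \<in> D}"
   using sets.sets_into_space[OF AM] by auto
  moreover have "prob ((\<lambda>w. W w t - W w s) -` D \<inter> space M) = measure (gauss (t - s)) D"
   unfolding d[symmetric] by (simp add: measure_distr)
  ultimately show "prob (A \<inter> ((\<lambda>w. W w t - W w s) -` D \<inter> space M)) = prob A * prob ((\<lambda>w. W w t - W w s) -` D \<inter> space M)"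
   using W_gauss(1)[OF s A D] by simp
 qed
qed

end

text \<open>Shrinks the sample space to an almost sure event on which all paths are regular.
  Posterior and innovation depend on the measure only through the law of \<open>X\<close>, which
  does not change, so regularity in the old sense is regularity in the new one.\<close>

theorem bm_solution_exists:
 fixes \<mu> :: "'a::euclidean_space measure"
 assumes "prob_space \<mu>" "sets \<mu> = sets borel" and \<rho>: "\<rho> \<in> borel_measurable borel"
 obtains M :: "real measure" and X :: "real => 'a" and B where "bm_solution M X B \<rho>" "distr M borel X = \<mu>"
proof -
 obtain M :: "real measure" and X :: "real => 'a" and B where MX: "bm_pair M X B" "distr M borel X = \<mu>"
  using bm_pair_exists[OF assms(1,2)] by blast
 interpret bm_pair M X B by (rule MX(1))
 interpret bm_filter M X B \<rho> by unfold_locales (rule \<rho>)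
 define G where "G = {w\<in>space M. tight w} \<inter> {w\<in>space M. vanishing w}"
 have G[measurable]: "G \<in> events" unfolding G_def using AE_tight(1) AE_vanishing(1) by blast
 have "AE w in M. w \<in> G"
  using AE_tight AE_vanishing prob_eq_1 by (auto simp: G_def)
 then have AEG: "AE w in M. w \<in> G" .
 then have G1: "prob G = 1" by (simp add: prob_eq_1)
 have Gs: "G \<subseteq> space M" by (auto simp: G_def)
 define M' where "M' = restrict_space M G"
 have spM': "space M' = G" unfolding M'_def using Gs by (auto simp: space_restrict_space)
 have meas': "measure M' (G \<inter> Q) = prob Q" if [measurable]: "Q \<in> events" for Q
 proof -
  have "measure M' (G \<inter> Q) = prob (G \<inter> Q)"
   unfolding M'_def using Gs G by (intro measure_restrict_space) (auto simp: Int_absorb2)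
  also have "\<dots> = prob Q" by (rule finite_measure_eq_AE) (use AEG in \<open>auto elim: eventually_mono\<close>)
  finally show ?thesis .
 qed
 have ps: "prob_space M'" unfolding M'_def using G G1 by (intro prob_space_restrict_space) (auto simp: emeasure_eq_measure)
 interpret P: bm_pair M' X B
 proof (unfold bm_pair_def bm_pair_axioms_def, intro conjI allI impI ps)
  show "X \<in> borel_measurable M'" unfolding M'_def by (intro measurable_restrict_space1) measurable
  show "(\<lambda>w. B w t) \<in> borel_measurable M'" if "0 <= t" for t
   unfolding M'_def by (intro measurable_restrict_space1 B_meas that)
  show "B w 0 = 0" "continuous_on {0..} (B w)" if "w \<in> space M'" for w using that Gs B_zero B_cont unfolding spM' by auto
  fix s t :: real and J and C0 :: "'a set" and C :: "real => real set" and D :: "real set"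
  assume s: "0 <= s" "s < t" and J: "finite J" "J \<subseteq> {0..s}" and C: "C0 \<in> sets borel" "\<forall>r. C r \<in> sets borel"
   and D[measurable]: "D \<in> sets borel"
  let ?Q = "{w\<in>space M. X w \<in> C0 \<and> (\<forall>r\<in>J. B w r \<in> C r)}"
  have "?Q \<in> cylG s" using J C unfolding cylG_def by blast
  then have Q: "?Q \<in> events" using cylG_events by blast
  have [measurable]: "(\<lambda>w. B w t) \<in> borel_measurable M" "(\<lambda>w. B w s) \<in> borel_measurable M" using s by (auto intro: B_meas)
  have Q2: "{w\<in>space M. (X w \<in> C0 \<and> (\<forall>r\<in>J. B w r \<in> C r)) \<and> B w t - B w s \<in> D} \<in> events"
   by (rule sets.sets_Collect_conj[OF _ Q]) measurable
  have e: "{w\<in>space M'. P w} = G \<inter> {w\<in>space M. P w}" for P using Gs by (auto simp: spM')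
  show "measure M' {w\<in>space M'. (X w \<in> C0 \<and> (\<forall>r\<in>J. B w r \<in> C r)) \<and> B w t - B w s \<in> D}
   = measure M' {w\<in>space M'. X w \<in> C0 \<and> (\<forall>r\<in>J. B w r \<in> C r)} * measure (gauss (t - s)) D"
   unfolding e meas'[OF Q] meas'[OF Q2] using C by (intro B_indep s J D) auto
 qed
 interpret P: bm_filter M' X B \<rho> by unfold_locales (rule \<rho>)
 have mu: "distr M' borel X = distr M borel X"
 proof (rule measure_eqI)
  fix A assume "A \<in> sets (distr M' borel X)"
  then have A[measurable]: "A \<in> sets borel" by simp
  have e: "X -` A \<inter> space M' = G \<inter> (X -` A \<inter> space M)" using Gs by (auto simp: spM')
  have m: "X -` A \<inter> space M \<in> events" by measurable
  show "emeasure (distr M' borel X) A = emeasure (distr M borel X) A"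
   by (subst (1 2) emeasure_distr) (use meas'[OF m] in \<open>auto simp: e P.emeasure_eq_measure emeasure_eq_measure\<close>)
 qed simp
 have Ze: "P.Z = Z" unfolding P.Z_def[abs_def] Z_def[abs_def] mu ..
 have pe: "P.post = post" unfolding P.post_def[abs_def] post_def[abs_def] mu Ze ..
 have pEe: "P.pE = pE" unfolding P.pE_def[abs_def] pE_def[abs_def] pe ..
 have pie: "P.V = V" unfolding P.V_def[abs_def] V_def[abs_def] P.pint_def[abs_def] pint_def[abs_def] pEe ..
 have "bm_solution M' X B \<rho>"
 proof unfold_locales
  fix w assume "w \<in> space M'"
  then have "tight w" "vanishing w" by (auto simp: spM' G_def)
  then show "P.tight w" "P.vanishing w"
   unfolding P.tight_def tight_def P.vanishing_def vanishing_def pEe pie by blast+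
 qed
 then show ?thesis by (rule that) (simp add: mu MX(2))
qed

section \<open>The stochastic integral\<close>

text \<open>The half-open intervals tile (t 0, t N], so exactly one index contributes at each point
  of it.\<close>

lemma sum_step:
 fixes t :: "nat => real"
 assumes mono: "\<And>i j. i <= j ==> t i <= t j"
 shows "i < N ==> s \<in> {t i<..t (Suc i)} ==> (\<Sum>i<N. c i * indicator {t i<..t (Suc i)} s) = (c i :: real)"
  and "s \<notin> {t 0<..t N} ==> (\<Sum>i<N. c i * indicator {t i<..t (Suc i)} s) = 0"
  and "s \<in> {t 0<..t N} ==> \<exists>i<N. s \<in> {t i<..t (Suc i)}"
proof -
 assume i: "i < N" "s \<in> {t i<..t (Suc i)}"
 have "c j * indicator {t j<..t (Suc j)} s = (if j = i then c i else 0)" for j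
 proof (cases j i rule: linorder_cases)
  case less
  then have "t (Suc j) <= t i" by (intro mono) simp
  then show ?thesis using less i by simp
 next
  case greater
  then have "t (Suc i) <= t j" by (intro mono) simp
  then show ?thesis using greater i by simp
 qed (use i in simp)
 then show "(\<Sum>i<N. c i * indicator {t i<..t (Suc i)} s) = c i" using i by simp
next
 assume s: "s \<notin> {t 0<..t N}"
 have "indicator {t i<..t (Suc i)} s = (0::real)" if "i < N" for i
  using s mono[of 0 i] mono[of "Suc i" N] that by (auto simp: indicator_def)
 then show "(\<Sum>i<N. c i * indicator {t i<..t (Suc i)} s) = 0" by simp
next
 show "\<exists>i<N. s \<in> {t i<..t (Suc i)}" if "s \<in> {t 0<..t N}"
  using that
 proof (induction N)
  case (Suc N)
  then show ?case by (cases "s <= t N") (auto intro: less_SucI)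
 qed simp
qed

context bm_filter
begin

lemma AE_pair_fst:
 assumes "AE w in M. P w" shows "AE p in MT. P (fst p)"
proof -
 interpret P: pair_sigma_finite M "lborel :: real measure" ..
 from assms obtain N where N: "{w\<in>space M. \<not> P w} \<subseteq> N" "emeasure M N = 0" "N \<in> events" by (rule AE_E)
 have "AE p in MT. fst p \<notin> N"
 proof (rule P.AE_pair_measure)
  show "{p \<in> space MT. fst p \<notin> N} \<in> sets MT" using N(3) by measurable
  show "AE x in M. AE y in (lborel :: real measure). fst (x, y) \<notin> N" using AE_not_in[of N M] N by (auto simp: null_sets_def)
 qed
 then show ?thesis using AE_space by eventually_elim (use N(1) in \<open>auto simp: space_pair_measure\<close>)
qed

lemma AE_pair_snd:
 assumes "AE s in lborel. P s" "{s. P s} \<in> sets borel" shows "AE p in MT. P (snd p)"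
proof -
 interpret P: pair_sigma_finite M "lborel :: real measure" ..
 have "{p \<in> space MT. P (snd p)} = space M \<times> {s. P s}" by (auto simp: space_pair_measure)
 then show ?thesis using assms by (intro P.AE_pair_measure) (auto intro!: AE_I2)
qed

text \<open>Simple processes live on half-open intervals so that steps do not overlap; the missing
  endpoint is a null set of times.\<close>

lemma increment_isometry_Ioc:
 assumes \<phi>: "\<phi> \<in> borel_measurable borel" "\<And>x. \<bar>\<phi> x\<bar> <= L" and s: "0 < s" "s < t"
  and g: "g \<in> borel_measurable (F s)" "\<And>w. \<bar>g w\<bar> <= c"
 shows "integrable MT (\<lambda>p. (HY \<phi> p - g (fst p))^2 * indicator {s<..t} (snd p))"
  "(LINT w|M. (cE \<phi> w t - cE \<phi> w s - g w * V s t w)^2)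
  = (LINT p|MT. (HY \<phi> p - g (fst p))^2 * indicator {s<..t} (snd p))"
proof -
 note I = increment_isometry(2,3)[OF \<phi> s g]
 let ?f = "\<lambda>p. indicator {s..t} (snd p) * (HY \<phi> p - g (fst p))^2"
 let ?f' = "\<lambda>p. (HY \<phi> p - g (fst p))^2 * indicator {s<..t} (snd p)"
 have eq: "?f' p = ?f p * indicator {s<..t} (snd p)" for p by (auto simp: indicator_def)
 have fm[measurable]: "?f \<in> borel_measurable MT" using I(1) by simp
 have fm': "?f' \<in> borel_measurable MT" unfolding eq by measurable
 have "{r. r \<noteq> s} \<in> sets borel" by measurable
 then have "AE p in MT. snd p \<noteq> s" by (intro AE_pair_snd AE_lborel_singleton)
 then have ae: "AE p in MT. ?f p = ?f' p" by eventually_elim (auto simp: indicator_def)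
 show "integrable MT ?f'" using I(1) integrable_cong_AE[OF fm fm' ae] by simp
 show "(LINT w|M. (cE \<phi> w t - cE \<phi> w s - g w * V s t w)^2) = integral\<^sup>L MT ?f'"
  unfolding I(2) by (rule integral_cong_AE[OF fm fm' ae])
qed

definition grid :: "real => real => nat => nat => real" where
 "grid e k n i = e + (k - e) * (real i / real (Suc n))"

lemma grid_simps:
 assumes "e < k"
 shows "grid e k n 0 = e" "grid e k n (Suc n) = k" "grid e k n i < grid e k n (Suc i)" "i <= j ==> grid e k n i <= grid e k n j"
  "grid e k n (Suc i) = grid e k n i + (k - e) / real (Suc n)"
proof -
 show 1: "grid e k n (Suc i) = grid e k n i + (k - e) / real (Suc n)" for i by (simp add: grid_def add_divide_distrib algebra_simps)
 show "grid e k n i < grid e k n (Suc i)" unfolding 1 using assms by simp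
 show "grid e k n i <= grid e k n j" if "i <= j"
  unfolding grid_def using that assms by (intro add_left_mono mult_left_mono divide_right_mono) auto
qed (auto simp: grid_def)

lemma step_approximation:
 assumes \<phi>: "\<phi> \<in> borel_measurable borel" "\<And>x. \<bar>\<phi> x\<bar> <= L" and e: "0 < e" "e < k" and d: "0 < d"
 obtains n h c where "\<And>i. h i \<in> borel_measurable (F (grid e k n i))" "\<And>i w. \<bar>h i w\<bar> <= c"
  "(LINT p|MT. indicator {e<..k} (snd p) * (HY \<phi> p - simple_proc (Suc n) (grid e k n) h (fst p) (snd p))^2) < d"
  "integrable MT (\<lambda>p. indicator {e<..k} (snd p) * (HY \<phi> p - simple_proc (Suc n) (grid e k n) h (fst p) (snd p))^2)"
proof -
 define H where "H p = HY \<phi> p" for p :: "'w \<times> real"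
 define I where "I p = (indicator {e<..k} (snd p) :: real)" for p :: "'w \<times> real"
 define cl where "cl m x = max (- real m) (min (real m) x)" for m and x :: real
 have cl: "\<bar>cl m x\<bar> <= real m" "\<bar>x - cl m x\<bar> <= \<bar>x\<bar>" for m x by (auto simp: cl_def)
 have clm[measurable]: "cl m \<in> borel_measurable borel" for m unfolding cl_def by measurable
 have clc: "continuous_on UNIV (cl m)" for m unfolding cl_def by (intro continuous_intros)
 note g = grid_simps[OF e(2)]
 have g0: "e <= grid e k n i" for n i using g(4)[of 0 i n] g(1) by simp
 have g1: "0 < grid e k n i" for n i using g0[of n i] e by simp
 define h where "h m n i w = cl m (Hc \<phi> (grid e k n i) (Y w (grid e k n i)))" for m n i w
 have hF: "h m n i \<in> borel_measurable (F (grid e k n i))" for m n i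
  unfolding h_def using measurable_compose[OF pathfun_meas_F[OF Hc_pathfun[OF \<phi>] g1] clm] by simp
 have hM[measurable]: "h m n i \<in> borel_measurable M" for m n i by (rule from_F[OF less_imp_le[OF g1] hF])
 define S where "S m n p = simple_proc (Suc n) (grid e k n) (h m n) (fst p) (snd p)" for m n and p :: "'w \<times> real"
 have Sm[measurable]: "S m n \<in> borel_measurable MT" for m n
  unfolding S_def[abs_def] simple_proc_def by measurable
 have ek: "e <= k" using e by simp
 have H0: "(\<lambda>p. indicator {e..k} (snd p) * H p) \<in> borel_measurable MT"
  unfolding H_def by (rule pathfun_meas_pair(2)[OF Hc_pathfun[OF \<phi>] e(1) ek])
 have Im[measurable]: "I \<in> borel_measurable MT" unfolding I_def[abs_def] by measurable
 have "(\<lambda>p. I p * H p) = (\<lambda>p. I p * (indicator {e..k} (snd p) * H p))" by (auto simp: I_def indicator_def)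
 then have IH: "(\<lambda>p. I p * H p) \<in> borel_measurable MT" using borel_measurable_times[OF Im H0] by (simp only:)
 have sq: "I p * (x - y)^2 = (I p * x - I p * y)^2" for p x y by (simp add: I_def indicator_def)
 have IHc: "(\<lambda>p. I p * cl m (H p)) \<in> borel_measurable MT" for m
 proof -
  have "(\<lambda>p. I p * cl m (H p)) = (\<lambda>p. I p * cl m (I p * H p))" by (auto simp: I_def indicator_def)
  then show ?thesis using borel_measurable_times[OF Im measurable_compose[OF IH clm[of m]]] by (simp only:)
 qed
 have iI: "integrable MT I"
  unfolding I_def[abs_def]
  by (rule Bochner_Integration.integrable_bound[OF integrable_pair_indicator(1)[OF ek]]) (auto intro!: AE_I2 simp: indicator_def)
 have iH2: "integrable MT (\<lambda>p. indicator {e..k} (snd p) * (H p)^2)"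
  unfolding H_def by (rule isometry(1)[OF \<phi> e(1) ek])
 have A: "(\<lambda>m. \<integral>p. I p * (H p - cl m (H p))^2 \<partial>MT) \<longlonglongrightarrow> (LINT p|MT. 0)"
  and A1: "\<And>m. integrable MT (\<lambda>p. I p * (H p - cl m (H p))^2)"
 proof -
  have meas: "(\<lambda>p. I p * (H p - cl m (H p))^2) \<in> borel_measurable MT" for m
   unfolding sq using IH IHc[of m] by measurable
  have bd: "norm (I p * (H p - cl m (H p))^2) <= indicator {e..k} (snd p) * (H p)^2" for m p
   using cl(2)[of "H p" m] by (auto simp: I_def indicator_def abs_le_square_iff)
  show "integrable MT (\<lambda>p. I p * (H p - cl m (H p))^2)" for m
   by (rule Bochner_Integration.integrable_bound[OF iH2 meas]) (use bd[of _ m] in \<open>auto intro!: AE_I2 intro: order_trans[OF _ abs_ge_self]\<close>)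
  show "(\<lambda>m. \<integral>p. I p * (H p - cl m (H p))^2 \<partial>MT) \<longlonglongrightarrow> (LINT p|MT. 0)"
  proof (rule integral_dominated_convergence[OF _ meas iH2 _ AE_I2[OF bd]])
   show "AE p in MT. (\<lambda>m. I p * (H p - cl m (H p))^2) \<longlonglongrightarrow> 0"
   proof (rule AE_I2, rule tendsto_eventually)
    fix p
    obtain m0 where m0: "\<bar>H p\<bar> <= real m0" using real_arch_simple by blast
    have "I p * (H p - cl m (H p))^2 = 0" if "m0 <= m" for m
    proof -
     have "\<bar>H p\<bar> <= real m" using m0 that by (meson of_nat_le_iff order_trans)
     then have "cl m (H p) = H p" unfolding cl_def by linarith
     then show ?thesis by simp
    qed
    then show "\<forall>\<^sub>F m in sequentially. I p * (H p - cl m (H p))^2 = 0" by (auto simp: eventually_sequentially)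
   qed
  qed simp
 qed
 from A have "(\<lambda>m. \<integral>p. I p * (H p - cl m (H p))^2 \<partial>MT) \<longlonglongrightarrow> 0" by simp
 \<comment> \<open>Clamping and sampling may each cost d / 4, because the square of a sum of two
   errors is at most twice the sum of their squares.\<close>
 from order_tendstoD(2)[OF this, of "d / 4"] d
 obtain m where m: "(LINT p|MT. I p * (H p - cl m (H p))^2) < d / 4" by (auto simp: eventually_sequentially)
 \<comment> \<open>On each step the process equals the clamped covariance at a time
   \<open>\<tau>\<close> within one mesh width of \<open>s\<close>, and this time is the same for
   all sample points.\<close>
 have st: "\<exists>\<tau>\<in>{e..k}. \<bar>\<tau> - s\<bar> <= (k - e) / real (Suc n) \<and> (\<forall>w. S m n (w, s) = cl m (H (w, \<tau>)))" if s: "s \<in> {e<..k}" for s n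
 proof -
  from sum_step(3)[of "grid e k n" s "Suc n", OF g(4)] s
  obtain i where i: "i < Suc n" "s \<in> {grid e k n i<..grid e k n (Suc i)}" unfolding g(1,2) by auto
  have "S m n (w, s) = h m n i w" for w
   unfolding S_def simple_proc_def fst_conv snd_conv by (rule sum_step(1)[of "grid e k n", OF g(4) i])
  then have "\<forall>w. S m n (w, s) = cl m (H (w, grid e k n i))" by (simp add: h_def H_def)
  moreover have "\<bar>grid e k n i - s\<bar> <= (k - e) / real (Suc n)" using i(2) unfolding g(5) by auto
  moreover have "grid e k n i \<in> {e..k}" using g0[of n i] i(2) s by auto
  ultimately show ?thesis by blast
 qed
 have Sb: "\<bar>S m n p\<bar> <= real m" for n p
 proof (cases "snd p \<in> {e<..k}")
  case True
  from st[OF this, of n] show ?thesis using cl(1)[of m] by (metis prod.collapse)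
 next
  case False
  then have "S m n p = 0" unfolding S_def simple_proc_def
   by (intro sum_step(2)[of "grid e k n", OF g(4)]) (auto simp: g(1,2))
  then show ?thesis by simp
 qed
 have Bm: "(\<lambda>p. I p * (cl m (H p) - S m n p)^2) \<in> borel_measurable MT" for n
  unfolding sq using IHc[of m] by measurable
 have Bb: "norm (I p * (cl m (H p) - S m n p)^2) <= (2 * real m)^2 * I p" for n p
 proof -
  have "\<bar>cl m (H p) - S m n p\<bar> <= 2 * real m" using cl(1)[of m "H p"] Sb[of n p] by linarith
  then have "(cl m (H p) - S m n p)^2 <= (2 * real m)^2" by (metis abs_ge_zero power2_abs power_mono)
  then show ?thesis by (simp add: I_def indicator_def)
 qed
 have iC: "integrable MT (\<lambda>p. (2 * real m)^2 * I p)" using iI by simp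
 have B1: "integrable MT (\<lambda>p. I p * (cl m (H p) - S m n p)^2)" for n
  by (rule Bochner_Integration.integrable_bound[OF iC Bm]) (use Bb[of _ n] in \<open>auto intro!: AE_I2 intro: order_trans[OF _ abs_ge_self]\<close>)
 have "(\<lambda>n. \<integral>p. I p * (cl m (H p) - S m n p)^2 \<partial>MT) \<longlonglongrightarrow> (LINT p|MT. 0)"
 proof (rule integral_dominated_convergence[OF _ Bm iC _ AE_I2[OF Bb]])
  show "AE p in MT. (\<lambda>n. I p * (cl m (H p) - S m n p)^2) \<longlonglongrightarrow> 0"
  proof (rule AE_I2)
   fix p assume "p \<in> space MT"
   then have dy: "fst p \<in> space M" by (auto simp: space_pair_measure)
   show "(\<lambda>n. I p * (cl m (H p) - S m n p)^2) \<longlonglongrightarrow> 0"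
   proof (cases "snd p \<in> {e<..k}")
    case True
    from st[OF this] obtain \<tau> where \<tau>: "\<And>n. \<tau> n \<in> {e..k}" "\<And>n. \<bar>\<tau> n - snd p\<bar> <= (k - e) / real (Suc n)"
     "\<And>n. S m n p = cl m (H (fst p, \<tau> n))" by (metis prod.collapse)
    have z: "(\<lambda>n. (k - e) / real (Suc n)) \<longlonglongrightarrow> 0" by (rule LIMSEQ_Suc[OF lim_const_over_n])
    have "(\<lambda>n. \<tau> n - snd p) \<longlonglongrightarrow> 0" by (rule Lim_null_comparison[OF _ z]) (use \<tau>(2) in auto)
    then have lim: "\<tau> \<longlonglongrightarrow> snd p" by (simp add: LIM_zero_iff)
    have "continuous_on {e..k} (\<lambda>r. cl m (Hc \<phi> r (Y (fst p) r)))"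
     by (rule continuous_on_compose2[OF clc pathfun_cont[OF Hc_pathfun[OF \<phi>] dy e(1)]]) auto
    from continuous_on_tendsto_compose[OF this lim] True \<tau>(1)
    have "(\<lambda>n. cl m (H (fst p, \<tau> n))) \<longlonglongrightarrow> cl m (H p)" by (simp add: H_def)
    then have "(\<lambda>n. I p * (cl m (H p) - S m n p)^2) \<longlonglongrightarrow> I p * (cl m (H p) - cl m (H p))^2"
     unfolding \<tau>(3) by (intro tendsto_intros)
    then show ?thesis by simp
   qed (simp add: I_def)
  qed
 qed simp
 then have "(\<lambda>n. \<integral>p. I p * (cl m (H p) - S m n p)^2 \<partial>MT) \<longlonglongrightarrow> 0" by simp
 from order_tendstoD(2)[OF this, of "d / 4"] d
 obtain n where n: "(LINT p|MT. I p * (cl m (H p) - S m n p)^2) < d / 4" by (auto simp: eventually_sequentially)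
 let ?R = "\<lambda>p. 2 * (I p * (H p - cl m (H p))^2) + 2 * (I p * (cl m (H p) - S m n p)^2)"
 have iR: "integrable MT ?R" using A1[of m] B1[of n] by simp
 have le: "I p * (H p - S m n p)^2 <= ?R p" for p
 proof -
  have "(a - c)^2 <= 2 * (a - b)^2 + 2 * (b - c)^2" for a b c :: real
   using zero_le_power2[of "(a - b) - (b - c)"] by (simp add: power2_eq_square algebra_simps)
  then show ?thesis by (simp add: I_def indicator_def)
 qed
 have "(\<lambda>p. I p * (H p - S m n p)^2) \<in> borel_measurable MT" unfolding sq using IH by measurable
 then have i: "integrable MT (\<lambda>p. I p * (H p - S m n p)^2)"
  by (rule Bochner_Integration.integrable_bound[OF iR]) (use le in \<open>auto intro!: AE_I2 simp: I_def intro: order_trans[OF _ abs_ge_self]\<close>)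
 have "(LINT p|MT. I p * (H p - S m n p)^2) <= (LINT p|MT. ?R p)" by (rule integral_mono[OF i iR le])
 also have "\<dots> < d" using A1[of m] B1[of n] m n by simp
 finally have "(LINT p|MT. I p * (H p - S m n p)^2) < d" .
 with that[of "h m n" n "real m"] hF i show ?thesis unfolding I_def H_def S_def by (simp add: h_def cl(1))
qed

end

context bm_solution
begin

lemma N_cont:
 assumes "\<phi> \<in> borel_measurable borel" "\<And>x. \<bar>\<phi> x\<bar> <= L" "w \<in> space M"
 shows "continuous_on {0..} (\<lambda>t. cE \<phi> w t)"
 by (rule tight_cont[OF assms all_tight[OF assms(3)]])

text \<open>Joint measurability is known on closed intervals of positive times; these exhaust (0,
  e].\<close>

lemma Hc_pair_meas:
 assumes \<phi>: "\<phi> \<in> borel_measurable borel" "\<And>x. \<bar>\<phi> x\<bar> <= L"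
 shows "(\<lambda>p. indicator {0<..e} (snd p) * HY \<phi> p) \<in> borel_measurable MT" (is "?f \<in> _")
proof (cases "0 < e")
 case True
 have le: "e / real (Suc n) <= e" "0 < e / real (Suc n)" for n using True by (auto simp: field_simps)
 show ?thesis
 proof (rule borel_measurable_LIMSEQ_real)
  show "(\<lambda>p. indicator {e / real (Suc n)..e} (snd p) * HY \<phi> p) \<in> borel_measurable MT" for n
   by (rule pathfun_meas_pair(2)[OF Hc_pathfun[OF \<phi>] le(2,1)])
  fix p :: "'w \<times> real"
  show "(\<lambda>n. indicator {e / real (Suc n)..e} (snd p) * HY \<phi> p) \<longlonglongrightarrow> ?f p"
  proof (cases "0 < snd p")
   case sp: True
   have "(\<lambda>n. e / real (Suc n)) \<longlonglongrightarrow> 0" by (rule LIMSEQ_Suc[OF lim_const_over_n])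
   from order_tendstoD(2)[OF this sp] have "eventually (\<lambda>n. indicator {e / real (Suc n)..e} (snd p) * HY \<phi> p = ?f p) sequentially"
    by eventually_elim (use sp in \<open>auto simp: indicator_def\<close>)
   then show ?thesis by (rule tendsto_eventually)
  next
   case False
   then have "snd p \<notin> {e / real (Suc n)..e}" for n using le(2)[of n] by auto
   then show ?thesis using False by simp
  qed
 qed
qed simp

text \<open>On [e / (n + 1), e] the isometry gives a difference of second moments, at most that from
  time 0 by Pythagoras; monotone convergence in n reaches (0, e]. So the covariance has finite
  energy near 0 although \<rho> may have no moments under \<mu>.\<close>

lemma head_bound:
 assumes \<phi>: "\<phi> \<in> borel_measurable borel" "\<And>x. \<bar>\<phi> x\<bar> <= L" and e: "0 < e"
 shows "(\<integral>\<^sup>+p. ennreal (indicator {0<..e} (snd p) * (HY \<phi> p)^2) \<partial>MT)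
  <= ennreal (LINT w|M. (cE \<phi> w e - pE \<phi> 0 0)^2)" (is "_ <= ennreal ?v")
proof -
 define f where "f n p = ennreal (indicator {e / real (Suc n)..e} (snd p) * (HY \<phi> p)^2)" for n and p :: "'w \<times> real"
 have le: "e / real (Suc n) <= e" "0 < e / real (Suc n)" for n using e by (auto simp: field_simps)
 note mart = L2mart_N[OF \<phi>]
 \<comment> \<open>\<open>pE \<phi> 0 0\<close> is the prior mean, which is the value of the
   martingale at time 0.\<close>
 have v: "?v = (LINT w|M. (cE \<phi> w e)^2) - (LINT w|M. (pE \<phi> 0 (Y w 0))^2)"
 proof -
  have "?v = (LINT w|M. (cE \<phi> w e - pE \<phi> 0 (Y w 0))^2)"
   by (intro Bochner_Integration.integral_cong) (auto simp: Y_zero)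
  then show ?thesis using L2mart_square_increment[OF mart order_refl less_imp_le[OF e]] by simp
 qed
 have b: "(\<integral>\<^sup>+p. f n p \<partial>MT) <= ennreal ?v" for n
 proof -
  note I = isometry[OF \<phi> le(2,1), of n]
  have "(\<integral>\<^sup>+p. f n p \<partial>MT) = ennreal ((LINT w|M. (cE \<phi> w e)^2) - (LINT w|M. (cE \<phi> w (e / real (Suc n)))^2))"
   unfolding f_def using nn_integral_eq_integral[OF I(1)] I(2) by simp
  also have "\<dots> <= ennreal ?v"
  proof (rule ennreal_leI)
   have "0 <= (LINT w|M. (cE \<phi> w (e / real (Suc n)) - pE \<phi> 0 (Y w 0))^2)" by simp
   then show "(LINT w|M. (cE \<phi> w e)^2) - (LINT w|M. (cE \<phi> w (e / real (Suc n)))^2) <= ?v"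
    unfolding v using L2mart_square_increment[OF mart order_refl less_imp_le[OF le(2)], of n] by linarith
  qed
  finally show ?thesis .
 qed
 have "(\<lambda>n. \<integral>\<^sup>+p. f n p \<partial>MT) \<longlonglongrightarrow> (\<integral>\<^sup>+p. ennreal (indicator {0<..e} (snd p) * (HY \<phi> p)^2) \<partial>MT)"
 proof (rule nn_integral_LIMSEQ)
  show "incseq f"
  proof (rule incseq_SucI, rule le_funI)
   fix n and p :: "'w \<times> real"
   have "e / real (Suc (Suc n)) <= e / real (Suc n)" using e by (intro divide_left_mono) auto
   then have "indicator {e / real (Suc n)..e} (snd p) <= (indicator {e / real (Suc (Suc n))..e} (snd p) :: real)"
    by (auto simp: indicator_def)
   then show "f n p <= f (Suc n) p" unfolding f_def by (intro ennreal_leI mult_right_mono) auto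
  qed
  show "f n \<in> borel_measurable MT" for n
   unfolding f_def using borel_measurable_integrable[OF isometry(1)[OF \<phi> le(2,1), of n]] by measurable
  fix p :: "'w \<times> real"
  show "(\<lambda>n. f n p) \<longlonglongrightarrow> ennreal (indicator {0<..e} (snd p) * (HY \<phi> p)^2)"
  proof (cases "0 < snd p")
   case sp: True
   have "(\<lambda>n. e / real (Suc n)) \<longlonglongrightarrow> 0" by (rule LIMSEQ_Suc[OF lim_const_over_n])
   from order_tendstoD(2)[OF this sp]
   have "eventually (\<lambda>n. f n p = ennreal (indicator {0<..e} (snd p) * (HY \<phi> p)^2)) sequentially"
    by eventually_elim (use sp in \<open>auto simp: indicator_def f_def\<close>)
   then show ?thesis by (rule tendsto_eventually)
  next
   case False
   then have "snd p \<notin> {e / real (Suc n)..e}" for n using le(2)[of n] by auto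
   then show ?thesis using False by (simp add: f_def)
  qed
 qed
 then show ?thesis by (rule LIMSEQ_le_const2) (use b in blast)
qed

text \<open>Bounded convergence, by continuity of the paths at 0.\<close>

lemma head_small:
 assumes \<phi>: "\<phi> \<in> borel_measurable borel" "\<And>x. \<bar>\<phi> x\<bar> <= L" and d: "0 < d" and k: "0 < k"
 obtains e where "0 < e" "e < k" "(LINT w|M. (cE \<phi> w e - pE \<phi> 0 0)^2) < d"
proof -
 define u where "u n = k / real (n + 2)" for n
 have u: "0 < u n" "u n < k" for n using k by (auto simp: u_def pos_divide_less_eq algebra_simps add_strict_increasing)
 have u0: "u \<longlonglongrightarrow> 0" unfolding u_def[abs_def] using LIMSEQ_ignore_initial_segment[OF lim_const_over_n, of k 2] by simp
 have p0: "pE \<phi> 0 0 = pE \<phi> 0 (Y w 0)" if "w \<in> space M" for w by (simp add: Y_zero[OF that])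
 have "(\<lambda>n. \<integral>w. (cE \<phi> w (u n) - pE \<phi> 0 0)^2 \<partial>M) \<longlonglongrightarrow> (LINT w|M. 0)"
 proof (rule integral_dominated_convergence[where w="\<lambda>_. (2 * L)^2"])
  show "AE w in M. (\<lambda>n. (cE \<phi> w (u n) - pE \<phi> 0 0)^2) \<longlonglongrightarrow> 0"
  proof (rule AE_I2)
   fix w assume dy: "w \<in> space M"
   have "(\<lambda>n. cE \<phi> w (u n)) \<longlonglongrightarrow> pE \<phi> 0 (Y w 0)"
    by (rule continuous_on_tendsto_compose[OF N_cont[OF \<phi> dy] u0]) (auto intro!: always_eventually less_imp_le[OF u(1)])
   then have "(\<lambda>n. (cE \<phi> w (u n) - pE \<phi> 0 0)^2) \<longlonglongrightarrow> (pE \<phi> 0 (Y w 0) - pE \<phi> 0 0)\<^sup>2" by (intro tendsto_intros)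
   then show "(\<lambda>n. (cE \<phi> w (u n) - pE \<phi> 0 0)^2) \<longlonglongrightarrow> 0" by (simp add: Y_zero[OF dy])
  qed
  show "AE w in M. norm ((cE \<phi> w (u n) - pE \<phi> 0 0)^2) <= (2 * L)^2" for n
  proof (rule AE_I2)
   fix w assume dy: "w \<in> space M"
   have "\<bar>cE \<phi> w (u n) - pE \<phi> 0 0\<bar> <= 2 * L"
    using N_bounded[OF \<phi> dy less_imp_le[OF u(1)[of n]]] N_bounded[OF \<phi> dy order_refl] unfolding p0[OF dy] by linarith
   then have "\<bar>cE \<phi> w (u n) - pE \<phi> 0 0\<bar>\<^sup>2 <= (2 * L)^2" by (intro power_mono) auto
   then show "norm ((cE \<phi> w (u n) - pE \<phi> 0 0)^2) <= (2 * L)^2" by simp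
  qed
  show "(\<lambda>w. (cE \<phi> w (u n) - pE \<phi> 0 0)^2) \<in> borel_measurable M" for n
   using from_F[OF _ pE_meas_F[OF _ \<phi>(1)], of "u n"] u(1)[of n] by simp
 qed auto
 then have "(\<lambda>n. \<integral>w. (cE \<phi> w (u n) - pE \<phi> 0 0)^2 \<partial>M) \<longlonglongrightarrow> 0" by simp
 from order_tendstoD(2)[OF this d] obtain n where "(LINT w|M. (cE \<phi> w (u n) - pE \<phi> 0 0)^2) < d"
  by (auto simp: eventually_sequentially)
 with that u show ?thesis by blast
qed

text \<open>The approximating integrand is 0 on (0, e] and a step process on (e, k]. The error
  \<open>D\<close> is a martingale whose second moment at \<open>k\<close> splits orthogonally into
  the head, small by \<open>head_small\<close>, and one increment per step, which
  \<open>increment_isometry_Ioc\<close> turns into the error of the integrand.\<close>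

lemma ito_approximation:
 assumes \<phi>: "\<phi> \<in> borel_measurable borel" "\<And>x. \<bar>\<phi> x\<bar> <= L" and k: "0 < k" and d: "0 < d"
 obtains n t h D where "simple_integrand F n t h"
  "(\<lambda>p. indicator {0<..k} (snd p) * (simple_proc n t h (fst p) (snd p) - HY \<phi> p)^2) \<in> borel_measurable MT"
  "(\<integral>\<^sup>+p. ennreal (indicator {0<..k} (snd p) * (simple_proc n t h (fst p) (snd p) - HY \<phi> p)^2) \<partial>MT) <= ennreal d"
  "L2mart D" "\<And>w. w \<in> space M ==> continuous_on {0..k} (\<lambda>r. D r w)"
  "\<And>w r. w \<in> space M ==> 0 <= r ==> D r w = cE \<phi> w r - pE \<phi> 0 0 - simple_stoch_int W n t h w r"
  "(LINT w|M. (D k w)^2) <= d"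
proof -
 have d2: "0 < d / 2" using d by simp
 obtain e where e: "0 < e" "e < k" and ve: "(LINT w|M. (cE \<phi> w e - pE \<phi> 0 0)^2) < d / 2"
  using head_small[OF \<phi> d2 k] by blast
 let ?v = "\<integral>w. (cE \<phi> w e - pE \<phi> 0 0)^2 \<partial>M"
 obtain m h c where h: "\<And>i. h i \<in> borel_measurable (F (grid e k m i))" "\<And>i w. \<bar>h i w\<bar> <= c"
  and err: "(LINT p|MT. indicator {e<..k} (snd p) * (HY \<phi> p - simple_proc (Suc m) (grid e k m) h (fst p) (snd p))^2) < d / 2"
  and ierr: "integrable MT (\<lambda>p. indicator {e<..k} (snd p) * (HY \<phi> p - simple_proc (Suc m) (grid e k m) h (fst p) (snd p))^2)"
  by (rule step_approximation[OF \<phi> e d2]) blast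
 define t where "t = grid e k m"
 note g = grid_simps[OF e(2), where n=m, folded t_def]
 have t0: "0 < t i" for i using g(4)[of 0 i] g(1) e by simp
 define H where "H p = HY \<phi> p" for p :: "'w \<times> real"
 define S where "S p = simple_proc (Suc m) t h (fst p) (snd p)" for p :: "'w \<times> real"
 \<comment> \<open>Written with innovation increments at clamped times, so that
   \<open>L2mart_V\<close> applies; \<open>Dint\<close> identifies the sum with
   \<open>simple_stoch_int\<close>.\<close>
 define D where "D r w = (cE \<phi> w r + (-1) * pE \<phi> 0 0) + (-1) * (\<Sum>i<Suc m. h i w * V (t i) (max (t i) (min r (t (Suc i)))) w)" for r w
 have mart: "L2mart D" unfolding D_def
  by (intro L2mart_add_scaled L2mart_N[OF \<phi>] L2mart_const L2mart_sum L2mart_V[OF t0 g(3) h[folded t_def]])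
 have cont: "continuous_on {0..k} (\<lambda>r. D r w)" if dy: "w \<in> space M" for w
 proof -
  have "continuous_on {0..k} (\<lambda>r. V (t i) (max (t i) (min r (t (Suc i)))) w)" for i
  proof (rule continuous_on_compose2[OF V_cont[OF dy t0]])
   show "continuous_on {0..k} (\<lambda>r. max (t i) (min r (t (Suc i))))" by (intro continuous_intros)
   show "(\<lambda>r. max (t i) (min r (t (Suc i)))) ` {0..k} \<subseteq> {t i..t (Suc i)}" using g(3)[of i] by auto
  qed
  then show ?thesis unfolding D_def
   by (intro continuous_intros continuous_on_subset[OF N_cont[OF \<phi> dy]]) auto
 qed
 have Dint: "D r w = cE \<phi> w r - pE \<phi> 0 0 - simple_stoch_int W (Suc m) t h w r" if dy: "w \<in> space M" and r: "0 <= r" for r w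
 proof -
  have "V (t i) (max (t i) (min r (t (Suc i)))) w = W w (min r (t (Suc i))) - W w (min r (t i))" for i
  proof (cases "r <= t i")
   case True
   then have "min r (t (Suc i)) = r" "min r (t i) = r" using g(3)[of i] by auto
   then show ?thesis using True by (simp add: V_self max_def)
  next
   case False
   then have "t i <= min r (t (Suc i))" "min r (t i) = t i" using g(3)[of i] by auto
   then show ?thesis using W_increment[OF dy t0] by (simp add: max_def)
  qed
  then show ?thesis unfolding D_def simple_stoch_int_def by simp
 qed
 have err_sum: "(\<Sum>i<Suc m. (H p - h i (fst p))\<^sup>2 * indicator {t i<..t (Suc i)} (snd p)) = indicator {e<..k} (snd p) * (H p - S p)^2" for p
 proof (cases "snd p \<in> {e<..k}")
  case True
  with sum_step(3)[of t "snd p" "Suc m", OF g(4)] obtain i where i: "i < Suc m" "snd p \<in> {t i<..t (Suc i)}"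
   unfolding g(1,2) by blast
  have "S p = h i (fst p)" unfolding S_def simple_proc_def by (rule sum_step(1)[of t, OF g(4) i])
  then show ?thesis using True sum_step(1)[of t, OF g(4) i] by simp
 next
  case False
  then have "snd p \<notin> {t 0<..t (Suc m)}" unfolding g(1,2) .
  from sum_step(2)[of t, OF g(4) this] False show ?thesis by simp
 qed
 have Dt: "(LINT w|M. (D (t j) w)^2) = ?v + (\<Sum>i<j. \<integral>p. (H p - h i (fst p))^2 * indicator {t i<..t (Suc i)} (snd p) \<partial>MT)"
  if "j <= Suc m" for j using that
 proof (induction j)
  case 0
  have "max (t i) (min e (t (Suc i))) = t i" for i using g(4)[of 0 i] unfolding g(1) by auto
  then have "D (t 0) w = cE \<phi> w e - pE \<phi> 0 0" for w unfolding D_def g(1) by (simp add: V_self)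
  then show ?case by simp
 next
  case (Suc j)
  have Dd: "D (t (Suc j)) w - D (t j) w = cE \<phi> w (t (Suc j)) - cE \<phi> w (t j) - h j w * V (t j) (t (Suc j)) w" for w
  proof -
   \<comment> \<open>Between consecutive grid times only the step in progress moves.\<close>
   have "h i w * V (t i) (max (t i) (min (t (Suc j)) (t (Suc i)))) w - h i w * V (t i) (max (t i) (min (t j) (t (Suc i)))) w
    = (if i = j then h j w * V (t j) (t (Suc j)) w else 0)" for i
   proof (cases i j rule: linorder_cases)
    case less
    then have "t (Suc i) <= t j" by (intro g(4)) simp
    then have "min (t (Suc j)) (t (Suc i)) = t (Suc i)" "min (t j) (t (Suc i)) = t (Suc i)" using g(3)[of j] by auto
    then show ?thesis using less by simp
   next
    case equal
    then show ?thesis using g(3)[of j] by (simp add: V_self max_def min_def)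
   next
    case greater
    then have "t (Suc j) <= t i" by (intro g(4)) simp
    then have "max (t i) (min (t (Suc j)) (t (Suc i))) = t i" "max (t i) (min (t j) (t (Suc i))) = t i" using g(3)[of j] by auto
    then show ?thesis using greater by simp
   qed
   then have "(\<Sum>i<Suc m. h i w * V (t i) (max (t i) (min (t (Suc j)) (t (Suc i)))) w) - (\<Sum>i<Suc m. h i w * V (t i) (max (t i) (min (t j) (t (Suc i)))) w)
    = h j w * V (t j) (t (Suc j)) w" unfolding sum_subtractf[symmetric] using Suc.prems by simp
   then show ?thesis unfolding D_def by simp
  qed
  show ?case
   unfolding L2mart_square_increment[OF mart less_imp_le[OF t0] less_imp_le[OF g(3)], of j] Dd
    increment_isometry_Ioc(2)[OF \<phi> t0 g(3) h[folded t_def]] using Suc by (simp add: H_def)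
 qed
 have "(LINT w|M. (D k w)^2) = ?v + (\<Sum>i<Suc m. \<integral>p. (H p - h i (fst p))^2 * indicator {t i<..t (Suc i)} (snd p) \<partial>MT)"
  using Dt[of "Suc m"] g(2) by simp
 also have "\<dots> = ?v + (LINT p|MT. (\<Sum>i<Suc m. (H p - h i (fst p))\<^sup>2 * indicator {t i<..t (Suc i)} (snd p)))"
  unfolding H_def by (subst Bochner_Integration.integral_sum) (auto intro: increment_isometry_Ioc(1)[OF \<phi> t0 g(3) h[folded t_def]])
 also have "\<dots> <= d" unfolding err_sum using ve err by (simp add: H_def S_def t_def)
 finally have D2: "(LINT w|M. (D k w)^2) <= d" .
 have split: "indicator {0<..k} (snd p) * (S p - H p)^2 = indicator {0<..e} (snd p) * (H p)^2 + indicator {e<..k} (snd p) * (H p - S p)^2" for p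
 proof (cases "snd p \<in> {e<..k}")
  case True
  then show ?thesis using e by (simp add: power2_commute)
 next
  case False
  then have "snd p \<notin> {t 0<..t (Suc m)}" unfolding g(1,2) .
  then have "S p = 0" unfolding S_def simple_proc_def by (intro sum_step(2)[of t, OF g(4)])
  then show ?thesis using False e by (auto simp: indicator_def)
 qed
 have m1: "(\<lambda>p. indicator {0<..e} (snd p) * (H p)^2) \<in> borel_measurable MT"
 proof -
  have "(\<lambda>p. indicator {0<..e} (snd p) * (H p)^2) = (\<lambda>p. (indicator {0<..e} (snd p) * H p)^2)" by (auto simp: indicator_def)
  then show ?thesis using borel_measurable_power[OF Hc_pair_meas[OF \<phi>, of e], of 2] by (simp add: H_def)
 qed
 note m2 = borel_measurable_integrable[OF ierr, folded t_def, folded S_def H_def]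
 show ?thesis
 proof (rule that[of "Suc m" t h D, OF _ _ _ mart cont Dint D2])
  show "simple_integrand F (Suc m) t h"
   unfolding simple_integrand_def using h g(3) less_imp_le[OF t0] by (auto simp: t_def)
  show "(\<lambda>p. indicator {0<..k} (snd p) * (simple_proc (Suc m) t h (fst p) (snd p) - HY \<phi> p)^2) \<in> borel_measurable MT"
   unfolding S_def[symmetric] H_def[symmetric] split using m1 m2 by (rule borel_measurable_add)
  have "(\<integral>\<^sup>+p. ennreal (indicator {0<..k} (snd p) * (S p - H p)^2) \<partial>MT)
   = (\<integral>\<^sup>+p. ennreal (indicator {0<..e} (snd p) * (H p)^2) \<partial>MT) + (\<integral>\<^sup>+p. ennreal (indicator {e<..k} (snd p) * (H p - S p)^2) \<partial>MT)"
   unfolding split using m1 m2 by (simp add: nn_integral_add)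
  also have "\<dots> <= ennreal (d / 2) + ennreal (d / 2)"
  proof (rule add_mono)
   show "(\<integral>\<^sup>+p. ennreal (indicator {0<..e} (snd p) * (H p)^2) \<partial>MT) <= ennreal (d / 2)"
    unfolding H_def by (rule order_trans[OF head_bound[OF \<phi> e(1)]]) (use ve in \<open>auto intro: ennreal_leI\<close>)
   show "(\<integral>\<^sup>+p. ennreal (indicator {e<..k} (snd p) * (H p - S p)^2) \<partial>MT) <= ennreal (d / 2)"
    using nn_integral_eq_integral[OF ierr] err by (auto simp: H_def S_def t_def intro: ennreal_leI)
  qed
  also have "\<dots> = ennreal d" using d by (simp add: ennreal_plus[symmetric] del: ennreal_plus)
  finally show "(\<integral>\<^sup>+p. ennreal (indicator {0<..k} (snd p) * (simple_proc (Suc m) t h (fst p) (snd p) - HY \<phi> p)^2) \<partial>MT) <= ennreal d"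
   by (simp add: S_def H_def)
 qed
qed

lemma meas_cov_eq: "meas_cov (\<xi> w s) \<phi> \<rho> = Hc \<phi> s (Y w s)"
 by (simp add: meas_cov_def Hc_def pE_def \<xi>_def)

lemma nn_integral_Icc_le_Ioc:
 fixes f :: "real => real"
 assumes "T <= k"
 shows "(\<integral>\<^sup>+ s\<in>{0..T}. ennreal (f s) \<partial>lborel) <= (\<integral>\<^sup>+ s. ennreal (indicator {0<..k} s * f s) \<partial>lborel)"
proof (rule nn_integral_mono_AE)
 show "AE s in lborel. ennreal (f s) * indicator {0..T} s <= ennreal (indicator {0<..k} s * f s)"
  using AE_lborel_singleton[of 0] by eventually_elim (use assms in \<open>auto simp: indicator_def\<close>)
qed

text \<open>One sequence of simple integrands must serve all horizons and tolerances, so the j-th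
  one has error at most 2^-j up to time j + 1. Markov's inequality then controls the integrand, the
  maximal inequality the integral uniformly in time.\<close>

lemma ito_integral_N:
 assumes \<phi>: "\<phi> \<in> borel_measurable borel" "\<And>x. \<bar>\<phi> x\<bar> <= L"
 shows "ito_integral M F W (\<lambda>w s. meas_cov (\<xi> w s) \<phi> \<rho>) (\<lambda>w t. (LINT x|\<xi> w t. \<phi> x) - (LINT x|\<xi> w 0. \<phi> x))"
proof -
 interpret P: pair_sigma_finite M lborel ..
 define f where "f n t h k p = indicator {0<..k} (snd p) * (simple_proc n t h (fst p) (snd p) - HY \<phi> p)^2"
  for n t h k and p :: "'w \<times> real"
 have "\<exists>n t h D. simple_integrand F n t h \<and> f n t h (real (Suc j)) \<in> borel_measurable MT \<and>
  (\<integral>\<^sup>+p. ennreal (f n t h (real (Suc j)) p) \<partial>MT) <= ennreal ((1/2) ^ j) \<and> L2mart D \<and>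
  (\<forall>w\<in>space M. continuous_on {0..real (Suc j)} (\<lambda>r. D r w)) \<and>
  (\<forall>w\<in>space M. \<forall>r\<ge>0. D r w = cE \<phi> w r - pE \<phi> 0 0 - simple_stoch_int W n t h w r) \<and>
  (LINT w|M. (D (real (Suc j)) w)^2) <= (1/2) ^ j" for j
  unfolding f_def by (rule ito_approximation[OF \<phi>, of "real (Suc j)" "(1/2) ^ j"]) (simp, simp, blast)
 then obtain n t h D where si: "\<And>j. simple_integrand F (n j) (t j) (h j)"
  and fm: "\<And>j. f (n j) (t j) (h j) (real (Suc j)) \<in> borel_measurable MT"
  and fi: "\<And>j. (\<integral>\<^sup>+p. ennreal (f (n j) (t j) (h j) (real (Suc j)) p) \<partial>MT) <= ennreal ((1/2) ^ j)"
  and mart: "\<And>j. L2mart (D j)"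
  and cont: "\<And>j w. w \<in> space M ==> continuous_on {0..real (Suc j)} (\<lambda>r. D j r w)"
  and Dint: "\<And>j w r. w \<in> space M ==> 0 <= r ==> D j r w = cE \<phi> w r - pE \<phi> 0 0 - simple_stoch_int W (n j) (t j) (h j) w r"
  and D2: "\<And>j. (LINT w|M. (D j (real (Suc j)) w)^2) <= (1/2) ^ j"
  by metis
 \<comment> \<open>The two powers are what the two inequalities consume: \<epsilon>^2 / \<epsilon>
   in Markov's, \<epsilon>^3 / \<epsilon>^2 in the maximal one.\<close>
 have ev: "eventually (\<lambda>j. T <= real (Suc j) \<and> (1/2) ^ j <= \<epsilon>\<^sup>2 \<and> (1/2) ^ j <= \<epsilon> ^ 3) sequentially" if "0 < \<epsilon>" for T \<epsilon> :: real
 proof -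
  obtain j0 where j0: "T <= real j0" using real_arch_simple by blast
  have p: "0 < \<epsilon>\<^sup>2" "0 < \<epsilon> ^ 3" using that by auto
  show ?thesis using eventually_ge_at_top[of j0] half_power_le_eventually[OF p(1)] half_power_le_eventually[OF p(2)]
  proof eventually_elim
   case (elim j)
   then have "real j0 <= real j" by simp
   then show ?case using elim j0 by simp
  qed
 qed
 show ?thesis unfolding ito_integral_def meas_cov_eq
 proof (intro exI[of _ n] exI[of _ t] exI[of _ h] conjI allI impI si)
  fix T \<epsilon> :: real assume T: "0 <= T" and \<epsilon>: "0 < \<epsilon>"
  show "\<forall>\<^sub>F k in sequentially. \<exists>A\<in>events. emeasure M A <= ennreal \<epsilon> \<and>
   (\<forall>w\<in>space M - A. (\<integral>\<^sup>+ s\<in>{0..T}. ennreal ((simple_proc (n k) (t k) (h k) w s - Hc \<phi> s (Y w s))^2) \<partial>lborel) <= ennreal \<epsilon>)"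
   using ev[OF \<epsilon>, of T]
  proof eventually_elim
   case (elim k)
   define u where "u w = (\<integral>\<^sup>+ s. ennreal (f (n k) (t k) (h k) (real (Suc k)) (w, s)) \<partial>lborel)" for w
   note [measurable] = fm[of k]
   have um[measurable]: "u \<in> borel_measurable M" unfolding u_def by measurable
   have uint: "(\<integral>\<^sup>+w. u w \<partial>M) <= ennreal ((1/2) ^ k)"
    unfolding u_def by (subst lborel.nn_integral_fst) (use fi[of k] fm[of k] in \<open>auto simp del: of_nat_Suc\<close>)
   define A where "A = {w\<in>space M. 1 <= ennreal (1 / \<epsilon>) * u w}"
   have A: "A \<in> events" unfolding A_def by measurable
   have "emeasure M A <= ennreal (1 / \<epsilon>) * (\<integral>\<^sup>+w. u w \<partial>M)"
   proof -
    have "emeasure M A <= ennreal (1 / \<epsilon>) * (\<integral>\<^sup>+w. u w * indicator (space M) w \<partial>M)"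
     unfolding A_def by (rule nn_integral_Markov_inequality) auto
    also have "(\<integral>\<^sup>+w. u w * indicator (space M) w \<partial>M) = (\<integral>\<^sup>+w. u w \<partial>M)" by (intro nn_integral_cong) simp
    finally show ?thesis .
   qed
   also have "\<dots> <= ennreal (1 / \<epsilon>) * ennreal (\<epsilon>\<^sup>2)"
    using elim by (intro mult_left_mono order_trans[OF uint] ennreal_leI) auto
   also have "\<dots> = ennreal \<epsilon>" using \<epsilon> by (simp add: ennreal_mult'[symmetric] power2_eq_square)
   finally have Ae: "emeasure M A <= ennreal \<epsilon>" .
   have "(\<integral>\<^sup>+ s\<in>{0..T}. ennreal ((simple_proc (n k) (t k) (h k) w s - Hc \<phi> s (Y w s))^2) \<partial>lborel) <= ennreal \<epsilon>" if dy: "w \<in> space M - A" for w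
   proof -
    have "ennreal (1 / \<epsilon>) * u w <= 1" using dy by (auto simp: A_def)
    then have "ennreal \<epsilon> * (ennreal (1 / \<epsilon>) * u w) <= ennreal \<epsilon> * 1" by (intro mult_left_mono) auto
    then have "u w <= ennreal \<epsilon>" using \<epsilon> by (simp add: mult.assoc[symmetric] ennreal_mult'[symmetric])
    then show ?thesis using elim by (intro order_trans[OF nn_integral_Icc_le_Ioc[of T "real (Suc k)"]]) (auto simp: u_def f_def)
   qed
   with A Ae show ?case by blast
  qed
  show "\<forall>\<^sub>F k in sequentially. \<exists>A\<in>events. emeasure M A <= ennreal \<epsilon> \<and>
   (\<forall>w\<in>space M - A. \<forall>s\<in>{0..T}. \<bar>simple_stoch_int W (n k) (t k) (h k) w s - ((LINT x|\<xi> w s. \<phi> x) - (LINT x|\<xi> w 0. \<phi> x))\<bar> <= \<epsilon>)"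
   using ev[OF \<epsilon>, of T]
  proof eventually_elim
   case (elim k)
   define A where "A = {w\<in>space M. \<exists>r\<in>{0..real (Suc k)}. \<epsilon> < \<bar>D k r w\<bar>}"
   note m = L2mart_maximal[of "D k" 0 "real (Suc k)" \<epsilon>, OF mart order_refl _ less_imp_le[OF \<epsilon>] cont, folded A_def]
   have "\<epsilon>\<^sup>2 * prob A <= \<epsilon> ^ 3" using m(2) D2[of k] elim by simp
   then have "\<epsilon>\<^sup>2 * prob A <= \<epsilon>\<^sup>2 * \<epsilon>" by (simp add: power2_eq_square power3_eq_cube)
   then have "prob A <= \<epsilon>" using \<epsilon> by simp
   then have Ae: "emeasure M A <= ennreal \<epsilon>" by (simp add: emeasure_eq_measure ennreal_leI)
   have "\<bar>simple_stoch_int W (n k) (t k) (h k) w s - ((LINT x|\<xi> w s. \<phi> x) - (LINT x|\<xi> w 0. \<phi> x))\<bar> <= \<epsilon>"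
    if dy: "w \<in> space M - A" and s: "s \<in> {0..T}" for w s
   proof -
    have "\<bar>D k s w\<bar> <= \<epsilon>" using dy s elim by (force simp: A_def not_less)
    moreover have "D k s w = (LINT x|\<xi> w s. \<phi> x) - (LINT x|\<xi> w 0. \<phi> x) - simple_stoch_int W (n k) (t k) (h k) w s"
     using Dint[of w s k] dy s by (simp add: pE_def \<xi>_def Y_zero)
    ultimately show ?thesis by (simp add: abs_minus_commute)
   qed
   with m(1) Ae show ?case by auto
  qed
 qed
qed

text \<open>At positive times \<rho> is integrable under the posterior; time 0, where it may fail to
  be, is a null set. The integral of the squared covariance is almost surely finite because its mean
  is, by \<open>head_bound\<close>.\<close>

lemma drift_finite:
 assumes \<phi>: "\<phi> \<in> borel_measurable borel" "\<And>x. \<bar>\<phi> x\<bar> <= L"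
 shows "AE p in MT. 0 <= snd p \<longrightarrow>
   (\<integral>\<^sup>+x. ennreal \<bar>\<rho> x\<bar> \<partial>\<xi> (fst p) (snd p)) < \<infinity> \<and>
   (\<integral>\<^sup>+ s\<in>{0..snd p}. ennreal ((meas_cov (\<xi> (fst p) s) \<phi> \<rho>)^2) \<partial>lborel) < \<infinity>"
proof -
 interpret P: pair_sigma_finite M lborel ..
 define u where "u n w = (\<integral>\<^sup>+ s. ennreal (indicator {0<..real (Suc n)} s * (Hc \<phi> s (Y w s))^2) \<partial>lborel)" for n w
 have "AE w in M. u n w \<noteq> \<infinity>" for n
 proof (rule nn_integral_PInf_AE)
  let ?f = "\<lambda>p. indicator {0<..real (Suc n)} (snd p) * (HY \<phi> p)^2"
  have "?f = (\<lambda>p. (indicator {0<..real (Suc n)} (snd p) * HY \<phi> p)^2)" by (auto simp: indicator_def)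
  then have [measurable]: "?f \<in> borel_measurable MT"
   using borel_measurable_power[OF Hc_pair_meas[OF \<phi>, of "real (Suc n)"], of 2] by simp
  have ue: "u n = (\<lambda>w. \<integral>\<^sup>+ s. ennreal (?f (w, s)) \<partial>lborel)" by (simp add: u_def[abs_def])
  show "u n \<in> borel_measurable M" unfolding ue by measurable
  have "(\<integral>\<^sup>+w. u n w \<partial>M) = (\<integral>\<^sup>+p. ennreal (?f p) \<partial>MT)" unfolding ue by (rule lborel.nn_integral_fst) measurable
  also have "\<dots> < \<infinity>" by (rule le_less_trans[OF head_bound[OF \<phi>]]) auto
  finally show "integral\<^sup>N M (u n) \<noteq> \<infinity>" by simp
 qed
 then have "AE w in M. \<forall>n. u n w \<noteq> \<infinity>" by (simp add: AE_all_countable)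
 from AE_pair_fst[OF this] have 1: "AE p in MT. \<forall>n. u n (fst p) \<noteq> \<infinity>" .
 have "{r. r \<noteq> (0::real)} \<in> sets borel" by measurable
 then have "AE p in MT. snd p \<noteq> 0" by (intro AE_pair_snd AE_lborel_singleton)
 with 1 show ?thesis
 proof eventually_elim
  case (elim p)
  show ?case
  proof
   assume "0 <= snd p"
   with elim have s: "0 < snd p" by simp
   have a: "(\<integral>\<^sup>+x. ennreal \<bar>\<rho> x\<bar> \<partial>\<xi> (fst p) (snd p)) < \<infinity>"
    using mild_integrable_post[OF mild_rho s, of "Y (fst p) (snd p)"] by (simp add: \<xi>_def integrable_iff_bounded)
   obtain n where "snd p <= real n" using real_arch_simple by blast
   then have n: "snd p <= real (Suc n)" by simp
   have "(\<integral>\<^sup>+ s\<in>{0..snd p}. ennreal ((meas_cov (\<xi> (fst p) s) \<phi> \<rho>)^2) \<partial>lborel) <= u n (fst p)"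
    unfolding u_def meas_cov_eq by (rule nn_integral_Icc_le_Ioc[OF n])
   also have "\<dots> < \<infinity>" using elim(1) by (simp add: top.not_eq_extremum)
   finally show "(\<integral>\<^sup>+x. ennreal \<bar>\<rho> x\<bar> \<partial>\<xi> (fst p) (snd p)) < \<infinity> \<and>
     (\<integral>\<^sup>+ s\<in>{0..snd p}. ennreal ((meas_cov (\<xi> (fst p) s) \<phi> \<rho>)^2) \<partial>lborel) < \<infinity>" using a by simp
  qed
 qed
qed

lemma Cb_bounded:
 assumes "\<phi> \<in> Cb" obtains L where "\<phi> \<in> borel_measurable borel" "\<And>x. \<bar>\<phi> x\<bar> <= L"
 using assms by (auto simp: Cb_def bounded_iff intro: borel_measurable_continuous_onI)

lemma continuous_MVM_xi: "continuous_MVM M F \<xi>"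
 unfolding continuous_MVM_def
proof (intro conjI ballI allI impI)
 have pe: "(LINT x|\<xi> w t. \<phi> x) = cE \<phi> w t" for \<phi> w t by (simp add: pE_def \<xi>_def)
 show "prob_space (\<xi> w t)" "sets (\<xi> w t) = sets borel" if "w \<in> space M" "0 <= t" for w t
  unfolding \<xi>_def using prob_space_post[OF adm_Y[OF that]] by auto
 fix \<phi> :: "'a => real" assume "\<phi> \<in> Cb"
 then obtain L where \<phi>: "\<phi> \<in> borel_measurable borel" "\<And>x. \<bar>\<phi> x\<bar> <= L" by (rule Cb_bounded) blast
 show "(\<lambda>w. \<integral>x. \<phi> x \<partial>\<xi> w t) \<in> borel_measurable (F t)" if "0 <= t" for t unfolding pe by (rule pE_meas_F[OF that \<phi>(1)])
 show "continuous_on {0..} (\<lambda>t. \<integral>x. \<phi> x \<partial>\<xi> w t)" if "w \<in> space M" for w unfolding pe by (rule N_cont[OF \<phi> that])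
 show "integrable M (\<lambda>w. \<integral>x. \<phi> x \<partial>\<xi> w t)" if "0 <= t" for t unfolding pe by (rule N_integrable(1)[OF \<phi> that])
 show "AE w in M. real_cond_exp M (F s) (\<lambda>w'. \<integral>x. \<phi> x \<partial>\<xi> w' t) w = (LINT x|\<xi> w s. \<phi> x)" if "0 <= s \<and> s <= t" for s t
 proof -
  have st: "0 <= s" "s <= t" using that by auto
  then interpret S: finite_measure_subalgebra M "F s" by unfold_locales (rule subalgebra_F)
  show ?thesis unfolding pe
  proof (rule S.real_cond_exp_charact)
   fix A assume A: "A \<in> sets (F s)"
   have AM: "A \<in> events" by (rule F_events[OF st(1) A])
   have "(LINT w|M. indicator A w * cE \<phi> w t) = (LINT w|M. indicator A w * cE \<phi> w s)"
    using AM by (intro N_martingale[OF \<phi> st borel_measurable_indicator[OF A]]) (auto simp: emeasure_eq_measure)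
   then show "(LINT w:A|M. cE \<phi> w t) = (LINT w:A|M. cE \<phi> w s)" by (simp add: set_lebesgue_integral_def)
  qed (use N_integrable(1)[OF \<phi>] pE_meas_F[OF _ \<phi>(1)] st in auto)
 qed
qed

lemma weak_MVM_solution_xi: "weak_MVM_solution M F W \<xi> (\<lambda>_ _. \<rho>)"
 unfolding weak_MVM_solution_def
proof (intro conjI ballI prob_space_axioms brownian_motion_W continuous_MVM_xi)
 show "filtration_on M F" unfolding filtration_on_def using subalgebra_F F_mono by (auto simp: subalgebra_def)
 show "progressive_field F (\<lambda>_ _. \<rho>)" unfolding progressive_field_def case_prod_beta' by measurable
 fix \<phi> :: "'a => real" assume "\<phi> \<in> Cb"
 then obtain L where \<phi>: "\<phi> \<in> borel_measurable borel" "\<And>x. \<bar>\<phi> x\<bar> <= L" by (rule Cb_bounded) blast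
 show "ito_integral M F W (\<lambda>w s. meas_cov (\<xi> w s) \<phi> \<rho>) (\<lambda>w t. (LINT x|\<xi> w t. \<phi> x) - (LINT x|\<xi> w 0. \<phi> x))"
  by (rule ito_integral_N[OF \<phi>])
 show "AE p in MT. 0 <= snd p \<longrightarrow>
   (\<integral>\<^sup>+x. ennreal \<bar>\<rho> x\<bar> \<partial>\<xi> (fst p) (snd p)) < \<infinity> \<and>
   (\<integral>\<^sup>+ s\<in>{0..snd p}. ennreal ((meas_cov (\<xi> (fst p) s) \<phi> \<rho>)^2) \<partial>lborel) < \<infinity>"
  by (rule drift_finite[OF \<phi>])
qed

end

theorem theorem3p7:
  fixes \<rho>bar :: "real ^ 'd \<Rightarrow> real" and \<mu> :: "(real ^ 'd) measure"
  assumes "\<rho>bar \<in> borel_measurable borel"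
    and "prob_space \<mu>" and "sets \<mu> = sets borel"
  shows "\<exists>(M :: real measure) F W \<xi> \<rho>.
           weak_MVM_solution M F W \<xi> \<rho> \<and>
           (\<forall>\<omega>\<in>space M. \<xi> \<omega> 0 = \<mu>) \<and>
           (\<forall>\<omega>\<in>space M. \<forall>t\<ge>0. \<rho> \<omega> t = \<rho>bar)"
proof -
  obtain M :: "real measure" and X :: "real \<Rightarrow> real ^ 'd" and B where S: "bm_solution M X B \<rho>bar" and mu: "distr M borel X = \<mu>"
    using bm_solution_exists[OF assms(2,3,1)] by blast
  interpret bm_solution M X B \<rho>bar by (rule S)
  have "\<xi> \<omega> 0 = \<mu>" if "\<omega> \<in> space M" for \<omega> by (simp add: \<xi>_def Y_zero[OF that] post_zero mu)
  then show ?thesis using weak_MVM_solution_xi by (intro exI[of _ M] exI[of _ F] exI[of _ W] exI[of _ \<xi>] exI[of _ "\<lambda>_ _. \<rho>bar"]) simp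
qed

end
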